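(* Let $B>0$ and let $\Omega\subset\mathbb{R}^d$, $d\in\{2,3\}$, be a domain of finite measure such that the embedding $H^1_{B\mathbf{A}}(\Omega)\subset L_2(\Omega)$ is compact. Let $H_\Omega^D(B)$ and $H_\Omega^N(B)$ be the Dirichlet and Neumann realizations in $L_2(\Omega)$ of the magnetic Laplacian $(\mathbf{D}-B\mathbf{A})^2$. (1) If $d=2$, let $k\in\mathbb{N}=\{1,2,3,\dots\}$ and let $j\ge 0$ be an integer such that $H_\Omega^D(B)$ has $j$ eigenvalues (counting multiplicities) less than or equal to $B(2k-1)$. Then $H_\Omega^N(B)$ has at least $j+1$ eigenvalues (counting multiplicities) strictly less than $B(2k-1)$. (2) If $d=3$, then $\lambda_{j+1}(H_\Omega^N(B))<\lambda_j(H_\Omega^D(B))$ for all $j\in\mathbb{N}$.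
   Context: A domain is a non-empty open connected set. Functions are complex-valued, and $\|\cdot\|$ is the norm of $L_2(\Omega)$ with respect to Lebesgue measure $dz$. $\mathbf{D}=-i\nabla$. If $d=2$, coordinates are $z=(x,y)$ and $\mathbf{A}(x,y)=\frac12(-y,x)^T$. If $d=3$, coordinates are $z=(x,y,t)$ and $\mathbf{A}(x,y,t)=\frac12(-y,x,0)^T$. For a domain $\Omega\subset\mathbb{R}^d$, $$H^1_{B\mathbf{A}}(\Omega)=\{u\in L_2(\Omega)\cap H^1_{\rm loc}(\Omega):\ (\mathbf{D}-B\mathbf{A})u\in L_2(\Omega)\}$$ with norm $(\|(\mathbf{D}-B\mathbf{A})u\|^2+\|u\|^2)^{1/2}$, and $\mathring{H}^1_{B\mathbf{A}}(\Omega)$ is the closure of $C_0^\infty(\Omega)$ in $H^1_{B\mathbf{A}}(\Omega)$. $H_\Omega^D(B)$ and $H_\Omega^N(B)$ are the self-adjoint operators in $L_2(\Omega)$ associated with the quadratic form $\|(\mathbf{D}-B\mathbf{A})u\|^2=\int_\Omega|(\mathbf{D}-B\mathbf{A})u|^2\,dz$ with form domain $\mathring{H}^1_{B\mathbf{A}}(\Omega)$ and $H^1_{B\mathbf{A}}(\Omega)$, respectively. For a lower semi-bounded self-adjoint operator $A$ with purely discrete spectrum, $\lambda_j(A)$, $j\in\mathbb{N}$, denotes its $j$-th eigenvalue in non-decreasing order, counting multiplicities. Under the compactness assumption both operators have purely discrete spectrum. *)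

theory Defs
  imports "HOL-Analysis.Analysis" "HOL-Library.Extended_Nat"
begin

text \<open>
  Functions on a domain are total functions on the whole space of which only the values on the
  domain matter. Elements of Lebesgue and Sobolev spaces are functions rather than classes of
  almost everywhere equal functions; the identification is made in \<open>ae_independent\<close> below.
\<close>

definition domain :: "'a::euclidean_space set \<Rightarrow> bool" where
  "domain \<Omega> \<longleftrightarrow> \<Omega> \<noteq> {} \<and> open \<Omega> \<and> connected \<Omega>"

definition L2 :: "'a::euclidean_space set \<Rightarrow> ('a \<Rightarrow> 'b::real_normed_vector) set" where
  "L2 \<Omega> = {f. f \<in> borel_measurable (lebesgue_on \<Omega>) \<and>
              integrable (lebesgue_on \<Omega>) (\<lambda>z. (norm (f z))\<^sup>2)}"

definition L2_norm :: "'a::euclidean_space set \<Rightarrow> ('a \<Rightarrow> 'b::real_normed_vector) \<Rightarrow> real" where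
  "L2_norm \<Omega> f = sqrt (LINT z|lebesgue_on \<Omega>. (norm (f z))\<^sup>2)"

definition L2_inner :: "'a::euclidean_space set \<Rightarrow> ('a \<Rightarrow> complex) \<Rightarrow> ('a \<Rightarrow> complex) \<Rightarrow> complex" where
  "L2_inner \<Omega> f g = (LINT z|lebesgue_on \<Omega>. f z * cnj (g z))"

definition L2_loc :: "'a::euclidean_space set \<Rightarrow> ('a \<Rightarrow> 'b::real_normed_vector) set" where
  "L2_loc \<Omega> = {f. \<forall>K. compact K \<and> K \<subseteq> \<Omega> \<longrightarrow> f \<in> L2 K}"

primrec C_k :: "nat \<Rightarrow> ('a::euclidean_space \<Rightarrow> 'b::real_normed_vector) \<Rightarrow> bool" where
  "C_k 0 f \<longleftrightarrow> continuous_on UNIV f"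
| "C_k (Suc k) f \<longleftrightarrow> (\<forall>x. f differentiable (at x)) \<and>
     (\<forall>b\<in>Basis. C_k k (\<lambda>x. frechet_derivative f (at x) b))"

text \<open>The functions in \<open>C\<^sub>0\<^sup>\<infinity>(\<Omega>)\<close>, extended by zero to the whole space.\<close>

definition test_fun :: "'a::euclidean_space set \<Rightarrow> ('a \<Rightarrow> complex) set" where
  "test_fun \<Omega> = {\<phi>. (\<forall>k. C_k k \<phi>) \<and>
     compact (closure {x. \<phi> x \<noteq> 0}) \<and> closure {x. \<phi> x \<noteq> 0} \<subseteq> \<Omega>}"

definition is_weak_grad ::
  "(real^'n) set \<Rightarrow> (real^'n \<Rightarrow> complex) \<Rightarrow> (real^'n \<Rightarrow> complex^'n) \<Rightarrow> bool" where
  "is_weak_grad \<Omega> u g \<longleftrightarrow> (\<forall>\<phi>\<in>test_fun \<Omega>. \<forall>i.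
     (LINT z|lebesgue_on \<Omega>. u z * frechet_derivative \<phi> (at z) (axis i 1)) =
     - (LINT z|lebesgue_on \<Omega>. g z $ i * \<phi> z))"

definition H1_loc :: "(real^'n) set \<Rightarrow> (real^'n \<Rightarrow> complex) set" where
  "H1_loc \<Omega> = {u \<in> L2_loc \<Omega>. \<exists>g \<in> L2_loc \<Omega>. is_weak_grad \<Omega> u g}"

text \<open>
  For \<open>u \<in> H1_loc \<Omega>\<close> the weak gradient is unique up to null sets, so the choice made here
  has no influence on any of the integrals in which it is used.
\<close>

definition weak_grad :: "(real^'n) set \<Rightarrow> (real^'n \<Rightarrow> complex) \<Rightarrow> real^'n \<Rightarrow> complex^'n" where
  "weak_grad \<Omega> u = (SOME g. g \<in> L2_loc \<Omega> \<and> is_weak_grad \<Omega> u g)"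

text \<open>\<open>(\<^bold>D - a) u\<close> with \<open>\<^bold>D = -\<i>\<nabla>\<close>, for a real vector potential \<open>a\<close> (later \<open>a = B \<^bold>A\<close>).\<close>

definition mag_grad ::
  "(real^'n \<Rightarrow> real^'n) \<Rightarrow> (real^'n) set \<Rightarrow> (real^'n \<Rightarrow> complex) \<Rightarrow> real^'n \<Rightarrow> complex^'n" where
  "mag_grad a \<Omega> u = (\<lambda>z. \<chi> i. - \<i> * weak_grad \<Omega> u z $ i - of_real (a z $ i) * u z)"

definition H1_mag :: "(real^'n \<Rightarrow> real^'n) \<Rightarrow> (real^'n) set \<Rightarrow> (real^'n \<Rightarrow> complex) set" where
  "H1_mag a \<Omega> = {u \<in> L2 \<Omega> \<inter> H1_loc \<Omega>. mag_grad a \<Omega> u \<in> L2 \<Omega>}"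

definition H1_mag_norm ::
  "(real^'n \<Rightarrow> real^'n) \<Rightarrow> (real^'n) set \<Rightarrow> (real^'n \<Rightarrow> complex) \<Rightarrow> real" where
  "H1_mag_norm a \<Omega> u = sqrt ((L2_norm \<Omega> (mag_grad a \<Omega> u))\<^sup>2 + (L2_norm \<Omega> u)\<^sup>2)"

definition H1_mag_0 :: "(real^'n \<Rightarrow> real^'n) \<Rightarrow> (real^'n) set \<Rightarrow> (real^'n \<Rightarrow> complex) set" where
  "H1_mag_0 a \<Omega> = {u \<in> H1_mag a \<Omega>.
     \<forall>\<epsilon>>0. \<exists>\<phi>\<in>test_fun \<Omega>. H1_mag_norm a \<Omega> (\<lambda>z. u z - \<phi> z) < \<epsilon>}"

definition compact_embedding :: "(real^'n \<Rightarrow> real^'n) \<Rightarrow> (real^'n) set \<Rightarrow> bool" where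
  "compact_embedding a \<Omega> \<longleftrightarrow>
     (\<forall>u :: nat \<Rightarrow> real^'n \<Rightarrow> complex.
        (\<forall>n. u n \<in> H1_mag a \<Omega>) \<and> (\<exists>C. \<forall>n. H1_mag_norm a \<Omega> (u n) \<le> C) \<longrightarrow>
        (\<exists>f\<in>L2 \<Omega>. \<exists>r. strict_mono r \<and>
           (\<lambda>n. L2_norm \<Omega> (\<lambda>z. u (r n) z - f z)) \<longlonglongrightarrow> 0))"

text \<open>Operators in \<open>L2 \<Omega>\<close> are represented by their graphs.\<close>

type_synonym 'a L2_op = "(('a \<Rightarrow> complex) \<times> ('a \<Rightarrow> complex)) set"

text \<open>The sesquilinear form obtained by polarization from the quadratic form
  \<open>u \<mapsto> (L2_norm \<Omega> (mag_grad a \<Omega> u))\<^sup>2\<close>.\<close>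

definition mag_form :: "(real^'n \<Rightarrow> real^'n) \<Rightarrow> (real^'n) set \<Rightarrow>
    (real^'n \<Rightarrow> complex) \<Rightarrow> (real^'n \<Rightarrow> complex) \<Rightarrow> complex" where
  "mag_form a \<Omega> u v = (LINT z|lebesgue_on \<Omega>.
     (\<Sum>i\<in>UNIV. mag_grad a \<Omega> u z $ i * cnj (mag_grad a \<Omega> v z $ i)))"

text \<open>The operator associated with a form \<open>h\<close> with form domain \<open>V\<close>, in the sense of the
  first representation theorem.\<close>

definition form_op :: "'a::euclidean_space set \<Rightarrow> ('a \<Rightarrow> complex) set \<Rightarrow>
    (('a \<Rightarrow> complex) \<Rightarrow> ('a \<Rightarrow> complex) \<Rightarrow> complex) \<Rightarrow> 'a L2_op" where
  "form_op \<Omega> V h = {(u, f). u \<in> V \<and> f \<in> L2 \<Omega> \<and> (\<forall>v\<in>V. h u v = L2_inner \<Omega> f v)}"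

definition H_D :: "(real^'n \<Rightarrow> real^'n) \<Rightarrow> (real^'n) set \<Rightarrow> (real^'n) L2_op" where
  "H_D a \<Omega> = form_op \<Omega> (H1_mag_0 a \<Omega>) (mag_form a \<Omega>)"

definition H_N :: "(real^'n \<Rightarrow> real^'n) \<Rightarrow> (real^'n) set \<Rightarrow> (real^'n) L2_op" where
  "H_N a \<Omega> = form_op \<Omega> (H1_mag a \<Omega>) (mag_form a \<Omega>)"

text \<open>Linear independence, over the complex numbers, of the classes of
  \<open>u 0, \<dots>, u (n - 1)\<close> modulo almost everywhere equality.\<close>

definition ae_independent ::
  "'a::euclidean_space set \<Rightarrow> nat \<Rightarrow> (nat \<Rightarrow> 'a \<Rightarrow> complex) \<Rightarrow> bool" where
  "ae_independent \<Omega> n u \<longleftrightarrow>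
     (\<forall>c :: nat \<Rightarrow> complex. (AE z in lebesgue_on \<Omega>. (\<Sum>i<n. c i * u i z) = 0) \<longrightarrow> (\<forall>i<n. c i = 0))"

text \<open>Only real \<open>\<mu>\<close> are considered, since the operators of interest are self-adjoint.\<close>

definition eigenspace :: "'a L2_op \<Rightarrow> real \<Rightarrow> ('a \<Rightarrow> complex) set" where
  "eigenspace H \<mu> = {u. (u, \<lambda>z. of_real \<mu> * u z) \<in> H}"

text \<open>The dimension of the eigenspace in \<open>L2 \<Omega>\<close>; it is zero if \<open>\<mu>\<close> is not an eigenvalue.\<close>

definition multiplicity_of :: "'a::euclidean_space set \<Rightarrow> 'a L2_op \<Rightarrow> real \<Rightarrow> enat" where
  "multiplicity_of \<Omega> H \<mu> =
     Sup {enat n | n. \<exists>u. (\<forall>i<n. u i \<in> eigenspace H \<mu>) \<and> ae_independent \<Omega> n u}"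

text \<open>The supremum over finite subsets gives the possibly infinite sum of multiplicities over \<open>S\<close>.\<close>

definition eigenvalue_count :: "'a::euclidean_space set \<Rightarrow> 'a L2_op \<Rightarrow> real set \<Rightarrow> enat" where
  "eigenvalue_count \<Omega> H S = (SUP F\<in>{F. finite F \<and> F \<subseteq> S}. \<Sum>\<mu>\<in>F. multiplicity_of \<Omega> H \<mu>)"

definition eigenvalue_enumeration ::
  "'a::euclidean_space set \<Rightarrow> 'a L2_op \<Rightarrow> (nat \<Rightarrow> real) \<Rightarrow> bool" where
  "eigenvalue_enumeration \<Omega> H l \<longleftrightarrow> mono l \<and>
     (\<forall>\<mu>. finite {i. l i = \<mu>} \<and> enat (card {i. l i = \<mu>}) = multiplicity_of \<Omega> H \<mu>)"

text \<open>The \<open>j\<close>-th eigenvalue for \<open>j \<ge> 1\<close>, while enumerations start at index \<open>0\<close>. An enumeration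
  is unique if it exists.\<close>

definition nth_eigenvalue :: "'a::euclidean_space set \<Rightarrow> 'a L2_op \<Rightarrow> nat \<Rightarrow> real" where
  "nth_eigenvalue \<Omega> H j = (THE l. eigenvalue_enumeration \<Omega> H l) (j - 1)"

definition A2 :: "real^2 \<Rightarrow> real^2" where
  "A2 z = (1/2) *\<^sub>R vector [- (z $ 2), z $ 1]"

definition A3 :: "real^3 \<Rightarrow> real^3" where
  "A3 z = (1/2) *\<^sub>R vector [- (z $ 2), z $ 1, 0]"

end

theory Submission
  imports Defs "HOL-Library.Function_Algebras" "HOL-Probability.Characteristic_Functions"
    "HOL-Complex_Analysis.Cauchy_Integral_Formula"
begin

text \<open>
  Filonov's argument. Let \<open>\<mu>\<close> bound \<open>j\<close> Dirichlet eigenvalues. The space spanned by their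
  eigenfunctions and one further function \<open>w\<close>, which solves \<open>(D - B A)\<^sup>2 w = \<mu> w\<close> pointwise, has
  dimension \<open>j + 1\<close>, and the Neumann form does not exceed \<open>\<mu>\<close> times the norm on it provided it does
  not on \<open>w\<close>, because \<open>w\<close> satisfies the eigenvalue equation against the Dirichlet form domain. For
  \<open>w\<close> one takes a magnetic translate of a Landau level function (times a plane wave in the third
  variable when \<open>d = 3\<close>, whose frequency adjusts the energy to \<open>\<mu> \<ge> B\<close>). The excess energy of the
  translate by \<open>c\<close> is half the Laplacian at \<open>c\<close> of a positive function vanishing at infinity, so it is
  strictly negative for some \<open>c\<close>.

  For a strict eigenvalue inequality one also needs that no Dirichlet eigenfunction \<open>v\<close> to \<open>\<mu>\<close>
  is a Neumann eigenfunction to \<open>\<mu>\<close>. Such a \<open>v\<close> is orthogonal to all Landau functions of energy other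
  than \<open>\<mu>\<close>. By the generating function of the Landau functions, the Fourier transform of
  \<open>cnj v\<close> times a Gaussian, extended by zero, then has Gaussian decay (\<open>d = 2\<close>) or is supported on a null
  set (\<open>d = 3\<close>). So this function is analytic on lines, and as it vanishes outside a set of finite
  measure, it is zero.
\<close>

section \<open>Positive semidefinite forms\<close>

text \<open>In the field-free case the extra function is a plane wave, whose gradient is a constant
  multiple of it, so its energy is exact on every domain. A Landau function lacks this: its energy
  on a domain may exceed its level. Hence the choice of a translate, by an averaging argument in
  place of an identity. The strict inequality for \<open>w\<close> also replaces a proof that
  \<open>w\<close> is independent of the Dirichlet eigenfunctions: a trial vector with a nonzero
  coefficient at \<open>w\<close> already has form value below \<open>\<mu>\<close> times its norm
  squared.

  For d = 2 only the Landau levels occur as energies, hence the thresholds B (2 k - 1). For d = 3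
  every \<open>\<mu>\<close> with B \<le> \<open>\<mu>\<close> occurs, and the Dirichlet form is
  bounded below by B.

  An explicit Fourier computation stands in for local unique continuation. When \<open>\<mu>\<close>
  is a level and d = 2, one term of the generating series may survive. Completing the square
  contributes the weight exp(r^2 / (2 B)), r being the length of the frequency, while that term
  grows at most like a polynomial times exp(r^2 / (4 B)); the difference is the Gaussian decay.
  Finite measure of the domain ensures that its complement is not a null set.\<close>

lemma underdetermined_system:
  fixes M :: "'k \<Rightarrow> 'i \<Rightarrow> 'f::field"
  assumes "finite K" "finite I" "card K < card I"
  shows "\<exists>c. (\<exists>i\<in>I. c i \<noteq> 0) \<and> (\<forall>k\<in>K. (\<Sum>i\<in>I. c i * M k i) = 0)"
  using assms
proof (induction K arbitrary: I M rule: finite_induct)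
  case empty
  then have "I \<noteq> {}" by auto
  then show ?case by (intro exI[of _ "\<lambda>_. 1"]) auto
next
  case (insert k K)
  show ?case
  proof (cases "\<forall>i\<in>I. M k i = 0")
    case True
    obtain c where "\<exists>i\<in>I. c i \<noteq> 0" "\<forall>k\<in>K. (\<Sum>i\<in>I. c i * M k i) = 0"
      using insert.IH[of I M] insert.prems insert.hyps by auto
    with True show ?thesis by (intro exI[of _ c]) auto
  next
    case False
    \<comment> \<open>Gaussian elimination: equation \<open>k\<close> is solved for the pivot
      unknown \<open>p\<close> and substituted into the others, which leaves one equation and one
      unknown fewer.\<close>
    then obtain p where p: "p \<in> I" "M k p \<noteq> 0" by auto
    define I' where "I' = I - {p}"
    define M' where "M' = (\<lambda>l i. M l i - M l p * M k i / M k p)"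
    have "card K < card I'"
      using insert.prems insert.hyps p by (simp add: I'_def)
    then obtain c where c: "\<exists>i\<in>I'. c i \<noteq> 0" "\<forall>l\<in>K. (\<Sum>i\<in>I'. c i * M' l i) = 0"
      using insert.IH[of I' M'] insert.prems by (auto simp: I'_def)
    define d where "d = c (p := - (\<Sum>i\<in>I'. c i * M k i) / M k p)"
    have split: "(\<Sum>i\<in>I. d i * M l i) = d p * M l p + (\<Sum>i\<in>I'. c i * M l i)" for l
    proof -
      have "(\<Sum>i\<in>I. d i * M l i) = d p * M l p + (\<Sum>i\<in>I'. d i * M l i)"
        using p insert.prems by (simp add: I'_def sum.remove)
      also have "(\<Sum>i\<in>I'. d i * M l i) = (\<Sum>i\<in>I'. c i * M l i)"
        by (intro sum.cong) (auto simp: d_def I'_def)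
      finally show ?thesis .
    qed
    have "(\<Sum>i\<in>I. d i * M l i) = 0" if "l \<in> K" for l
    proof -
      have "0 = (\<Sum>i\<in>I'. c i * M' l i)" using c that by auto
      also have "\<dots> = (\<Sum>i\<in>I'. c i * M l i - (c i * M k i) * (M l p / M k p))"
        by (intro sum.cong) (auto simp: M'_def field_simps)
      also have "\<dots> = (\<Sum>i\<in>I'. c i * M l i) - (\<Sum>i\<in>I'. c i * M k i) * (M l p / M k p)"
        by (simp add: sum_subtractf sum_distrib_right sum_divide_distrib)
      finally show ?thesis unfolding split by (simp add: d_def)
    qed
    moreover have "(\<Sum>i\<in>I. d i * M k i) = 0"
      using p unfolding split by (simp add: d_def)
    moreover have "\<exists>i\<in>I. d i \<noteq> 0" using c by (auto simp: d_def I'_def)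
    ultimately show ?thesis by auto
  qed
qed

text \<open>Only semidefinite, because vectors will be functions and not classes, so a nonzero
  function may have norm zero. The carrier \<open>V\<close> is a subspace of an ambient space, which
  lets one theory serve the Neumann form domain, the Dirichlet form domain, \<open>L2\<close> and
  orthogonal complements.\<close>

locale psd_form = vector_space scale
  for scale :: "complex \<Rightarrow> 'v::ab_group_add \<Rightarrow> 'v" (infixr \<open>\<odot>\<close> 75) +
  fixes V :: "'v set" and s :: "'v \<Rightarrow> 'v \<Rightarrow> complex"
  assumes subsp: "subspace V"
    and add_left: "u \<in> V \<Longrightarrow> v \<in> V \<Longrightarrow> w \<in> V \<Longrightarrow> s (u + v) w = s u w + s v w"
    and scale_left: "u \<in> V \<Longrightarrow> w \<in> V \<Longrightarrow> s (c \<odot> u) w = c * s u w"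
    and herm: "u \<in> V \<Longrightarrow> v \<in> V \<Longrightarrow> s v u = cnj (s u v)"
    and nonneg: "u \<in> V \<Longrightarrow> 0 \<le> Re (s u u)"
begin

abbreviation q :: "'v \<Rightarrow> real" where "q u \<equiv> Re (s u u)"

lemma add_right: "u \<in> V \<Longrightarrow> v \<in> V \<Longrightarrow> w \<in> V \<Longrightarrow> s w (u + v) = s w u + s w v"
  using add_left[of u v w] herm[of _ w] subspace_add[OF subsp] by (metis complex_cnj_add)

lemma scale_right: "u \<in> V \<Longrightarrow> w \<in> V \<Longrightarrow> s w (c \<odot> u) = cnj c * s w u"
  using scale_left[of u w c] herm[of _ w] subspace_scale[OF subsp] by (metis complex_cnj_mult)

lemma minus_left: "u \<in> V \<Longrightarrow> w \<in> V \<Longrightarrow> s (- u) w = - s u w"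
  using scale_left[of u w "-1"] by simp

lemma minus_right: "u \<in> V \<Longrightarrow> w \<in> V \<Longrightarrow> s w (- u) = - s w u"
  using scale_right[of u w "-1"] by simp

lemma diff_left: "u \<in> V \<Longrightarrow> v \<in> V \<Longrightarrow> w \<in> V \<Longrightarrow> s (u - v) w = s u w - s v w"
  using add_left[of u "- v" w] minus_left[of v w] subspace_neg[OF subsp] by simp

lemma diff_right: "u \<in> V \<Longrightarrow> v \<in> V \<Longrightarrow> w \<in> V \<Longrightarrow> s w (u - v) = s w u - s w v"
  using add_right[of u "- v" w] minus_right[of v w] subspace_neg[OF subsp] by simp

lemma zero_left: "w \<in> V \<Longrightarrow> s 0 w = 0"
  using diff_left[of w w w] by simp

lemma zero_right: "w \<in> V \<Longrightarrow> s w 0 = 0"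
  using diff_right[of w w w] by simp

lemma sum_in: "(\<And>i. i \<in> I \<Longrightarrow> u i \<in> V) \<Longrightarrow> (\<Sum>i\<in>I. c i \<odot> u i) \<in> V"
  by (intro subspace_sum[OF subsp] subspace_scale[OF subsp])

lemma sum_left:
  assumes "finite I" "\<And>i. i \<in> I \<Longrightarrow> u i \<in> V" "w \<in> V"
  shows "s (\<Sum>i\<in>I. c i \<odot> u i) w = (\<Sum>i\<in>I. c i * s (u i) w)"
  using assms
proof (induction I rule: finite_induct)
  case empty then show ?case by (simp add: zero_left)
next
  case (insert i I)
  then show ?case
    using sum_in[of I u c] subspace_scale[OF subsp]
    by (simp add: add_left scale_left)
qed

lemma sum_right:
  assumes "finite I" "\<And>i. i \<in> I \<Longrightarrow> u i \<in> V" "w \<in> V"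
  shows "s w (\<Sum>i\<in>I. c i \<odot> u i) = (\<Sum>i\<in>I. cnj (c i) * s w (u i))"
  using assms
proof (induction I rule: finite_induct)
  case empty then show ?case by (simp add: zero_right)
next
  case (insert i I)
  then show ?case
    using sum_in[of I u c] subspace_scale[OF subsp]
    by (simp add: add_right scale_right)
qed

lemma s_self: "u \<in> V \<Longrightarrow> s u u = of_real (q u)"
  using herm[of u u] by (simp add: complex_eq_iff)

lemma q_scale: "u \<in> V \<Longrightarrow> q (c \<odot> u) = (cmod c)\<^sup>2 * q u"
  using s_self[of u] subspace_scale[OF subsp]
  by (simp add: scale_left scale_right) (simp add: cmod_power2 power2_eq_square[of "Re c"] power2_eq_square[of "Im c"] algebra_simps)

lemma q_add: "u \<in> V \<Longrightarrow> v \<in> V \<Longrightarrow> q (u + v) = q u + q v + 2 * Re (s u v)"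
  using herm[of u v] subspace_add[OF subsp] by (simp add: add_left add_right)

lemma q_diff: "u \<in> V \<Longrightarrow> v \<in> V \<Longrightarrow> q (u - v) = q u + q v - 2 * Re (s u v)"
  using herm[of u v] subspace_diff[OF subsp] by (simp add: diff_left diff_right)

lemma q_diff_le: "u \<in> V \<Longrightarrow> v \<in> V \<Longrightarrow> q (u - v) \<le> 2 * q u + 2 * q v"
  using nonneg[of "u + v"] q_add[of u v] q_diff[of u v] subspace_add[OF subsp] by auto

lemma q_add_le: "u \<in> V \<Longrightarrow> v \<in> V \<Longrightarrow> q (u + v) \<le> 2 * q u + 2 * q v"
  using nonneg[of "u - v"] q_add[of u v] q_diff[of u v] subspace_diff[OF subsp] by auto

text \<open>Expand \<open>q (u - c \<odot> v)\<close> \<ge> 0 with \<open>c\<close> a real multiple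
  t of \<open>s u v\<close>. The choice t = 1 / \<open>q v\<close> is optimal; if
  \<open>q v = 0\<close> the expression is affine in t, and a large t forces
  \<open>s u v = 0\<close>. This degenerate case is what later shows that null vectors of a form are
  orthogonal to everything.\<close>

lemma cauchy_schwarz:
  assumes "u \<in> V" "v \<in> V"
  shows "(cmod (s u v))\<^sup>2 \<le> q u * q v"
proof -
  define a where "a = s u v"
  have *: "0 \<le> q u + t\<^sup>2 * (cmod a)\<^sup>2 * q v - 2 * t * (cmod a)\<^sup>2" for t :: real
  proof -
    define c where "c = of_real t * a"
    have cv: "c \<odot> v \<in> V" using assms subspace_scale[OF subsp] by auto
    have "0 \<le> q (u - c \<odot> v)"
      using assms cv subspace_diff[OF subsp] by (intro nonneg) auto
    also have "\<dots> = q u + (cmod c)\<^sup>2 * q v - 2 * Re (cnj c * a)"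
      unfolding q_diff[OF assms(1) cv] q_scale[OF assms(2)] scale_right[OF assms(2,1)] a_def ..
    also have "Re (cnj c * a) = t * (cmod a)\<^sup>2"
      by (simp add: c_def cmod_power2) (simp add: power2_eq_square algebra_simps)
    also have "(cmod c)\<^sup>2 = t\<^sup>2 * (cmod a)\<^sup>2" by (simp add: c_def norm_mult power_mult_distrib)
    finally show ?thesis by simp
  qed
  show ?thesis
  proof (cases "q v = 0")
    case True
    have "cmod a = 0"
    proof (rule ccontr)
      assume "cmod a \<noteq> 0"
      then have "(cmod a)\<^sup>2 > 0" by simp
      then show False
        using *[of "(q u + 1) / (cmod a)\<^sup>2"] True nonneg[OF assms(1)] by simp
    qed
    then show ?thesis using True by (simp add: a_def)
  next
    case False
    then have "q v > 0" using nonneg[OF assms(2)] by simp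
    then show ?thesis using *[of "1 / q v"] by (simp add: a_def field_simps power2_eq_square)
  qed
qed

lemma null_left: "u \<in> V \<Longrightarrow> v \<in> V \<Longrightarrow> q u = 0 \<Longrightarrow> s u v = 0"
  using cauchy_schwarz[of u v] by simp

lemma q_limit:
  assumes "\<And>n. u n \<in> V" "v \<in> V" "(\<lambda>n. q (u n - v)) \<longlonglongrightarrow> 0" "w \<in> V"
  shows "(\<lambda>n. s (u n) w) \<longlonglongrightarrow> s v w"
proof -
  have "(\<lambda>n. cmod (s (u n) w - s v w)) \<longlonglongrightarrow> 0"
  proof (rule tendsto_sandwich)
    show "\<forall>\<^sub>F n in sequentially. 0 \<le> cmod (s (u n) w - s v w)" by simp
    show "\<forall>\<^sub>F n in sequentially. cmod (s (u n) w - s v w) \<le> sqrt (q (u n - v) * q w)"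
    proof (intro always_eventually allI)
      fix n
      have "u n - v \<in> V" using assms subspace_diff[OF subsp] by auto
      then have "(cmod (s (u n - v) w))\<^sup>2 \<le> q (u n - v) * q w"
        using assms by (intro cauchy_schwarz)
      then show "cmod (s (u n) w - s v w) \<le> sqrt (q (u n - v) * q w)"
        using assms by (simp add: diff_left real_le_rsqrt)
    qed
    show "(\<lambda>n. sqrt (q (u n - v) * q w)) \<longlonglongrightarrow> 0"
      using tendsto_real_sqrt[OF tendsto_mult_left_zero[OF assms(3), of "q w"]] by simp
  qed auto
  then show ?thesis by (metis LIM_zero_cancel tendsto_norm_zero_iff)
qed

lemma q_limit_q:
  assumes "\<And>n. u n \<in> V" "v \<in> V" "(\<lambda>n. q (u n - v)) \<longlonglongrightarrow> 0"
  shows "(\<lambda>n. q (u n)) \<longlonglongrightarrow> q v"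
proof -
  have "(\<lambda>n. Re (s (u n) v)) \<longlonglongrightarrow> q v"
    by (rule tendsto_Re, rule q_limit) (use assms in auto)
  then have "(\<lambda>n. q (u n - v) + 2 * Re (s (u n) v) - q v) \<longlonglongrightarrow> 0 + 2 * q v - q v"
    by (intro tendsto_diff tendsto_add tendsto_const assms(3) tendsto_mult_left)
  moreover have "q (u n - v) + 2 * Re (s (u n) v) - q v = q (u n)" for n
    using assms by (simp add: q_diff)
  ultimately show ?thesis by (simp add: algebra_simps)
qed

end

section \<open>Eigenvalues of compact forms\<close>

text \<open>\<open>compact\<close> is the compact embedding and \<open>complete\<close> the
  closedness of the form. The first only yields an \<open>ip\<close>-Cauchy subsequence; a limit is
  supplied by the second, in the energy norm. \<open>infinite_dim\<close> asks for independence
  modulo null vectors and keeps the complement of every finite set nontrivial, so that the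
  eigenvalue sequence never stops.\<close>

locale compact_form = vector_space scale + ip: psd_form scale V ip + h: psd_form scale V h
  for scale :: "complex \<Rightarrow> 'v::ab_group_add \<Rightarrow> 'v" (infixr \<open>\<odot>\<close> 75)
    and V :: "'v set" and ip h :: "'v \<Rightarrow> 'v \<Rightarrow> complex" +
  assumes compact: "\<And>u C. (\<And>n. u n \<in> V) \<Longrightarrow> (\<And>n. Re (h (u n) (u n)) + Re (ip (u n) (u n)) \<le> C) \<Longrightarrow>
      \<exists>r::nat \<Rightarrow> nat. strict_mono r \<and> (\<forall>\<epsilon>>0. \<exists>N. \<forall>m\<ge>N. \<forall>n\<ge>N.
        Re (ip (u (r m) - u (r n)) (u (r m) - u (r n))) < \<epsilon>)"
    and complete: "\<And>u. (\<And>n. u n \<in> V) \<Longrightarrow> (\<And>\<epsilon>. \<epsilon> > 0 \<Longrightarrow> \<exists>N. \<forall>m\<ge>N. \<forall>n\<ge>N.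
        Re (h (u m - u n) (u m - u n)) + Re (ip (u m - u n) (u m - u n)) < \<epsilon>) \<Longrightarrow>
      \<exists>v\<in>V. (\<lambda>n. Re (h (u n - v) (u n - v)) + Re (ip (u n - v) (u n - v))) \<longlonglongrightarrow> 0"
    and infinite_dim: "\<And>n::nat. \<exists>u. (\<forall>i<n. u i \<in> V) \<and>
      (\<forall>c. Re (ip (\<Sum>i<n. c i \<odot> u i) (\<Sum>i<n. c i \<odot> u i)) = 0 \<longrightarrow> (\<forall>i<n. c i = 0))"
begin

definition eigen :: "real \<Rightarrow> 'v \<Rightarrow> bool" where
  "eigen \<mu> u \<longleftrightarrow> u \<in> V \<and> (\<forall>v\<in>V. h u v = \<mu> * ip u v)"

lemma eigen_sum:
  assumes "finite I" "\<And>i. i \<in> I \<Longrightarrow> eigen \<mu> (u i)"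
  shows "eigen \<mu> (\<Sum>i\<in>I. c i \<odot> u i)"
  using assms ip.sum_in[of I u c]
  by (auto simp: eigen_def h.sum_left ip.sum_left sum_distrib_left intro!: sum.cong)

lemma eigen_q: "eigen \<mu> u \<Longrightarrow> h.q u = \<mu> * ip.q u"
  by (simp add: eigen_def)

lemma eigen_orthogonal:
  assumes "eigen \<mu> u" "eigen \<nu> v" "\<mu> \<noteq> \<nu>"
  shows "ip u v = 0"
proof -
  have "\<mu> * ip u v = h u v" using assms by (simp add: eigen_def)
  also have "\<dots> = cnj (h v u)" using assms h.herm[of v u] by (simp add: eigen_def)
  also have "\<dots> = \<nu> * ip u v" using assms ip.herm[of v u] by (simp add: eigen_def)
  finally show ?thesis using assms by simp
qed

definition perp :: "'v set \<Rightarrow> 'v set" where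
  "perp S = {u \<in> V. \<forall>f\<in>S. ip u f = 0}"

text \<open>The eigenvector property is built in so that adjoining \<open>e\<close> to
  \<open>S\<close> preserves the hypothesis \<open>eigen_orthonormal\<close> under which the next
  minimiser is constructed.\<close>

definition eigenmin :: "'v set \<Rightarrow> 'v \<Rightarrow> bool" where
  "eigenmin S e \<longleftrightarrow> e \<in> perp S \<and> ip e e = 1 \<and> (\<exists>\<mu>. eigen \<mu> e) \<and> (\<forall>u\<in>perp S. h.q e * ip.q u \<le> h.q u)"

definition eigen_orthonormal :: "'v set \<Rightarrow> bool" where
  "eigen_orthonormal S \<longleftrightarrow> finite S \<and> (\<forall>f\<in>S. \<exists>\<mu>. eigen \<mu> f) \<and> (\<forall>f\<in>S. \<forall>g\<in>S. ip f g = (if f = g then 1 else 0))"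

lemma subspace_perp: "S \<subseteq> V \<Longrightarrow> subspace (perp S)"
  unfolding perp_def subspace_def using ip.subsp unfolding subspace_def
  by (auto simp: ip.add_left ip.scale_left ip.zero_left subset_iff)

lemma eigen_orthonormal_subset: "eigen_orthonormal S \<Longrightarrow> S \<subseteq> V"
  by (auto simp: eigen_orthonormal_def eigen_def)

lemma h_perp:
  assumes "eigen_orthonormal S" "u \<in> perp S" "f \<in> S"
  shows "h u f = 0"
proof -
  from assms obtain \<mu> where "eigen \<mu> f" by (auto simp: eigen_orthonormal_def)
  then have "h f u = \<mu> * ip f u" using assms by (simp add: eigen_def perp_def)
  moreover have "ip f u = 0"
    using assms eigen_orthonormal_subset[OF assms(1)] ip.herm[of u f] by (auto simp: perp_def)
  ultimately show ?thesis
    using assms eigen_orthonormal_subset[OF assms(1)] h.herm[of f u] by (auto simp: perp_def)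
qed

text \<open>On \<open>perp S\<close> the form \<open>h - \<mu> ip\<close> is semidefinite and
  \<open>u\<close> is a null vector of it, so Cauchy-Schwarz makes it vanish against all of
  \<open>perp S\<close>. Against \<open>S\<close> both \<open>h\<close> and \<open>ip\<close> vanish
  separately, because \<open>S\<close> consists of eigenvectors.\<close>

lemma minimizer_eigen:
  assumes S: "eigen_orthonormal S" and u: "u \<in> perp S" "h.q u = \<mu> * ip.q u"
    and min: "\<And>w. w \<in> perp S \<Longrightarrow> \<mu> * ip.q w \<le> h.q w"
  shows "eigen \<mu> u"
proof -
  have SV: "S \<subseteq> V" "finite S" using S eigen_orthonormal_subset by (auto simp: eigen_orthonormal_def)
  have sp: "subspace (perp S)" using SV subspace_perp by auto
  have perpV: "w \<in> V" if "w \<in> perp S" for w using that by (simp add: perp_def)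
  interpret m: psd_form scale "perp S" "\<lambda>u v. h u v - \<mu> * ip u v"
  proof
    show "subspace (perp S)" by fact
  next
    fix u v assume "u \<in> perp S" "v \<in> perp S"
    then show "h v u - \<mu> * ip v u = cnj (h u v - \<mu> * ip u v)"
      using h.herm[of u v] ip.herm[of u v] perpV by simp
  next
    fix u assume "u \<in> perp S"
    then show "0 \<le> Re (h u u - \<mu> * ip u u)"
      using min[of u] perpV by simp
  qed (auto simp: perpV h.add_left h.scale_left ip.add_left ip.scale_left algebra_simps)
  have null: "h u w = \<mu> * ip u w" if "w \<in> perp S" for w
    using m.null_left[OF u(1) that] u(2) by simp
  show ?thesis unfolding eigen_def
  proof (intro conjI ballI)
    show "u \<in> V" using u perpV by auto
    fix v assume v: "v \<in> V"
    \<comment> \<open>Orthogonal projection of \<open>v\<close> onto the span of \<open>S\<close>,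
      so that \<open>v - p\<close> lies in \<open>perp S\<close>.\<close>
    define p where "p = (\<Sum>f\<in>S. ip v f \<odot> f)"
    have pV: "p \<in> V" unfolding p_def using SV by (intro ip.sum_in) auto
    have "ip p g = ip v g" if "g \<in> S" for g
    proof -
      have "ip p g = (\<Sum>f\<in>S. ip v f * ip f g)"
        unfolding p_def using SV that by (intro ip.sum_left) auto
      also have "\<dots> = (\<Sum>f\<in>S. if f = g then ip v f else 0)"
        using S that by (intro sum.cong) (auto simp: eigen_orthonormal_def)
      also have "\<dots> = ip v g" using that SV by simp
      finally show ?thesis .
    qed
    then have w: "v - p \<in> perp S"
      using v pV SV ip.subsp by (auto simp: perp_def ip.diff_left subspace_diff subset_iff)
    have "h u p = 0"
      unfolding p_def using h_perp[OF S u(1)] SV perpV[OF u(1)] by (subst h.sum_right) auto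
    moreover have "ip u p = 0"
      unfolding p_def using u SV perpV[OF u(1)] by (subst ip.sum_right) (auto simp: perp_def)
    ultimately show "h u v = \<mu> * ip u v"
      using null[OF w] v pV perpV[OF u(1)] by (simp add: h.diff_right ip.diff_right)
  qed
qed

text \<open>Take one independent vector more than there are orthogonality conditions; some
  nontrivial combination satisfies them all and has nonzero norm.\<close>

lemma perp_nontrivial:
  assumes "finite S" "S \<subseteq> V"
  shows "\<exists>u\<in>perp S. ip.q u = 1"
proof -
  obtain u where u: "\<And>i. i < Suc (card S) \<Longrightarrow> u i \<in> V"
    and ind: "\<And>c. ip.q (\<Sum>i<Suc (card S). c i \<odot> u i) = 0 \<Longrightarrow> \<forall>i<Suc (card S). c i = 0"
    using infinite_dim[of "Suc (card S)"] by blast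
  obtain c where c: "\<exists>i\<in>{..<Suc (card S)}. c i \<noteq> 0"
      "\<forall>f\<in>S. (\<Sum>i<Suc (card S). c i * ip (u i) f) = 0"
    using underdetermined_system[of S "{..<Suc (card S)}" "\<lambda>f i. ip (u i) f"] assms by auto
  define w where "w = (\<Sum>i<Suc (card S). c i \<odot> u i)"
  have wV: "w \<in> V" unfolding w_def using u by (intro ip.sum_in) auto
  have "ip w f = 0" if "f \<in> S" for f
    unfolding w_def using assms c(2) u that by (subst ip.sum_left) auto
  then have w: "w \<in> perp S" using wV by (simp add: perp_def)
  have "ip.q w \<noteq> 0" using ind[of c] c unfolding w_def by blast
  then have pos: "ip.q w > 0" using ip.nonneg[OF wV] by simp
  define v where "v = of_real (1 / sqrt (ip.q w)) \<odot> w"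
  have "ip.q v = 1"
    unfolding v_def using wV pos by (simp add: ip.q_scale power_divide norm_divide)
  moreover have "v \<in> perp S"
    unfolding v_def using w subspace_perp[OF assms(2)] subspace_scale by blast
  ultimately show ?thesis by blast
qed

text \<open>Direct method for the Rayleigh quotient on \<open>perp S\<close>. Compactness makes a
  minimising sequence Cauchy only for \<open>ip\<close>; the parallelogram bound for the shifted
  form, whose values along the sequence tend to 0, upgrades this to the energy norm. Closedness then
  gives the limit and \<open>minimizer_eigen\<close> the equation.\<close>

lemma eigenmin_exists:
  assumes S: "eigen_orthonormal S"
  shows "\<exists>e. eigenmin S e"
proof -
  have SV: "S \<subseteq> V" "finite S" using S eigen_orthonormal_subset by (auto simp: eigen_orthonormal_def)
  have sp: "subspace (perp S)" using SV subspace_perp by auto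
  have perpV: "w \<in> V" if "w \<in> perp S" for w using that by (simp add: perp_def)
  define R where "R = h.q ` {u \<in> perp S. ip.q u = 1}"
  have R_ne: "R \<noteq> {}" using perp_nontrivial[OF SV(2,1)] by (auto simp: R_def)
  have R_bdd: "bdd_below R"
    by (rule bdd_belowI[of _ 0]) (auto simp: R_def intro: h.nonneg perpV)
  define \<mu> where "\<mu> = Inf R"
  have min: "\<mu> * ip.q w \<le> h.q w" if w: "w \<in> perp S" for w
  proof (cases "ip.q w = 0")
    case True
    then show ?thesis using h.nonneg[OF perpV[OF w]] by simp
  next
    case False
    then have pos: "ip.q w > 0" using ip.nonneg[OF perpV[OF w]] by simp
    define v where "v = of_real (1 / sqrt (ip.q w)) \<odot> w"
    have "ip.q v = 1"
      unfolding v_def using perpV[OF w] pos by (simp add: ip.q_scale power_divide norm_divide)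
    moreover have "v \<in> perp S"
      unfolding v_def using w sp subspace_scale by blast
    ultimately have "\<mu> \<le> h.q v"
      unfolding \<mu>_def using R_bdd by (intro cInf_lower) (auto simp: R_def)
    also have "h.q v = h.q w / ip.q w"
      unfolding v_def using perpV[OF w] pos by (simp add: h.q_scale power_divide norm_divide)
    finally show ?thesis using pos by (simp add: field_simps)
  qed
  have "\<exists>u. u \<in> perp S \<and> ip.q u = 1 \<and> h.q u < \<mu> + 1 / Suc n" for n
  proof -
    have "\<exists>x\<in>R. x < \<mu> + 1 / Suc n"
      using R_ne R_bdd by (subst cInf_less_iff[symmetric]) (auto simp: \<mu>_def)
    then show ?thesis by (auto simp: R_def)
  qed
  then obtain u where u: "\<And>n. u n \<in> perp S" "\<And>n. ip.q (u n) = 1"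
    "\<And>n. h.q (u n) < \<mu> + 1 / Suc n" by metis
  \<comment> \<open>Excess of the minimising sequence over the infimum, that is, its value under the
    shifted form.\<close>
  define d where "d n = h.q (u n) - \<mu> * ip.q (u n)" for n
  have d: "0 \<le> d n" "d n < 1 / Suc n" for n
    using u(2,3)[of n] min[OF u(1), of n] by (auto simp: d_def)
  have "\<exists>r::nat \<Rightarrow> nat. strict_mono r \<and> (\<forall>\<epsilon>>0. \<exists>N. \<forall>m\<ge>N. \<forall>n\<ge>N. ip.q (u (r m) - u (r n)) < \<epsilon>)"
  proof (rule compact[where u = u and C = "\<mu> + 2"])
    show "u n \<in> V" for n using u perpV by blast
    show "h.q (u n) + ip.q (u n) \<le> \<mu> + 2" for n
    proof -
      have "1 / real (Suc n) \<le> 1" by simp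
      then show ?thesis using u(2,3)[of n] by linarith
    qed
  qed
  then obtain r :: "nat \<Rightarrow> nat" where r: "strict_mono r"
    "\<forall>\<epsilon>>0. \<exists>N. \<forall>m\<ge>N. \<forall>n\<ge>N. ip.q (u (r m) - u (r n)) < \<epsilon>" by blast
  have d_lim: "d \<longlonglongrightarrow> 0"
    by (rule tendsto_sandwich[OF _ _ tendsto_const LIMSEQ_inverse_real_of_nat])
      (use d in \<open>auto simp: inverse_eq_divide intro!: always_eventually less_imp_le\<close>)
  interpret m: psd_form scale "perp S" "\<lambda>u v. h u v - \<mu> * ip u v"
  proof
    show "subspace (perp S)" by fact
  next
    fix u v assume "u \<in> perp S" "v \<in> perp S"
    then show "h v u - \<mu> * ip v u = cnj (h u v - \<mu> * ip u v)"
      using h.herm[of u v] ip.herm[of u v] perpV by simp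
  next
    fix u assume "u \<in> perp S"
    then show "0 \<le> Re (h u u - \<mu> * ip u u)"
      using min[of u] perpV by simp
  qed (auto simp: perpV h.add_left h.scale_left ip.add_left ip.scale_left algebra_simps)
  have \<mu>0: "0 \<le> \<mu>"
    unfolding \<mu>_def using R_ne by (intro cInf_greatest) (auto simp: R_def intro: h.nonneg perpV)
  have "\<exists>v\<in>V. (\<lambda>n. h.q (u (r n) - v) + ip.q (u (r n) - v)) \<longlonglongrightarrow> 0"
  proof (rule complete)
    show "u (r n) \<in> V" for n using u perpV by blast
    fix \<epsilon> :: real assume "\<epsilon> > 0"
    \<comment> \<open>Half of \<epsilon> is reserved for the \<open>ip\<close> part, multiplied by
      \<open>\<mu> + 1\<close>; the other half is covered by the four excess terms of size
      \<epsilon> / 8.\<close>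
    define \<delta> where "\<delta> = \<epsilon> / (2 * (\<mu> + 1))"
    have \<delta>: "\<delta> > 0" "(\<mu> + 1) * \<delta> = \<epsilon> / 2" using \<open>\<epsilon> > 0\<close> \<mu>0 by (auto simp: \<delta>_def field_simps)
    obtain N1 where N1: "\<forall>m\<ge>N1. \<forall>n\<ge>N1. ip.q (u (r m) - u (r n)) < \<delta>" using r(2)[rule_format, OF \<delta>(1)] by blast
    have "(\<lambda>n. d (r n)) \<longlonglongrightarrow> 0" using LIMSEQ_subseq_LIMSEQ[OF d_lim r(1)] by (simp add: o_def)
    then obtain N2 where N2: "\<forall>n\<ge>N2. d (r n) < \<epsilon> / 8"
      using \<open>\<epsilon> > 0\<close> d(1) by (auto simp: LIMSEQ_def dest!: spec[of _ "\<epsilon> / 8"])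
    show "\<exists>N. \<forall>m\<ge>N. \<forall>n\<ge>N. h.q (u (r m) - u (r n)) + ip.q (u (r m) - u (r n)) < \<epsilon>"
    proof (intro exI[of _ "max N1 N2"] allI impI)
      fix m n assume mn: "max N1 N2 \<le> m" "max N1 N2 \<le> n"
      define w where "w = u (r m) - u (r n)"
      \<comment> \<open>The shifted form of a difference is at most twice the sum of the shifted
        forms, which are small by minimality. This is the passage from \<open>ip\<close>-Cauchy to
        energy-Cauchy.\<close>
      have "h.q w - \<mu> * ip.q w \<le> 2 * d (r m) + 2 * d (r n)"
        using m.q_diff_le[OF u(1)[of "r m"] u(1)[of "r n"]] by (simp add: w_def d_def)
      also have "\<dots> < \<epsilon> / 2" using N2[rule_format, of m] N2[rule_format, of n] mn by simp
      finally have "h.q w + ip.q w < \<epsilon> / 2 + (\<mu> + 1) * ip.q w" by (simp add: algebra_simps)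
      also have "\<dots> \<le> \<epsilon> / 2 + (\<mu> + 1) * \<delta>"
        using N1 mn \<mu>0 by (auto simp: w_def intro!: mult_left_mono less_imp_le)
      finally show "h.q (u (r m) - u (r n)) + ip.q (u (r m) - u (r n)) < \<epsilon>"
        using \<delta> by (simp add: w_def)
    qed
  qed
  then obtain e where e: "e \<in> V" and lim: "(\<lambda>n. h.q (u (r n) - e) + ip.q (u (r n) - e)) \<longlonglongrightarrow> 0"
    by blast
  have inV: "u (r n) \<in> V" "u (r n) - e \<in> V" for n
    using u perpV e subspace_diff[OF ip.subsp] by auto
  have lim1: "(\<lambda>n. ip.q (u (r n) - e)) \<longlonglongrightarrow> 0"
    by (rule tendsto_sandwich[OF _ _ tendsto_const lim])
      (use inV in \<open>auto intro!: always_eventually h.nonneg ip.nonneg\<close>)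
  have lim2: "(\<lambda>n. h.q (u (r n) - e)) \<longlonglongrightarrow> 0"
    by (rule tendsto_sandwich[OF _ _ tendsto_const lim])
      (use inV in \<open>auto intro!: always_eventually h.nonneg ip.nonneg\<close>)
  have "(\<lambda>n. ip.q (u (r n))) \<longlonglongrightarrow> ip.q e"
    using inV e lim1 by (intro ip.q_limit_q) auto
  then have e1: "ip.q e = 1" by (simp add: u(2) LIMSEQ_const_iff)
  have ep: "e \<in> perp S"
  proof -
    have "ip e f = 0" if "f \<in> S" for f
    proof -
      have "(\<lambda>n. ip (u (r n)) f) \<longlonglongrightarrow> ip e f"
        using inV e lim1 that SV by (intro ip.q_limit) auto
      moreover have "ip (u (r n)) f = 0" for n using u(1)[of "r n"] that by (simp add: perp_def)
      ultimately show ?thesis by (simp add: LIMSEQ_const_iff)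
    qed
    then show ?thesis using e by (simp add: perp_def)
  qed
  have "(\<lambda>n. h.q (u (r n))) \<longlonglongrightarrow> h.q e"
    using inV e lim2 by (intro h.q_limit_q) auto
  moreover have "(\<lambda>n. h.q (u (r n))) \<longlonglongrightarrow> \<mu>"
  proof -
    have "(\<lambda>n. d (r n)) \<longlonglongrightarrow> 0" using LIMSEQ_subseq_LIMSEQ[OF d_lim r(1)] by (simp add: o_def)
    then have "(\<lambda>n. d (r n) + \<mu>) \<longlonglongrightarrow> 0 + \<mu>" by (intro tendsto_intros)
    then show ?thesis by (simp add: d_def u(2))
  qed
  ultimately have he: "h.q e = \<mu>" by (rule LIMSEQ_unique)
  have "eigen \<mu> e" using he e1 min ep by (intro minimizer_eigen[OF S]) auto
  moreover have "ip e e = 1" using ip.s_self[OF e] e1 by simp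
  ultimately show ?thesis
    unfolding eigenmin_def using ep min he by auto
qed

section \<open>The eigenvalue sequence obtained by successive minimisation\<close>

primrec eset :: "nat \<Rightarrow> 'v set" where
  "eset 0 = {}"
| "eset (Suc n) = insert (SOME e. eigenmin (eset n) e) (eset n)"

definition evec :: "nat \<Rightarrow> 'v" where "evec n = (SOME e. eigenmin (eset n) e)"
definition eval :: "nat \<Rightarrow> real" where "eval n = h.q (evec n)"

lemma eset_eq: "eset n = evec ` {..<n}"
  by (induction n) (auto simp: evec_def lessThan_Suc)

lemma eigen_orthonormal_insert:
  assumes "eigen_orthonormal S" "eigenmin S e"
  shows "eigen_orthonormal (insert e S)"
proof -
  have "ip e f = 0" "ip f e = 0" if "f \<in> S" for f
    using assms that eigen_orthonormal_subset[OF assms(1)] ip.herm[of e f]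
    by (auto simp: eigenmin_def perp_def)
  then show ?thesis using assms unfolding eigen_orthonormal_def eigenmin_def by auto
qed

lemma eset_orthonormal: "eigen_orthonormal (eset n)"
proof (induction n)
  case 0 then show ?case by (simp add: eigen_orthonormal_def)
next
  case (Suc n)
  then show ?case
    using eigen_orthonormal_insert[OF Suc someI_ex[OF eigenmin_exists[OF Suc]]] by simp
qed

lemma evec_eigenmin: "eigenmin (eset n) (evec n)"
  unfolding evec_def by (rule someI_ex[OF eigenmin_exists[OF eset_orthonormal]])

lemma evec_eigen: "eigen (eval n) (evec n)"
proof -
  obtain \<mu> where \<mu>: "eigen \<mu> (evec n)" using evec_eigenmin[of n] by (auto simp: eigenmin_def)
  then have "eval n = \<mu>" using eigen_q[OF \<mu>] evec_eigenmin[of n] by (simp add: eval_def eigenmin_def)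
  then show ?thesis using \<mu> by simp
qed

lemma evec_V: "evec n \<in> V"
  using evec_eigen by (auto simp: eigen_def)

lemma evec_orthonormal: "ip (evec m) (evec n) = (if m = n then 1 else 0)"
proof -
  have *: "ip (evec m) (evec n) = 0" if "n < m" for m n
    using evec_eigenmin[of m] that by (auto simp: eigenmin_def perp_def eset_eq)
  have "ip (evec n) (evec n) = 1" using evec_eigenmin[of n] by (auto simp: eigenmin_def)
  then show ?thesis
    using *[of m n] *[of n m] ip.herm[OF evec_V evec_V, of n m] by (cases m n rule: linorder_cases) auto
qed

lemma eval_min:
  assumes "u \<in> V" "\<And>i. i < n \<Longrightarrow> ip u (evec i) = 0"
  shows "eval n * ip.q u \<le> h.q u"
  using evec_eigenmin[of n] assms by (auto simp: eigenmin_def perp_def eset_eq eval_def)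

text \<open>The vector found at step \<open>Suc n\<close> was already an admissible competitor at
  step \<open>n\<close>.\<close>

lemma mono_eval: "mono eval"
proof (rule mono_iff_le_Suc[THEN iffD2], rule allI)
  fix n
  show "eval n \<le> eval (Suc n)"
    using eval_min[OF evec_V, of n "Suc n"] evec_orthonormal by (simp add: eval_def)
qed

text \<open>Orthonormal vectors have squared distance 2. If their energies stayed bounded,
  compactness would produce a Cauchy subsequence among them.\<close>

lemma eval_unbounded: "\<exists>n. eval n > C"
proof (rule ccontr)
  assume "\<not> ?thesis"
  then have C: "eval n \<le> C" for n by (auto simp: not_less)
  have "\<exists>r::nat \<Rightarrow> nat. strict_mono r \<and> (\<forall>\<epsilon>>0. \<exists>N. \<forall>m\<ge>N. \<forall>n\<ge>N. ip.q (evec (r m) - evec (r n)) < \<epsilon>)"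
    by (rule compact[where u = evec and C = "C + 1"]) (use C in \<open>auto simp: evec_V eval_def evec_orthonormal\<close>)
  then obtain r :: "nat \<Rightarrow> nat" where r0: "strict_mono r"
    "\<forall>\<epsilon>>0. \<exists>N. \<forall>m\<ge>N. \<forall>n\<ge>N. ip.q (evec (r m) - evec (r n)) < \<epsilon>" by blast
  obtain N where r: "strict_mono r" "\<forall>m\<ge>N. \<forall>n\<ge>N. ip.q (evec (r m) - evec (r n)) < 1"
    using r0(2)[rule_format, OF zero_less_one] r0(1) by blast
  have "r N \<noteq> r (Suc N)" using r(1) by (simp add: strict_mono_eq)
  then have "ip.q (evec (r N) - evec (r (Suc N))) = 2"
    by (simp add: ip.q_diff evec_V evec_orthonormal)
  then show False using r(2)[rule_format, of N "Suc N"] by auto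
qed

lemma finite_eval_le: "finite {n. eval n \<le> C}"
proof -
  obtain N where N: "eval N > C" using eval_unbounded by blast
  have "{n. eval n \<le> C} \<subseteq> {..<N}"
    using N mono_eval by (force simp: not_less dest: monoD)
  then show ?thesis by (rule finite_subset) auto
qed

lemma finite_eval_eq: "finite {n. eval n = C}"
  by (rule finite_subset[OF _ finite_eval_le[of C]]) auto

text \<open>Eigenvectors to different eigenvalues are orthogonal, so \<open>u\<close> is orthogonal
  to every \<open>evec n\<close>. At an index with \<open>eval n > \<mu>\<close> the minimum
  property then contradicts the energy of \<open>u\<close>, unless \<open>u\<close> is null.\<close>

lemma eigen_complete:
  assumes u: "eigen \<mu> u" and perp: "\<And>n. eval n = \<mu> \<Longrightarrow> ip u (evec n) = 0"
  shows "ip.q u = 0"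
proof (rule ccontr)
  assume "ip.q u \<noteq> 0"
  then have pos: "ip.q u > 0" using ip.nonneg[of u] u by (auto simp: eigen_def)
  have *: "ip u (evec n) = 0" for n
    using perp eigen_orthogonal[OF u evec_eigen[of n]] by blast
  obtain n where n: "eval n > \<mu>" using eval_unbounded by blast
  have "eval n * ip.q u \<le> \<mu> * ip.q u"
    using eval_min[of u n] * u by (auto simp: eigen_def)
  then show False using n pos by simp
qed

text \<open>With more vectors than indices of eigenvalue \<open>\<mu>\<close>, some nontrivial
  combination is orthogonal to all the corresponding \<open>evec\<close>; it is an eigenvector,
  hence null by \<open>eigen_complete\<close>.\<close>

lemma eigen_independent_le:
  assumes u: "\<And>i. i < m \<Longrightarrow> eigen \<mu> (u i)"
    and ind: "\<And>c. ip.q (\<Sum>i<m. c i \<odot> u i) = 0 \<Longrightarrow> \<forall>i<m. c i = 0"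
  shows "m \<le> card {n. eval n = \<mu>}"
proof (rule ccontr)
  assume "\<not> ?thesis"
  then obtain c where c: "\<exists>i\<in>{..<m}. c i \<noteq> 0"
      "\<forall>k\<in>{n. eval n = \<mu>}. (\<Sum>i<m. c i * ip (u i) (evec k)) = 0"
    using underdetermined_system[of "{n. eval n = \<mu>}" "{..<m}" "\<lambda>k i. ip (u i) (evec k)"]
      finite_eval_eq[of \<mu>] by auto
  have "eigen \<mu> (\<Sum>i<m. c i \<odot> u i)" using u by (intro eigen_sum) auto
  moreover have "ip (\<Sum>i<m. c i \<odot> u i) (evec k) = 0" if "eval k = \<mu>" for k
    using c(2) that u evec_V by (subst ip.sum_left) (auto simp: eigen_def)
  ultimately have "ip.q (\<Sum>i<m. c i \<odot> u i) = 0" by (rule eigen_complete)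
  with ind c(1) show False by blast
qed

lemma eigen_independent_ex:
  "\<exists>u. (\<forall>i < card {n. eval n = \<mu>}. eigen \<mu> (u i)) \<and>
     (\<forall>c. ip.q (\<Sum>i<card {n. eval n = \<mu>}. c i \<odot> u i) = 0 \<longrightarrow> (\<forall>i<card {n. eval n = \<mu>}. c i = 0))"
proof -
  let ?m = "card {n. eval n = \<mu>}"
  obtain b where b: "bij_betw b {..<?m} {n. eval n = \<mu>}"
    using finite_eval_eq ex_bij_betw_nat_finite[of "{n. eval n = \<mu>}"] by (auto simp: atLeast0LessThan)
  have 1: "eigen \<mu> (evec (b i))" if "i < ?m" for i
    using evec_eigen[of "b i"] bij_betwE[OF b] that by auto
  have 2: "c j = 0" if c: "ip.q (\<Sum>i<?m. c i \<odot> evec (b i)) = 0" and j: "j < ?m" for c j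
  proof -
    have V: "(\<Sum>i<?m. c i \<odot> evec (b i)) \<in> V" by (intro ip.sum_in evec_V)
    have "0 = ip (\<Sum>i<?m. c i \<odot> evec (b i)) (evec (b j))"
      using ip.null_left[OF V evec_V c] by simp
    also have "\<dots> = (\<Sum>i<?m. c i * ip (evec (b i)) (evec (b j)))"
      by (intro ip.sum_left) (auto simp: evec_V)
    also have "\<dots> = (\<Sum>i<?m. if i = j then c i else 0)"
      using bij_betw_imp_inj_on[OF b] j
      by (intro sum.cong) (auto simp: evec_orthonormal inj_on_eq_iff)
    also have "\<dots> = c j" using j by simp
    finally show ?thesis by simp
  qed
  show ?thesis using 1 2 by (intro exI[of _ "\<lambda>i. evec (b i)"]) blast
qed

text \<open>Filonov's argument: a function \<open>w\<close> satisfying the eigenvalue equation tested against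
  the smaller form domain and of form value below \<open>\<mu>\<close> yields one more trial function.\<close>

lemma eval_less:
  assumes VD: "VD \<subseteq> V" "subspace VD"
    and f: "\<And>i. i < j \<Longrightarrow> f i \<in> VD" "\<And>i k. i < j \<Longrightarrow> k < j \<Longrightarrow> ip (f i) (f k) = (if i = k then 1 else 0)"
    and l: "\<And>i v. i < j \<Longrightarrow> v \<in> VD \<Longrightarrow> h (f i) v = of_real (l i) * ip (f i) v" "\<And>i. i < j \<Longrightarrow> l i \<le> \<mu>"
    and w: "w \<in> V" "\<And>v. v \<in> VD \<Longrightarrow> h w v = of_real \<mu> * ip w v" "h.q w < \<mu> * ip.q w"
    and triv: "\<And>v. v \<in> VD \<Longrightarrow> (\<And>u. u \<in> V \<Longrightarrow> h v u = of_real \<mu> * ip v u) \<Longrightarrow> ip.q v = 0"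
  shows "eval j < \<mu>"
proof (rule ccontr)
  assume "\<not> ?thesis"
  then have ge: "\<mu> \<le> eval j" by simp
  define g where "g i = (if i < j then f i else w)" for i
  have gV: "g i \<in> V" for i using f VD w by (auto simp: g_def)
  \<comment> \<open>There are \<open>j + 1\<close> coefficients for \<open>j\<close> conditions:
    orthogonality to the first \<open>j\<close> vectors \<open>evec\<close>.\<close>
  obtain c where c: "\<exists>i\<in>{..j}. c i \<noteq> 0" "\<forall>k\<in>{..<j}. (\<Sum>i\<le>j. c i * ip (g i) (evec k)) = 0"
    using underdetermined_system[of "{..<j}" "{..j}" "\<lambda>k i. ip (g i) (evec k)"] by auto
  define v where "v = (\<Sum>i<j. c i \<odot> f i)"
  define u where "u = v + c j \<odot> w"
  have vVD: "v \<in> VD" unfolding v_def using VD f by (intro subspace_sum subspace_scale) auto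
  then have vV: "v \<in> V" using VD by auto
  have cwV: "c j \<odot> w \<in> V" using w ip.subsp subspace_scale by blast
  have uV: "u \<in> V" unfolding u_def using vV cwV ip.subsp subspace_add by blast
  have u_eq: "u = (\<Sum>i\<le>j. c i \<odot> g i)"
    by (simp add: u_def v_def g_def lessThan_Suc_atMost[symmetric])
  have perp: "ip u (evec k) = 0" if "k < j" for k
    unfolding u_eq using gV evec_V c(2) that by (subst ip.sum_left) auto
  have low: "\<mu> * ip.q u \<le> h.q u"
  proof -
    have "\<mu> * ip.q u \<le> eval j * ip.q u" using ge ip.nonneg[OF uV] by (rule mult_right_mono)
    also have "\<dots> \<le> h.q u" using eval_min[OF uV perp] .
    finally show ?thesis .
  qed
  have ip_f: "ip v (f k) = c k" if "k < j" for k
  proof -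
    have "ip v (f k) = (\<Sum>i<j. c i * ip (f i) (f k))"
      unfolding v_def using f VD that by (intro ip.sum_left) auto
    also have "\<dots> = (\<Sum>i<j. if i = k then c i else 0)" using f(2) that by (intro sum.cong) auto
    also have "\<dots> = c k" using that by simp
    finally show ?thesis .
  qed
  have ipv: "ip v x = (\<Sum>i<j. c i * ip (f i) x)" if "x \<in> V" for x
    unfolding v_def using f VD that by (intro ip.sum_left) auto
  have hv: "h v x = (\<Sum>i<j. c i * of_real (l i) * ip (f i) x)" if "x \<in> VD" for x
    unfolding v_def using f VD that l(1) by (subst h.sum_left) (auto intro!: sum.cong simp: mult.assoc)
  have ipfv: "ip (f i) v = cnj (c i)" if "i < j" for i
    using ip_f[OF that] ip.herm[of v "f i"] f VD vV that by auto
  \<comment> \<open>On the span of the \<open>f i\<close> the form is diagonal: the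
    \<open>f i\<close> are orthonormal and each solves its own equation against all of
    \<open>VD\<close>, in particular against \<open>v\<close>.\<close>
  have qv: "h.q v - \<mu> * ip.q v = (\<Sum>i<j. (l i - \<mu>) * (cmod (c i))\<^sup>2)"
  proof -
    have "h v v - \<mu> * ip v v = (\<Sum>i<j. of_real ((l i - \<mu>) * (cmod (c i))\<^sup>2))"
      unfolding hv[OF vVD] ipv[OF vV] sum_distrib_left sum_subtractf[symmetric]
    proof (intro sum.cong refl)
      fix i assume "i \<in> {..<j}"
      then have "ip (f i) v = cnj (c i)" by (simp add: ipfv)
      then show "c i * of_real (l i) * ip (f i) v - of_real \<mu> * (c i * ip (f i) v)
          = of_real ((l i - \<mu>) * (cmod (c i))\<^sup>2)"
        by (simp only: of_real_mult of_real_diff complex_norm_square) (simp add: algebra_simps)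
    qed
    then have "Re (h v v - \<mu> * ip v v) = Re (of_real (\<Sum>i<j. (l i - \<mu>) * (cmod (c i))\<^sup>2))"
      by (simp only: of_real_sum)
    then show ?thesis by simp
  qed
  \<comment> \<open>The equation for \<open>w\<close>, tested with \<open>v\<close> in
    \<open>VD\<close>, makes the mixed term of \<open>h - \<mu> ip\<close> vanish, so the
    contributions of \<open>v\<close> and \<open>w\<close> simply add.\<close>
  have cross: "h v (c j \<odot> w) = \<mu> * ip v (c j \<odot> w)"
  proof -
    have "h v w = \<mu> * ip v w"
      using w(2)[OF vVD] h.herm[OF w(1) vV] ip.herm[OF w(1) vV] by simp
    then show ?thesis using vV w by (simp add: h.scale_right ip.scale_right)
  qed
  have qu: "h.q u - \<mu> * ip.q u = (\<Sum>i<j. (l i - \<mu>) * (cmod (c i))\<^sup>2) + (cmod (c j))\<^sup>2 * (h.q w - \<mu> * ip.q w)"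
    unfolding u_def h.q_add[OF vV cwV] ip.q_add[OF vV cwV] cross qv[symmetric]
    using w by (simp add: h.q_scale ip.q_scale algebra_simps)
  have le1: "(\<Sum>i<j. (l i - \<mu>) * (cmod (c i))\<^sup>2) \<le> 0"
    using l(2) by (intro sum_nonpos mult_nonpos_nonneg) auto
  have le2: "(cmod (c j))\<^sup>2 * (h.q w - \<mu> * ip.q w) \<le> 0"
    using w(3) by (intro mult_nonneg_nonpos) auto
  \<comment> \<open>The lower bound from orthogonality says that the sum is nonnegative, while each
    of the two summands is nonpositive; hence both are zero.\<close>
  have eq0: "(\<Sum>i<j. (l i - \<mu>) * (cmod (c i))\<^sup>2) = 0" "(cmod (c j))\<^sup>2 * (h.q w - \<mu> * ip.q w) = 0"
    using low qu le1 le2 by linarith+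
  have cj: "c j = 0"
  proof (rule ccontr)
    assume "c j \<noteq> 0"
    then show False using eq0(2) w(3) by simp
  qed
  have uv: "u = v" using cj by (simp add: u_def)
  have ci: "c i = 0 \<or> l i = \<mu>" if "i < j" for i
  proof -
    have "(\<Sum>i<j. (\<mu> - l i) * (cmod (c i))\<^sup>2) = 0"
      using eq0(1) by (simp add: left_diff_distrib sum_subtractf)
    then have "\<forall>i\<in>{..<j}. (\<mu> - l i) * (cmod (c i))\<^sup>2 = 0"
      using l(2) by (subst (asm) sum_nonneg_eq_0_iff) auto
    then show ?thesis using that by auto
  qed
  \<comment> \<open>Equality in the minimum problem makes \<open>u\<close> an eigenvector on all of
    \<open>V\<close>. Since \<open>u = v\<close> also lies in \<open>VD\<close>, hypothesis
    \<open>triv\<close> applies to it.\<close>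
  have eig: "eigen \<mu> u"
  proof (rule minimizer_eigen[OF eset_orthonormal[of j]])
    show "u \<in> perp (eset j)" using perp uV by (auto simp: perp_def eset_eq)
    show "h.q u = \<mu> * ip.q u" using qu eq0 by simp
    fix x assume x: "x \<in> perp (eset j)"
    then have xV: "x \<in> V" by (simp add: perp_def)
    have "\<mu> * ip.q x \<le> eval j * ip.q x" using ge ip.nonneg[OF xV] by (rule mult_right_mono)
    also have "\<dots> \<le> h.q x" using eval_min[OF xV] x by (auto simp: perp_def eset_eq)
    finally show "\<mu> * ip.q x \<le> h.q x" .
  qed
  have "ip.q v = 0"
    using triv[OF vVD] eig by (auto simp: uv eigen_def)
  then have "c i = 0" if "i < j" for i
    using ip.null_left[OF vV, of "f i"] ip_f[OF that] f VD that by auto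
  then show False using c(1) cj by (auto simp: le_less)
qed

end

text \<open>If l n < k n, the values of \<open>l\<close> at the indices up to \<open>n\<close>
  account for at least n + 1 indices of \<open>l\<close>. By equal fibre sizes they account for as
  many indices of \<open>k\<close>; but \<open>k\<close> takes values at most l n only below index
  \<open>n\<close>.\<close>

lemma mono_enumeration_unique:
  fixes l k :: "nat \<Rightarrow> real"
  assumes "mono l" "mono k" "\<And>\<mu>. finite {i. l i = \<mu>}" "\<And>\<mu>. finite {i. k i = \<mu>}"
    and eq: "\<And>\<mu>. card {i. l i = \<mu>} = card {i. k i = \<mu>}"
  shows "l = k"
proof -
  have *: "k n \<le> l n" if "mono l" "mono k" "\<And>\<mu>. finite {i. l i = \<mu>}" "\<And>\<mu>. finite {i. k i = \<mu>}"
    "\<And>\<mu>. card {i. l i = \<mu>} = card {i. k i = \<mu>}" for l k :: "nat \<Rightarrow> real" and n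
  proof (rule ccontr)
    assume "\<not> k n \<le> l n"
    then have less: "l n < k n" by simp
    define F where "F = l ` {..n}"
    have "{..n} \<subseteq> (\<Union>\<mu>\<in>F. {i. l i = \<mu>})" by (auto simp: F_def)
    then have "card {..n} \<le> card (\<Union>\<mu>\<in>F. {i. l i = \<mu>})"
      using that by (intro card_mono) (auto simp: F_def)
    also have "\<dots> = (\<Sum>\<mu>\<in>F. card {i. l i = \<mu>})"
      using that by (intro card_UN_disjoint) (auto simp: F_def)
    also have "\<dots> = (\<Sum>\<mu>\<in>F. card {i. k i = \<mu>})" using that by simp
    also have "\<dots> = card (\<Union>\<mu>\<in>F. {i. k i = \<mu>})"
      using that by (intro card_UN_disjoint[symmetric]) (auto simp: F_def)
    also have "\<dots> \<le> card {..<n}"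
    proof (intro card_mono subsetI)
      fix i assume "i \<in> (\<Union>\<mu>\<in>F. {i. k i = \<mu>})"
      then obtain m where "m \<le> n" "k i = l m" by (auto simp: F_def)
      then have "k i < k n" using less monoD[OF that(1), of m n] by simp
      then show "i \<in> {..<n}" using monoD[OF that(2), of n i] by force
    qed auto
    finally show False by simp
  qed
  show ?thesis
    using *[of l k] *[of k l] assms by (intro ext antisym) auto
qed

section \<open>Test functions\<close>

lemma sigma_finite_lebesgue: "sigma_finite_measure (lebesgue :: 'a::euclidean_space measure)"
proof
  show "\<exists>A::'a set set. countable A \<and> A \<subseteq> sets lebesgue \<and> \<Union>A = space lebesgue \<and> (\<forall>a\<in>A. emeasure lebesgue a \<noteq> \<infinity>)"
  proof (intro exI[of _ "range (\<lambda>n::nat. box (-(real n *\<^sub>R One)) (real n *\<^sub>R One))"] conjI ballI)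
    show "\<Union> (range (\<lambda>n::nat. box (-(real n *\<^sub>R One)) (real n *\<^sub>R One))) = space (lebesgue :: 'a measure)"
      using UN_box_eq_UNIV by simp
    fix a :: "'a set" assume "a \<in> range (\<lambda>n::nat. box (-(real n *\<^sub>R One)) (real n *\<^sub>R One))"
    then show "emeasure lebesgue a \<noteq> \<infinity>"
      using lmeasurable_box fmeasurableD2 by fastforce
  qed auto
qed

text \<open>Boxes form an intersection-stable generator of the Borel sets, so the sets over which
  the integral vanishes include all Borel sets; the complement step uses the integral over the whole
  space, reached by exhausting boxes. Lebesgue sets differ from Borel sets by null sets
  only.\<close>

lemma AE_zero_lebesgue_if_box_integrals_zero:
  fixes f :: "'a::euclidean_space \<Rightarrow> 'b::{banach, second_countable_topology}"
  assumes f: "integrable lebesgue f"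
    and zero: "\<And>a b. (LINT x|lebesgue. indicator (box a b) x *\<^sub>R f x) = 0"
  shows "AE x in lebesgue. f x = 0"
proof -
  have int: "integrable lebesgue (\<lambda>x. indicator A x *\<^sub>R f x)" if "A \<in> sets lebesgue" for A
    using f that by (intro integrable_mult_indicator) auto
  have UNIV_zero: "(LINT x|lebesgue. f x) = 0"
  proof -
    have "(\<lambda>n. LINT x|lebesgue. indicator (box (-(real n *\<^sub>R One)) (real n *\<^sub>R One)) x *\<^sub>R f x)
        \<longlonglongrightarrow> (LINT x|lebesgue. f x)"
    proof (rule integral_dominated_convergence[where w = "\<lambda>x. norm (f x)"])
      show "AE x in lebesgue. (\<lambda>n. indicator (box (-(real n *\<^sub>R One)) (real n *\<^sub>R One)) x *\<^sub>R f x) \<longlonglongrightarrow> f x"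
      proof (intro AE_I2)
        fix x :: 'a
        obtain N where N: "norm x < real N" using reals_Archimedean2 by blast
        have "x \<in> box (-(real n *\<^sub>R One)) (real n *\<^sub>R One)" if "n \<ge> N" for n
          using N that Basis_le_norm[of _ x] by (fastforce simp: mem_box abs_less_iff)
        then have "\<forall>\<^sub>F n in sequentially. indicator (box (-(real n *\<^sub>R One)) (real n *\<^sub>R One)) x *\<^sub>R f x = f x"
          by (auto simp: eventually_sequentially intro!: exI[of _ N])
        then show "(\<lambda>n. indicator (box (-(real n *\<^sub>R One)) (real n *\<^sub>R One)) x *\<^sub>R f x) \<longlonglongrightarrow> f x"
          by (rule tendsto_eventually)
      qed
      show "(\<lambda>x. indicator (box (-(real n *\<^sub>R One)) (real n *\<^sub>R One)) x *\<^sub>R f x) \<in> borel_measurable lebesgue" for n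
        by (intro borel_measurable_integrable int) auto
    qed (use f in \<open>auto split: split_indicator\<close>)
    then show ?thesis using zero by (simp add: LIMSEQ_const_iff)
  qed
  have borel_zero: "(LINT x|lebesgue. indicator A x *\<^sub>R f x) = 0" if "A \<in> sets lborel" for A
  proof -
    have "Int_stable (range (\<lambda>(a, b). box a b :: 'a set))"
      by (auto simp: Int_stable_def box_Int_box)
    moreover have "range (\<lambda>(a, b). box a b :: 'a set) \<subseteq> Pow UNIV" by auto
    moreover have "A \<in> sigma_sets UNIV (range (\<lambda>(a, b). box a b :: 'a set))"
      using that by (simp add: borel_eq_box)
    ultimately show ?thesis
    proof (induction rule: sigma_sets_induct_disjoint)
      case (basic A)
      then show ?case using zero by auto
    next
      case empty
      show ?case by simp
    next
      case (compl A)
      have "A \<in> sets borel" using compl by (simp add: borel_eq_box)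
      then have A: "A \<in> sets lebesgue" by auto
      have "(LINT x|lebesgue. indicator (UNIV - A) x *\<^sub>R f x)
          = (LINT x|lebesgue. f x - indicator A x *\<^sub>R f x)"
        by (intro Bochner_Integration.integral_cong) (auto split: split_indicator)
      also have "\<dots> = 0"
        using compl UNIV_zero by (simp add: Bochner_Integration.integral_diff f int[OF A])
      finally show ?case .
    next
      case (union A)
      have "A i \<in> sets borel" for i using union(2) by (auto simp: borel_eq_box)
      then have A: "A i \<in> sets lebesgue" for i by auto
      have "(LINT x:(\<Union>i. A i)|lebesgue. f x) = (\<Sum>i. (LINT x:A i|lebesgue. f x))"
        using A union(1) int by (intro lebesgue_integral_countable_add)
          (auto simp: disjoint_family_on_def set_integrable_def)
      then show ?case using union(3) by (simp add: set_lebesgue_integral_def)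
    qed
  qed
  have "(LINT x|lebesgue. indicator A x *\<^sub>R f x) = 0" if A: "A \<in> sets lebesgue" for A
  proof -
    obtain S N N' where S: "A = S \<union> N" "N \<subseteq> N'" "N' \<in> null_sets lborel" "S \<in> sets lborel"
      using sets_completionE[OF A] by blast
    have N: "AE x in lebesgue. x \<notin> N"
      using S AE_completion[OF AE_not_in[OF S(3)]] by (auto elim: eventually_mono)
    have "(LINT x|lebesgue. indicator A x *\<^sub>R f x) = (LINT x|lebesgue. indicator S x *\<^sub>R f x)"
    proof (rule integral_cong_AE)
      show "AE x in lebesgue. indicator A x *\<^sub>R f x = indicator S x *\<^sub>R f x"
        using N by eventually_elim (auto simp: S split: split_indicator)
      show "(\<lambda>x. indicator A x *\<^sub>R f x) \<in> borel_measurable lebesgue" using int[OF A] by auto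
      have "S \<in> sets lebesgue" using S by auto
      then show "(\<lambda>x. indicator S x *\<^sub>R f x) \<in> borel_measurable lebesgue" using int by auto
    qed
    then show ?thesis using borel_zero[OF S(4)] by simp
  qed
  then show ?thesis
    using sigma_finite_measure.density_unique_banach[OF sigma_finite_lebesgue, OF f integrable_zero] by (simp add: set_lebesgue_integral_def)
qed

text \<open>The classical smooth function that is flat at 0. The power of x is included because
  differentiation produces negative powers, so that the family is closed under derivatives;
  \<epsilon> is kept so that \<open>bump1 0 \<epsilon>\<close> tends to 1 on the positive axis as
  \<epsilon> tends to 0.\<close>

definition bump1 :: "nat \<Rightarrow> real \<Rightarrow> real \<Rightarrow> real" where
  "bump1 m \<epsilon> x = (if x > 0 then exp (- \<epsilon> / x) / x ^ m else 0)"

text \<open>Compare exp(\<epsilon> / x) with the single term of order m + 2 of its series. Two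
  powers more than the denominator leave the factor x^2, which makes the derivative at 0 exist and
  vanish.\<close>

lemma bump1_bound:
  assumes "\<epsilon> > 0"
  shows "\<bar>bump1 m \<epsilon> x\<bar> \<le> fact (m + 2) / \<epsilon> ^ (m + 2) * x\<^sup>2"
proof (cases "x > 0")
  case True
  define t where "t = \<epsilon> / x"
  have t: "t > 0" using assms True by (simp add: t_def)
  have "t ^ (m + 2) / fact (m + 2) \<le> (\<Sum>n\<in>{m + 2}. t ^ n /\<^sub>R fact n)" by (simp add: divide_inverse mult.commute)
  also have "\<dots> \<le> (\<Sum>n. t ^ n /\<^sub>R fact n)"
    using t by (intro sum_le_suminf sums_summable[OF exp_converges]) auto
  finally have "t ^ (m + 2) / fact (m + 2) \<le> exp t" by (simp add: exp_def)
  then have *: "t ^ (m + 2) \<le> exp t * fact (m + 2)"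
    by (subst (asm) pos_divide_le_eq) (auto simp del: fact_Suc)
  have "exp (- t) * t ^ (m + 2) \<le> exp (- t) * (exp t * fact (m + 2))"
    using * by (rule mult_left_mono) simp
  also have "\<dots> = fact (m + 2)" by (simp add: exp_minus mult.assoc[symmetric] del: fact_Suc)
  finally have "exp (- t) * t ^ (m + 2) \<le> fact (m + 2)" .
  then have "exp (- t) \<le> fact (m + 2) / t ^ (m + 2)" using t by (simp add: pos_le_divide_eq)
  also have "\<dots> = fact (m + 2) / \<epsilon> ^ (m + 2) * x\<^sup>2 * x ^ m"
    using True assms by (simp add: t_def power_divide power_add power2_eq_square field_simps)
  finally show ?thesis using True by (simp add: bump1_def t_def divide_le_eq)
next
  case False
  then show ?thesis using assms by (simp add: bump1_def)
qed

lemma bump1_deriv: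
  assumes "\<epsilon> > 0"
  shows "(bump1 m \<epsilon> has_real_derivative (\<epsilon> * bump1 (m + 2) \<epsilon> x - real m * bump1 (m + 1) \<epsilon> x)) (at x)"
proof -
  consider "x > 0" | "x < 0" | "x = 0" by linarith
  then show ?thesis
  proof cases
    case 1
    have "((\<lambda>x. exp (- \<epsilon> / x) / x ^ m) has_real_derivative
        (\<epsilon> * bump1 (m + 2) \<epsilon> x - real m * bump1 (m + 1) \<epsilon> x)) (at x)"
      using 1 by (auto intro!: derivative_eq_intros simp: bump1_def field_simps power2_eq_square)
        (cases m; simp add: field_simps)
    then show ?thesis
      by (rule has_field_derivative_transform_within_open[where S = "{0<..}"]) (use 1 in \<open>auto simp: bump1_def\<close>)
  next
    case 2
    have "((\<lambda>x. 0) has_real_derivative (\<epsilon> * bump1 (m + 2) \<epsilon> x - real m * bump1 (m + 1) \<epsilon> x)) (at x)"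
      using 2 by (simp add: bump1_def)
    then show ?thesis
      by (rule has_field_derivative_transform_within_open[where S = "{..<0}"]) (use 2 in \<open>auto simp: bump1_def\<close>)
  next
    case 3
    define C where "C = fact (m + 2) / \<epsilon> ^ (m + 2)"
    have "((\<lambda>h. (bump1 m \<epsilon> (0 + h) - bump1 m \<epsilon> 0) / h) \<longlongrightarrow> 0) (at 0)"
    proof (rule Lim_null_comparison)
      show "((\<lambda>h. C * \<bar>h\<bar>) \<longlongrightarrow> 0) (at 0)" by (auto intro!: tendsto_eq_intros)
      have "norm ((bump1 m \<epsilon> (0 + h) - bump1 m \<epsilon> 0) / h) \<le> C * \<bar>h\<bar>" if "h \<noteq> 0" for h
        using bump1_bound[OF assms, of m h, folded C_def] that
        by (simp add: bump1_def[of m \<epsilon> 0] divide_le_eq power2_eq_square mult.assoc)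
      then show "\<forall>\<^sub>F h in at 0. norm ((bump1 m \<epsilon> (0 + h) - bump1 m \<epsilon> 0) / h) \<le> C * \<bar>h\<bar>"
        by (auto simp: eventually_at_filter)
    qed
    then show ?thesis using 3 by (simp add: DERIV_def bump1_def[of _ \<epsilon> 0])
  qed
qed

text \<open>A class of smooth functions that is visibly closed under partial derivatives.\<close>

inductive bump_alg :: "(real^'n \<Rightarrow> complex) \<Rightarrow> bool" where
  const: "bump_alg (\<lambda>_. c)"
| left: "\<epsilon> > 0 \<Longrightarrow> bump_alg (\<lambda>z. of_real (bump1 m \<epsilon> (z $ i - c)))"
| right: "\<epsilon> > 0 \<Longrightarrow> bump_alg (\<lambda>z. of_real (bump1 m \<epsilon> (c - z $ i)))"
| add: "bump_alg f \<Longrightarrow> bump_alg g \<Longrightarrow> bump_alg (\<lambda>z. f z + g z)"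
| mult: "bump_alg f \<Longrightarrow> bump_alg g \<Longrightarrow> bump_alg (\<lambda>z. f z * g z)"

lemma bump_alg_deriv:
  fixes f :: "real^'n \<Rightarrow> complex"
  shows "bump_alg f \<Longrightarrow> \<exists>D. (\<forall>z. (f has_derivative D z) (at z)) \<and> (\<forall>b. bump_alg (\<lambda>z. D z b))"
proof (induction rule: bump_alg.induct)
  case (const c)
  show ?case
    by (intro exI[of _ "\<lambda>_ _. 0"]) (auto intro: bump_alg.const)
next
  case (left \<epsilon> m i c)
  let ?d = "\<lambda>x. \<epsilon> * bump1 (m + 2) \<epsilon> x - real m * bump1 (m + 1) \<epsilon> x"
  have "((\<lambda>z::real^'n. complex_of_real (bump1 m \<epsilon> (z $ i - c))) has_derivative
      (\<lambda>h. of_real (?d (z $ i - c) * h $ i))) (at z)" for z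
  proof (rule has_derivative_of_real)
    have "((\<lambda>z. bump1 m \<epsilon> (z $ i - c)) has_derivative (\<lambda>h. ?d (z $ i - c) * h $ i)) (at z)"
      by (rule has_derivative_compose[where f = "\<lambda>z. z $ i - c", OF _ bump1_deriv[OF left, unfolded has_field_derivative_def]])
        (auto intro!: derivative_eq_intros bounded_linear_imp_has_derivative bounded_linear_vec_nth)
    then show "((\<lambda>z. bump1 m \<epsilon> (z $ i - c)) has_derivative (\<lambda>h. ?d (z $ i - c) * h $ i)) (at z)" .
  qed
  moreover have "bump_alg (\<lambda>z::real^'n. of_real (?d (z $ i - c) * b $ i))" for b :: "real^'n"
  proof -
    have "bump_alg (\<lambda>z::real^'n. of_real (\<epsilon> * b $ i) * of_real (bump1 (m + 2) \<epsilon> (z $ i - c)) +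
        of_real (- real m * b $ i) * of_real (bump1 (m + 1) \<epsilon> (z $ i - c)))"
      using left by (intro bump_alg.intros)
    then show ?thesis by (simp add: algebra_simps)
  qed
  ultimately show ?case
    by (intro exI[of _ "\<lambda>z h. of_real (?d (z $ i - c) * h $ i)"] conjI allI)
next
  case (right \<epsilon> m c i)
  let ?d = "\<lambda>x. \<epsilon> * bump1 (m + 2) \<epsilon> x - real m * bump1 (m + 1) \<epsilon> x"
  have "((\<lambda>z::real^'n. complex_of_real (bump1 m \<epsilon> (c - z $ i))) has_derivative
      (\<lambda>h. of_real (?d (c - z $ i) * - (h $ i)))) (at z)" for z
  proof (rule has_derivative_of_real)
    show "((\<lambda>z. bump1 m \<epsilon> (c - z $ i)) has_derivative (\<lambda>h. ?d (c - z $ i) * - (h $ i))) (at z)"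
      by (rule has_derivative_compose[where f = "\<lambda>z. c - z $ i", OF _ bump1_deriv[OF right, unfolded has_field_derivative_def]])
        (auto intro!: derivative_eq_intros bounded_linear_imp_has_derivative bounded_linear_vec_nth)
  qed
  moreover have "bump_alg (\<lambda>z::real^'n. of_real (?d (c - z $ i) * - (b $ i)))" for b :: "real^'n"
  proof -
    have "bump_alg (\<lambda>z::real^'n. of_real (- \<epsilon> * b $ i) * of_real (bump1 (m + 2) \<epsilon> (c - z $ i)) +
        of_real (real m * b $ i) * of_real (bump1 (m + 1) \<epsilon> (c - z $ i)))"
      using right by (intro bump_alg.intros)
    then show ?thesis by (simp add: algebra_simps)
  qed
  ultimately show ?case
    by (intro exI[of _ "\<lambda>z h. of_real (?d (c - z $ i) * - (h $ i))"] conjI allI)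
next
  case (add f g)
  then obtain D E where D: "\<And>z. (f has_derivative D z) (at z)" "\<And>b. bump_alg (\<lambda>z. D z b)"
    "\<And>z. (g has_derivative E z) (at z)" "\<And>b. bump_alg (\<lambda>z. E z b)" by blast
  show ?case
    by (intro exI[of _ "\<lambda>z b. D z b + E z b"] conjI allI has_derivative_add D bump_alg.intros)
next
  case (mult f g)
  then obtain D E where D: "\<And>z. (f has_derivative D z) (at z)" "\<And>b. bump_alg (\<lambda>z. D z b)"
    "\<And>z. (g has_derivative E z) (at z)" "\<And>b. bump_alg (\<lambda>z. E z b)" by blast
  show ?case
    by (intro exI[of _ "\<lambda>z b. f z * E z b + D z b * g z"] conjI allI has_derivative_mult D
        bump_alg.intros mult)
qed

lemma bump_alg_C_k: "bump_alg f \<Longrightarrow> C_k k f"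
proof (induction k arbitrary: f)
  case 0
  obtain D where "\<And>z. (f has_derivative D z) (at z)" using bump_alg_deriv[OF 0] by blast
  then show ?case by (auto intro!: continuous_at_imp_continuous_on has_derivative_continuous)
next
  case (Suc k)
  obtain D where D: "\<And>z. (f has_derivative D z) (at z)" "\<And>b. bump_alg (\<lambda>z. D z b)"
    using bump_alg_deriv[OF Suc.prems] by blast
  have "frechet_derivative f (at z) = D z" for z using frechet_derivative_at[OF D(1)] by simp
  then show ?case using D Suc.IH by (auto simp: differentiable_def)
qed

lemma bump_alg_prod:
  "finite I \<Longrightarrow> (\<And>i. i \<in> I \<Longrightarrow> bump_alg (f i)) \<Longrightarrow> bump_alg (\<lambda>z. \<Prod>i\<in>I. f i z)"
  by (induction I rule: finite_induct) (auto intro: bump_alg.intros)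

text \<open>A product over coordinates is nonzero exactly on the open box and converges to its
  indicator. This fits the criterion that detects null functions by their integrals over
  boxes.\<close>

definition bump :: "real \<Rightarrow> real^'n \<Rightarrow> real^'n \<Rightarrow> real^'n \<Rightarrow> complex" where
  "bump \<epsilon> a b z = (\<Prod>i\<in>UNIV. of_real (bump1 0 \<epsilon> (z $ i - a $ i)) * of_real (bump1 0 \<epsilon> (b $ i - z $ i)))"

lemma bump_nonzero_iff: "bump \<epsilon> a b z \<noteq> 0 \<longleftrightarrow> z \<in> box a b"
  by (auto simp: bump_def bump1_def mem_box_cart)

lemma bump_test_fun:
  assumes "\<epsilon> > 0" "cbox a b \<subseteq> \<Omega>"
  shows "bump \<epsilon> a b \<in> test_fun \<Omega>"
proof -
  have "bump_alg (bump \<epsilon> a b)"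
    unfolding bump_def using assms by (intro bump_alg_prod bump_alg.intros) auto
  moreover have sub: "closure {x. bump \<epsilon> a b x \<noteq> 0} \<subseteq> cbox a b"
    by (rule closure_minimal) (auto simp: bump_nonzero_iff box_subset_cbox[THEN subsetD])
  moreover have "compact (closure {x. bump \<epsilon> a b x \<noteq> 0})"
    using sub bounded_subset[OF bounded_cbox sub] by (simp add: compact_eq_bounded_closed)
  ultimately show ?thesis using assms by (auto simp: test_fun_def bump_alg_C_k)
qed

lemma bump_tendsto_indicator:
  "(\<lambda>n. bump (1 / Suc n) a b z) \<longlonglongrightarrow> indicator (box a b) z"
proof (cases "z \<in> box a b")
  case True
  have *: "(\<lambda>n. bump1 0 (1 / Suc n) x) \<longlonglongrightarrow> 1" if "x > 0" for x
  proof -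
    have "(\<lambda>n. exp (- (inverse (real (Suc n))) / x)) \<longlonglongrightarrow> exp (- 0 / x)"
      using that by (intro tendsto_intros LIMSEQ_inverse_real_of_nat) auto
    then show ?thesis using that by (simp add: bump1_def inverse_eq_divide)
  qed
  have "(\<lambda>n. bump (1 / Suc n) a b z) \<longlonglongrightarrow> (\<Prod>i\<in>(UNIV::'a set). of_real 1 * of_real 1)"
    unfolding bump_def using True by (intro tendsto_intros *) (auto simp: mem_box_cart)
  then show ?thesis using True by simp
next
  case False
  then have "bump (1 / Suc n) a b z = 0" for n using bump_nonzero_iff by blast
  then show ?thesis using False by simp
qed

lemma norm_bump_le: "\<epsilon> > 0 \<Longrightarrow> norm (bump \<epsilon> a b z) \<le> indicator (cbox a b) z"
proof (cases "z \<in> cbox a b")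
  case True
  assume "\<epsilon> > 0"
  then have "norm (of_real (bump1 0 \<epsilon> x) :: complex) \<le> 1" for x by (simp add: bump1_def)
  then have "norm (bump \<epsilon> a b z) \<le> (\<Prod>i\<in>(UNIV::'a set). 1 * 1)"
    unfolding bump_def prod_norm[symmetric] norm_mult
    by (intro prod_mono conjI mult_mono mult_nonneg_nonneg norm_ge_zero) auto
  then show ?thesis using True by simp
next
  case False
  then show ?thesis using bump_nonzero_iff[of \<epsilon> a b z] box_subset_cbox[of a b] by auto
qed

lemma LINT_lebesgue_on_eq_lborel:
  fixes f :: "'a::euclidean_space \<Rightarrow> 'b::{banach, second_countable_topology}"
  assumes "\<Omega> \<in> sets lebesgue" "f \<in> borel_measurable borel" "\<And>z. z \<notin> \<Omega> \<Longrightarrow> f z = 0"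
  shows "(LINT z|lebesgue_on \<Omega>. f z) = (LINT z|lborel. f z)"
proof -
  have "(LINT z|lebesgue_on \<Omega>. f z) = (LINT z|lebesgue. indicator \<Omega> z *\<^sub>R f z)"
    using assms by (intro integral_restrict_space) auto
  also have "(\<lambda>z. indicator \<Omega> z *\<^sub>R f z) = f" using assms by (auto split: split_indicator)
  finally show ?thesis using assms by (simp add: integral_completion)
qed

text \<open>Fundamental lemma of the calculus of variations: bumps converge boundedly to indicators
  of boxes. The claim is first shown on a single closed box inside \<Omega>, where \<open>g\<close>
  is integrable, and countably many such boxes cover \<Omega>.\<close>

lemma AE_zero_if_test_integrals_zero:
  fixes g :: "real^'n \<Rightarrow> complex"
  assumes "open \<Omega>"
    and g: "\<And>K. compact K \<Longrightarrow> K \<subseteq> \<Omega> \<Longrightarrow> integrable (lebesgue_on K) g"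
    and zero: "\<And>\<phi>. \<phi> \<in> test_fun \<Omega> \<Longrightarrow> (LINT z|lebesgue_on \<Omega>. g z * \<phi> z) = 0"
  shows "AE z in lebesgue_on \<Omega>. g z = 0"
proof -
  have *: "AE z in lebesgue. z \<in> cbox c d \<longrightarrow> g z = 0" if cd: "cbox c d \<subseteq> \<Omega>" for c d
  proof -
    define G where "G = (\<lambda>z. indicator (cbox c d) z *\<^sub>R g z)"
    have G: "integrable lebesgue G"
      unfolding G_def using g[OF compact_cbox cd] by (subst integrable_restrict_space[symmetric]) auto
    have "AE z in lebesgue. G z = 0"
    proof (rule AE_zero_lebesgue_if_box_integrals_zero[OF G])
      fix a b
      \<comment> \<open>Up to the null frontier of \<open>cbox c d\<close>, the test box may be
        replaced by its intersection with the open box. The closure of that intersection stays in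
        \<Omega>, so the bumps on it are admissible.\<close>
      obtain a' b' where ab: "box a b \<inter> box c d = box a' b'" by (rule that[OF box_Int_box])
      have null: "AE z in lebesgue. z \<notin> cbox c d - box c d"
        using negligible_frontier_interval[of c d] by (intro AE_not_in) (simp add: negligible_iff_null_sets)
      have "(LINT x|lebesgue. indicator (box a b) x *\<^sub>R G x) = (LINT x|lebesgue. indicator (box a' b') x *\<^sub>R G x)"
      proof (rule integral_cong_AE)
        show "AE x in lebesgue. indicator (box a b) x *\<^sub>R G x = indicator (box a' b') x *\<^sub>R G x"
          using null by eventually_elim (auto simp: G_def ab[symmetric] split: split_indicator)
      qed (auto intro!: borel_measurable_integrable integrable_mult_indicator G)
      also have "\<dots> = 0"
      proof (cases "box a' b' = {}")
        case False
        have "closure (box a' b') \<subseteq> closure (box c d)" using ab by (intro closure_mono) auto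
        moreover have "box c d \<noteq> {}" using ab False by auto
        ultimately have sub: "cbox a' b' \<subseteq> cbox c d" using False by (simp add: closure_box)
        have ind: "(\<lambda>x. indicator (box a' b') x * G x) = (\<lambda>x. indicator (box a' b') x *\<^sub>R G x)"
          by (auto split: split_indicator)
        let ?\<phi> = "\<lambda>n. bump (1 / Suc n) a' b'"
        have test: "?\<phi> n \<in> test_fun \<Omega>" for n using sub cd by (intro bump_test_fun) auto
        have "(\<lambda>n. LINT x|lebesgue. ?\<phi> n x * G x) \<longlonglongrightarrow> (LINT x|lebesgue. indicator (box a' b') x * G x)"
        proof (rule integral_dominated_convergence[where w = "\<lambda>x. norm (G x)"])
          show "AE x in lebesgue. (\<lambda>n. ?\<phi> n x * G x) \<longlonglongrightarrow> indicator (box a' b') x * G x"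
            by (intro AE_I2 tendsto_mult bump_tendsto_indicator tendsto_const)
          have "norm (?\<phi> n x) \<le> 1" for n x
            using norm_bump_le[of "1 / Suc n" a' b' x] by (auto split: split_indicator_asm)
          then show "AE x in lebesgue. norm (?\<phi> n x * G x) \<le> norm (G x)" for n
            by (intro AE_I2) (simp add: norm_mult mult_left_le_one_le)
          have "continuous_on UNIV (?\<phi> n)" for n
            using test[of n] by (auto simp: test_fun_def dest!: spec[of _ 0])
          then have "?\<phi> n \<in> borel_measurable lebesgue" for n
            by (intro measurable_completion) (simp add: borel_measurable_continuous_onI)
          then show "(\<lambda>x. ?\<phi> n x * G x) \<in> borel_measurable lebesgue" for n
            using G by auto
          have "(\<lambda>x. indicator (box a' b') x *\<^sub>R G x) \<in> borel_measurable lebesgue"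
            by (auto intro!: borel_measurable_integrable integrable_mult_indicator G)
          then show "(\<lambda>x. indicator (box a' b') x * G x) \<in> borel_measurable lebesgue"
            by (simp only: ind)
        qed (use G in auto)
        moreover have "(LINT x|lebesgue. ?\<phi> n x * G x) = 0" for n
        proof -
          have "0 = (LINT z|lebesgue_on \<Omega>. g z * ?\<phi> n z)" using zero[OF test] by simp
          also have "\<dots> = (LINT z|lebesgue. indicator \<Omega> z *\<^sub>R (g z * ?\<phi> n z))"
            using assms(1) by (intro integral_restrict_space) auto
          also have "\<dots> = (LINT x|lebesgue. ?\<phi> n x * G x)"
          proof (intro Bochner_Integration.integral_cong refl)
            fix x
            have "?\<phi> n x = 0" if "x \<notin> cbox c d"
              using bump_nonzero_iff[of "1 / Suc n" a' b' x] that sub box_subset_cbox by blast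
            then show "indicator \<Omega> x *\<^sub>R (g x * ?\<phi> n x) = ?\<phi> n x * G x"
              using cd by (auto simp: G_def split: split_indicator)
          qed
          finally show ?thesis by simp
        qed
        ultimately have "(LINT x|lebesgue. indicator (box a' b') x * G x) = 0"
          by (simp add: LIMSEQ_const_iff)
        then show ?thesis
          by (simp only: ind)
      qed simp
      finally show "(LINT x|lebesgue. indicator (box a b) x *\<^sub>R G x) = 0" .
    qed
    then show ?thesis by eventually_elim (auto simp: G_def)
  qed
  obtain \<D> where \<D>: "countable \<D>" "\<And>X. X \<in> \<D> \<Longrightarrow> X \<subseteq> \<Omega>" "\<And>X. X \<in> \<D> \<Longrightarrow> \<exists>a b. X = cbox a b" "\<Union>\<D> = \<Omega>"
    using open_countable_Union_open_cbox[OF assms(1)] by (metis PowD subsetD)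
  have "AE z in lebesgue. \<forall>X\<in>\<D>. z \<in> X \<longrightarrow> g z = 0"
  proof (subst AE_ball_countable[OF \<D>(1)], intro ballI)
    fix X assume X: "X \<in> \<D>"
    then obtain a b where "X = cbox a b" using \<D>(3) by blast
    then show "AE z in lebesgue. z \<in> X \<longrightarrow> g z = 0" using * \<D>(2)[OF X] by auto
  qed
  then have "AE z in lebesgue. z \<in> \<Omega> \<longrightarrow> g z = 0"
    by eventually_elim (use \<D>(4) in auto)
  then show ?thesis using assms(1) by (subst AE_restrict_space_iff) auto
qed

section \<open>Integration by parts\<close>

lemma has_vector_derivative_at_0_lim:
  fixes f :: "real \<Rightarrow> 'b::real_normed_vector"
  assumes "(f has_vector_derivative d) (at 0)"
  shows "((\<lambda>h. (f h - f 0) /\<^sub>R h) \<longlongrightarrow> d) (at 0)"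
proof -
  have "((\<lambda>h. norm ((f h - f 0) - h *\<^sub>R d) / norm h) \<longlongrightarrow> 0) (at 0)"
    using assms by (simp add: has_vector_derivative_def has_derivative_at)
  moreover have "norm ((f h - f 0) - h *\<^sub>R d) / norm h = norm ((f h - f 0) /\<^sub>R h - d)" if "h \<noteq> 0" for h
  proof -
    have "(f h - f 0) /\<^sub>R h - d = ((f h - f 0) - h *\<^sub>R d) /\<^sub>R h" using that by (simp add: scaleR_right_diff_distrib)
    then show ?thesis by (simp add: divide_inverse mult.commute)
  qed
  ultimately have "((\<lambda>h. norm ((f h - f 0) /\<^sub>R h - d)) \<longlongrightarrow> 0) (at 0)"
    by (auto intro: Lim_transform_eventually simp: eventually_at_filter)
  then show ?thesis by (metis LIM_zero_cancel tendsto_norm_zero_iff)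
qed

text \<open>Translation invariance gives every difference quotient of \<open>f\<close> integral
  zero, and the quotients converge to the derivative under an integrable majorant.\<close>

lemma integral_directional_derivative_zero:
  fixes f :: "'a::euclidean_space \<Rightarrow> 'b::{banach, second_countable_topology}"
  assumes D: "\<And>z. (f has_derivative D z) (at z)" and cont: "continuous_on UNIV (\<lambda>z. D z e)"
    and K: "compact K" "\<And>z. z \<notin> K \<Longrightarrow> f z = 0"
  shows "(LINT z|lborel. D z e) = 0"
proof -
  have Dz: "D z e = 0" if "z \<notin> K" for z
  proof -
    have op: "open (- K)" "z \<in> - K" using compact_imp_closed[OF K(1)] that by auto
    have "((\<lambda>_. 0) has_derivative D z) (at z)"
      by (rule has_derivative_transform_within_open[OF D op]) (use K(2) in auto)
    then have "D z = (\<lambda>_. 0)" using has_derivative_const by (rule has_derivative_unique)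
    then show ?thesis by simp
  qed
  obtain R where R: "R > 0" "K \<subseteq> cball 0 R"
    using compact_imp_bounded[OF K(1)] by (auto simp: bounded_pos subset_iff)
  have "compact ((\<lambda>z. D z e) ` K)"
    using cont K(1) by (intro compact_continuous_image) (auto intro: continuous_on_subset)
  then have "bounded ((\<lambda>z. D z e) ` K)" by (rule compact_imp_bounded)
  then obtain M where M: "M > 0" "\<And>z. z \<in> K \<Longrightarrow> norm (D z e) \<le> M"
    unfolding bounded_pos by blast
  have DM: "norm (D z e) \<le> M" for z using M Dz[of z] by (cases "z \<in> K") auto
  have fc: "continuous_on UNIV f"
    using has_derivative_continuous[OF D] by (intro continuous_at_imp_continuous_on ballI)
  have fm[measurable]: "f \<in> borel_measurable borel" using fc by (rule borel_measurable_continuous_onI)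
  have dm[measurable]: "(\<lambda>z. D z e) \<in> borel_measurable borel" using cont by (rule borel_measurable_continuous_onI)
  define g where "g n z = real (Suc n) *\<^sub>R (f (z + (1 / Suc n) *\<^sub>R e) - f z)" for n z
  have diff: "norm (f (z + t *\<^sub>R e) - f z) \<le> M * t" if "t \<ge> 0" for z t
  proof -
    have "norm (f (z + t *\<^sub>R e) - f (z + 0 *\<^sub>R e)) \<le> M * norm (t - 0)"
    proof (rule differentiable_bound[of UNIV "\<lambda>s. f (z + s *\<^sub>R e)" "\<lambda>s h. D (z + s *\<^sub>R e) (h *\<^sub>R e)"])
      show "((\<lambda>s. f (z + s *\<^sub>R e)) has_derivative (\<lambda>h. D (z + s *\<^sub>R e) (h *\<^sub>R e))) (at s within UNIV)" for s
        by (rule has_derivative_compose[OF _ D]) (auto intro!: derivative_eq_intros)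
      show "onorm (\<lambda>h. D (z + s *\<^sub>R e) (h *\<^sub>R e)) \<le> M" for s
      proof (rule onorm_bound)
        fix h :: real
        have "D (z + s *\<^sub>R e) (h *\<^sub>R e) = h *\<^sub>R D (z + s *\<^sub>R e) e"
          using has_derivative_bounded_linear[OF D] by (simp add: linear_simps)
        then show "norm (D (z + s *\<^sub>R e) (h *\<^sub>R e)) \<le> M * norm h"
          using DM[of "z + s *\<^sub>R e"] by (simp add: mult.commute[of M] mult_left_mono)
      qed (use M in auto)
    qed auto
    then show ?thesis using that by simp
  qed
  have gM: "norm (g n z) \<le> M" for n z
  proof -
    have "norm (g n z) = real (Suc n) * norm (f (z + (1 / Suc n) *\<^sub>R e) - f z)" by (simp add: g_def)
    also have "\<dots> \<le> real (Suc n) * (M * (1 / Suc n))" by (intro mult_left_mono diff) auto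
    also have "\<dots> = M" by simp
    finally show ?thesis .
  qed
  \<comment> \<open>The steps are no longer than \<open>e\<close>, so all quotients live in one
    enlarged ball; together with the uniform bound \<open>M\<close> this gives the majorant.\<close>
  have g0: "g n z = 0" if "z \<notin> cball 0 (R + norm e)" for n z
  proof -
    have n1: "norm ((1 / Suc n) *\<^sub>R e) \<le> norm e" by (simp add: divide_le_eq mult_le_cancel_left1)
    have "z \<notin> K" "z + (1 / Suc n) *\<^sub>R e \<notin> K"
    proof -
      have "R < norm z" using that norm_ge_zero[of e] unfolding mem_cball dist_0_norm by linarith
      then show "z \<notin> K" using R by (auto simp: subset_iff)
      have "norm z \<le> norm (z + (1 / Suc n) *\<^sub>R e) + norm ((1 / Suc n) *\<^sub>R e)"
        by (metis add_diff_cancel_right' norm_triangle_ineq4)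
      then have "norm (z + (1 / Suc n) *\<^sub>R e) > R" using that n1 by auto
      then show "z + (1 / Suc n) *\<^sub>R e \<notin> K" using R by (auto simp: subset_iff)
    qed
    then show ?thesis using K(2) by (simp add: g_def)
  qed
  have f_int: "integrable lborel f"
  proof -
    have "integrable lborel (\<lambda>x. indicator K x *\<^sub>R f x)"
      using K fc by (intro borel_integrable_compact) (auto intro: continuous_on_subset)
    also have "(\<lambda>x. indicator K x *\<^sub>R f x) = f" using K(2) by (auto split: split_indicator)
    finally show ?thesis .
  qed
  have g_int: "(LINT z|lborel. g n z) = 0" for n
  proof -
    let ?c = "(1 / Suc n) *\<^sub>R e"
    have "integrable (distr lborel borel ((+) ?c)) f" using f_int by (simp add: lborel_distr_plus)
    then have i: "integrable lborel (\<lambda>z. f (z + ?c))"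
      by (subst (asm) integrable_distr_eq) (auto simp: add.commute)
    have "(LINT z|distr lborel borel ((+) ?c). f z) = (LINT z|lborel. f (z + ?c))"
      by (subst integral_distr) (auto simp: add.commute)
    then have "(LINT z|lborel. f (z + ?c)) = (LINT z|lborel. f z)"
      by (simp add: lborel_distr_plus)
    then show ?thesis using i f_int unfolding g_def by simp
  qed
  have "(\<lambda>n. LINT z|lborel. g n z) \<longlonglongrightarrow> (LINT z|lborel. D z e)"
  proof (rule integral_dominated_convergence[where w = "\<lambda>z. M * indicator (cball 0 (R + norm e)) z"])
    show "AE z in lborel. (\<lambda>n. g n z) \<longlonglongrightarrow> D z e"
    proof (intro AE_I2)
      fix z
      have "((\<lambda>t. f (z + t *\<^sub>R e)) has_vector_derivative D z e) (at 0)"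
      proof -
        have "((\<lambda>s. f (z + s *\<^sub>R e)) has_derivative (\<lambda>h. D (z + 0 *\<^sub>R e) (h *\<^sub>R e))) (at 0)"
          by (rule has_derivative_compose[OF _ D]) (auto intro!: derivative_eq_intros)
        moreover have "D z (h *\<^sub>R e) = h *\<^sub>R D z e" for h
          using has_derivative_bounded_linear[OF D] by (simp add: linear_simps)
        ultimately show ?thesis by (simp add: has_vector_derivative_def)
      qed
      then have lim: "((\<lambda>h. (f (z + h *\<^sub>R e) - f z) /\<^sub>R h) \<longlongrightarrow> D z e) (at 0)"
        using has_vector_derivative_at_0_lim[of "\<lambda>t. f (z + t *\<^sub>R e)"] by simp
      have "filterlim (\<lambda>n. inverse (real (Suc n))) (at 0) sequentially"
        using LIMSEQ_inverse_real_of_nat by (simp add: filterlim_at)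
      then have "(\<lambda>n. (f (z + inverse (real (Suc n)) *\<^sub>R e) - f z) /\<^sub>R inverse (real (Suc n))) \<longlonglongrightarrow> D z e"
        by (rule filterlim_compose[OF lim])
      then show "(\<lambda>n. g n z) \<longlonglongrightarrow> D z e" by (simp add: g_def inverse_eq_divide)
    qed
    show "AE z in lborel. norm (g n z) \<le> M * indicator (cball 0 (R + norm e)) z" for n
      using gM g0 by (intro AE_I2) (auto split: split_indicator)
    show "integrable lborel (\<lambda>z::'a. M * indicator (cball 0 (R + norm e)) z)"
      using emeasure_lborel_cball_finite[of "0::'a" "R + norm e"] by (intro integrable_mult_right integrable_real_indicator) simp_all
    show "(\<lambda>z. g n z) \<in> borel_measurable lborel" for n unfolding g_def by measurable
  qed measurable
  then show ?thesis using g_int by (simp add: LIMSEQ_const_iff)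
qed

lemma test_fun_facts:
  fixes \<phi> :: "real^'n \<Rightarrow> complex"
  assumes "\<phi> \<in> test_fun \<Omega>"
  shows test_fun_has_derivative: "(\<phi> has_derivative frechet_derivative \<phi> (at z)) (at z)"
    and test_fun_continuous: "continuous_on UNIV \<phi>"
    and test_fun_continuous_partial: "continuous_on UNIV (\<lambda>z. frechet_derivative \<phi> (at z) (axis i 1))"
proof -
  have 1: "C_k 1 \<phi>" and 0: "C_k 0 \<phi>" using assms by (auto simp: test_fun_def)
  show "(\<phi> has_derivative frechet_derivative \<phi> (at z)) (at z)"
    using 1 by (simp add: frechet_derivative_works)
  show "continuous_on UNIV \<phi>" using 0 by simp
  show "continuous_on UNIV (\<lambda>z. frechet_derivative \<phi> (at z) (axis i 1))"
    using 1 by (auto simp: Basis_vec_def)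
qed

lemma test_fun_support:
  fixes \<phi> :: "real^'n \<Rightarrow> complex"
  assumes "\<phi> \<in> test_fun \<Omega>"
  obtains K where "compact K" "K \<subseteq> \<Omega>" "\<And>z. z \<notin> K \<Longrightarrow> \<phi> z = 0"
    "\<And>z b. z \<notin> K \<Longrightarrow> frechet_derivative \<phi> (at z) b = 0"
proof (rule that)
  let ?K = "closure {x. \<phi> x \<noteq> 0}"
  show "compact ?K" "?K \<subseteq> \<Omega>" using assms by (auto simp: test_fun_def)
  show 0: "\<phi> z = 0" if "z \<notin> ?K" for z using that closure_subset by force
  show "frechet_derivative \<phi> (at z) b = 0" if "z \<notin> ?K" for z b
  proof -
    have op: "open (- ?K)" "z \<in> - ?K" using that by auto
    have "((\<lambda>_. 0) has_derivative frechet_derivative \<phi> (at z)) (at z)"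
      by (rule has_derivative_transform_within_open[OF test_fun_has_derivative[OF assms] op], rule 0, simp)
    then have "frechet_derivative \<phi> (at z) = (\<lambda>_. 0)" using has_derivative_const by (rule has_derivative_unique)
    then show ?thesis by simp
  qed
qed

lemma test_fun_bounded:
  fixes \<phi> :: "real^'n \<Rightarrow> complex"
  assumes "\<phi> \<in> test_fun \<Omega>"
  obtains M where "\<And>z. cmod (\<phi> z) \<le> M" "\<And>z i. cmod (frechet_derivative \<phi> (at z) (axis i 1)) \<le> M"
proof -
  obtain K where K: "compact K" "K \<subseteq> \<Omega>" "\<And>z. z \<notin> K \<Longrightarrow> \<phi> z = 0"
    "\<And>z b. z \<notin> K \<Longrightarrow> frechet_derivative \<phi> (at z) b = 0"
    using test_fun_support[OF assms] by blast
  have bdd: "\<exists>M. \<forall>z. cmod (f z) \<le> M" if "continuous_on UNIV f" "\<And>z. z \<notin> K \<Longrightarrow> f z = 0"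
    for f :: "real^'n \<Rightarrow> complex"
  proof -
    have "compact (f ` K)"
      using that K(1) by (intro compact_continuous_image) (auto intro: continuous_on_subset)
    then have "bounded (f ` K)" by (rule compact_imp_bounded)
    then obtain M where M: "M > 0" "\<forall>x\<in>f ` K. cmod x \<le> M"
      unfolding bounded_pos by blast
    have "cmod (f z) \<le> M" for z using M that(2)[of z] by (cases "z \<in> K") auto
    then show ?thesis by blast
  qed
  have "\<exists>M. \<forall>z. cmod (\<phi> z) \<le> M" by (rule bdd[OF test_fun_continuous[OF assms] K(3)])
  then obtain M where M: "\<And>z. cmod (\<phi> z) \<le> M" by blast
  have "\<forall>i. \<exists>M. \<forall>z. cmod (frechet_derivative \<phi> (at z) (axis i 1)) \<le> M"
    by (intro allI bdd[OF test_fun_continuous_partial[OF assms] K(4)])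
  then obtain N where N: "\<And>i z. cmod (frechet_derivative \<phi> (at z) (axis i 1)) \<le> N i" by metis
  show ?thesis
  proof (rule that)
    show "cmod (\<phi> z) \<le> max M (Max (range N))" for z using M[of z] by auto
    show "cmod (frechet_derivative \<phi> (at z) (axis i 1)) \<le> max M (Max (range N))" for z i
    proof -
      have "N i \<le> Max (range N)" by (intro Max_ge) auto
      then show ?thesis using N[of z i] by linarith
    qed
  qed
qed

lemma C_k_cnj: "C_k k f \<Longrightarrow> C_k k (\<lambda>z. cnj (f z))"
proof (induction k arbitrary: f)
  case 0
  then show ?case by (auto intro: continuous_intros)
next
  case (Suc k)
  have d: "((\<lambda>z. cnj (f z)) has_derivative (\<lambda>h. cnj (frechet_derivative f (at x) h))) (at x)" for x
    using Suc.prems by (intro has_derivative_cnj) (simp add: frechet_derivative_works)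
  have "frechet_derivative (\<lambda>z. cnj (f z)) (at x) = (\<lambda>h. cnj (frechet_derivative f (at x) h))" for x
    using frechet_derivative_at[OF d] by simp
  then show ?case using Suc d by (auto simp: differentiable_def)
qed

text \<open>The weak identities are bilinear while the inner products conjugate their second
  argument; passing between them conjugates the test function.\<close>

lemma test_fun_cnj: "\<phi> \<in> test_fun \<Omega> \<Longrightarrow> (\<lambda>z. cnj (\<phi> z)) \<in> test_fun \<Omega>"
  by (simp add: test_fun_def C_k_cnj del: C_k.simps)

lemma frechet_derivative_cnj_test_fun:
  fixes \<phi> :: "real^'n \<Rightarrow> complex"
  assumes "\<phi> \<in> test_fun \<Omega>"
  shows "frechet_derivative (\<lambda>z. cnj (\<phi> z)) (at x) b = cnj (frechet_derivative \<phi> (at x) b)"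
  using frechet_derivative_at[OF has_derivative_cnj[OF test_fun_has_derivative[OF assms]]] by metis

text \<open>The product of \<open>f\<close> with \<open>\<phi>\<close> has compact support, so its
  directional derivative has integral zero; no decay of \<open>f\<close> is required.\<close>

lemma integral_by_parts_test_fun:
  fixes f :: "real^'n \<Rightarrow> complex"
  assumes \<phi>: "\<phi> \<in> test_fun \<Omega>" and \<Omega>: "open \<Omega>"
    and F: "\<And>z. (f has_derivative F z) (at z)" "continuous_on UNIV (\<lambda>z. F z (axis i 1))"
  shows "(LINT z|lebesgue_on \<Omega>. f z * frechet_derivative \<phi> (at z) (axis i 1)) =
    - (LINT z|lebesgue_on \<Omega>. F z (axis i 1) * \<phi> z)"
proof -
  obtain K where K: "compact K" "K \<subseteq> \<Omega>" "\<And>z. z \<notin> K \<Longrightarrow> \<phi> z = 0"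
    "\<And>z b. z \<notin> K \<Longrightarrow> frechet_derivative \<phi> (at z) b = 0"
    using test_fun_support[OF \<phi>] by blast
  have fc: "continuous_on UNIV f"
    using has_derivative_continuous[OF F(1)] by (intro continuous_at_imp_continuous_on ballI)
  define p where "p z = f z * frechet_derivative \<phi> (at z) (axis i 1)" for z
  define r where "r z = F z (axis i 1) * \<phi> z" for z
  have c: "continuous_on UNIV p" "continuous_on UNIV r"
    unfolding p_def r_def using fc F(2) test_fun_continuous[OF \<phi>] test_fun_continuous_partial[OF \<phi>]
    by (auto intro!: continuous_intros)
  have zero: "p z = 0" "r z = 0" if "z \<notin> K" for z using K that by (auto simp: p_def r_def)
  have int: "integrable lborel g" if "continuous_on UNIV g" "\<And>z. z \<notin> K \<Longrightarrow> g z = 0" for g :: "real^'n \<Rightarrow> complex"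
  proof -
    have "integrable lborel (\<lambda>x. indicator K x *\<^sub>R g x)"
      using K that by (intro borel_integrable_compact) (auto intro: continuous_on_subset)
    also have "(\<lambda>x. indicator K x *\<^sub>R g x) = g" using that(2) by (auto split: split_indicator)
    finally show ?thesis .
  qed
  have "(LINT z|lborel. p z + r z) = 0"
    unfolding p_def r_def
  proof (rule integral_directional_derivative_zero[where f = "\<lambda>z. f z * \<phi> z"
        and D = "\<lambda>z h. f z * frechet_derivative \<phi> (at z) h + F z h * \<phi> z" and e = "axis i 1"])
    show "((\<lambda>z. f z * \<phi> z) has_derivative (\<lambda>h. f z * frechet_derivative \<phi> (at z) h + F z h * \<phi> z)) (at z)" for z
      by (intro has_derivative_mult F test_fun_has_derivative[OF \<phi>])
    show "continuous_on UNIV (\<lambda>z. f z * frechet_derivative \<phi> (at z) (axis i 1) + F z (axis i 1) * \<phi> z)"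
      using c by (auto simp: p_def r_def intro!: continuous_intros)
  qed (use K in auto)
  then have "(LINT z|lborel. p z) = - (LINT z|lborel. r z)"
    using int[OF c(1) zero(1)] int[OF c(2) zero(2)] by (simp add: eq_neg_iff_add_eq_0)
  moreover have "(LINT z|lebesgue_on \<Omega>. p z) = (LINT z|lborel. p z)" "(LINT z|lebesgue_on \<Omega>. r z) = (LINT z|lborel. r z)"
    using \<Omega> K(2) zero c by (auto intro!: LINT_lebesgue_on_eq_lborel borel_measurable_continuous_onI)
  ultimately show ?thesis by (simp add: p_def r_def)
qed

section \<open>Square-integrable functions\<close>

lemma integrable_lebesgue_on_subset:
  fixes f :: "'a::euclidean_space \<Rightarrow> 'b::{banach, second_countable_topology}"
  assumes "integrable (lebesgue_on S) f" "T \<subseteq> S" "T \<in> sets lebesgue" "S \<in> sets lebesgue"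
  shows "integrable (lebesgue_on T) f"
proof -
  have "integrable lebesgue (\<lambda>x. indicator S x *\<^sub>R f x)"
    using assms by (subst integrable_restrict_space[symmetric]) auto
  then have "integrable lebesgue (\<lambda>x. indicator T x *\<^sub>R (indicator S x *\<^sub>R f x))"
    using assms by (intro integrable_mult_indicator[of T]) auto
  also have "(\<lambda>x. indicator T x *\<^sub>R (indicator S x *\<^sub>R f x)) = (\<lambda>x. indicator T x *\<^sub>R f x)"
    using assms(2) by (auto simp: indicator_def fun_eq_iff)
  finally show ?thesis using assms by (subst integrable_restrict_space) auto
qed

lemma L2_measurable: "f \<in> L2 \<Omega> \<Longrightarrow> f \<in> borel_measurable (lebesgue_on \<Omega>)"
  by (simp add: L2_def)

lemma L2_integrable_sq: "f \<in> L2 \<Omega> \<Longrightarrow> integrable (lebesgue_on \<Omega>) (\<lambda>z. (norm (f z))\<^sup>2)"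
  by (simp add: L2_def)

lemma L2_I:
  fixes f :: "'a::euclidean_space \<Rightarrow> 'b::{real_normed_vector, second_countable_topology}"
  assumes "f \<in> borel_measurable (lebesgue_on \<Omega>)" "integrable (lebesgue_on \<Omega>) w"
    "\<And>z. z \<in> \<Omega> \<Longrightarrow> (norm (f z))\<^sup>2 \<le> w z"
  shows "f \<in> L2 \<Omega>"
  unfolding L2_def
proof (intro CollectI conjI)
  show "integrable (lebesgue_on \<Omega>) (\<lambda>z. (norm (f z))\<^sup>2)"
  proof (rule Bochner_Integration.integrable_bound[OF assms(2)])
    show "(\<lambda>z. (norm (f z))\<^sup>2) \<in> borel_measurable (lebesgue_on \<Omega>)"
      using assms(1) by measurable
    show "AE z in lebesgue_on \<Omega>. norm ((norm (f z))\<^sup>2) \<le> norm (w z)"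
    proof (rule AE_I2)
      fix z assume "z \<in> space (lebesgue_on \<Omega>)"
      then have "(norm (f z))\<^sup>2 \<le> w z" using assms(3) by simp
      then show "norm ((norm (f z))\<^sup>2) \<le> norm (w z)" by simp
    qed
  qed
qed (rule assms)

lemma norm_add_sq_le:
  fixes x y :: "'b::real_normed_vector"
  shows "(norm (x + y))\<^sup>2 \<le> 2 * (norm x)\<^sup>2 + 2 * (norm y)\<^sup>2"
proof -
  have "(norm (x + y))\<^sup>2 \<le> (norm x + norm y)\<^sup>2"
    by (intro power_mono norm_triangle_ineq) auto
  also have "\<dots> \<le> 2 * (norm x)\<^sup>2 + 2 * (norm y)\<^sup>2"
    using zero_le_power2[of "norm x - norm y"] by (simp add: power2_eq_square algebra_simps)
  finally show ?thesis .
qed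

lemma L2_add:
  fixes f g :: "'a::euclidean_space \<Rightarrow> 'b::{real_normed_vector, second_countable_topology}"
  assumes "f \<in> L2 \<Omega>" "g \<in> L2 \<Omega>"
  shows "(\<lambda>z. f z + g z) \<in> L2 \<Omega>"
proof (rule L2_I)
  show "(\<lambda>z. f z + g z) \<in> borel_measurable (lebesgue_on \<Omega>)"
    using assms[THEN L2_measurable] by measurable
  show "integrable (lebesgue_on \<Omega>) (\<lambda>z. 2 * (norm (f z))\<^sup>2 + 2 * (norm (g z))\<^sup>2)"
    using assms[THEN L2_integrable_sq] by auto
qed (rule norm_add_sq_le)

lemma L2_uminus:
  fixes f :: "'a::euclidean_space \<Rightarrow> 'b::{real_normed_vector, second_countable_topology}"
  assumes "f \<in> L2 \<Omega>"
  shows "(\<lambda>z. - f z) \<in> L2 \<Omega>"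
  using assms by (auto simp: L2_def)

lemma L2_diff:
  fixes f g :: "'a::euclidean_space \<Rightarrow> 'b::{real_normed_vector, second_countable_topology}"
  assumes "f \<in> L2 \<Omega>" "g \<in> L2 \<Omega>"
  shows "(\<lambda>z. f z - g z) \<in> L2 \<Omega>"
  using L2_add[OF assms(1) L2_uminus[OF assms(2)]] by simp

lemma L2_cmult:
  fixes f :: "'a::euclidean_space \<Rightarrow> complex"
  assumes "f \<in> L2 \<Omega>"
  shows "(\<lambda>z. c * f z) \<in> L2 \<Omega>"
  using assms by (auto simp: L2_def norm_mult power_mult_distrib)

lemma L2_cnj:
  assumes "f \<in> L2 \<Omega>"
  shows "(\<lambda>z. cnj (f z)) \<in> L2 \<Omega>"
  using assms borel_measurable_continuous_onI[OF continuous_on_cnj[OF continuous_on_id]]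
  by (auto simp: L2_def intro: measurable_compose[where g = cnj])

lemma L2_integrable_mult:
  fixes f g :: "'a::euclidean_space \<Rightarrow> complex"
  assumes "f \<in> L2 \<Omega>" "g \<in> L2 \<Omega>"
  shows "integrable (lebesgue_on \<Omega>) (\<lambda>z. f z * g z)"
proof (rule Bochner_Integration.integrable_bound[where f = "\<lambda>z. (norm (f z))\<^sup>2 + (norm (g z))\<^sup>2"])
  show "integrable (lebesgue_on \<Omega>) (\<lambda>z. (norm (f z))\<^sup>2 + (norm (g z))\<^sup>2)"
    using assms[THEN L2_integrable_sq] by auto
  show "(\<lambda>z. f z * g z) \<in> borel_measurable (lebesgue_on \<Omega>)"
    using assms[THEN L2_measurable] by measurable
  have "x * y \<le> x\<^sup>2 + y\<^sup>2" if "x \<ge> 0" "y \<ge> 0" for x y :: real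
  proof -
    have "2 * (x * y) \<le> x\<^sup>2 + y\<^sup>2"
      using zero_le_power2[of "x - y"] by (simp add: power2_eq_square algebra_simps)
    moreover have "0 \<le> x * y" using that by simp
    ultimately show ?thesis by linarith
  qed
  then show "AE z in lebesgue_on \<Omega>. norm (f z * g z) \<le> norm ((norm (f z))\<^sup>2 + (norm (g z))\<^sup>2)"
    by (intro AE_I2) (simp add: norm_mult)
qed

lemma L2_integrable_cnj:
  assumes "f \<in> L2 \<Omega>" "g \<in> L2 \<Omega>"
  shows "integrable (lebesgue_on \<Omega>) (\<lambda>z. f z * cnj (g z))"
  using L2_integrable_mult[OF assms(1) L2_cnj[OF assms(2)]] .

lemma L2_const:
  assumes "\<Omega> \<in> lmeasurable"
  shows "(\<lambda>_. c) \<in> L2 \<Omega>"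
proof -
  interpret finite_measure "lebesgue_on \<Omega>" using assms by (rule finite_measure_lebesgue_on)
  show ?thesis by (simp add: L2_def)
qed

lemma L2_integrable:
  fixes f :: "'a::euclidean_space \<Rightarrow> 'b::{banach, second_countable_topology}"
  assumes "\<Omega> \<in> lmeasurable" "f \<in> L2 \<Omega>"
  shows "integrable (lebesgue_on \<Omega>) f"
proof -
  interpret finite_measure "lebesgue_on \<Omega>" using assms by (intro finite_measure_lebesgue_on)
  show ?thesis
  proof (rule Bochner_Integration.integrable_bound[where f = "\<lambda>z. 1 + (norm (f z))\<^sup>2"])
    show "integrable (lebesgue_on \<Omega>) (\<lambda>z. 1 + (norm (f z))\<^sup>2)"
      by (intro Bochner_Integration.integrable_add integrable_const L2_integrable_sq[OF assms(2)])
    show "AE z in lebesgue_on \<Omega>. norm (f z) \<le> norm (1 + (norm (f z))\<^sup>2)"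
    proof (rule AE_I2)
      fix z
      have "0 \<le> (norm (f z) - 1)\<^sup>2" by simp
      then have "2 * norm (f z) \<le> 1 + (norm (f z))\<^sup>2" by (simp add: power2_eq_square algebra_simps)
      then have "norm (f z) \<le> 1 + (norm (f z))\<^sup>2" using norm_ge_zero[of "f z"] by linarith
      then show "norm (f z) \<le> norm (1 + (norm (f z))\<^sup>2)" by simp
    qed
  qed (use assms L2_measurable in auto)
qed

lemma L2_mult_bounded:
  fixes f g :: "'a::euclidean_space \<Rightarrow> complex"
  assumes "f \<in> L2 \<Omega>" "g \<in> borel_measurable (lebesgue_on \<Omega>)" "\<And>z. z \<in> \<Omega> \<Longrightarrow> cmod (g z) \<le> K"
  shows "(\<lambda>z. f z * g z) \<in> L2 \<Omega>"
proof (rule L2_I)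
  show "(\<lambda>z. f z * g z) \<in> borel_measurable (lebesgue_on \<Omega>)"
    using assms(1)[THEN L2_measurable] assms(2) by measurable
  show "integrable (lebesgue_on \<Omega>) (\<lambda>z. (norm (f z))\<^sup>2 * K\<^sup>2)"
    using assms(1)[THEN L2_integrable_sq] by auto
  show "(norm (f z * g z))\<^sup>2 \<le> (norm (f z))\<^sup>2 * K\<^sup>2" if "z \<in> \<Omega>" for z
    using assms(3)[OF that] by (simp add: norm_mult power_mult_distrib mult_left_mono power_mono)
qed

lemma L2_bounded:
  fixes f :: "'a::euclidean_space \<Rightarrow> complex"
  assumes "\<Omega> \<in> lmeasurable" "f \<in> borel_measurable borel" "\<And>z. cmod (f z) \<le> K"
  shows "f \<in> L2 \<Omega>"
proof -
  have "f \<in> borel_measurable (lebesgue_on \<Omega>)"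
    using assms(2) by (intro measurable_restrict_space1 measurable_completion) simp
  then show ?thesis
    using L2_mult_bounded[OF L2_const[OF assms(1), of 1], of f K] assms(3) by simp
qed

lemma norm_sq_vec: "(norm (x :: 'b::real_normed_vector ^ 'm))\<^sup>2 = (\<Sum>i\<in>UNIV. (norm (x $ i))\<^sup>2)"
  by (simp add: norm_vec_def L2_set_def sum_nonneg)

lemma borel_measurable_vec_iff:
  fixes p :: "'a \<Rightarrow> complex ^ 'm"
  shows "p \<in> borel_measurable M \<longleftrightarrow> (\<forall>i. (\<lambda>z. p z $ i) \<in> borel_measurable M)"
proof
  assume p: "p \<in> borel_measurable M"
  show "\<forall>i. (\<lambda>z. p z $ i) \<in> borel_measurable M"
  proof
    fix i
    have "(\<lambda>x :: complex ^ 'm. x $ i) \<in> borel_measurable borel"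
      by (intro borel_measurable_continuous_onI continuous_intros)
    then show "(\<lambda>z. p z $ i) \<in> borel_measurable M" using p by (rule measurable_compose[rotated])
  qed
next
  assume *: "\<forall>i. (\<lambda>z. p z $ i) \<in> borel_measurable M"
  have "(\<lambda>c. axis i c :: complex ^ 'm) \<in> borel_measurable borel" for i
  proof (intro borel_measurable_continuous_onI, unfold axis_def, rule continuous_on_vec_lambda)
    show "continuous_on UNIV (\<lambda>c :: complex. if k = i then c else 0)" for k
      by (cases "k = i") (auto intro: continuous_intros)
  qed
  then have "(\<lambda>z. axis i (p z $ i) :: complex ^ 'm) \<in> borel_measurable M" for i
    using * by (intro measurable_compose[of "\<lambda>z. p z $ i" M borel "\<lambda>c. axis i c"]) auto
  then have "(\<lambda>z. \<Sum>i\<in>UNIV. axis i (p z $ i) :: complex ^ 'm) \<in> borel_measurable M" by auto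
  also have "(\<lambda>z. \<Sum>i\<in>UNIV. axis i (p z $ i) :: complex ^ 'm) = p"
    by (auto simp: vec_eq_iff axis_def if_distrib cong: if_cong)
  finally show "p \<in> borel_measurable M" .
qed

lemma L2_vec_iff:
  fixes p :: "'a::euclidean_space \<Rightarrow> complex ^ 'm"
  shows "p \<in> L2 \<Omega> \<longleftrightarrow> (\<forall>i. (\<lambda>z. p z $ i) \<in> L2 \<Omega>)"
proof
  assume p: "p \<in> L2 \<Omega>"
  show "\<forall>i. (\<lambda>z. p z $ i) \<in> L2 \<Omega>"
  proof
    fix i
    show "(\<lambda>z. p z $ i) \<in> L2 \<Omega>"
    proof (rule L2_I)
      show "(\<lambda>z. p z $ i) \<in> borel_measurable (lebesgue_on \<Omega>)"
        using p L2_measurable borel_measurable_vec_iff by blast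
      show "integrable (lebesgue_on \<Omega>) (\<lambda>z. (norm (p z))\<^sup>2)" using p by (rule L2_integrable_sq)
      show "(norm (p z $ i))\<^sup>2 \<le> (norm (p z))\<^sup>2" for z
        using Finite_Cartesian_Product.norm_nth_le[of "p z" i] by (intro power_mono) auto
    qed
  qed
next
  assume *: "\<forall>i. (\<lambda>z. p z $ i) \<in> L2 \<Omega>"
  show "p \<in> L2 \<Omega>"
  proof (rule L2_I)
    show "p \<in> borel_measurable (lebesgue_on \<Omega>)"
      using * L2_measurable borel_measurable_vec_iff by blast
    show "integrable (lebesgue_on \<Omega>) (\<lambda>z. \<Sum>i\<in>UNIV. (norm (p z $ i))\<^sup>2)"
      using * L2_integrable_sq by (intro Bochner_Integration.integrable_sum) blast
  qed (simp add: norm_sq_vec)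
qed

lemma L2_norm_sq: "(L2_norm \<Omega> f)\<^sup>2 = (LINT z|lebesgue_on \<Omega>. (norm (f z))\<^sup>2)"
  by (simp add: L2_norm_def)

text \<open>On a finite measure space an \<open>L2\<close>-Cauchy sequence is
  \<open>L1\<close>-Cauchy, hence has an almost everywhere convergent subsequence. Fatou's lemma
  along it turns the Cauchy estimate into an estimate of the distance to the limit.\<close>

lemma L2_complete:
  fixes u :: "nat \<Rightarrow> 'a::euclidean_space \<Rightarrow> 'b::{banach, second_countable_topology}"
  assumes \<Omega>: "\<Omega> \<in> lmeasurable" and u: "\<And>n. u n \<in> L2 \<Omega>"
    and cauchy: "\<And>\<epsilon>. \<epsilon> > 0 \<Longrightarrow> \<exists>N. \<forall>m\<ge>N. \<forall>n\<ge>N. (LINT z|lebesgue_on \<Omega>. (norm (u m z - u n z))\<^sup>2) < \<epsilon>"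
  shows "\<exists>f\<in>L2 \<Omega>. (\<lambda>n. LINT z|lebesgue_on \<Omega>. (norm (u n z - f z))\<^sup>2) \<longlonglongrightarrow> 0"
proof -
  let ?M = "lebesgue_on \<Omega>"
  interpret finite_measure ?M using \<Omega> by (rule finite_measure_lebesgue_on)
  have m[measurable]: "u n \<in> borel_measurable ?M" for n using u L2_measurable by blast
  have d: "(\<lambda>z. u m z - u n z) \<in> L2 \<Omega>" for m n using u by (intro L2_diff)
  have L1: "\<exists>N. \<forall>i\<ge>N. \<forall>j\<ge>N. (LINT x|?M. norm (u i x - u j x)) < e" if e: "e > 0" for e
  proof -
    define c where "c = measure ?M \<Omega> + 1"
    have c: "c > 0" unfolding c_def using measure_nonneg[of ?M \<Omega>] by linarith
    \<comment> \<open>Chosen for t \<le> \<eta> + t^2 / \<eta>: the constant contributes at most e /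
      2 after integration, and a square integral below \<eta> e / 2 contributes the other half. The
      summand 1 in \<open>c\<close> keeps it positive.\<close>
    define \<eta> where "\<eta> = e / (2 * c)"
    have \<eta>: "\<eta> > 0" using e c by (simp add: \<eta>_def)
    obtain N where N: "\<forall>m\<ge>N. \<forall>n\<ge>N. (LINT z|?M. (norm (u m z - u n z))\<^sup>2) < \<eta> * (e / 2)"
      using cauchy[OF mult_pos_pos[OF \<eta> half_gt_zero[OF e]]] by blast
    have "(LINT x|?M. norm (u i x - u j x)) < e" if ij: "i \<ge> N" "j \<ge> N" for i j
    proof -
      have "(LINT x|?M. norm (u i x - u j x)) \<le> (LINT x|?M. \<eta> + (norm (u i x - u j x))\<^sup>2 / \<eta>)"
      proof (rule integral_mono)
        show "integrable ?M (\<lambda>x. norm (u i x - u j x))" using L2_integrable[OF \<Omega> d] by auto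
        show "integrable ?M (\<lambda>x. \<eta> + (norm (u i x - u j x))\<^sup>2 / \<eta>)"
          using L2_integrable_sq[OF d] by auto
        fix x
        have "0 \<le> (norm (u i x - u j x) - \<eta>)\<^sup>2" by simp
        then have "norm (u i x - u j x) * (2 * \<eta>) \<le> \<eta>\<^sup>2 + (norm (u i x - u j x))\<^sup>2"
          by (simp add: power2_eq_square algebra_simps)
        moreover have "0 \<le> norm (u i x - u j x) * \<eta>" using \<eta> by simp
        ultimately have "norm (u i x - u j x) * \<eta> \<le> \<eta>\<^sup>2 + (norm (u i x - u j x))\<^sup>2" by linarith
        then show "norm (u i x - u j x) \<le> \<eta> + (norm (u i x - u j x))\<^sup>2 / \<eta>"
          using \<eta> by (simp add: field_simps power2_eq_square)
      qed
      also have "\<dots> = \<eta> * measure ?M \<Omega> + (LINT x|?M. (norm (u i x - u j x))\<^sup>2) / \<eta>"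
        using L2_integrable_sq[OF d, of i j] by (subst Bochner_Integration.integral_add) auto
      also have "\<dots> < \<eta> * c + \<eta> * (e / 2) / \<eta>"
        using N ij \<eta> by (intro add_less_le_mono mult_strict_left_mono divide_right_mono)
          (auto simp: c_def intro: less_imp_le)
      also have "\<dots> = e" using \<eta> c by (simp add: \<eta>_def)
      finally show ?thesis .
    qed
    then show ?thesis by blast
  qed
  obtain r where r: "strict_mono r" "AE x in ?M. Cauchy (\<lambda>i. u (r i) x)"
    by (rule cauchy_L1_AE_cauchy_subseq[of ?M u]) (use L2_integrable[OF \<Omega> u] L1 in auto)
  define f where "f x = lim (\<lambda>i. u (r i) x)" for x
  have fm[measurable]: "f \<in> borel_measurable ?M" unfolding f_def by measurable
  have lim: "AE x in ?M. (\<lambda>i. u (r i) x) \<longlonglongrightarrow> f x"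
    using r(2) by eventually_elim (simp add: f_def Cauchy_convergent_iff convergent_LIMSEQ_iff)
  have est: "(\<integral>\<^sup>+x. ennreal ((norm (u n x - f x))\<^sup>2) \<partial>?M) \<le> ennreal \<epsilon>"
    if N: "\<forall>m\<ge>N. \<forall>n\<ge>N. (LINT z|?M. (norm (u m z - u n z))\<^sup>2) < \<epsilon>" and n: "n \<ge> N" for N n \<epsilon>
  proof -
    have "(\<integral>\<^sup>+x. ennreal ((norm (u n x - f x))\<^sup>2) \<partial>?M)
        = (\<integral>\<^sup>+x. liminf (\<lambda>i. ennreal ((norm (u n x - u (r i) x))\<^sup>2)) \<partial>?M)"
    proof (rule nn_integral_cong_AE)
      show "AE x in ?M. ennreal ((norm (u n x - f x))\<^sup>2) = liminf (\<lambda>i. ennreal ((norm (u n x - u (r i) x))\<^sup>2))"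
        using lim
      proof eventually_elim
        case (elim x)
        then have "(\<lambda>i. ennreal ((norm (u n x - u (r i) x))\<^sup>2)) \<longlonglongrightarrow> ennreal ((norm (u n x - f x))\<^sup>2)"
          by (intro tendsto_intros tendsto_ennrealI)
        then show ?case by (intro lim_imp_Liminf[symmetric]) auto
      qed
    qed
    also have "\<dots> \<le> liminf (\<lambda>i. \<integral>\<^sup>+x. ennreal ((norm (u n x - u (r i) x))\<^sup>2) \<partial>?M)"
      by (rule nn_integral_liminf) measurable
    also have "\<dots> \<le> ennreal \<epsilon>"
    proof (rule Liminf_le)
      show "\<forall>\<^sub>F i in sequentially. (\<integral>\<^sup>+x. ennreal ((norm (u n x - u (r i) x))\<^sup>2) \<partial>?M) \<le> ennreal \<epsilon>"
      proof (rule eventually_sequentiallyI[of N])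
        fix i assume "i \<ge> N"
        then have "r i \<ge> N" using seq_suble[OF r(1), of i] by linarith
        have "(\<integral>\<^sup>+x. ennreal ((norm (u n x - u (r i) x))\<^sup>2) \<partial>?M) = ennreal (LINT x|?M. (norm (u n x - u (r i) x))\<^sup>2)"
          using L2_integrable_sq[OF d] by (intro nn_integral_eq_integral) auto
        also have "\<dots> \<le> ennreal \<epsilon>" using N n \<open>r i \<ge> N\<close> by (intro ennreal_leI) (auto intro: less_imp_le)
        finally show "(\<integral>\<^sup>+x. ennreal ((norm (u n x - u (r i) x))\<^sup>2) \<partial>?M) \<le> ennreal \<epsilon>" .
      qed
    qed simp
    finally show ?thesis .
  qed
  have dL2: "\<exists>N. \<forall>n\<ge>N. (\<lambda>x. u n x - f x) \<in> L2 \<Omega> \<and> (LINT x|?M. (norm (u n x - f x))\<^sup>2) \<le> \<epsilon>" if \<epsilon>: "\<epsilon> > 0" for \<epsilon>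
  proof -
    obtain N where N: "\<forall>m\<ge>N. \<forall>n\<ge>N. (LINT z|?M. (norm (u m z - u n z))\<^sup>2) < \<epsilon>" using cauchy[OF \<epsilon>] by blast
    have "(\<lambda>x. u n x - f x) \<in> L2 \<Omega> \<and> (LINT x|?M. (norm (u n x - f x))\<^sup>2) \<le> \<epsilon>" if n: "n \<ge> N" for n
    proof -
      have "integrable ?M (\<lambda>x. (norm (u n x - f x))\<^sup>2)"
        using est[OF N n] by (intro integrableI_bounded) (auto simp: le_less_trans)
      then show ?thesis
        using est[OF N n] \<open>\<epsilon> > 0\<close> by (simp add: L2_def nn_integral_eq_integral)
    qed
    then show ?thesis by blast
  qed
  obtain N where "(\<lambda>x. u N x - f x) \<in> L2 \<Omega>" using dL2[of 1] by auto
  from L2_diff[OF u[of N] this] have "f \<in> L2 \<Omega>" by simp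
  moreover have "(\<lambda>n. LINT z|?M. (norm (u n z - f z))\<^sup>2) \<longlonglongrightarrow> 0"
  proof (rule LIMSEQ_I)
    fix e :: real assume "e > 0"
    then obtain N where "\<forall>n\<ge>N. (LINT x|?M. (norm (u n x - f x))\<^sup>2) \<le> e / 2" using dL2[of "e / 2"] by auto
    then show "\<exists>N. \<forall>n\<ge>N. norm ((LINT z|?M. (norm (u n z - f z))\<^sup>2) - 0) < e"
      using \<open>e > 0\<close> by (intro exI[of _ N]) (force simp: integral_nonneg_AE)
  qed
  ultimately show ?thesis by blast
qed

section \<open>The space of square-integrable functions as a semidefinite form\<close>

definition fscale :: "complex \<Rightarrow> ('a \<Rightarrow> complex) \<Rightarrow> 'a \<Rightarrow> complex" where
  "fscale c u = (\<lambda>z. c * u z)"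

interpretation fscale: vector_space fscale
  by unfold_locales (auto simp: fscale_def fun_eq_iff algebra_simps)

lemma sum_fun_apply: "(\<Sum>i\<in>I. f i) z = (\<Sum>i\<in>I. f i z)" for f :: "'i \<Rightarrow> 'a \<Rightarrow> complex"
  by (induction I rule: infinite_finite_induct) auto

lemma Re_L2_inner_self: "f \<in> L2 \<Omega> \<Longrightarrow> Re (L2_inner \<Omega> f f) = (LINT z|lebesgue_on \<Omega>. (cmod (f z))\<^sup>2)"
proof -
  have "L2_inner \<Omega> f f = (LINT z|lebesgue_on \<Omega>. of_real ((cmod (f z))\<^sup>2))"
    unfolding L2_inner_def by (intro Bochner_Integration.integral_cong) (auto simp: complex_norm_square[symmetric] simp del: of_real_power)
  also have "\<dots> = of_real (LINT z|lebesgue_on \<Omega>. (cmod (f z))\<^sup>2)" by (rule integral_complex_of_real)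
  finally show ?thesis by simp
qed

lemma psd_form_L2: "psd_form fscale (L2 \<Omega> :: ('a::euclidean_space \<Rightarrow> complex) set) (L2_inner \<Omega>)"
proof
  show "fscale.subspace (L2 \<Omega> :: ('a \<Rightarrow> complex) set)"
    unfolding fscale.subspace_def
    by (auto simp: plus_fun_def fscale_def zero_fun_def intro: L2_add L2_cmult) (simp add: L2_def)
next
  fix u v w :: "'a \<Rightarrow> complex" assume "u \<in> L2 \<Omega>" "v \<in> L2 \<Omega>" "w \<in> L2 \<Omega>"
  then show "L2_inner \<Omega> (u + v) w = L2_inner \<Omega> u w + L2_inner \<Omega> v w"
    by (simp add: L2_inner_def plus_fun_def ring_distribs L2_integrable_cnj)
next
  fix u w :: "'a \<Rightarrow> complex" and c assume "u \<in> L2 \<Omega>" "w \<in> L2 \<Omega>"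
  then show "L2_inner \<Omega> (fscale c u) w = c * L2_inner \<Omega> u w"
    by (simp add: L2_inner_def fscale_def mult.assoc)
next
  fix u v :: "'a \<Rightarrow> complex" assume "u \<in> L2 \<Omega>" "v \<in> L2 \<Omega>"
  show "L2_inner \<Omega> v u = cnj (L2_inner \<Omega> u v)"
    unfolding L2_inner_def by (subst Bochner_Integration.integral_cnj[symmetric]) (simp add: mult.commute del: Bochner_Integration.integral_cnj)
next
  fix u :: "'a \<Rightarrow> complex" assume "u \<in> L2 \<Omega>"
  then show "0 \<le> Re (L2_inner \<Omega> u u)" by (simp add: Re_L2_inner_self)
qed

lemma L2_tendsto_integral:
  assumes "\<And>n. f n \<in> L2 \<Omega>" "g \<in> L2 \<Omega>" "\<psi> \<in> L2 \<Omega>"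
    and "(\<lambda>n. LINT z|lebesgue_on \<Omega>. (cmod (f n z - g z))\<^sup>2) \<longlonglongrightarrow> 0"
  shows "(\<lambda>n. LINT z|lebesgue_on \<Omega>. f n z * \<psi> z) \<longlonglongrightarrow> (LINT z|lebesgue_on \<Omega>. g z * \<psi> z)"
proof -
  interpret psd_form fscale "L2 \<Omega>" "L2_inner \<Omega>" by (rule psd_form_L2)
  have "Re (L2_inner \<Omega> (f n - g) (f n - g)) = (LINT z|lebesgue_on \<Omega>. (cmod (f n z - g z))\<^sup>2)" for n
    using Re_L2_inner_self[OF L2_diff[OF assms(1,2)]] by (simp add: fun_diff_def)
  then have "(\<lambda>n. L2_inner \<Omega> (f n) (\<lambda>z. cnj (\<psi> z))) \<longlonglongrightarrow> L2_inner \<Omega> g (\<lambda>z. cnj (\<psi> z))"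
    using assms by (intro q_limit) (auto intro: L2_cnj)
  then show ?thesis by (simp add: L2_inner_def)
qed

section \<open>Magnetic Sobolev spaces\<close>

text \<open>The transpose, without conjugation, of component i of D - a applied to a test function.
  Integrating by parts reverses the sign of the derivative but not that of the multiplication by
  \<open>a\<close>.\<close>

definition mag_test :: "(real^'n \<Rightarrow> real^'n) \<Rightarrow> (real^'n \<Rightarrow> complex) \<Rightarrow> 'n \<Rightarrow> real^'n \<Rightarrow> complex" where
  "mag_test a \<phi> i z = \<i> * frechet_derivative \<phi> (at z) (axis i 1) - of_real (a z $ i) * \<phi> z"

text \<open>A weak magnetic gradient as a relation. Unlike \<open>mag_grad\<close> it involves no
  choice, and it is linear and closed under \<open>L2\<close> limits; the lemmas
  \<open>H1_mag_mag_weak\<close> and \<open>mag_weak_H1_mag\<close> translate between the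
  two.\<close>

definition mag_weak ::
  "(real^'n \<Rightarrow> real^'n) \<Rightarrow> (real^'n) set \<Rightarrow> (real^'n \<Rightarrow> complex) \<Rightarrow> (real^'n \<Rightarrow> complex^'n) \<Rightarrow> bool" where
  "mag_weak a \<Omega> u p \<longleftrightarrow> u \<in> L2 \<Omega> \<and> p \<in> L2 \<Omega> \<and> (\<forall>\<phi>\<in>test_fun \<Omega>. \<forall>i.
     (LINT z|lebesgue_on \<Omega>. u z * mag_test a \<phi> i z) = (LINT z|lebesgue_on \<Omega>. p z $ i * \<phi> z))"

lemma mag_weakD:
  "mag_weak a \<Omega> u p \<Longrightarrow> \<phi> \<in> test_fun \<Omega> \<Longrightarrow>
    (LINT z|lebesgue_on \<Omega>. u z * mag_test a \<phi> i z) = (LINT z|lebesgue_on \<Omega>. p z $ i * \<phi> z)"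
  by (simp add: mag_weak_def)

lemma C_k_add: "C_k k f \<Longrightarrow> C_k k g \<Longrightarrow> C_k k (\<lambda>z. f z + g z)"
proof (induction k arbitrary: f g)
  case 0
  then show ?case by (auto intro: continuous_intros)
next
  case (Suc k)
  have d: "((\<lambda>z. f z + g z) has_derivative (\<lambda>h. frechet_derivative f (at x) h + frechet_derivative g (at x) h)) (at x)" for x
    using Suc.prems by (intro has_derivative_add) (simp_all add: frechet_derivative_works)
  have "frechet_derivative (\<lambda>z. f z + g z) (at x) = (\<lambda>h. frechet_derivative f (at x) h + frechet_derivative g (at x) h)" for x
    using frechet_derivative_at[OF d] by simp
  then show ?case using Suc differentiableI[OF d] by auto
qed

lemma C_k_cmult: "C_k k f \<Longrightarrow> C_k k (\<lambda>z. c * f z)" for f :: "'a::euclidean_space \<Rightarrow> complex"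
proof (induction k arbitrary: f)
  case 0
  then show ?case by (auto intro: continuous_intros)
next
  case (Suc k)
  have d: "((\<lambda>z. c * f z) has_derivative (\<lambda>h. c * frechet_derivative f (at x) h)) (at x)" for x
    using Suc.prems by (intro has_derivative_mult_right) (simp add: frechet_derivative_works)
  have "frechet_derivative (\<lambda>z. c * f z) (at x) = (\<lambda>h. c * frechet_derivative f (at x) h)" for x
    using frechet_derivative_at[OF d] by simp
  then show ?case using Suc differentiableI[OF d] by auto
qed

lemma test_fun_I:
  assumes "\<And>k. C_k k \<phi>" "compact K" "K \<subseteq> \<Omega>" "\<And>z. z \<notin> K \<Longrightarrow> \<phi> z = 0"
  shows "\<phi> \<in> test_fun \<Omega>"
proof -
  have sub: "closure {x. \<phi> x \<noteq> 0} \<subseteq> K"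
    using assms compact_imp_closed[OF assms(2)] by (intro closure_minimal) auto
  then have "compact (closure {x. \<phi> x \<noteq> 0})"
    using compact_imp_bounded[OF assms(2)] bounded_subset by (simp add: compact_eq_bounded_closed) blast
  then show ?thesis using sub assms by (auto simp: test_fun_def)
qed

lemma subspace_test_fun: "fscale.subspace (test_fun \<Omega> :: (real^'n \<Rightarrow> complex) set)"
  unfolding fscale.subspace_def
proof (intro conjI ballI allI)
  have "bump_alg (0 :: real^'n \<Rightarrow> complex)" unfolding zero_fun_def by (rule bump_alg.const)
  then show "(0 :: real^'n \<Rightarrow> complex) \<in> test_fun \<Omega>"
    by (intro test_fun_I[of _ "{}"] bump_alg_C_k) auto
next
  fix \<phi> \<psi> :: "real^'n \<Rightarrow> complex" assume A: "\<phi> \<in> test_fun \<Omega>" "\<psi> \<in> test_fun \<Omega>"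
  obtain K where K: "compact K" "K \<subseteq> \<Omega>" "\<And>z. z \<notin> K \<Longrightarrow> \<phi> z = 0" by (rule test_fun_support[OF A(1)]) (rule that)
  obtain L where L: "compact L" "L \<subseteq> \<Omega>" "\<And>z. z \<notin> L \<Longrightarrow> \<psi> z = 0" by (rule test_fun_support[OF A(2)]) (rule that)
  show "\<phi> + \<psi> \<in> test_fun \<Omega>"
    unfolding plus_fun_def
  proof (rule test_fun_I[of _ "K \<union> L"])
    show "C_k k (\<lambda>x. \<phi> x + \<psi> x)" for k using A by (intro C_k_add) (auto simp: test_fun_def)
  qed (use K L in auto)
next
  fix \<phi> :: "real^'n \<Rightarrow> complex" and c assume A: "\<phi> \<in> test_fun \<Omega>"
  obtain K where K: "compact K" "K \<subseteq> \<Omega>" "\<And>z. z \<notin> K \<Longrightarrow> \<phi> z = 0" by (rule test_fun_support[OF A(1)]) (rule that)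
  show "fscale c \<phi> \<in> test_fun \<Omega>"
    unfolding fscale_def
  proof (rule test_fun_I[of _ K])
    show "C_k k (\<lambda>x. c * \<phi> x)" for k using A by (intro C_k_cmult) (auto simp: test_fun_def)
  qed (use K in auto)
qed

lemma continuous_compact_support_bounded:
  fixes f :: "'a::euclidean_space \<Rightarrow> complex"
  assumes "continuous_on UNIV f" "compact K" "\<And>z. z \<notin> K \<Longrightarrow> f z = 0"
  shows "\<exists>M. \<forall>z. cmod (f z) \<le> M"
proof -
  have "compact (f ` K)"
    using assms by (intro compact_continuous_image) (auto intro: continuous_on_subset)
  then have "bounded (f ` K)" by (rule compact_imp_bounded)
  then obtain M where M: "M > 0" "\<forall>x\<in>f ` K. cmod x \<le> M"
    unfolding bounded_pos by blast
  have "cmod (f z) \<le> M" for z using M assms(3)[of z] by (cases "z \<in> K") auto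
  then show ?thesis by blast
qed

lemma L2_continuous_compact_support:
  fixes f :: "'a::euclidean_space \<Rightarrow> complex"
  assumes "\<Omega> \<in> lmeasurable" "continuous_on UNIV f" "compact K" "\<And>z. z \<notin> K \<Longrightarrow> f z = 0"
  shows "f \<in> L2 \<Omega>"
proof -
  obtain M where M: "\<And>z. cmod (f z) \<le> M"
    using continuous_compact_support_bounded[OF assms(2-4)] by blast
  show ?thesis
    by (rule L2_bounded[OF assms(1) borel_measurable_continuous_onI[OF assms(2)] M])
qed

lemma psd_form_subset:
  assumes "psd_form sc V s" "W \<subseteq> V" "module.subspace sc W"
  shows "psd_form sc W s"
proof -
  interpret psd_form sc V s by fact
  show ?thesis
    using assms(2,3) by unfold_locales (auto simp: subset_iff add_left scale_left nonneg intro: herm)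
qed

lemma psd_form_sum:
  assumes "psd_form sc V s" "psd_form sc V t"
  shows "psd_form sc V (\<lambda>u v. s u v + t u v)"
proof -
  interpret s: psd_form sc V s by fact
  interpret t: psd_form sc V t by fact
  show ?thesis
  proof
    show "s.subspace V" by (rule s.subsp)
    show "s v u + t v u = cnj (s u v + t u v)" if "u \<in> V" "v \<in> V" for u v
      using s.herm[OF that] t.herm[OF that] by simp
    show "0 \<le> Re (s u u + t u u)" if "u \<in> V" for u
      using s.nonneg[OF that] t.nonneg[OF that] by simp
  qed (auto simp: s.add_left t.add_left s.scale_left t.scale_left algebra_simps)
qed

locale mag_domain =
  fixes \<Omega> :: "(real^'n) set" and a :: "real^'n \<Rightarrow> real^'n"
  assumes open_\<Omega>: "open \<Omega>" and lmeas: "\<Omega> \<in> lmeasurable" and nonempty: "\<Omega> \<noteq> {}"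
    and cont_a: "continuous_on UNIV a"
begin

lemma cont_a_nth: "continuous_on UNIV (\<lambda>z. a z $ i)"
  using cont_a by (intro continuous_intros)

lemma mag_test_L2:
  assumes "\<phi> \<in> test_fun \<Omega>"
  shows "mag_test a \<phi> i \<in> L2 \<Omega>" "(\<lambda>z. of_real (a z $ i) * \<phi> z) \<in> L2 \<Omega>" "\<phi> \<in> L2 \<Omega>"
    "(\<lambda>z. frechet_derivative \<phi> (at z) (axis i 1)) \<in> L2 \<Omega>"
proof -
  obtain K where K: "compact K" "K \<subseteq> \<Omega>" "\<And>z. z \<notin> K \<Longrightarrow> \<phi> z = 0"
    "\<And>z b. z \<notin> K \<Longrightarrow> frechet_derivative \<phi> (at z) b = 0"
    by (rule test_fun_support[OF assms]) (rule that)
  note c = test_fun_continuous[OF assms] test_fun_continuous_partial[OF assms] cont_a_nth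
  show "\<phi> \<in> L2 \<Omega>" by (rule L2_continuous_compact_support[OF lmeas c(1) K(1,3)])
  show "(\<lambda>z. frechet_derivative \<phi> (at z) (axis i 1)) \<in> L2 \<Omega>"
    by (rule L2_continuous_compact_support[OF lmeas c(2) K(1,4)])
  show "(\<lambda>z. of_real (a z $ i) * \<phi> z) \<in> L2 \<Omega>"
  proof (rule L2_continuous_compact_support[OF lmeas _ K(1)])
    show "continuous_on UNIV (\<lambda>z. of_real (a z $ i) * \<phi> z)"
      by (intro continuous_on_mult continuous_on_of_real c)
  qed (simp add: K(3))
  show "mag_test a \<phi> i \<in> L2 \<Omega>"
  proof (rule L2_continuous_compact_support[OF lmeas _ K(1)])
    show "continuous_on UNIV (mag_test a \<phi> i)"
      unfolding mag_test_def[abs_def]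
      by (intro continuous_on_diff continuous_on_mult continuous_on_const continuous_on_of_real c)
  qed (simp add: K(3,4) mag_test_def)
qed

lemma mag_weak_add:
  assumes "mag_weak a \<Omega> u p" "mag_weak a \<Omega> v q"
  shows "mag_weak a \<Omega> (u + v) (\<lambda>z. p z + q z)"
proof -
  have L: "u \<in> L2 \<Omega>" "v \<in> L2 \<Omega>" "p \<in> L2 \<Omega>" "q \<in> L2 \<Omega>"
    "\<And>i. (\<lambda>z. p z $ i) \<in> L2 \<Omega>" "\<And>i. (\<lambda>z. q z $ i) \<in> L2 \<Omega>"
    using assms L2_vec_iff[of p \<Omega>] L2_vec_iff[of q \<Omega>] by (auto simp: mag_weak_def)
  show ?thesis unfolding mag_weak_def
  proof (intro conjI ballI allI)
    show "u + v \<in> L2 \<Omega>" using L by (simp add: plus_fun_def L2_add)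
    show "(\<lambda>z. p z + q z) \<in> L2 \<Omega>" using L by (simp add: L2_add)
    fix \<phi> i assume \<phi>: "\<phi> \<in> test_fun \<Omega>"
    then show "(LINT z|lebesgue_on \<Omega>. (u + v) z * mag_test a \<phi> i z) = (LINT z|lebesgue_on \<Omega>. (p z + q z) $ i * \<phi> z)"
      using assms L mag_test_L2[OF \<phi>] by (simp add: ring_distribs L2_integrable_mult mag_weak_def)
  qed
qed

lemma mag_weak_scale:
  assumes "mag_weak a \<Omega> u p"
  shows "mag_weak a \<Omega> (fscale c u) (\<lambda>z. c *s p z)"
proof -
  have L: "u \<in> L2 \<Omega>" "p \<in> L2 \<Omega>" "\<And>i. (\<lambda>z. p z $ i) \<in> L2 \<Omega>"
    using assms L2_vec_iff[of p \<Omega>] by (auto simp: mag_weak_def)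
  show ?thesis unfolding mag_weak_def
  proof (intro conjI ballI allI)
    show "fscale c u \<in> L2 \<Omega>" using L by (simp add: fscale_def L2_cmult)
    show "(\<lambda>z. c *s p z) \<in> L2 \<Omega>" using L by (simp add: L2_vec_iff L2_cmult)
    fix \<phi> i assume \<phi>: "\<phi> \<in> test_fun \<Omega>"
    then show "(LINT z|lebesgue_on \<Omega>. fscale c u z * mag_test a \<phi> i z) = (LINT z|lebesgue_on \<Omega>. (c *s p z) $ i * \<phi> z)"
      using assms by (simp add: fscale_def mult.assoc mag_weak_def)
  qed
qed

lemma L2_loc_nth_integrable:
  assumes "(g :: real^'n \<Rightarrow> complex^'n) \<in> L2_loc \<Omega>" "compact K" "K \<subseteq> \<Omega>"
  shows "integrable (lebesgue_on K) (\<lambda>z. g z $ i)"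
proof -
  have "g \<in> L2 K" using assms by (auto simp: L2_loc_def)
  then have "(\<lambda>z. g z $ i) \<in> L2 K" by (simp add: L2_vec_iff)
  then show ?thesis using assms lmeasurable_compact by (intro L2_integrable) auto
qed

lemma integrable_mult_compact_support:
  assumes g: "\<And>K. compact K \<Longrightarrow> K \<subseteq> \<Omega> \<Longrightarrow> integrable (lebesgue_on K) g"
    and \<psi>: "continuous_on UNIV \<psi>" "compact K" "K \<subseteq> \<Omega>" "\<And>z. z \<notin> K \<Longrightarrow> \<psi> z = 0"
  shows "integrable (lebesgue_on \<Omega>) (\<lambda>z. g z * (\<psi> z :: complex))"
proof -
  obtain M where M: "\<And>z. cmod (\<psi> z) \<le> M"
    using continuous_compact_support_bounded[OF \<psi>(1,2,4)] by blast
  have "\<psi> \<in> borel_measurable (lebesgue_on K)"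
    using borel_measurable_continuous_onI[OF \<psi>(1)] by (intro measurable_restrict_space1 measurable_completion) simp
  then have gm: "(\<lambda>z. g z * \<psi> z) \<in> borel_measurable (lebesgue_on K)"
    using g[OF \<psi>(2,3)] by measurable
  have "integrable (lebesgue_on K) (\<lambda>z. M * norm (g z))"
    using g[OF \<psi>(2,3)] by simp
  then have "integrable (lebesgue_on K) (\<lambda>z. g z * \<psi> z)"
  proof (rule Bochner_Integration.integrable_bound[OF _ gm])
    have "norm (g z * \<psi> z) \<le> norm (M * norm (g z))" for z
    proof -
      have "norm (g z * \<psi> z) \<le> norm (g z) * M"
        unfolding norm_mult by (intro mult_left_mono M norm_ge_zero)
      also have "\<dots> \<le> \<bar>norm (g z) * M\<bar>" by (rule abs_ge_self)
      finally show ?thesis by (simp add: mult.commute)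
    qed
    then show "AE z in lebesgue_on K. norm (g z * \<psi> z) \<le> norm (M * norm (g z))" by simp
  qed
  then have "integrable lebesgue (\<lambda>z. indicator K z *\<^sub>R (g z * \<psi> z))"
    using lmeasurable_compact[OF \<psi>(2)] by (subst integrable_restrict_space[symmetric]) (auto dest: fmeasurableD)
  also have "(\<lambda>z. indicator K z *\<^sub>R (g z * \<psi> z)) = (\<lambda>z. indicator \<Omega> z *\<^sub>R (g z * \<psi> z))"
    using \<psi>(3,4) by (auto simp: fun_eq_iff indicator_def)
  finally show ?thesis using open_\<Omega> by (subst integrable_restrict_space) auto
qed

text \<open>The fundamental lemma, applied to each component of the difference. Weak gradients are
  only locally square-integrable, hence the compact subsets in the hypotheses of that lemma.\<close>

lemma weak_grad_AE_unique:
  assumes "g \<in> L2_loc \<Omega>" "is_weak_grad \<Omega> u g" "k \<in> L2_loc \<Omega>" "is_weak_grad \<Omega> u k"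
  shows "AE z in lebesgue_on \<Omega>. g z = k z"
proof -
  have "AE z in lebesgue_on \<Omega>. g z $ i - k z $ i = 0" for i
  proof (rule AE_zero_if_test_integrals_zero[OF open_\<Omega>])
    show "integrable (lebesgue_on K) (\<lambda>z. g z $ i - k z $ i)" if "compact K" "K \<subseteq> \<Omega>" for K
      using that assms L2_loc_nth_integrable by (intro Bochner_Integration.integrable_diff)
    fix \<phi> :: "real^'n \<Rightarrow> complex" assume \<phi>: "\<phi> \<in> test_fun \<Omega>"
    obtain K where K: "compact K" "K \<subseteq> \<Omega>" "\<And>z. z \<notin> K \<Longrightarrow> \<phi> z = 0"
      by (rule test_fun_support[OF \<phi>]) (rule that)
    have "integrable (lebesgue_on \<Omega>) (\<lambda>z. g z $ i * \<phi> z)" "integrable (lebesgue_on \<Omega>) (\<lambda>z. k z $ i * \<phi> z)"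
      using assms K test_fun_continuous[OF \<phi>] L2_loc_nth_integrable
      by (auto intro!: integrable_mult_compact_support[where K = K])
    moreover have "- (LINT z|lebesgue_on \<Omega>. g z $ i * \<phi> z) = - (LINT z|lebesgue_on \<Omega>. k z $ i * \<phi> z)"
      using assms(2,4)[unfolded is_weak_grad_def, rule_format, OF \<phi>, of i] by simp
    ultimately show "(LINT z|lebesgue_on \<Omega>. (g z $ i - k z $ i) * \<phi> z) = 0"
      by (simp add: ring_distribs)
  qed
  then have "AE z in lebesgue_on \<Omega>. \<forall>i. g z $ i - k z $ i = 0"
    by (subst AE_all_countable) blast
  then show ?thesis by eventually_elim (simp add: vec_eq_iff)
qed

lemma L2_imp_L2_loc:
  fixes f :: "real^'n \<Rightarrow> 'b::{real_normed_vector, second_countable_topology}"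
  assumes "f \<in> L2 \<Omega>"
  shows "f \<in> L2_loc \<Omega>"
  unfolding L2_loc_def
proof (intro CollectI allI impI)
  fix K assume K: "compact K \<and> K \<subseteq> \<Omega>"
  then have Ks: "K \<in> sets lebesgue" by (auto intro: lmeasurable_compact fmeasurableD)
  show "f \<in> L2 K" unfolding L2_def
  proof (intro CollectI conjI)
    show "f \<in> borel_measurable (lebesgue_on K)"
      using L2_measurable[OF assms] K by (blast intro: measurable_restrict_mono)
    show "integrable (lebesgue_on K) (\<lambda>z. (norm (f z))\<^sup>2)"
      using K Ks open_\<Omega> by (intro integrable_lebesgue_on_subset[OF L2_integrable_sq[OF assms]]) auto
  qed
qed

lemma H1_mag_mag_weak:
  assumes "u \<in> H1_mag a \<Omega>"
  shows "mag_weak a \<Omega> u (mag_grad a \<Omega> u)"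
proof -
  let ?g = "weak_grad \<Omega> u"
  have u: "u \<in> L2 \<Omega>" "u \<in> H1_loc \<Omega>" "mag_grad a \<Omega> u \<in> L2 \<Omega>" using assms by (auto simp: H1_mag_def)
  have g: "?g \<in> L2_loc \<Omega> \<and> is_weak_grad \<Omega> u ?g"
  proof -
    obtain g0 where "g0 \<in> L2_loc \<Omega> \<and> is_weak_grad \<Omega> u g0" using u(2) by (auto simp: H1_loc_def)
    then show ?thesis unfolding weak_grad_def by (rule someI[of "\<lambda>g. g \<in> L2_loc \<Omega> \<and> is_weak_grad \<Omega> u g"])
  qed
  show ?thesis unfolding mag_weak_def
  proof (intro conjI ballI allI u)
    fix \<phi> :: "real^'n \<Rightarrow> complex" and i assume \<phi>: "\<phi> \<in> test_fun \<Omega>"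
    obtain K where K: "compact K" "K \<subseteq> \<Omega>" "\<And>z. z \<notin> K \<Longrightarrow> \<phi> z = 0"
      by (rule test_fun_support[OF \<phi>]) (rule that)
    have i1: "integrable (lebesgue_on \<Omega>) (\<lambda>z. ?g z $ i * \<phi> z)"
      using g K test_fun_continuous[OF \<phi>] L2_loc_nth_integrable
      by (auto intro!: integrable_mult_compact_support[where K = K])
    have i2: "integrable (lebesgue_on \<Omega>) (\<lambda>z. u z * frechet_derivative \<phi> (at z) (axis i 1))"
      "integrable (lebesgue_on \<Omega>) (\<lambda>z. u z * (of_real (a z $ i) * \<phi> z))"
      using u(1) mag_test_L2[OF \<phi>] by (auto intro!: L2_integrable_mult)
    have "(LINT z|lebesgue_on \<Omega>. u z * mag_test a \<phi> i z) =
        (LINT z|lebesgue_on \<Omega>. \<i> * (u z * frechet_derivative \<phi> (at z) (axis i 1)) - u z * (of_real (a z $ i) * \<phi> z))"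
      by (intro Bochner_Integration.integral_cong) (auto simp: mag_test_def algebra_simps)
    also have "\<dots> = \<i> * (LINT z|lebesgue_on \<Omega>. u z * frechet_derivative \<phi> (at z) (axis i 1))
        - (LINT z|lebesgue_on \<Omega>. u z * (of_real (a z $ i) * \<phi> z))"
      using i2 by (subst Bochner_Integration.integral_diff) auto
    also have "(LINT z|lebesgue_on \<Omega>. u z * frechet_derivative \<phi> (at z) (axis i 1)) =
        - (LINT z|lebesgue_on \<Omega>. ?g z $ i * \<phi> z)"
      using g \<phi> by (auto simp: is_weak_grad_def)
    also have "\<i> * (- (LINT z|lebesgue_on \<Omega>. ?g z $ i * \<phi> z)) - (LINT z|lebesgue_on \<Omega>. u z * (of_real (a z $ i) * \<phi> z))
        = (LINT z|lebesgue_on \<Omega>. - \<i> * (?g z $ i * \<phi> z) - u z * (of_real (a z $ i) * \<phi> z))"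
      using i1 i2 by (subst Bochner_Integration.integral_diff) auto
    also have "\<dots> = (LINT z|lebesgue_on \<Omega>. mag_grad a \<Omega> u z $ i * \<phi> z)"
      by (intro Bochner_Integration.integral_cong) (auto simp: mag_grad_def algebra_simps)
    finally show "(LINT z|lebesgue_on \<Omega>. u z * mag_test a \<phi> i z) = (LINT z|lebesgue_on \<Omega>. mag_grad a \<Omega> u z $ i * \<phi> z)" .
  qed
qed

lemma borel_measurable_lebesgue_on_AE:
  fixes f g :: "real^'n \<Rightarrow> 'b::euclidean_space"
  assumes "f \<in> borel_measurable (lebesgue_on \<Omega>)" "AE z in lebesgue_on \<Omega>. f z = g z"
  shows "g \<in> borel_measurable (lebesgue_on \<Omega>)"
proof -
  have s: "\<Omega> \<in> sets lebesgue" using open_\<Omega> by auto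
  have "(\<lambda>z. if z \<in> \<Omega> then f z else 0) \<in> borel_measurable lebesgue"
    using assms(1) by (simp add: borel_measurable_if[OF s])
  moreover have "AE z in lebesgue. z \<in> \<Omega> \<longrightarrow> f z = g z"
    using assms(2) s by (subst (asm) AE_restrict_space_iff) auto
  then have "AE z in lebesgue. (if z \<in> \<Omega> then f z else 0) = (if z \<in> \<Omega> then g z else 0)"
    by eventually_elim auto
  ultimately have "(\<lambda>z. if z \<in> \<Omega> then g z else 0) \<in> borel_measurable lebesgue"
    by (rule borel_measurable_AE)
  then show ?thesis by (simp add: borel_measurable_if[OF s])
qed

lemma L2_AE:
  fixes f g :: "real^'n \<Rightarrow> 'b::euclidean_space"
  assumes "f \<in> L2 \<Omega>" "AE z in lebesgue_on \<Omega>. f z = g z"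
  shows "g \<in> L2 \<Omega>"
proof -
  have g: "g \<in> borel_measurable (lebesgue_on \<Omega>)"
    using borel_measurable_lebesgue_on_AE[OF L2_measurable[OF assms(1)] assms(2)] .
  have "integrable (lebesgue_on \<Omega>) (\<lambda>z. (norm (g z))\<^sup>2)"
  proof (rule integrable_cong_AE_imp[OF L2_integrable_sq[OF assms(1)]])
    show "(\<lambda>z. (norm (g z))\<^sup>2) \<in> borel_measurable (lebesgue_on \<Omega>)" using g by measurable
    show "AE z in lebesgue_on \<Omega>. (norm (f z))\<^sup>2 = (norm (g z))\<^sup>2" using assms(2) by eventually_elim simp
  qed
  then show ?thesis using g by (simp add: L2_def)
qed

text \<open>A weak gradient of \<open>u\<close> is recovered algebraically from \<open>p\<close>,
  \<open>a\<close> and \<open>u\<close>; it is locally square-integrable because \<open>a\<close> is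
  bounded on compact sets. Uniqueness identifies it with the chosen
  \<open>weak_grad\<close>.\<close>

lemma mag_weak_H1_mag:
  assumes "mag_weak a \<Omega> u p"
  shows "u \<in> H1_mag a \<Omega>" "AE z in lebesgue_on \<Omega>. mag_grad a \<Omega> u z = p z"
proof -
  have L: "u \<in> L2 \<Omega>" "p \<in> L2 \<Omega>" "\<And>i. (\<lambda>z. p z $ i) \<in> L2 \<Omega>"
    using assms L2_vec_iff[of p \<Omega>] by (auto simp: mag_weak_def)
  \<comment> \<open>The solution of p = - \<i> g - a u for g.\<close>
  define g where "g z = (\<chi> i. \<i> * (p z $ i + of_real (a z $ i) * u z))" for z
  have g_loc: "g \<in> L2_loc \<Omega>"
    unfolding L2_loc_def
  proof (intro CollectI allI impI)
    fix K assume K: "compact K \<and> K \<subseteq> \<Omega>"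
    have "(\<lambda>z. g z $ i) \<in> L2 K" for i
    proof -
      have "compact ((\<lambda>z. a z $ i) ` K)"
        using K cont_a_nth by (intro compact_continuous_image) (auto intro: continuous_on_subset)
      then have "bounded ((\<lambda>z. a z $ i) ` K)" by (rule compact_imp_bounded)
      then obtain M where M: "\<forall>x\<in>(\<lambda>z. a z $ i) ` K. norm x \<le> M" unfolding bounded_pos by blast
      have "(\<lambda>z. complex_of_real (a z $ i)) \<in> borel_measurable borel"
        by (intro borel_measurable_continuous_onI continuous_on_of_real cont_a_nth)
      then have am: "(\<lambda>z. complex_of_real (a z $ i)) \<in> borel_measurable (lebesgue_on K)"
        by (intro measurable_restrict_space1 measurable_completion) simp
      have "(\<lambda>z. u z * of_real (a z $ i)) \<in> L2 K"
        using L2_imp_L2_loc[OF L(1)] K M am by (intro L2_mult_bounded[where K = M]) (auto simp: L2_loc_def)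
      moreover have "(\<lambda>z. p z $ i) \<in> L2 K" using L2_imp_L2_loc[OF L(3)] K by (auto simp: L2_loc_def)
      ultimately have "(\<lambda>z. \<i> * (p z $ i + u z * of_real (a z $ i))) \<in> L2 K" by (intro L2_cmult L2_add)
      then show ?thesis by (simp add: g_def mult.commute)
    qed
    then show "g \<in> L2 K" by (simp add: L2_vec_iff)
  qed
  have g_grad: "is_weak_grad \<Omega> u g"
    unfolding is_weak_grad_def
  proof (intro ballI allI)
    fix \<phi> :: "real^'n \<Rightarrow> complex" and i assume \<phi>: "\<phi> \<in> test_fun \<Omega>"
    note T = mag_test_L2[OF \<phi>]
    note ints = L2_integrable_mult[OF L(1) T(1)] L2_integrable_mult[OF L(1) T(2)] L2_integrable_mult[OF L(3) T(3)]
    have "(LINT z|lebesgue_on \<Omega>. u z * frechet_derivative \<phi> (at z) (axis i 1)) =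
        (LINT z|lebesgue_on \<Omega>. - \<i> * (u z * mag_test a \<phi> i z) - \<i> * (u z * (of_real (a z $ i) * \<phi> z)))"
      by (intro Bochner_Integration.integral_cong) (auto simp: mag_test_def algebra_simps)
    also have "\<dots> = - \<i> * (LINT z|lebesgue_on \<Omega>. u z * mag_test a \<phi> i z) - \<i> * (LINT z|lebesgue_on \<Omega>. u z * (of_real (a z $ i) * \<phi> z))"
      using ints by (subst Bochner_Integration.integral_diff) auto
    also have "(LINT z|lebesgue_on \<Omega>. u z * mag_test a \<phi> i z) = (LINT z|lebesgue_on \<Omega>. p z $ i * \<phi> z)"
      using assms \<phi> by (auto simp: mag_weak_def)
    also have "- \<i> * (LINT z|lebesgue_on \<Omega>. p z $ i * \<phi> z) - \<i> * (LINT z|lebesgue_on \<Omega>. u z * (of_real (a z $ i) * \<phi> z))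
        = - (LINT z|lebesgue_on \<Omega>. \<i> * (p z $ i * \<phi> z) + \<i> * (u z * (of_real (a z $ i) * \<phi> z)))"
      using ints by (subst Bochner_Integration.integral_add) auto
    also have "\<dots> = - (LINT z|lebesgue_on \<Omega>. g z $ i * \<phi> z)"
      by (intro arg_cong[where f = uminus] Bochner_Integration.integral_cong) (auto simp: g_def algebra_simps)
    finally show "(LINT z|lebesgue_on \<Omega>. u z * frechet_derivative \<phi> (at z) (axis i 1)) =
       - (LINT z|lebesgue_on \<Omega>. g z $ i * \<phi> z)" .
  qed
  have w: "weak_grad \<Omega> u \<in> L2_loc \<Omega> \<and> is_weak_grad \<Omega> u (weak_grad \<Omega> u)"
    unfolding weak_grad_def by (rule someI[of _ g]) (use g_loc g_grad in simp)
  have "AE z in lebesgue_on \<Omega>. g z = weak_grad \<Omega> u z"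
    using weak_grad_AE_unique g_loc g_grad w by blast
  then show AE: "AE z in lebesgue_on \<Omega>. mag_grad a \<Omega> u z = p z"
  proof eventually_elim
    case (elim z)
    then show ?case
      unfolding mag_grad_def elim[symmetric] by (simp add: vec_eq_iff g_def algebra_simps)
  qed
  then have "AE z in lebesgue_on \<Omega>. p z = mag_grad a \<Omega> u z" by eventually_elim simp
  then have "mag_grad a \<Omega> u \<in> L2 \<Omega>" by (rule L2_AE[OF L(2)])
  then show "u \<in> H1_mag a \<Omega>"
    using L g_loc g_grad L2_imp_L2_loc[OF L(1)] by (auto simp: H1_mag_def H1_loc_def)
qed

lemma H1_mag_L2: "H1_mag a \<Omega> \<subseteq> L2 \<Omega>"
  by (auto simp: H1_mag_def)

lemma mag_form_eq:
  assumes "mag_weak a \<Omega> u p" "mag_weak a \<Omega> v q"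
  shows "mag_form a \<Omega> u v = (\<Sum>i\<in>UNIV. L2_inner \<Omega> (\<lambda>z. p z $ i) (\<lambda>z. q z $ i))"
proof -
  note W = mag_weak_H1_mag[OF assms(1)] mag_weak_H1_mag[OF assms(2)]
  have L: "\<And>i. (\<lambda>z. p z $ i) \<in> L2 \<Omega>" "\<And>i. (\<lambda>z. q z $ i) \<in> L2 \<Omega>"
    "\<And>i. (\<lambda>z. mag_grad a \<Omega> u z $ i) \<in> L2 \<Omega>" "\<And>i. (\<lambda>z. mag_grad a \<Omega> v z $ i) \<in> L2 \<Omega>"
    using assms W(1,3) L2_vec_iff[of p \<Omega>] L2_vec_iff[of q \<Omega>]
      L2_vec_iff[of "mag_grad a \<Omega> u" \<Omega>] L2_vec_iff[of "mag_grad a \<Omega> v" \<Omega>]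
    by (auto simp: mag_weak_def H1_mag_def)
  have "mag_form a \<Omega> u v = (LINT z|lebesgue_on \<Omega>. (\<Sum>i\<in>UNIV. p z $ i * cnj (q z $ i)))"
    unfolding mag_form_def
  proof (rule integral_cong_AE)
    show "(\<lambda>z. \<Sum>i\<in>UNIV. mag_grad a \<Omega> u z $ i * cnj (mag_grad a \<Omega> v z $ i)) \<in> borel_measurable (lebesgue_on \<Omega>)"
      using L by (intro borel_measurable_sum borel_measurable_integrable L2_integrable_cnj)
    show "(\<lambda>z. \<Sum>i\<in>UNIV. p z $ i * cnj (q z $ i)) \<in> borel_measurable (lebesgue_on \<Omega>)"
      using L by (intro borel_measurable_sum borel_measurable_integrable L2_integrable_cnj)
    show "AE z in lebesgue_on \<Omega>. (\<Sum>i\<in>UNIV. mag_grad a \<Omega> u z $ i * cnj (mag_grad a \<Omega> v z $ i)) =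
        (\<Sum>i\<in>UNIV. p z $ i * cnj (q z $ i))"
      using W(2,4) by eventually_elim simp
  qed
  also have "\<dots> = (\<Sum>i\<in>UNIV. L2_inner \<Omega> (\<lambda>z. p z $ i) (\<lambda>z. q z $ i))"
    unfolding L2_inner_def using L by (intro Bochner_Integration.integral_sum L2_integrable_cnj)
  finally show ?thesis .
qed

lemma Re_mag_form:
  assumes "mag_weak a \<Omega> u p"
  shows "Re (mag_form a \<Omega> u u) = (LINT z|lebesgue_on \<Omega>. (norm (p z))\<^sup>2)"
proof -
  have L: "\<And>i. (\<lambda>z. p z $ i) \<in> L2 \<Omega>"
    using assms L2_vec_iff[of p \<Omega>] by (auto simp: mag_weak_def)
  have "Re (mag_form a \<Omega> u u) = (\<Sum>i\<in>UNIV. (LINT z|lebesgue_on \<Omega>. (cmod (p z $ i))\<^sup>2))"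
    using mag_form_eq[OF assms assms] L by (simp add: Re_L2_inner_self)
  also have "\<dots> = (LINT z|lebesgue_on \<Omega>. (\<Sum>i\<in>UNIV. (cmod (p z $ i))\<^sup>2))"
    using L by (intro Bochner_Integration.integral_sum[symmetric] L2_integrable_sq)
  finally show ?thesis by (simp add: norm_sq_vec)
qed

lemma subspace_H1_mag: "fscale.subspace (H1_mag a \<Omega>)"
  unfolding fscale.subspace_def
proof (intro conjI ballI allI)
  have "mag_weak a \<Omega> 0 (\<lambda>_. 0)" by (auto simp: mag_weak_def L2_def zero_fun_def)
  then show "0 \<in> H1_mag a \<Omega>" by (rule mag_weak_H1_mag)
next
  fix x y assume "x \<in> H1_mag a \<Omega>" "y \<in> H1_mag a \<Omega>"
  then show "x + y \<in> H1_mag a \<Omega>"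
    by (intro mag_weak_H1_mag(1)[OF mag_weak_add[OF H1_mag_mag_weak H1_mag_mag_weak]])
next
  fix x c assume "x \<in> H1_mag a \<Omega>"
  then show "fscale c x \<in> H1_mag a \<Omega>"
    by (intro mag_weak_H1_mag(1)[OF mag_weak_scale[OF H1_mag_mag_weak]])
qed

lemma psd_form_ip: "psd_form fscale (H1_mag a \<Omega>) (L2_inner \<Omega>)"
  by (rule psd_form_subset[OF psd_form_L2 H1_mag_L2 subspace_H1_mag])

lemma psd_form_h: "psd_form fscale (H1_mag a \<Omega>) (mag_form a \<Omega>)"
proof
  interpret l: psd_form fscale "L2 \<Omega>" "L2_inner \<Omega>" by (rule psd_form_L2)
  show "fscale.subspace (H1_mag a \<Omega>)" by (rule subspace_H1_mag)
  have g: "(\<lambda>z. mag_grad a \<Omega> u z $ i) \<in> L2 \<Omega>" if "u \<in> H1_mag a \<Omega>" for u i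
    using that L2_vec_iff[of "mag_grad a \<Omega> u" \<Omega>] by (auto simp: H1_mag_def)
  note W = H1_mag_mag_weak
  fix u v w :: "real^'n \<Rightarrow> complex" and c :: complex
  assume u: "u \<in> H1_mag a \<Omega>"
  show "0 \<le> Re (mag_form a \<Omega> u u)"
    by (simp add: Re_mag_form[OF W[OF u]])
  assume w: "w \<in> H1_mag a \<Omega>"
  have "l.q 0 = l.q 0" ..
  have "L2_inner \<Omega> (\<lambda>z. c * mag_grad a \<Omega> u z $ i) (\<lambda>z. mag_grad a \<Omega> w z $ i)
      = c * L2_inner \<Omega> (\<lambda>z. mag_grad a \<Omega> u z $ i) (\<lambda>z. mag_grad a \<Omega> w z $ i)" for i
    using l.scale_left[OF g[OF u] g[OF w], of c i i] by (simp add: fscale_def)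
  then show "mag_form a \<Omega> (fscale c u) w = c * mag_form a \<Omega> u w"
    by (simp add: mag_form_eq[OF mag_weak_scale[OF W[OF u]] W[OF w]] mag_form_eq[OF W[OF u] W[OF w]] sum_distrib_left)
  show "mag_form a \<Omega> w u = cnj (mag_form a \<Omega> u w)"
    unfolding mag_form_eq[OF W[OF u] W[OF w]] mag_form_eq[OF W[OF w] W[OF u]] cnj_sum
    by (intro sum.cong refl l.herm g u w)
  assume v: "v \<in> H1_mag a \<Omega>"
  have "L2_inner \<Omega> (\<lambda>z. mag_grad a \<Omega> u z $ i + mag_grad a \<Omega> v z $ i) (\<lambda>z. mag_grad a \<Omega> w z $ i)
      = L2_inner \<Omega> (\<lambda>z. mag_grad a \<Omega> u z $ i) (\<lambda>z. mag_grad a \<Omega> w z $ i)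
       + L2_inner \<Omega> (\<lambda>z. mag_grad a \<Omega> v z $ i) (\<lambda>z. mag_grad a \<Omega> w z $ i)" for i
    using l.add_left[OF g[OF u] g[OF v] g[OF w], of i i i] by (simp add: plus_fun_def)
  then show "mag_form a \<Omega> (u + v) w = mag_form a \<Omega> u w + mag_form a \<Omega> v w"
    by (simp add: mag_form_eq[OF mag_weak_add[OF W[OF u] W[OF v]] W[OF w]]
        mag_form_eq[OF W[OF u] W[OF w]] mag_form_eq[OF W[OF v] W[OF w]] sum.distrib)
qed

text \<open>For a fixed test function both sides of the weak identity are \<open>L2\<close> pairings
  with square-integrable functions, so they pass to the limit.\<close>

lemma mag_weak_closed:
  assumes w: "\<And>n. mag_weak a \<Omega> (u n) (p n)" and L: "f \<in> L2 \<Omega>" "q \<in> L2 \<Omega>"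
    and u: "(\<lambda>n. LINT z|lebesgue_on \<Omega>. (cmod (u n z - f z))\<^sup>2) \<longlonglongrightarrow> 0"
    and p: "(\<lambda>n. LINT z|lebesgue_on \<Omega>. (norm (p n z - q z))\<^sup>2) \<longlonglongrightarrow> 0"
  shows "mag_weak a \<Omega> f q"
  unfolding mag_weak_def
proof (intro conjI ballI allI L)
  fix \<phi> :: "real^'n \<Rightarrow> complex" and i assume \<phi>: "\<phi> \<in> test_fun \<Omega>"
  note T = mag_test_L2[OF \<phi>]
  have up: "u n \<in> L2 \<Omega>" "p n \<in> L2 \<Omega>" for n using w by (auto simp: mag_weak_def)
  have pc: "(\<lambda>z. p n z $ i) \<in> L2 \<Omega>" "(\<lambda>z. q z $ i) \<in> L2 \<Omega>" for n
    using up(2)[of n] L(2) by (simp_all add: L2_vec_iff)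
  have "(\<lambda>n. LINT z|lebesgue_on \<Omega>. u n z * mag_test a \<phi> i z) \<longlonglongrightarrow> (LINT z|lebesgue_on \<Omega>. f z * mag_test a \<phi> i z)"
    by (rule L2_tendsto_integral[OF up(1) L(1) T(1) u])
  moreover have "(\<lambda>n. LINT z|lebesgue_on \<Omega>. p n z $ i * \<phi> z) \<longlonglongrightarrow> (LINT z|lebesgue_on \<Omega>. q z $ i * \<phi> z)"
  proof (rule L2_tendsto_integral[OF pc(1) pc(2) T(3)])
    show "(\<lambda>n. LINT z|lebesgue_on \<Omega>. (cmod (p n z $ i - q z $ i))\<^sup>2) \<longlonglongrightarrow> 0"
    proof (rule tendsto_sandwich[OF _ _ tendsto_const p])
      show "\<forall>\<^sub>F n in sequentially. (LINT z|lebesgue_on \<Omega>. (cmod (p n z $ i - q z $ i))\<^sup>2)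
          \<le> (LINT z|lebesgue_on \<Omega>. (norm (p n z - q z))\<^sup>2)"
      proof (intro always_eventually allI integral_mono)
        fix n
        show "integrable (lebesgue_on \<Omega>) (\<lambda>z. (cmod (p n z $ i - q z $ i))\<^sup>2)"
          by (rule L2_integrable_sq[OF L2_diff[OF pc]])
        show "integrable (lebesgue_on \<Omega>) (\<lambda>z. (norm (p n z - q z))\<^sup>2)"
          by (rule L2_integrable_sq[OF L2_diff[OF up(2) L(2)]])
        show "(cmod (p n z $ i - q z $ i))\<^sup>2 \<le> (norm (p n z - q z))\<^sup>2" for z
          using Finite_Cartesian_Product.norm_nth_le[of "p n z - q z" i] by (intro power_mono) auto
      qed
    qed auto
  qed
  moreover have "(LINT z|lebesgue_on \<Omega>. u n z * mag_test a \<phi> i z) = (LINT z|lebesgue_on \<Omega>. p n z $ i * \<phi> z)" for n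
    using w[of n] \<phi> by (auto simp: mag_weak_def)
  ultimately show "(LINT z|lebesgue_on \<Omega>. f z * mag_test a \<phi> i z) = (LINT z|lebesgue_on \<Omega>. q z $ i * \<phi> z)"
    using LIMSEQ_unique by simp
qed

end

section \<open>Completeness in the energy norm and the Dirichlet form domain\<close>

context mag_domain
begin

interpretation ip: psd_form fscale "H1_mag a \<Omega>" "L2_inner \<Omega>" by (rule psd_form_ip)
interpretation h: psd_form fscale "H1_mag a \<Omega>" "mag_form a \<Omega>" by (rule psd_form_h)
interpretation e: psd_form fscale "H1_mag a \<Omega>" "\<lambda>u v. mag_form a \<Omega> u v + L2_inner \<Omega> u v"
  by (rule psd_form_sum[OF psd_form_h psd_form_ip])

lemma H1_mag_norm_eq:
  assumes "u \<in> H1_mag a \<Omega>"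
  shows "H1_mag_norm a \<Omega> u = sqrt (e.q u)"
  using Re_mag_form[OF H1_mag_mag_weak[OF assms]] Re_L2_inner_self[of u \<Omega>] assms H1_mag_L2
  by (auto simp: H1_mag_norm_def L2_norm_sq)

lemma mag_weak_diff:
  assumes "mag_weak a \<Omega> u p" "mag_weak a \<Omega> v q"
  shows "mag_weak a \<Omega> (u - v) (\<lambda>z. p z - q z)"
proof -
  have "u + fscale (-1) v = u - v" by (simp add: fscale_def fun_eq_iff)
  moreover have "p z + (-1) *s q z = p z - q z" for z by (simp add: vec_eq_iff)
  ultimately show ?thesis using mag_weak_add[OF assms(1) mag_weak_scale[OF assms(2), of "-1"]] by simp
qed

lemma e_diff:
  assumes "mag_weak a \<Omega> u p" "mag_weak a \<Omega> v q"
  shows "e.q (u - v) = (LINT z|lebesgue_on \<Omega>. (norm (p z - q z))\<^sup>2) + (LINT z|lebesgue_on \<Omega>. (cmod (u z - v z))\<^sup>2)"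
proof -
  have w: "mag_weak a \<Omega> (u - v) (\<lambda>z. p z - q z)" by (rule mag_weak_diff[OF assms])
  then have "u - v \<in> L2 \<Omega>" by (simp add: mag_weak_def)
  then show ?thesis using Re_mag_form[OF w] Re_L2_inner_self[of "u - v" \<Omega>] by simp
qed

text \<open>An energy-Cauchy sequence is a Cauchy sequence of functions together with one of
  magnetic gradients. Both converge in \<open>L2\<close>, and the relation between them is
  closed.\<close>

lemma H1_mag_complete:
  assumes u: "\<And>n. u n \<in> H1_mag a \<Omega>"
    and cauchy: "\<And>\<epsilon>. \<epsilon> > 0 \<Longrightarrow> \<exists>N. \<forall>m\<ge>N. \<forall>n\<ge>N. e.q (u m - u n) < \<epsilon>"
  shows "\<exists>v\<in>H1_mag a \<Omega>. (\<lambda>n. e.q (u n - v)) \<longlonglongrightarrow> 0"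
proof -
  define p where "p n = mag_grad a \<Omega> (u n)" for n
  have w: "mag_weak a \<Omega> (u n) (p n)" for n unfolding p_def by (rule H1_mag_mag_weak[OF u])
  have L: "u n \<in> L2 \<Omega>" "p n \<in> L2 \<Omega>" for n using w[of n] by (simp_all add: mag_weak_def)
  have eq: "e.q (u m - u n) = (LINT z|lebesgue_on \<Omega>. (norm (p m z - p n z))\<^sup>2) + (LINT z|lebesgue_on \<Omega>. (cmod (u m z - u n z))\<^sup>2)" for m n
    by (rule e_diff[OF w w])
  have "\<exists>f\<in>L2 \<Omega>. (\<lambda>n. LINT z|lebesgue_on \<Omega>. (cmod (u n z - f z))\<^sup>2) \<longlonglongrightarrow> 0"
  proof (rule L2_complete[OF lmeas L(1)])
    fix \<epsilon> :: real assume "\<epsilon> > 0"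
    then obtain N where N: "\<forall>m\<ge>N. \<forall>n\<ge>N. e.q (u m - u n) < \<epsilon>" using cauchy by blast
    have "(LINT z|lebesgue_on \<Omega>. (cmod (u m z - u n z))\<^sup>2) < \<epsilon>" if "m \<ge> N" "n \<ge> N" for m n
    proof -
      have "0 \<le> (LINT z|lebesgue_on \<Omega>. (norm (p m z - p n z))\<^sup>2)" by simp
      then show ?thesis using N[rule_format, OF that] unfolding eq by linarith
    qed
    then show "\<exists>N. \<forall>m\<ge>N. \<forall>n\<ge>N. (LINT z|lebesgue_on \<Omega>. (cmod (u m z - u n z))\<^sup>2) < \<epsilon>" by blast
  qed
  then obtain f where f: "f \<in> L2 \<Omega>" "(\<lambda>n. LINT z|lebesgue_on \<Omega>. (cmod (u n z - f z))\<^sup>2) \<longlonglongrightarrow> 0" by blast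
  have "\<exists>q\<in>L2 \<Omega>. (\<lambda>n. LINT z|lebesgue_on \<Omega>. (norm (p n z - q z))\<^sup>2) \<longlonglongrightarrow> 0"
  proof (rule L2_complete[OF lmeas L(2)])
    fix \<epsilon> :: real assume "\<epsilon> > 0"
    then obtain N where N: "\<forall>m\<ge>N. \<forall>n\<ge>N. e.q (u m - u n) < \<epsilon>" using cauchy by blast
    have "(LINT z|lebesgue_on \<Omega>. (norm (p m z - p n z))\<^sup>2) < \<epsilon>" if "m \<ge> N" "n \<ge> N" for m n
    proof -
      have "0 \<le> (LINT z|lebesgue_on \<Omega>. (cmod (u m z - u n z))\<^sup>2)" by simp
      then show ?thesis using N[rule_format, OF that] unfolding eq by linarith
    qed
    then show "\<exists>N. \<forall>m\<ge>N. \<forall>n\<ge>N. (LINT z|lebesgue_on \<Omega>. (norm (p m z - p n z))\<^sup>2) < \<epsilon>" by blast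
  qed
  then obtain q where q: "q \<in> L2 \<Omega>" "(\<lambda>n. LINT z|lebesgue_on \<Omega>. (norm (p n z - q z))\<^sup>2) \<longlonglongrightarrow> 0" by blast
  have fq: "mag_weak a \<Omega> f q" by (rule mag_weak_closed[OF w f(1) q(1) f(2) q(2)])
  have "(\<lambda>n. e.q (u n - f)) \<longlonglongrightarrow> 0"
    unfolding e_diff[OF w fq] using tendsto_add[OF q(2) f(2)] by simp
  then show ?thesis using mag_weak_H1_mag(1)[OF fq] by blast
qed

text \<open>Makes explicit functions available as trial functions: no boundary condition enters,
  since the boundary terms vanish through the compact support of the test function.\<close>

lemma mag_weak_C1:
  assumes F: "\<And>z. (f has_derivative F z) (at z)" "\<And>i. continuous_on UNIV (\<lambda>z. F z (axis i 1))"
    and L: "f \<in> L2 \<Omega>" "(\<lambda>z. \<chi> i. - \<i> * F z (axis i 1) - of_real (a z $ i) * f z) \<in> L2 \<Omega>"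
  shows "mag_weak a \<Omega> f (\<lambda>z. \<chi> i. - \<i> * F z (axis i 1) - of_real (a z $ i) * f z)"
  unfolding mag_weak_def
proof (intro conjI ballI allI L)
  fix \<phi> :: "real^'n \<Rightarrow> complex" and i assume \<phi>: "\<phi> \<in> test_fun \<Omega>"
  note T = mag_test_L2[OF \<phi>]
  obtain K where K: "compact K" "K \<subseteq> \<Omega>" "\<And>z. z \<notin> K \<Longrightarrow> \<phi> z = 0"
    by (rule test_fun_support[OF \<phi>]) (rule that)
  have "(\<lambda>z. F z (axis i 1) * \<phi> z) \<in> L2 \<Omega>"
    by (rule L2_continuous_compact_support[OF lmeas _ K(1)])
      (use F(2) test_fun_continuous[OF \<phi>] K(3) in \<open>auto intro: continuous_on_mult\<close>)
  then have i1: "integrable (lebesgue_on \<Omega>) (\<lambda>z. F z (axis i 1) * \<phi> z)" by (rule L2_integrable[OF lmeas])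
  note i2 = L2_integrable_mult[OF L(1) T(4)] L2_integrable_mult[OF L(1) T(2)]
  have "(LINT z|lebesgue_on \<Omega>. f z * mag_test a \<phi> i z) =
      (LINT z|lebesgue_on \<Omega>. \<i> * (f z * frechet_derivative \<phi> (at z) (axis i 1)) - f z * (of_real (a z $ i) * \<phi> z))"
    by (intro Bochner_Integration.integral_cong) (auto simp: mag_test_def algebra_simps)
  also have "\<dots> = \<i> * (LINT z|lebesgue_on \<Omega>. f z * frechet_derivative \<phi> (at z) (axis i 1))
      - (LINT z|lebesgue_on \<Omega>. f z * (of_real (a z $ i) * \<phi> z))"
    using i2 by (subst Bochner_Integration.integral_diff) auto
  also have "(LINT z|lebesgue_on \<Omega>. f z * frechet_derivative \<phi> (at z) (axis i 1)) =
      - (LINT z|lebesgue_on \<Omega>. F z (axis i 1) * \<phi> z)"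
    by (rule integral_by_parts_test_fun[OF \<phi> open_\<Omega> F])
  also have "\<i> * (- (LINT z|lebesgue_on \<Omega>. F z (axis i 1) * \<phi> z)) - (LINT z|lebesgue_on \<Omega>. f z * (of_real (a z $ i) * \<phi> z))
      = (LINT z|lebesgue_on \<Omega>. - \<i> * (F z (axis i 1) * \<phi> z) - f z * (of_real (a z $ i) * \<phi> z))"
    using i1 i2 by (subst Bochner_Integration.integral_diff) auto
  also have "\<dots> = (LINT z|lebesgue_on \<Omega>. (\<chi> i. - \<i> * F z (axis i 1) - of_real (a z $ i) * f z) $ i * \<phi> z)"
    by (intro Bochner_Integration.integral_cong) (auto simp: algebra_simps)
  finally show "(LINT z|lebesgue_on \<Omega>. f z * mag_test a \<phi> i z) =
      (LINT z|lebesgue_on \<Omega>. (\<chi> i. - \<i> * F z (axis i 1) - of_real (a z $ i) * f z) $ i * \<phi> z)" .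
qed

lemma mag_weak_test_fun:
  assumes \<phi>: "\<phi> \<in> test_fun \<Omega>"
  shows "mag_weak a \<Omega> \<phi> (\<lambda>z. \<chi> i. - \<i> * frechet_derivative \<phi> (at z) (axis i 1) - of_real (a z $ i) * \<phi> z)"
proof (rule mag_weak_C1)
  note T = mag_test_L2[OF \<phi>]
  show "(\<lambda>z. \<chi> i. - \<i> * frechet_derivative \<phi> (at z) (axis i 1) - of_real (a z $ i) * \<phi> z) \<in> L2 \<Omega>"
    using L2_diff[OF L2_cmult[OF T(4), of "-\<i>"] T(2)] by (simp add: L2_vec_iff)
qed (use test_fun_has_derivative[OF \<phi>] test_fun_continuous_partial[OF \<phi>] mag_test_L2[OF \<phi>] in auto)

lemma test_fun_H1_mag: "test_fun \<Omega> \<subseteq> H1_mag a \<Omega>"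
  using mag_weak_H1_mag(1)[OF mag_weak_test_fun] by blast

lemma H1_mag_0_iff:
  "u \<in> H1_mag_0 a \<Omega> \<longleftrightarrow> u \<in> H1_mag a \<Omega> \<and> (\<forall>\<epsilon>>0. \<exists>\<phi>\<in>test_fun \<Omega>. e.q (u - \<phi>) < \<epsilon>)"
proof (cases "u \<in> H1_mag a \<Omega>")
  case True
  have eq: "H1_mag_norm a \<Omega> (\<lambda>z. u z - \<phi> z) = sqrt (e.q (u - \<phi>))" if "\<phi> \<in> test_fun \<Omega>" for \<phi>
  proof -
    have "u - \<phi> \<in> H1_mag a \<Omega>"
      using True that test_fun_H1_mag by (intro fscale.subspace_diff[OF subspace_H1_mag]) auto
    then show ?thesis using H1_mag_norm_eq[of "u - \<phi>"] by (simp add: fun_diff_def)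
  qed
  have "(\<forall>\<epsilon>>0. \<exists>\<phi>\<in>test_fun \<Omega>. sqrt (e.q (u - \<phi>)) < \<epsilon>) \<longleftrightarrow> (\<forall>\<epsilon>>0. \<exists>\<phi>\<in>test_fun \<Omega>. e.q (u - \<phi>) < \<epsilon>)"
  proof (intro iffI allI impI)
    fix \<epsilon> :: real assume *: "\<forall>\<epsilon>>0. \<exists>\<phi>\<in>test_fun \<Omega>. sqrt (e.q (u - \<phi>)) < \<epsilon>" and "\<epsilon> > 0"
    then obtain \<phi> where "\<phi> \<in> test_fun \<Omega>" "sqrt (e.q (u - \<phi>)) < sqrt \<epsilon>" using real_sqrt_gt_zero by blast
    then show "\<exists>\<phi>\<in>test_fun \<Omega>. e.q (u - \<phi>) < \<epsilon>" unfolding real_sqrt_less_iff by blast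
  next
    fix \<epsilon> :: real assume *: "\<forall>\<epsilon>>0. \<exists>\<phi>\<in>test_fun \<Omega>. e.q (u - \<phi>) < \<epsilon>" and \<epsilon>: "\<epsilon> > 0"
    then obtain \<phi> where \<phi>: "\<phi> \<in> test_fun \<Omega>" "e.q (u - \<phi>) < \<epsilon>\<^sup>2" using zero_less_power by blast
    have "sqrt (e.q (u - \<phi>)) < sqrt (\<epsilon>\<^sup>2)" using \<phi>(2) unfolding real_sqrt_less_iff .
    then have "sqrt (e.q (u - \<phi>)) < \<epsilon>" using \<epsilon> by (simp only: real_sqrt_abs abs_of_pos)
    then show "\<exists>\<phi>\<in>test_fun \<Omega>. sqrt (e.q (u - \<phi>)) < \<epsilon>" using \<phi>(1) by blast
  qed
  moreover have "u \<in> H1_mag_0 a \<Omega> \<longleftrightarrow> (\<forall>\<epsilon>>0. \<exists>\<phi>\<in>test_fun \<Omega>. sqrt (e.q (u - \<phi>)) < \<epsilon>)"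
    unfolding H1_mag_0_def using True by (auto simp: eq simp del: plus_complex.simps)
  ultimately show ?thesis using True by (simp del: plus_complex.simps)
qed (simp add: H1_mag_0_def)

lemma H1_mag_0_subset: "H1_mag_0 a \<Omega> \<subseteq> H1_mag a \<Omega>"
  by (auto simp: H1_mag_0_def)

lemma test_fun_H1_mag_0: "test_fun \<Omega> \<subseteq> H1_mag_0 a \<Omega>"
proof
  fix \<phi> assume \<phi>: "\<phi> \<in> test_fun \<Omega>"
  have "e.q (\<phi> - \<phi>) = 0"
    using e.zero_left[OF e.subsp[THEN fscale.subspace_0]] by simp
  then show "\<phi> \<in> H1_mag_0 a \<Omega>"
    unfolding H1_mag_0_iff using \<phi> test_fun_H1_mag by (intro conjI allI impI bexI[of _ \<phi>]) (auto simp del: diff_self)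
qed

lemma H1_mag_0_approx:
  assumes u: "u \<in> H1_mag_0 a \<Omega>"
  shows "\<exists>\<phi>. (\<forall>n. \<phi> n \<in> test_fun \<Omega>) \<and> (\<lambda>n. e.q (\<phi> n - u)) \<longlonglongrightarrow> 0"
proof -
  have "\<forall>n. \<exists>\<phi>\<in>test_fun \<Omega>. e.q (u - \<phi>) < inverse (real (Suc n))"
    using u unfolding H1_mag_0_iff by simp
  then obtain \<phi> where \<phi>: "\<And>n. \<phi> n \<in> test_fun \<Omega>" "\<And>n. e.q (u - \<phi> n) < inverse (real (Suc n))" by metis
  have V: "u \<in> H1_mag a \<Omega>" "\<phi> n \<in> H1_mag a \<Omega>" for n using u \<phi> H1_mag_0_subset test_fun_H1_mag by auto
  have V': "u - \<phi> n \<in> H1_mag a \<Omega>" for n using V by (intro fscale.subspace_diff[OF subspace_H1_mag])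
  have sym: "e.q (\<phi> n - u) = e.q (u - \<phi> n)" for n
    using e.q_diff[OF V(2)[of n] V(1)] e.q_diff[OF V(1) V(2)[of n]] e.herm[OF V(1) V(2)[of n]] by simp
  have "(\<lambda>n. e.q (u - \<phi> n)) \<longlonglongrightarrow> 0"
    by (rule tendsto_sandwich[OF _ _ tendsto_const LIMSEQ_inverse_real_of_nat])
      (use \<phi>(2) e.nonneg[OF V'] in \<open>auto intro!: always_eventually less_imp_le\<close>)
  then show ?thesis using \<phi>(1) unfolding sym[symmetric] by blast
qed

lemma H1_mag_0_closed:
  assumes u: "\<And>n. u n \<in> H1_mag_0 a \<Omega>" and v: "v \<in> H1_mag a \<Omega>" and lim: "(\<lambda>n. e.q (u n - v)) \<longlonglongrightarrow> 0"
  shows "v \<in> H1_mag_0 a \<Omega>"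
  unfolding H1_mag_0_iff
proof (intro conjI allI impI v)
  fix \<epsilon> :: real assume "\<epsilon> > 0"
  then have "\<forall>\<^sub>F n in sequentially. e.q (u n - v) < \<epsilon> / 4" using lim by (intro order_tendstoD(2)) auto
  then obtain n where n: "e.q (u n - v) < \<epsilon> / 4" using eventually_happens'[OF sequentially_bot] by blast
  obtain \<phi> where \<phi>: "\<phi> \<in> test_fun \<Omega>" "e.q (u n - \<phi>) < \<epsilon> / 4"
    using u[of n] \<open>\<epsilon> > 0\<close> unfolding H1_mag_0_iff by (meson divide_pos_pos zero_less_numeral)
  have V: "u n \<in> H1_mag a \<Omega>" "\<phi> \<in> H1_mag a \<Omega>" using u \<phi> H1_mag_0_subset test_fun_H1_mag by auto
  have V': "u n - \<phi> \<in> H1_mag a \<Omega>" "u n - v \<in> H1_mag a \<Omega>"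
    using V v by (auto intro: fscale.subspace_diff[OF subspace_H1_mag])
  have "v - \<phi> = (u n - \<phi>) - (u n - v)" by simp
  then have "e.q (v - \<phi>) \<le> 2 * e.q (u n - \<phi>) + 2 * e.q (u n - v)" using e.q_diff_le[OF V'] by simp
  then show "\<exists>\<phi>\<in>test_fun \<Omega>. e.q (v - \<phi>) < \<epsilon>" using n \<phi> by (intro bexI[of _ \<phi>]) linarith+
qed

lemma subspace_H1_mag_0: "fscale.subspace (H1_mag_0 a \<Omega>)"
  unfolding fscale.subspace_def
proof (intro conjI ballI allI)
  show "0 \<in> H1_mag_0 a \<Omega>" using test_fun_H1_mag_0 fscale.subspace_0[OF subspace_test_fun] by blast
next
  fix u v assume uv: "u \<in> H1_mag_0 a \<Omega>" "v \<in> H1_mag_0 a \<Omega>"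
  obtain \<phi> where \<phi>: "\<forall>n. \<phi> n \<in> test_fun \<Omega>" "(\<lambda>n. e.q (\<phi> n - u)) \<longlonglongrightarrow> 0" using H1_mag_0_approx[OF uv(1)] by blast
  obtain \<psi> where \<psi>: "\<forall>n. \<psi> n \<in> test_fun \<Omega>" "(\<lambda>n. e.q (\<psi> n - v)) \<longlonglongrightarrow> 0" using H1_mag_0_approx[OF uv(2)] by blast
  have V: "u \<in> H1_mag a \<Omega>" "v \<in> H1_mag a \<Omega>" "\<phi> n \<in> H1_mag a \<Omega>" "\<psi> n \<in> H1_mag a \<Omega>" for n
    using uv \<phi> \<psi> H1_mag_0_subset test_fun_H1_mag by auto
  have V': "\<phi> n - u \<in> H1_mag a \<Omega>" "\<psi> n - v \<in> H1_mag a \<Omega>" for n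
    using V by (auto intro: fscale.subspace_diff[OF subspace_H1_mag])
  show "u + v \<in> H1_mag_0 a \<Omega>"
  proof (rule H1_mag_0_closed[of "\<lambda>n. \<phi> n + \<psi> n"])
    show "\<phi> n + \<psi> n \<in> H1_mag_0 a \<Omega>" for n
      using \<phi> \<psi> fscale.subspace_add[OF subspace_test_fun] test_fun_H1_mag_0 by blast
    show uvV: "u + v \<in> H1_mag a \<Omega>" using V by (auto intro: fscale.subspace_add[OF subspace_H1_mag])
    have le: "e.q (\<phi> n + \<psi> n - (u + v)) \<le> 2 * e.q (\<phi> n - u) + 2 * e.q (\<psi> n - v)" for n
    proof -
      have "\<phi> n + \<psi> n - (u + v) = (\<phi> n - u) + (\<psi> n - v)" by simp
      then show ?thesis using e.q_add_le[OF V'] by metis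
    qed
    have pos: "0 \<le> e.q (\<phi> n + \<psi> n - (u + v))" for n
      using V uvV by (intro e.nonneg fscale.subspace_diff[OF subspace_H1_mag] fscale.subspace_add[OF subspace_H1_mag])
    have lim: "(\<lambda>n. 2 * e.q (\<phi> n - u) + 2 * e.q (\<psi> n - v)) \<longlonglongrightarrow> 0"
      using tendsto_add[OF tendsto_mult_left[OF \<phi>(2), of 2] tendsto_mult_left[OF \<psi>(2), of 2]] by simp
    show "(\<lambda>n. e.q (\<phi> n + \<psi> n - (u + v))) \<longlonglongrightarrow> 0"
      by (rule tendsto_sandwich[OF always_eventually always_eventually tendsto_const lim]) (intro allI pos, intro allI le)
  qed
next
  fix u c assume u: "u \<in> H1_mag_0 a \<Omega>"
  obtain \<phi> where \<phi>: "\<forall>n. \<phi> n \<in> test_fun \<Omega>" "(\<lambda>n. e.q (\<phi> n - u)) \<longlonglongrightarrow> 0" using H1_mag_0_approx[OF u] by blast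
  have V: "u \<in> H1_mag a \<Omega>" "\<phi> n \<in> H1_mag a \<Omega>" for n
    using u \<phi> H1_mag_0_subset test_fun_H1_mag by auto
  have V': "\<phi> n - u \<in> H1_mag a \<Omega>" for n
    using V by (auto intro: fscale.subspace_diff[OF subspace_H1_mag])
  show "fscale c u \<in> H1_mag_0 a \<Omega>"
  proof (rule H1_mag_0_closed[of "\<lambda>n. fscale c (\<phi> n)"])
    show "fscale c (\<phi> n) \<in> H1_mag_0 a \<Omega>" for n
      using \<phi> fscale.subspace_scale[OF subspace_test_fun] test_fun_H1_mag_0 by blast
    show "fscale c u \<in> H1_mag a \<Omega>" using V by (auto intro: fscale.subspace_scale[OF subspace_H1_mag])
    have "fscale c (\<phi> n) - fscale c u = fscale c (\<phi> n - u)" for n by (simp add: fscale.scale_right_diff_distrib)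
    then have "e.q (fscale c (\<phi> n) - fscale c u) = (cmod c)\<^sup>2 * e.q (\<phi> n - u)" for n
      using e.q_scale[OF V'] by metis
    then show "(\<lambda>n. e.q (fscale c (\<phi> n) - fscale c u)) \<longlonglongrightarrow> 0"
      using tendsto_mult_left[OF \<phi>(2), of "(cmod c)\<^sup>2"] by simp
  qed
qed

text \<open>Cut a box inside \<Omega> into \<open>n\<close> slabs and put one bump on each. The open
  slabs are disjoint, so a combination with a nonzero coefficient is nonzero on a whole
  slab.\<close>

lemma test_fun_infinite_dim:
  fixes n :: nat
  shows "\<exists>u. (\<forall>i<n. u i \<in> test_fun \<Omega>) \<and>
    (\<forall>c. Re (L2_inner \<Omega> (\<Sum>i<n. fscale (c i) (u i)) (\<Sum>i<n. fscale (c i) (u i))) = 0 \<longrightarrow> (\<forall>i<n. c i = 0))"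
proof (cases "n = 0")
  case False
  obtain x where x: "x \<in> \<Omega>" using nonempty by blast
  obtain l r where lr: "x \<in> box l r" "cbox l r \<subseteq> \<Omega>"
    by (rule open_contains_cbox[OF open_\<Omega> x]) (rule that)
  obtain i0 :: 'n where "i0 \<in> UNIV" by blast
  \<comment> \<open>Width of a slab; the cuts are orthogonal to one arbitrarily chosen direction
    \<open>i0\<close>.\<close>
  define w where "w = (r $ i0 - l $ i0) / real n"
  have "l $ i0 < x $ i0" "x $ i0 < r $ i0" using lr(1) by (auto simp: mem_box_cart)
  then have w: "w > 0" using False by (simp add: w_def)
  have wn: "w * real n = r $ i0 - l $ i0" using False by (simp add: w_def)
  define lo where "lo k = (\<chi> i. if i = i0 then l $ i0 + w * real k else l $ i)" for k
  define hi where "hi k = (\<chi> i. if i = i0 then l $ i0 + w * real (Suc k) else r $ i)" for k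
  have sub: "cbox (lo k) (hi k) \<subseteq> \<Omega>" if k: "k < n" for k
  proof -
    have "w * real (Suc k) \<le> w * real n" using w k by (intro mult_left_mono) auto
    then have 1: "l $ i0 + w * real (Suc k) \<le> r $ i0" using wn by linarith
    have 2: "0 \<le> w * real k" using w by simp
    have "z \<in> cbox l r" if z: "z \<in> cbox (lo k) (hi k)" for z
      unfolding mem_box_cart
    proof
      fix i
      show "l $ i \<le> z $ i \<and> z $ i \<le> r $ i"
        using z[unfolded mem_box_cart, rule_format, of i] 1 2 by (cases "i = i0") (auto simp: lo_def hi_def)
    qed
    then show ?thesis using lr by blast
  qed
  have ne: "box (lo k) (hi k) \<noteq> {}" for k
  proof -
    have "(\<chi> i. if i = i0 then l $ i0 + w * real k + w / 2 else x $ i) \<in> box (lo k) (hi k)"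
      using w lr(1) by (auto simp: mem_box_cart lo_def hi_def algebra_simps)
    then show ?thesis by blast
  qed
  have disj: "z \<notin> box (lo m) (hi m)" if "z \<in> box (lo k) (hi k)" "m \<noteq> k" for z k m
  proof
    assume "z \<in> box (lo m) (hi m)"
    then have "l $ i0 + w * real m < z $ i0" "z $ i0 < l $ i0 + w * real (Suc m)"
      "l $ i0 + w * real k < z $ i0" "z $ i0 < l $ i0 + w * real (Suc k)"
      using that(1) by (auto simp: mem_box_cart lo_def hi_def dest!: spec[of _ i0])
    then have "w * real m < w * real (Suc k)" "w * real k < w * real (Suc m)" by linarith+
    then have "real m < real (Suc k)" "real k < real (Suc m)" using w mult_less_cancel_left_pos by blast+
    then show False using that(2) by linarith
  qed
  define u where "u k = bump 1 (lo k) (hi k)" for k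
  have u: "u k \<in> test_fun \<Omega>" if "k < n" for k unfolding u_def using sub[OF that] by (intro bump_test_fun) auto
  have "c k = 0" if q: "Re (L2_inner \<Omega> (\<Sum>i<n. fscale (c i) (u i)) (\<Sum>i<n. fscale (c i) (u i))) = 0" and k: "k < n" for c k
  proof (rule ccontr)
    assume ck: "c k \<noteq> 0"
    let ?f = "\<Sum>i<n. fscale (c i) (u i)"
    have f: "?f \<in> test_fun \<Omega>"
      using u by (intro fscale.subspace_sum[OF subspace_test_fun] fscale.subspace_scale[OF subspace_test_fun]) auto
    have fL: "?f \<in> L2 \<Omega>" by (rule mag_test_L2(3)[OF f])
    have "(LINT z|lebesgue_on \<Omega>. (cmod (?f z))\<^sup>2) = 0" using q Re_L2_inner_self[OF fL] by simp
    then have "AE z in lebesgue_on \<Omega>. (cmod (?f z))\<^sup>2 = 0"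
      using integral_nonneg_eq_0_iff_AE[OF L2_integrable_sq[OF fL]] by simp
    then have ae: "AE z in lebesgue. z \<in> \<Omega> \<longrightarrow> (cmod (?f z))\<^sup>2 = 0"
      using open_\<Omega> by (subst (asm) AE_restrict_space_iff) auto
    have nz: "?f z \<noteq> 0" if z: "z \<in> box (lo k) (hi k)" for z
    proof -
      have "?f z = (\<Sum>i<n. c i * u i z)" by (simp add: sum_fun_apply fscale_def)
      also have "\<dots> = (\<Sum>i<n. if i = k then c i * u i z else 0)"
        using disj[OF z] by (intro sum.cong) (auto simp: u_def bump_nonzero_iff)
      also have "\<dots> = c k * u k z" using k by simp
      also have "\<dots> \<noteq> 0" using ck z by (simp add: u_def bump_nonzero_iff)
      finally show ?thesis .
    qed
    have "AE z in lebesgue. z \<notin> box (lo k) (hi k)"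
      using ae
    proof eventually_elim
      case (elim z)
      then show ?case using nz[of z] sub[OF k] box_subset_cbox by auto
    qed
    then have "negligible (box (lo k) (hi k))"
      by (simp add: negligible_iff_null_sets AE_iff_null_sets)
    then show False using ne open_not_negligible[OF open_box] by blast
  qed
  then show ?thesis using u by (intro exI[of _ u]) blast
qed simp

text \<open>One argument for both boundary conditions: compactness is inherited by any subspace,
  completeness by an energy-closed one, and the test functions supply infinite dimension.\<close>

lemma compact_form_sub:
  assumes ce: "compact_embedding a \<Omega>" and W: "W \<subseteq> H1_mag a \<Omega>" "fscale.subspace W"
    and closed: "\<And>u v. (\<And>n. u n \<in> W) \<Longrightarrow> v \<in> H1_mag a \<Omega> \<Longrightarrow> (\<lambda>n. e.q (u n - v)) \<longlonglongrightarrow> 0 \<Longrightarrow> v \<in> W"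
    and test: "test_fun \<Omega> \<subseteq> W"
  shows "compact_form fscale W (L2_inner \<Omega>) (mag_form a \<Omega>)"
proof -
  interpret l: psd_form fscale "L2 \<Omega>" "L2_inner \<Omega>" by (rule psd_form_L2)
  interpret W1: psd_form fscale W "L2_inner \<Omega>" by (rule psd_form_subset[OF psd_form_ip W])
  interpret W2: psd_form fscale W "mag_form a \<Omega>" by (rule psd_form_subset[OF psd_form_h W])
  show ?thesis
  proof
    fix u :: "nat \<Rightarrow> real^'n \<Rightarrow> complex" and C
    assume u: "\<And>n. u n \<in> W" and C: "\<And>n. Re (mag_form a \<Omega> (u n) (u n)) + Re (L2_inner \<Omega> (u n) (u n)) \<le> C"
    have uH: "u n \<in> H1_mag a \<Omega>" for n using u W by auto
    have "H1_mag_norm a \<Omega> (u n) \<le> sqrt C" for n using C[of n] H1_mag_norm_eq[OF uH] by simp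
    then obtain f r where f: "f \<in> L2 \<Omega>" "strict_mono r" "(\<lambda>n. L2_norm \<Omega> (\<lambda>z. u (r n) z - f z)) \<longlonglongrightarrow> 0"
      using ce uH unfolding compact_embedding_def by blast
    have uL: "u n \<in> L2 \<Omega>" for n using uH H1_mag_L2 by auto
    have "(\<lambda>n. (L2_norm \<Omega> (\<lambda>z. u (r n) z - f z))\<^sup>2) \<longlonglongrightarrow> 0" using tendsto_power[OF f(3), of 2] by simp
    moreover have "(L2_norm \<Omega> (\<lambda>z. u (r n) z - f z))\<^sup>2 = l.q (u (r n) - f)" for n
      using Re_L2_inner_self[OF L2_diff[OF uL f(1)]] by (simp add: L2_norm_sq fun_diff_def)
    ultimately have lim: "(\<lambda>n. l.q (u (r n) - f)) \<longlonglongrightarrow> 0" by simp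
    have "\<exists>N. \<forall>m\<ge>N. \<forall>n\<ge>N. l.q (u (r m) - u (r n)) < \<epsilon>" if \<epsilon>: "\<epsilon> > 0" for \<epsilon>
    proof -
      have "\<forall>\<^sub>F n in sequentially. l.q (u (r n) - f) < \<epsilon> / 4" using lim \<epsilon> by (intro order_tendstoD(2)) auto
      then obtain N where N: "\<forall>n\<ge>N. l.q (u (r n) - f) < \<epsilon> / 4" unfolding eventually_sequentially by blast
      have "l.q (u (r m) - u (r n)) < \<epsilon>" if "m \<ge> N" "n \<ge> N" for m n
      proof -
        have V: "u (r m) - f \<in> L2 \<Omega>" "u (r n) - f \<in> L2 \<Omega>"
          using uL f(1) by (auto intro: fscale.subspace_diff[OF l.subsp])
        have "u (r m) - u (r n) = (u (r m) - f) - (u (r n) - f)" by simp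
        then have "l.q (u (r m) - u (r n)) \<le> 2 * l.q (u (r m) - f) + 2 * l.q (u (r n) - f)"
          using l.q_diff_le[OF V] by metis
        then show ?thesis using N[rule_format, OF that(1)] N[rule_format, OF that(2)] by linarith
      qed
      then show ?thesis by blast
    qed
    then show "\<exists>r::nat \<Rightarrow> nat. strict_mono r \<and> (\<forall>\<epsilon>>0. \<exists>N. \<forall>m\<ge>N. \<forall>n\<ge>N. l.q (u (r m) - u (r n)) < \<epsilon>)"
      using f(2) by (intro exI[of _ r]) blast
  next
    fix u :: "nat \<Rightarrow> real^'n \<Rightarrow> complex"
    assume u: "\<And>n. u n \<in> W" and C: "\<And>\<epsilon>. \<epsilon> > 0 \<Longrightarrow> \<exists>N. \<forall>m\<ge>N. \<forall>n\<ge>N.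
      Re (mag_form a \<Omega> (u m - u n) (u m - u n)) + Re (L2_inner \<Omega> (u m - u n) (u m - u n)) < \<epsilon>"
    have uH: "u n \<in> H1_mag a \<Omega>" for n using u W by auto
    have "\<exists>v\<in>H1_mag a \<Omega>. (\<lambda>n. e.q (u n - v)) \<longlonglongrightarrow> 0"
    proof (rule H1_mag_complete[OF uH])
      fix \<epsilon> :: real assume "\<epsilon> > 0"
      from C[OF this] show "\<exists>N. \<forall>m\<ge>N. \<forall>n\<ge>N. e.q (u m - u n) < \<epsilon>" by simp
    qed
    then obtain v where v: "v \<in> H1_mag a \<Omega>" "(\<lambda>n. e.q (u n - v)) \<longlonglongrightarrow> 0" by blast
    then have "v \<in> W" using closed u by blast
    then show "\<exists>v\<in>W. (\<lambda>n. Re (mag_form a \<Omega> (u n - v) (u n - v)) + Re (L2_inner \<Omega> (u n - v) (u n - v))) \<longlonglongrightarrow> 0"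
      using v(2) by (intro bexI[of _ v]) simp_all
  next
    fix n :: nat
    show "\<exists>u. (\<forall>i<n. u i \<in> W) \<and>
      (\<forall>c. Re (L2_inner \<Omega> (\<Sum>i<n. fscale (c i) (u i)) (\<Sum>i<n. fscale (c i) (u i))) = 0 \<longrightarrow> (\<forall>i<n. c i = 0))"
      using test_fun_infinite_dim[of n] test by (meson subsetD)
  qed
qed

lemma compact_form_N: "compact_embedding a \<Omega> \<Longrightarrow> compact_form fscale (H1_mag a \<Omega>) (L2_inner \<Omega>) (mag_form a \<Omega>)"
  by (rule compact_form_sub[OF _ order_refl subspace_H1_mag _ test_fun_H1_mag])

lemma compact_form_D: "compact_embedding a \<Omega> \<Longrightarrow> compact_form fscale (H1_mag_0 a \<Omega>) (L2_inner \<Omega>) (mag_form a \<Omega>)"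
  by (rule compact_form_sub[OF _ H1_mag_0_subset subspace_H1_mag_0 H1_mag_0_closed test_fun_H1_mag_0])

text \<open>Both forms are continuous in the energy norm, so identities tested on \<open>C\<^sub>0\<^sup>\<infinity>\<close> extend to
  the Dirichlet form domain.\<close>

lemma H1_mag_0_limits:
  assumes v: "v \<in> H1_mag_0 a \<Omega>"
  shows "\<exists>\<phi>. (\<forall>n. \<phi> n \<in> test_fun \<Omega>) \<and>
    (\<forall>w\<in>H1_mag a \<Omega>. (\<lambda>n. mag_form a \<Omega> (\<phi> n) w) \<longlonglongrightarrow> mag_form a \<Omega> v w) \<and>
    (\<forall>w\<in>H1_mag a \<Omega>. (\<lambda>n. L2_inner \<Omega> (\<phi> n) w) \<longlonglongrightarrow> L2_inner \<Omega> v w) \<and>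
    (\<lambda>n. h.q (\<phi> n)) \<longlonglongrightarrow> h.q v \<and> (\<lambda>n. ip.q (\<phi> n)) \<longlonglongrightarrow> ip.q v"
proof -
  obtain \<phi> where \<phi>: "\<forall>n. \<phi> n \<in> test_fun \<Omega>" "(\<lambda>n. e.q (\<phi> n - v)) \<longlonglongrightarrow> 0" using H1_mag_0_approx[OF v] by blast
  have V: "v \<in> H1_mag a \<Omega>" "\<phi> n \<in> H1_mag a \<Omega>" for n
    using v \<phi> H1_mag_0_subset test_fun_H1_mag by auto
  have V': "\<phi> n - v \<in> H1_mag a \<Omega>" for n
    using V by (auto intro: fscale.subspace_diff[OF subspace_H1_mag])
  have e1: "h.q (\<phi> n - v) \<le> e.q (\<phi> n - v)" "ip.q (\<phi> n - v) \<le> e.q (\<phi> n - v)" for n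
    using h.nonneg[OF V', of n] ip.nonneg[OF V', of n] by simp_all
  have l1: "(\<lambda>n. h.q (\<phi> n - v)) \<longlonglongrightarrow> 0"
    by (rule tendsto_sandwich[OF always_eventually always_eventually tendsto_const \<phi>(2)]) (intro allI h.nonneg V', intro allI e1)
  have l2: "(\<lambda>n. ip.q (\<phi> n - v)) \<longlonglongrightarrow> 0"
    by (rule tendsto_sandwich[OF always_eventually always_eventually tendsto_const \<phi>(2)]) (intro allI ip.nonneg V', intro allI e1)
  show ?thesis
    using \<phi>(1) h.q_limit[OF V(2) V(1) l1] ip.q_limit[OF V(2) V(1) l2] h.q_limit_q[OF V(2) V(1) l1] ip.q_limit_q[OF V(2) V(1) l2]
    by (intro exI[of _ \<phi>] conjI ballI) blast+
qed

end

section \<open>From the abstract eigenvalue sequence to multiplicities and counts of the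
  operators\<close>

lemma sum_enat: "finite F \<Longrightarrow> (\<Sum>x\<in>F. enat (f x)) = enat (\<Sum>x\<in>F. f x)"
  by (induction F rule: finite_induct) (auto simp: zero_enat_def)

locale compact_form_fun = compact_form fscale W "L2_inner \<Omega>" h
  for W :: "('a::euclidean_space \<Rightarrow> complex) set" and \<Omega> h +
  assumes WL2: "W \<subseteq> L2 \<Omega>"
begin

lemma eigenspace_form_op: "u \<in> eigenspace (form_op \<Omega> W h) \<mu> \<longleftrightarrow> eigen \<mu> u"
proof -
  interpret l: psd_form fscale "L2 \<Omega>" "L2_inner \<Omega>" by (rule psd_form_L2)
  have "L2_inner \<Omega> (\<lambda>z. of_real \<mu> * u z) v = of_real \<mu> * L2_inner \<Omega> u v" if "u \<in> W" "v \<in> W" for v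
    using l.scale_left[of u v "of_real \<mu>"] that WL2 by (auto simp: fscale_def)
  then show ?thesis
    using WL2 by (auto simp: eigenspace_def form_op_def eigen_def intro: L2_cmult)
qed

text \<open>A combination vanishes almost everywhere exactly when its \<open>L2\<close> norm is
  zero, which is the notion of independence used by the abstract theory.\<close>

lemma ae_independent_iff:
  assumes "\<And>i. i < n \<Longrightarrow> u i \<in> W"
  shows "ae_independent \<Omega> n u \<longleftrightarrow>
    (\<forall>c. Re (L2_inner \<Omega> (\<Sum>i<n. fscale (c i) (u i)) (\<Sum>i<n. fscale (c i) (u i))) = 0 \<longrightarrow> (\<forall>i<n. c i = 0))"
proof -
  have "(AE z in lebesgue_on \<Omega>. (\<Sum>i<n. c i * u i z) = 0) \<longleftrightarrow>
    Re (L2_inner \<Omega> (\<Sum>i<n. fscale (c i) (u i)) (\<Sum>i<n. fscale (c i) (u i))) = 0" for c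
  proof -
    let ?f = "\<Sum>i<n. fscale (c i) (u i)"
    have f: "?f \<in> L2 \<Omega>" using ip.sum_in[of "{..<n}" u c] assms WL2 by auto
    have fz: "?f z = (\<Sum>i<n. c i * u i z)" for z by (simp add: sum_fun_apply fscale_def)
    have "Re (L2_inner \<Omega> ?f ?f) = 0 \<longleftrightarrow> (AE z in lebesgue_on \<Omega>. (cmod (?f z))\<^sup>2 = 0)"
      unfolding Re_L2_inner_self[OF f] using integral_nonneg_eq_0_iff_AE[OF L2_integrable_sq[OF f]] by simp
    then show ?thesis by (simp add: fz)
  qed
  then show ?thesis by (simp add: ae_independent_def)
qed

lemma multiplicity_of_form_op: "multiplicity_of \<Omega> (form_op \<Omega> W h) \<mu> = enat (card {n. eval n = \<mu>})"
proof -
  let ?S = "{enat n | n. \<exists>u. (\<forall>i<n. u i \<in> eigenspace (form_op \<Omega> W h) \<mu>) \<and> ae_independent \<Omega> n u}"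
  have W: "u i \<in> W" if "eigen \<mu> (u i)" for u :: "nat \<Rightarrow> _" and i using that by (simp add: eigen_def)
  have "x \<le> enat (card {n. eval n = \<mu>})" if x: "x \<in> ?S" for x
  proof -
    obtain n u where n: "x = enat n" "\<forall>i<n. eigen \<mu> (u i)" "ae_independent \<Omega> n u"
      using x unfolding eigenspace_form_op by blast
    have "n \<le> card {n. eval n = \<mu>}"
    proof (rule eigen_independent_le)
      show "eigen \<mu> (u i)" if "i < n" for i using n(2) that by blast
      show "\<forall>i<n. c i = 0" if "ip.q (\<Sum>i<n. fscale (c i) (u i)) = 0" for c
        using n(3) ae_independent_iff[of n u] n(2) W that by blast
    qed
    then show ?thesis using n(1) by simp
  qed
  moreover have "enat (card {n. eval n = \<mu>}) \<in> ?S"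
  proof -
    obtain u where u: "\<forall>i<card {n. eval n = \<mu>}. eigen \<mu> (u i)"
      "\<forall>c. ip.q (\<Sum>i<card {n. eval n = \<mu>}. fscale (c i) (u i)) = 0 \<longrightarrow> (\<forall>i<card {n. eval n = \<mu>}. c i = 0)"
      using eigen_independent_ex by blast
    then have "ae_independent \<Omega> (card {n. eval n = \<mu>}) u"
      using ae_independent_iff[of "card {n. eval n = \<mu>}" u] W by blast
    then show ?thesis using u(1) unfolding eigenspace_form_op by blast
  qed
  ultimately show ?thesis unfolding multiplicity_of_def by (intro Sup_eqI) auto
qed

text \<open>\<open>eval\<close> is monotone with the correct fibre sizes, and such enumerations are
  unique, so the description denotes it. The index shift is inherited from
  \<open>nth_eigenvalue\<close>.\<close>

lemma nth_eigenvalue_form_op: "nth_eigenvalue \<Omega> (form_op \<Omega> W h) j = eval (j - 1)"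
proof -
  have "(THE l. eigenvalue_enumeration \<Omega> (form_op \<Omega> W h) l) = eval"
  proof (rule the_equality)
    show "eigenvalue_enumeration \<Omega> (form_op \<Omega> W h) eval"
      by (simp add: eigenvalue_enumeration_def mono_eval finite_eval_eq multiplicity_of_form_op)
    fix l assume "eigenvalue_enumeration \<Omega> (form_op \<Omega> W h) l"
    then show "l = eval"
      by (intro mono_enumeration_unique mono_eval finite_eval_eq)
        (auto simp: eigenvalue_enumeration_def multiplicity_of_form_op)
  qed
  then show ?thesis by (simp add: nth_eigenvalue_def)
qed

lemma eigenvalue_count_form_op:
  assumes fin: "finite {n. eval n \<in> S}"
  shows "eigenvalue_count \<Omega> (form_op \<Omega> W h) S = enat (card {n. eval n \<in> S})"
proof -
  have eq: "(\<Sum>\<mu>\<in>F. multiplicity_of \<Omega> (form_op \<Omega> W h) \<mu>) = enat (card {n. eval n \<in> F})" if "finite F" for F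
  proof -
    have "{n. eval n \<in> F} = (\<Union>\<mu>\<in>F. {n. eval n = \<mu>})" by auto
    then have "card {n. eval n \<in> F} = (\<Sum>\<mu>\<in>F. card {n. eval n = \<mu>})"
      using that finite_eval_eq by (simp add: card_UN_disjoint disjoint_iff)
    then show ?thesis by (simp add: multiplicity_of_form_op sum_enat[OF that])
  qed
  show ?thesis unfolding eigenvalue_count_def
  proof (rule antisym)
    show "(SUP F\<in>{F. finite F \<and> F \<subseteq> S}. \<Sum>\<mu>\<in>F. multiplicity_of \<Omega> (form_op \<Omega> W h) \<mu>) \<le> enat (card {n. eval n \<in> S})"
    proof (rule SUP_least)
      fix F assume "F \<in> {F. finite F \<and> F \<subseteq> S}"
      then show "(\<Sum>\<mu>\<in>F. multiplicity_of \<Omega> (form_op \<Omega> W h) \<mu>) \<le> enat (card {n. eval n \<in> S})"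
        using fin by (auto simp: eq intro!: card_mono)
    qed
    \<comment> \<open>Only finitely many indices have their value in \<open>S\<close>, so the
      supremum over finite subsets is attained at the set of all eigenvalues in
      \<open>S\<close>.\<close>
    let ?F = "eval ` {n. eval n \<in> S}"
    have F: "finite ?F" "?F \<subseteq> S" using fin by auto
    have "{n. eval n \<in> S} = {n. eval n \<in> ?F}" by auto
    then have "enat (card {n. eval n \<in> S}) = (\<Sum>\<mu>\<in>?F. multiplicity_of \<Omega> (form_op \<Omega> W h) \<mu>)"
      using eq[OF F(1)] by simp
    also have "\<dots> \<le> (SUP F\<in>{F. finite F \<and> F \<subseteq> S}. \<Sum>\<mu>\<in>F. multiplicity_of \<Omega> (form_op \<Omega> W h) \<mu>)"
      using F by (intro SUP_upper) auto
    finally show "enat (card {n. eval n \<in> S}) \<le> (SUP F\<in>{F. finite F \<and> F \<subseteq> S}. \<Sum>\<mu>\<in>F. multiplicity_of \<Omega> (form_op \<Omega> W h) \<mu>)" .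
  qed
qed

end

section \<open>Landau functions\<close>

text \<open>Second order Taylor expansions at t and - t: the first order terms cancel. The bound
  provides the majorant and the limit the pointwise convergence needed to take second differences
  under an integral.\<close>

lemma second_difference:
  fixes f f' f'' :: "real \<Rightarrow> real"
  assumes f: "\<And>t. (f has_real_derivative f' t) (at t)" "\<And>t. (f' has_real_derivative f'' t) (at t)"
    and M: "\<And>t. \<bar>f'' t\<bar> \<le> M"
  shows second_difference_bound: "\<bar>f t + f (- t) - 2 * f 0\<bar> \<le> M * t\<^sup>2"
    and second_difference_limit: "isCont f'' 0 \<Longrightarrow>
      (\<lambda>k. (f (inverse (real (Suc k))) + f (- inverse (real (Suc k))) - 2 * f 0) / (inverse (real (Suc k)))\<^sup>2) \<longlonglongrightarrow> f'' 0"
proof -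
  define D where "D m = (if m = 0 then f else if m = 1 then f' else f'')" for m :: nat
  have taylor: "\<exists>s. \<bar>s\<bar> \<le> \<bar>x\<bar> \<and> f x = f 0 + f' 0 * x + f'' s / 2 * x\<^sup>2" for x
  proof -
    have "\<exists>s. \<bar>s\<bar> \<le> \<bar>x\<bar> \<and> f x = (\<Sum>m<2. D m 0 / fact m * x ^ m) + D 2 s / fact 2 * x ^ 2"
    proof (rule Maclaurin_bi_le)
      show "\<forall>m t. m < 2 \<and> \<bar>t\<bar> \<le> \<bar>x\<bar> \<longrightarrow> DERIV (D m) t :> D (Suc m) t"
        using f by (auto simp: D_def less_2_cases_iff)
    qed (simp add: D_def)
    then show ?thesis by (simp add: D_def numeral_2_eq_2)
  qed
  have both: "\<exists>s r. \<bar>s\<bar> \<le> \<bar>x\<bar> \<and> \<bar>r\<bar> \<le> \<bar>x\<bar> \<and> f x + f (- x) - 2 * f 0 = (f'' s + f'' r) / 2 * x\<^sup>2" for x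
  proof -
    obtain s where s: "\<bar>s\<bar> \<le> \<bar>x\<bar>" "f x = f 0 + f' 0 * x + f'' s / 2 * x\<^sup>2" using taylor[of x] by blast
    obtain r where r: "\<bar>r\<bar> \<le> \<bar>-x\<bar>" "f (-x) = f 0 + f' 0 * (-x) + f'' r / 2 * (-x)\<^sup>2" using taylor[of "-x"] by blast
    have "f x + f (- x) - 2 * f 0 = (f'' s + f'' r) / 2 * x\<^sup>2"
      unfolding s(2) r(2) by (simp add: field_simps)
    then show ?thesis using s(1) r(1) by (intro exI[of _ s] exI[of _ r]) simp
  qed
  show "\<bar>f t + f (- t) - 2 * f 0\<bar> \<le> M * t\<^sup>2"
  proof -
    obtain s r where sr: "f t + f (- t) - 2 * f 0 = (f'' s + f'' r) / 2 * t\<^sup>2" using both[of t] by blast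
    have "\<bar>(f'' s + f'' r) / 2\<bar> \<le> M" using M[of s] M[of r] by (simp add: abs_le_iff)
    then show ?thesis unfolding sr by (simp only: abs_mult abs_power2 mult_right_mono zero_le_power2)
  qed
  show "(\<lambda>k. (f (inverse (real (Suc k))) + f (- inverse (real (Suc k))) - 2 * f 0) / (inverse (real (Suc k)))\<^sup>2) \<longlonglongrightarrow> f'' 0"
    if cont: "isCont f'' 0"
  proof -
    let ?x = "\<lambda>k. inverse (real (Suc k))"
    have "\<forall>k. \<exists>s r. \<bar>s\<bar> \<le> \<bar>?x k\<bar> \<and> \<bar>r\<bar> \<le> \<bar>?x k\<bar> \<and> f (?x k) + f (- ?x k) - 2 * f 0 = (f'' s + f'' r) / 2 * (?x k)\<^sup>2"
      by (intro allI both)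
    then obtain s r where sr: "\<And>k. \<bar>s k\<bar> \<le> \<bar>?x k\<bar>" "\<And>k. \<bar>r k\<bar> \<le> \<bar>?x k\<bar>"
      "\<And>k. f (?x k) + f (- ?x k) - 2 * f 0 = (f'' (s k) + f'' (r k)) / 2 * (?x k)\<^sup>2" by metis
    have x0: "(\<lambda>k. \<bar>?x k\<bar>) \<longlonglongrightarrow> 0" using tendsto_rabs[OF LIMSEQ_inverse_real_of_nat] by simp
    have s0: "s \<longlonglongrightarrow> 0" "r \<longlonglongrightarrow> 0"
      using sr(1,2) by (auto intro!: Lim_null_comparison[OF _ x0] always_eventually)
    have "(\<lambda>k. (f'' (s k) + f'' (r k)) / 2) \<longlonglongrightarrow> (f'' 0 + f'' 0) / 2"
      by (intro tendsto_divide tendsto_add isCont_tendsto_compose[OF cont] s0 tendsto_const) simp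
    then show ?thesis unfolding sr(3) by simp
  qed
qed

lemma power_exp_bounded:
  fixes b :: real
  assumes "b > 0"
  obtains C where "C > 0" "\<And>s. s \<ge> 0 \<Longrightarrow> s ^ n * exp (- b * s) \<le> C"
proof (rule that)
  show "fact n / b ^ n > 0" using assms by simp
  fix s :: real assume s: "s \<ge> 0"
  have "(b * s) ^ n / fact n = (\<Sum>k\<in>{n}. (b * s) ^ k /\<^sub>R fact k)" by (simp add: divide_inverse mult.commute)
  also have "\<dots> \<le> (\<Sum>k. (b * s) ^ k /\<^sub>R fact k)"
    using assms s by (intro sum_le_suminf sums_summable[OF exp_converges]) auto
  finally have "(b * s) ^ n / fact n \<le> exp (b * s)" by (simp add: exp_def)
  then have "(b * s) ^ n \<le> exp (b * s) * fact n" by (subst (asm) pos_divide_le_eq) auto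
  then have "b ^ n * s ^ n * exp (- (b * s)) \<le> exp (b * s) * fact n * exp (- (b * s))"
    by (intro mult_right_mono) (simp_all add: power_mult_distrib)
  also have "\<dots> = fact n" by (simp add: exp_minus)
  finally show "s ^ n * exp (- b * s) \<le> fact n / b ^ n"
    using assms by (simp add: field_simps)
qed

text \<open>Radial profile of the squared modulus of a Landau function, in terms of the squared
  distance s to its centre. \<open>rho1\<close> and \<open>rho2\<close> are its first two
  derivatives in s; for n = 0 the truncated index \<open>n - 1\<close> is harmless because of the
  factor n.\<close>

definition rho :: "real \<Rightarrow> nat \<Rightarrow> real \<Rightarrow> real" where
  "rho b n s = s ^ n * exp (- b * s)"

definition rho1 :: "real \<Rightarrow> nat \<Rightarrow> real \<Rightarrow> real" where
  "rho1 b n s = real n * rho b (n - 1) s - b * rho b n s"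

definition rho2 :: "real \<Rightarrow> nat \<Rightarrow> real \<Rightarrow> real" where
  "rho2 b n s = real n * rho1 b (n - 1) s - b * rho1 b n s"

lemma rho_deriv: "(rho b n has_real_derivative rho1 b n s) (at s)"
  unfolding rho_def[abs_def] rho1_def
  by (auto intro!: derivative_eq_intros simp: algebra_simps)

lemma rho1_deriv: "(rho1 b n has_real_derivative rho2 b n s) (at s)"
  unfolding rho1_def[abs_def] rho2_def
  by (auto intro!: derivative_eq_intros rho_deriv simp: rho1_def algebra_simps)

lemma rho_bounded:
  assumes "b > 0"
  obtains C where "\<And>s. s \<ge> 0 \<Longrightarrow> \<bar>rho b n s\<bar> \<le> C" "\<And>s. s \<ge> 0 \<Longrightarrow> \<bar>s * rho b n s\<bar> \<le> C"
proof -
  obtain C1 where C1: "\<And>s. s \<ge> 0 \<Longrightarrow> s ^ n * exp (- b * s) \<le> C1" by (rule power_exp_bounded[OF assms]) (rule that)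
  obtain C2 where C2: "\<And>s. s \<ge> 0 \<Longrightarrow> s ^ Suc n * exp (- b * s) \<le> C2" by (rule power_exp_bounded[OF assms]) (rule that)
  show ?thesis
  proof (rule that)
    fix s :: real assume s: "s \<ge> 0"
    show "\<bar>rho b n s\<bar> \<le> max C1 C2" using C1[OF s] s by (simp add: rho_def le_max_iff_disj)
    have "\<bar>s * rho b n s\<bar> = s ^ Suc n * exp (- b * s)" using s by (simp add: rho_def)
    then show "\<bar>s * rho b n s\<bar> \<le> max C1 C2" using C2[OF s] by simp
  qed
qed

text \<open>Bounds every second directional derivative of rho(|w|^2): it equals 2
  \<open>rho1\<close> + l^2 \<open>rho2\<close> with l^2 \<le> 4 s. The factor s is absorbed by the
  exponential.\<close>

lemma rho2_bounded:
  assumes b: "b > 0"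
  obtains C where "\<And>s. s \<ge> 0 \<Longrightarrow> \<bar>2 * rho1 b n s\<bar> + 4 * (s * \<bar>rho2 b n s\<bar>) \<le> C"
proof -
  have r1: "\<exists>C. \<forall>s\<ge>0. \<bar>rho1 b m s\<bar> \<le> C \<and> s * \<bar>rho1 b m s\<bar> \<le> C" for m
  proof -
    obtain C where C: "\<And>s. s \<ge> 0 \<Longrightarrow> \<bar>rho b (m - 1) s\<bar> \<le> C" "\<And>s. s \<ge> 0 \<Longrightarrow> \<bar>s * rho b (m - 1) s\<bar> \<le> C"
      by (rule rho_bounded[OF b]) (rule that)
    obtain D where D: "\<And>s. s \<ge> 0 \<Longrightarrow> \<bar>rho b m s\<bar> \<le> D" "\<And>s. s \<ge> 0 \<Longrightarrow> \<bar>s * rho b m s\<bar> \<le> D"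
      by (rule rho_bounded[OF b]) (rule that)
    have "\<bar>rho1 b m s\<bar> \<le> real m * C + b * D \<and> s * \<bar>rho1 b m s\<bar> \<le> real m * C + b * D" if s: "s \<ge> 0" for s
    proof
      have "\<bar>rho1 b m s\<bar> \<le> real m * \<bar>rho b (m - 1) s\<bar> + b * \<bar>rho b m s\<bar>"
        unfolding rho1_def using b abs_triangle_ineq4[of "real m * rho b (m - 1) s" "b * rho b m s"] by (simp add: abs_mult)
      also have "\<dots> \<le> real m * C + b * D"
        using b C(1)[OF s] D(1)[OF s] by (intro add_mono mult_left_mono) auto
      finally show "\<bar>rho1 b m s\<bar> \<le> real m * C + b * D" .
      have "s * \<bar>rho1 b m s\<bar> = \<bar>real m * (s * rho b (m - 1) s) - b * (s * rho b m s)\<bar>"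
      proof -
        have "s * \<bar>rho1 b m s\<bar> = \<bar>s * rho1 b m s\<bar>" using s by (simp add: abs_mult)
        also have "s * rho1 b m s = real m * (s * rho b (m - 1) s) - b * (s * rho b m s)"
          unfolding rho1_def by (simp add: algebra_simps)
        finally show ?thesis .
      qed
      also have "\<dots> \<le> real m * \<bar>s * rho b (m - 1) s\<bar> + b * \<bar>s * rho b m s\<bar>"
        using b abs_triangle_ineq4[of "real m * (s * rho b (m - 1) s)" "b * (s * rho b m s)"]
        by (simp add: abs_mult)
      also have "\<dots> \<le> real m * C + b * D"
        using b C(2)[OF s] D(2)[OF s] by (intro add_mono mult_left_mono) auto
      finally show "s * \<bar>rho1 b m s\<bar> \<le> real m * C + b * D" .
    qed
    then show ?thesis by blast
  qed
  obtain C where C: "\<forall>s\<ge>0. \<bar>rho1 b n s\<bar> \<le> C \<and> s * \<bar>rho1 b n s\<bar> \<le> C" using r1[of n] by blast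
  obtain D where D: "\<forall>s\<ge>0. \<bar>rho1 b (n - 1) s\<bar> \<le> D \<and> s * \<bar>rho1 b (n - 1) s\<bar> \<le> D" using r1[of "n - 1"] by blast
  show ?thesis
  proof (rule that)
    fix s :: real assume s: "s \<ge> 0"
    have "\<bar>rho2 b n s\<bar> \<le> real n * \<bar>rho1 b (n - 1) s\<bar> + b * \<bar>rho1 b n s\<bar>"
      unfolding rho2_def using b abs_triangle_ineq4[of "real n * rho1 b (n - 1) s" "b * rho1 b n s"] by (simp add: abs_mult)
    then have "s * \<bar>rho2 b n s\<bar> \<le> s * (real n * \<bar>rho1 b (n - 1) s\<bar> + b * \<bar>rho1 b n s\<bar>)"
      using s by (rule mult_left_mono)
    also have "\<dots> = real n * (s * \<bar>rho1 b (n - 1) s\<bar>) + b * (s * \<bar>rho1 b n s\<bar>)" by (simp add: algebra_simps)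
    also have "\<dots> \<le> real n * D + b * C"
      using b C D s by (intro add_mono mult_left_mono) auto
    finally have "s * \<bar>rho2 b n s\<bar> \<le> real n * D + b * C" .
    then show "\<bar>2 * rho1 b n s\<bar> + 4 * (s * \<bar>rho2 b n s\<bar>) \<le> 2 * C + 4 * (real n * D + b * C)"
      using C s by (auto simp: abs_mult)
  qed
qed

text \<open>The left-hand side is the planar Laplacian of rho(|w|^2). Writing it through the
  neighbouring indices n - 1 and n + 1 prepares the comparison with the squared magnetic gradient,
  which raises and lowers the index.\<close>

lemma rho_laplacian:
  "4 * rho1 b n s + 4 * s * rho2 b n s =
    4 * (real n)\<^sup>2 * rho b (n - 1) s - 4 * b * (2 * real n + 1) * rho b n s + 4 * b\<^sup>2 * rho b (Suc n) s"
proof -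
  have 1: "s * rho b m s = rho b (Suc m) s" for m by (simp add: rho_def)
  show ?thesis
  proof (cases n)
    case 0
    then show ?thesis using 1[of 0] by (simp add: rho1_def rho2_def power2_eq_square algebra_simps)
  next
    case (Suc m)
    show ?thesis
    proof (cases m)
      case 0
      then show ?thesis using Suc
        by (simp add: rho1_def rho2_def rho_def power2_eq_square algebra_simps)
    next
      case (Suc k)
      with \<open>n = Suc m\<close> show ?thesis
        by (simp add: rho1_def rho2_def rho_def power2_eq_square algebra_simps)
    qed
  qed
qed

text \<open>The polynomial \<open>S\<close> has derivative \<open>l\<close>, which is twice the
  inner product of the moving point with the unit direction \<open>d\<close>; so the last claim is
  Cauchy-Schwarz.\<close>

lemma rho_cmod_deriv:
  fixes c d :: complex
  assumes d: "d = 1 \<or> d = \<i>"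
  defines "S \<equiv> \<lambda>t. (cmod (c + of_real t * d))\<^sup>2"
    and "l \<equiv> \<lambda>t. 2 * (Re c * Re d + Im c * Im d + t)"
  shows "((\<lambda>t. rho b n (S t)) has_real_derivative (l t * rho1 b n (S t))) (at t)"
    and "((\<lambda>t. l t * rho1 b n (S t)) has_real_derivative (2 * rho1 b n (S t) + (l t)\<^sup>2 * rho2 b n (S t))) (at t)"
    and "(l t)\<^sup>2 \<le> 4 * S t"
proof -
  have S_eq: "S t = (cmod c)\<^sup>2 + 2 * t * (Re c * Re d + Im c * Im d) + t\<^sup>2" for t
    using d unfolding S_def cmod_power2 by (auto simp: power2_eq_square algebra_simps)
  have S: "(S has_real_derivative l t) (at t)" for t
    unfolding S_eq[abs_def] l_def by (auto intro!: derivative_eq_intros simp: algebra_simps)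
  show 1: "((\<lambda>t. rho b n (S t)) has_real_derivative (l t * rho1 b n (S t))) (at t)" for t
    using DERIV_chain2[OF rho_deriv S] by (simp add: mult.commute)
  have 2: "((\<lambda>t. rho1 b n (S t)) has_real_derivative (l t * rho2 b n (S t))) (at t)" for t
    using DERIV_chain2[OF rho1_deriv S] by (simp add: mult.commute)
  have l: "(l has_real_derivative 2) (at t)" for t
    unfolding l_def by (auto intro!: derivative_eq_intros)
  show "((\<lambda>t. l t * rho1 b n (S t)) has_real_derivative (2 * rho1 b n (S t) + (l t)\<^sup>2 * rho2 b n (S t))) (at t)"
    using DERIV_mult[OF l 2] by (simp add: power2_eq_square algebra_simps)
  show "(l t)\<^sup>2 \<le> 4 * S t"
    using d unfolding l_def S_def cmod_power2 by (auto simp: power2_eq_square algebra_simps)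
qed

text \<open>Complex coordinate in the plane on which the field acts. The two coordinate indices are
  parameters so that dimensions 2 and 3 are treated together.\<close>

definition zeta :: "'n \<Rightarrow> 'n \<Rightarrow> real^'n \<Rightarrow> complex" where
  "zeta i1 i2 z = Complex (z $ i1) (z $ i2)"

lemma bounded_linear_zeta: "bounded_linear (zeta i1 i2)"
proof -
  have "zeta i1 i2 = (\<lambda>z. of_real (z $ i1) + \<i> * of_real (z $ i2))"
    by (auto simp: zeta_def complex_eq_iff)
  moreover have "bounded_linear (\<lambda>z. of_real (z $ i1) + \<i> * of_real (z $ i2) :: complex)"
    by (intro bounded_linear_add bounded_linear_const_mult bounded_linear_compose[OF bounded_linear_of_real] bounded_linear_vec_nth)
  ultimately show ?thesis by simp
qed

lemma continuous_on_zeta: "continuous_on S (zeta i1 i2)"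
  using linear_continuous_on[OF bounded_linear_zeta] .

text \<open>The left-hand side is half the Laplacian of \<open>h w = \<integral>\<^sub>\<Omega> rho b n (cmod (zeta z - w)\<^sup>2)\<close>. Since \<open>h\<close>
  vanishes at infinity, \<open>h w + \<epsilon> (cmod (w - w0))\<^sup>2\<close> has an interior maximum on a large disc for small \<open>\<epsilon>\<close>.\<close>

lemma exists_negative_mean:
  fixes \<Omega> :: "(real^'n) set"
  assumes \<Omega>: "\<Omega> \<in> lmeasurable" "open \<Omega>" "\<Omega> \<noteq> {}" and b: "b > 0"
  shows "\<exists>w. (LINT z|lebesgue_on \<Omega>. 2 * rho1 b n ((cmod (zeta i1 i2 z - w))\<^sup>2) +
    2 * (cmod (zeta i1 i2 z - w))\<^sup>2 * rho2 b n ((cmod (zeta i1 i2 z - w))\<^sup>2)) < 0"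
proof -
  let ?M = "lebesgue_on \<Omega>"
  let ?\<zeta> = "zeta i1 i2 :: real^'n \<Rightarrow> complex"
  interpret finite_measure ?M using \<Omega> by (intro finite_measure_lebesgue_on)
  define F where "F c = rho b n ((cmod c)\<^sup>2)" for c
  define h where "h w = (LINT z|?M. F (?\<zeta> z - w))" for w
  obtain C where C: "\<And>s. s \<ge> 0 \<Longrightarrow> \<bar>rho b n s\<bar> \<le> C" "\<And>s. s \<ge> 0 \<Longrightarrow> \<bar>s * rho b n s\<bar> \<le> C"
    by (rule rho_bounded[OF b]) (rule that)
  obtain M where M: "\<And>s. s \<ge> 0 \<Longrightarrow> \<bar>2 * rho1 b n s\<bar> + 4 * (s * \<bar>rho2 b n s\<bar>) \<le> M"
    by (rule rho2_bounded[OF b]) (rule that)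
  have F0: "F c \<ge> 0" for c by (simp add: F_def rho_def)
  have FC: "\<bar>F c\<bar> \<le> C" for c unfolding F_def by (rule C) simp
  have Fcont: "continuous_on UNIV F"
    unfolding F_def rho_def by (intro continuous_intros)
  have Fm[measurable]: "F \<in> borel_measurable borel" using Fcont by (rule borel_measurable_continuous_onI)
  have "?\<zeta> \<in> borel_measurable borel" using continuous_on_zeta by (rule borel_measurable_continuous_onI)
  then have zm[measurable]: "?\<zeta> \<in> borel_measurable ?M"
    by (intro measurable_restrict_space1 measurable_completion) simp
  have Fint: "integrable ?M (\<lambda>z. F (?\<zeta> z - w))" for w
    using FC by (intro integrable_const_bound[of _ C]) auto
  have h0: "h w \<ge> 0" for w unfolding h_def using F0 by simp
  have hlim: "(\<lambda>k. h (w k)) \<longlonglongrightarrow> h v" if "w \<longlonglongrightarrow> v" for w v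
    unfolding h_def
  proof (rule integral_dominated_convergence[where w = "\<lambda>_. C"])
    show "AE z in ?M. (\<lambda>k. F (?\<zeta> z - w k)) \<longlonglongrightarrow> F (?\<zeta> z - v)"
    proof (rule AE_I2)
      fix z
      have "(\<lambda>k. ?\<zeta> z - w k) \<longlonglongrightarrow> ?\<zeta> z - v" using that by (intro tendsto_intros)
      moreover have "isCont F (?\<zeta> z - v)" using Fcont by (simp add: continuous_on_eq_continuous_at)
      ultimately show "(\<lambda>k. F (?\<zeta> z - w k)) \<longlonglongrightarrow> F (?\<zeta> z - v)" by (rule isCont_tendsto_compose[rotated])
    qed
  qed (use FC in auto)
  then have hcont: "continuous_on UNIV h"
    by (auto simp: continuous_on_sequentially o_def)
  \<comment> \<open>The integrands tend to 0 as \<open>w\<close> goes to infinity and are bounded by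
    \<open>C\<close> on a set of finite measure; dominated convergence is applied along a sequence
    violating the limit.\<close>
  have hinf: "(h \<longlongrightarrow> 0) at_infinity"
  proof -
    have F_lim: "\<exists>R. \<forall>c. cmod c \<ge> R \<longrightarrow> \<bar>F c\<bar> < \<epsilon>" if "\<epsilon> > 0" for \<epsilon>
    proof -
      have C0: "C \<ge> 0" using C(1)[of 0] by linarith
      have "\<bar>F c\<bar> < \<epsilon>" if "cmod c \<ge> sqrt (C / \<epsilon> + 1)" for c
      proof -
        have "C / \<epsilon> + 1 \<le> (cmod c)\<^sup>2"
          using that by (metis norm_ge_zero power_mono real_sqrt_ge_zero real_sqrt_pow2_iff real_sqrt_le_iff real_sqrt_abs abs_norm_cancel real_sqrt_le_mono sqrt_le_D)
        moreover have "\<bar>(cmod c)\<^sup>2 * F c\<bar> \<le> C" unfolding F_def by (rule C) simp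
        then have "(cmod c)\<^sup>2 * F c \<le> C" by linarith
        moreover have "(C / \<epsilon> + 1) * F c \<le> (cmod c)\<^sup>2 * F c" using calculation(1) F0 by (intro mult_right_mono)
        ultimately have "(C / \<epsilon> + 1) * F c \<le> C" by linarith
        then have "(C + \<epsilon>) * F c \<le> C * \<epsilon>" using \<open>\<epsilon> > 0\<close> by (simp add: field_simps)
        moreover have "C * \<epsilon> < (C + \<epsilon>) * \<epsilon>" using \<open>\<epsilon> > 0\<close> by (simp add: algebra_simps)
        ultimately have "(C + \<epsilon>) * F c < (C + \<epsilon>) * \<epsilon>" by linarith
        then show ?thesis using C0 \<open>\<epsilon> > 0\<close> F0[of c] by (simp add: mult_less_cancel_left)
      qed
      then show ?thesis by blast
    qed
    have Finf: "(F \<longlongrightarrow> 0) at_infinity"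
      unfolding Lim_at_infinity using F_lim by (auto simp: dist_real_def)
    show ?thesis
    proof (rule ccontr)
      assume "\<not> ?thesis"
      then obtain e where e: "e > 0" "\<And>R. \<exists>w. cmod w \<ge> R \<and> \<not> dist (h w) 0 < e"
        unfolding Lim_at_infinity by blast
      have "\<forall>k::nat. \<exists>w. cmod w \<ge> real k \<and> \<not> dist (h w) 0 < e" using e(2) by blast
      from choice[OF this] obtain w where w: "\<forall>k::nat. cmod (w k) \<ge> real k \<and> \<not> dist (h (w k)) 0 < e" ..
      have "(\<lambda>k. h (w k)) \<longlonglongrightarrow> (LINT z|?M. 0)"
        unfolding h_def
      proof (rule integral_dominated_convergence[where w = "\<lambda>_. C"])
        show "AE z in ?M. (\<lambda>k. F (?\<zeta> z - w k)) \<longlonglongrightarrow> 0"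
        proof (rule AE_I2)
          fix z
          have "filterlim (\<lambda>k. cmod (?\<zeta> z - w k)) at_top sequentially"
          proof (rule filterlim_at_top_mono)
            show "filterlim (\<lambda>k. - cmod (?\<zeta> z) + real k) at_top sequentially"
              by (rule filterlim_tendsto_add_at_top[OF tendsto_const filterlim_real_sequentially])
            show "\<forall>\<^sub>F k in sequentially. - cmod (?\<zeta> z) + real k \<le> cmod (?\<zeta> z - w k)"
            proof (intro always_eventually allI)
              fix k
              show "- cmod (?\<zeta> z) + real k \<le> cmod (?\<zeta> z - w k)"
                using w[rule_format, of k] norm_triangle_ineq3[of "w k" "?\<zeta> z"] norm_minus_commute[of "w k" "?\<zeta> z"] by linarith
            qed
          qed
          then have "filterlim (\<lambda>k. ?\<zeta> z - w k) at_infinity sequentially"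
            by (rule filterlim_norm_at_top_imp_at_infinity)
          then show "(\<lambda>k. F (?\<zeta> z - w k)) \<longlonglongrightarrow> 0" by (rule filterlim_compose[OF Finf])
        qed
      qed (use FC in auto)
      then have "(\<lambda>k. h (w k)) \<longlonglongrightarrow> 0" by simp
      then have "\<forall>\<^sub>F k in sequentially. dist (h (w k)) 0 < e" using e(1) by (rule tendstoD)
      then obtain k where "dist (h (w k)) 0 < e" using eventually_happens'[OF sequentially_bot] by blast
      then show False using w by blast
    qed
  qed
  have "\<exists>w. h w > 0"
  proof (rule ccontr)
    assume "\<not> ?thesis"
    then have hz: "h w = 0" for w using h0[of w] by (metis less_eq_real_def)
    \<comment> \<open>\<open>F\<close> vanishes at most at the origin, so mean zero at
      \<open>w\<close> puts almost all of \<Omega> where \<open>zeta\<close> equals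
      \<open>w\<close>. Two different values of \<open>w\<close> contradict each other.\<close>
    have ae: "AE z in ?M. ?\<zeta> z = w" for w
    proof -
      have "AE z in ?M. F (?\<zeta> z - w) = 0"
        using hz[of w] integral_nonneg_eq_0_iff_AE[OF Fint] F0 by (simp add: h_def)
      then show ?thesis by eventually_elim (simp add: F_def rho_def)
    qed
    have "AE z in ?M. False" using ae[of 0] ae[of 1] by eventually_elim simp
    then have "AE z in lebesgue. z \<notin> \<Omega>" using \<Omega>(2) by (subst (asm) AE_restrict_space_iff) auto
    then have "negligible \<Omega>" using \<Omega>(2) by (simp add: negligible_iff_null_sets AE_iff_null_sets)
    then show False using open_not_negligible[OF \<Omega>(2,3)] by blast
  qed
  then obtain w0 where w0: "h w0 > 0" by blast
  have "\<forall>\<^sub>F w in at_infinity. dist (h w) 0 < h w0 / 2" using hinf w0 by (intro tendstoD) auto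
  then obtain R0 where R0: "\<And>w. cmod w \<ge> R0 \<Longrightarrow> h w < h w0 / 2"
    unfolding eventually_at_infinity using h0 by (auto simp: dist_real_def)
  \<comment> \<open>Points at distance \<open>R\<close> from \<open>w0\<close> have modulus at least
    \<open>R0\<close>, where \<open>h\<close> is below half of \<open>h w0\<close>.\<close>
  define R where "R = \<bar>R0\<bar> + cmod w0 + 1"
  have R: "R > 0" unfolding R_def by (smt (verit) norm_ge_zero)
  \<comment> \<open>The quadratic term reaches only \<open>h w0 / 4\<close> on the boundary circle.
    There the total stays below \<open>h w0\<close>, so the maximum is interior.\<close>
  define \<epsilon> where "\<epsilon> = h w0 / (4 * R\<^sup>2)"
  have \<epsilon>: "\<epsilon> > 0" using w0 R by (simp add: \<epsilon>_def)
  define g where "g w = h w + \<epsilon> * (cmod (w - w0))\<^sup>2" for w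
  have "continuous_on UNIV g" unfolding g_def by (intro continuous_intros hcont)
  then have "continuous_on (cball w0 R) g" by (rule continuous_on_subset) simp
  then obtain v where v: "v \<in> cball w0 R" "\<And>w. w \<in> cball w0 R \<Longrightarrow> g w \<le> g v"
    using continuous_attains_sup[of "cball w0 R" g] R by auto
  have vR: "dist w0 v < R"
  proof (rule ccontr)
    assume "\<not> dist w0 v < R"
    then have eq: "cmod (v - w0) = R" using v(1) by (simp add: dist_norm norm_minus_commute)
    then have "cmod v \<ge> R0" using norm_triangle_ineq3[of v w0] norm_triangle_ineq4[of v w0] unfolding R_def by linarith
    then have "g v < h w0 / 2 + \<epsilon> * R\<^sup>2" using R0 eq by (simp add: g_def)
    also have "\<epsilon> * R\<^sup>2 = h w0 / 4" using R by (simp add: \<epsilon>_def)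
    finally have "g v < h w0" using w0 by simp
    moreover have "g w0 \<le> g v" using v(2)[of w0] R by simp
    ultimately show False by (simp add: g_def)
  qed
  \<comment> \<open>Second difference quotients in the two real directions: an interior maximum
    controls them directly, without differentiating \<open>h\<close>.\<close>
  define \<Delta> where "\<Delta> k z = (\<Sum>d\<in>{1, \<i>}. (F (?\<zeta> z - v + of_real (inverse (real (Suc k))) * d)
     + F (?\<zeta> z - v + of_real (- inverse (real (Suc k))) * d) - 2 * F (?\<zeta> z - v)) / (inverse (real (Suc k)))\<^sup>2)" for k z
  \<comment> \<open>The Laplacian 4 rho' + 4 s rho'', written as twice the integrand of the
    claim.\<close>
  define L where "L z = 2 * (2 * rho1 b n ((cmod (?\<zeta> z - v))\<^sup>2) +
    2 * (cmod (?\<zeta> z - v))\<^sup>2 * rho2 b n ((cmod (?\<zeta> z - v))\<^sup>2))" for z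
  have lim: "(\<lambda>k. LINT z|?M. \<Delta> k z) \<longlonglongrightarrow> (LINT z|?M. L z)"
  proof (rule integral_dominated_convergence[where w = "\<lambda>_. 2 * M"])
    have bd: "\<bar>2 * rho1 b n S + l\<^sup>2 * rho2 b n S\<bar> \<le> M" if "l\<^sup>2 \<le> 4 * S" for l S
    proof -
      have S0: "S \<ge> 0" using that zero_le_power2[of l] by linarith
      have "\<bar>2 * rho1 b n S + l\<^sup>2 * rho2 b n S\<bar> \<le> \<bar>2 * rho1 b n S\<bar> + l\<^sup>2 * \<bar>rho2 b n S\<bar>"
        using abs_triangle_ineq[of "2 * rho1 b n S" "l\<^sup>2 * rho2 b n S"] by (simp add: abs_mult)
      also have "l\<^sup>2 * \<bar>rho2 b n S\<bar> \<le> 4 * S * \<bar>rho2 b n S\<bar>" using that by (intro mult_right_mono) auto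
      finally show ?thesis using M[OF S0] by (simp add: mult.assoc)
    qed
    have sd: "\<bar>(F (c + of_real t * d) + F (c + of_real (- t) * d) - 2 * F c) / t\<^sup>2\<bar> \<le> M"
      if d: "d = 1 \<or> d = \<i>" and t: "t \<noteq> 0" for c d t
    proof -
      note D = rho_cmod_deriv(1,2)[OF d, where b = b and n = n and c = c] rho_cmod_deriv(3)[OF d, where c = c]
      have "\<bar>rho b n ((cmod (c + of_real t * d))\<^sup>2) + rho b n ((cmod (c + of_real (- t) * d))\<^sup>2) - 2 * rho b n ((cmod (c + of_real 0 * d))\<^sup>2)\<bar> \<le> M * t\<^sup>2"
        by (rule second_difference_bound[OF D(1) D(2) bd[OF D(3)]])
      then show ?thesis using t by (simp add: F_def divide_le_eq abs_divide)
    qed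
    show "AE z in ?M. norm (\<Delta> k z) \<le> 2 * M" for k
    proof (rule AE_I2)
      fix z
      have "norm (\<Delta> k z) \<le> (\<Sum>d\<in>{1, \<i>}. M)"
        unfolding \<Delta>_def by (intro sum_norm_le) (use sd[of _ "inverse (real (Suc k))"] in auto)
      then show "norm (\<Delta> k z) \<le> 2 * M" by (simp add: complex_eq_iff)
    qed
    show "AE z in ?M. (\<lambda>k. \<Delta> k z) \<longlonglongrightarrow> L z"
    proof (rule AE_I2)
      fix z
      define c where "c = ?\<zeta> z - v"
      have lim1: "(\<lambda>k. (F (c + of_real (inverse (real (Suc k))) * d) + F (c + of_real (- inverse (real (Suc k))) * d)
          - 2 * F c) / (inverse (real (Suc k)))\<^sup>2)
          \<longlonglongrightarrow> 2 * rho1 b n ((cmod c)\<^sup>2) + (2 * (Re c * Re d + Im c * Im d))\<^sup>2 * rho2 b n ((cmod c)\<^sup>2)"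
        if d: "d = 1 \<or> d = \<i>" for d
      proof -
        note D = rho_cmod_deriv(1,2)[OF d, where b = b and n = n and c = c] rho_cmod_deriv(3)[OF d, where c = c]
        have rho2_cont: "continuous_on UNIV (rho2 b n)"
          unfolding rho2_def[abs_def] rho1_def[abs_def] rho_def[abs_def] by (intro continuous_intros)
        have rho1_cont: "continuous_on UNIV (rho1 b n)"
          unfolding rho1_def[abs_def] rho_def[abs_def] by (intro continuous_intros)
        have "continuous_on UNIV (\<lambda>t. 2 * rho1 b n ((cmod (c + of_real t * d))\<^sup>2)
            + (2 * (Re c * Re d + Im c * Im d + t))\<^sup>2 * rho2 b n ((cmod (c + of_real t * d))\<^sup>2))"
          by (intro continuous_intros continuous_on_compose2[OF rho1_cont] continuous_on_compose2[OF rho2_cont]) auto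
        then have "isCont (\<lambda>t. 2 * rho1 b n ((cmod (c + of_real t * d))\<^sup>2)
            + (2 * (Re c * Re d + Im c * Im d + t))\<^sup>2 * rho2 b n ((cmod (c + of_real t * d))\<^sup>2)) 0"
          by (simp add: continuous_on_eq_continuous_at)
        from second_difference_limit[OF D(1) D(2) bd[OF D(3)] this] show ?thesis by (simp add: F_def)
      qed
      have "(\<lambda>k. \<Delta> k z) \<longlonglongrightarrow> (\<Sum>d\<in>{1, \<i>}. 2 * rho1 b n ((cmod c)\<^sup>2) + (2 * (Re c * Re d + Im c * Im d))\<^sup>2 * rho2 b n ((cmod c)\<^sup>2))"
        unfolding \<Delta>_def c_def[symmetric] by (intro tendsto_sum lim1) auto
      moreover have "(\<Sum>d\<in>{1, \<i>}. 2 * rho1 b n ((cmod c)\<^sup>2) + (2 * (Re c * Re d + Im c * Im d))\<^sup>2 * rho2 b n ((cmod c)\<^sup>2)) = L z"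
      proof -
        define r where "r = rho2 b n ((cmod c)\<^sup>2)"
        have "L z = 2 * (2 * rho1 b n ((cmod c)\<^sup>2) + 2 * ((Re c)\<^sup>2 + (Im c)\<^sup>2) * r)"
          unfolding L_def c_def[symmetric] r_def cmod_power2[symmetric] ..
        then show ?thesis unfolding r_def[symmetric]
          by (simp add: complex_eq_iff) (simp add: power2_eq_square algebra_simps)
      qed
      ultimately show "(\<lambda>k. \<Delta> k z) \<longlonglongrightarrow> L z" by simp
    qed
    have r1: "continuous_on UNIV (rho1 b n)" "continuous_on UNIV (rho2 b n)"
      unfolding rho2_def[abs_def] rho1_def[abs_def] rho_def[abs_def] by (intro continuous_intros)+
    note [measurable] = r1[THEN borel_measurable_continuous_onI]
    show "L \<in> borel_measurable ?M" unfolding L_def by measurable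
    show "(\<lambda>z. \<Delta> k z) \<in> borel_measurable ?M" for k unfolding \<Delta>_def by measurable
  qed simp
  \<comment> \<open>At the maximum the second differences of \<open>g\<close> are nonpositive. The
    quadratic term has second difference quotient 2 \<epsilon> in each of the two directions, and
    \<open>h\<close> must compensate for it.\<close>
  have neg: "(LINT z|?M. \<Delta> k z) \<le> - 4 * \<epsilon>" if k: "inverse (real (Suc k)) < R - dist w0 v" for k
  proof -
    define t where "t = inverse (real (Suc k))"
    have t: "t > 0" "t < R - dist w0 v" using k by (simp_all add: t_def)
    have int: "(LINT z|?M. \<Delta> k z) = (\<Sum>d\<in>{1, \<i>}. (h (v - of_real t * d) + h (v + of_real t * d) - 2 * h v) / t\<^sup>2)"
    proof -
      have "F (?\<zeta> z - v + of_real t * d) = F (?\<zeta> z - (v - of_real t * d))"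
        "F (?\<zeta> z - v + of_real (- t) * d) = F (?\<zeta> z - (v + of_real t * d))" for z d by (simp_all add: algebra_simps)
      then have "(LINT z|?M. \<Delta> k z) = (\<Sum>d\<in>{1, \<i>}. (LINT z|?M. (F (?\<zeta> z - (v - of_real t * d)) + F (?\<zeta> z - (v + of_real t * d))
          - 2 * F (?\<zeta> z - v)) / t\<^sup>2))"
        unfolding \<Delta>_def t_def[symmetric] using Fint
        by (subst Bochner_Integration.integral_sum[symmetric]) auto
      then show ?thesis using Fint by (simp add: h_def)
    qed
    have le: "(h (v - of_real t * d) + h (v + of_real t * d) - 2 * h v) / t\<^sup>2 \<le> - 2 * \<epsilon>" if d: "cmod d = 1" for d
    proof -
      have in_ball: "v - of_real t * d \<in> cball w0 R" "v + of_real t * d \<in> cball w0 R"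
      proof -
        have "dist v (v - of_real t * d) = t" "dist v (v + of_real t * d) = t"
          using t(1) d by (simp_all add: dist_norm norm_mult)
        then show "v - of_real t * d \<in> cball w0 R" "v + of_real t * d \<in> cball w0 R"
          using t(2) dist_triangle[of w0 "v - of_real t * d" v] dist_triangle[of w0 "v + of_real t * d" v]
          by (simp_all add: dist_commute)
      qed
      have sq: "(cmod (v - of_real t * d - w0))\<^sup>2 + (cmod (v + of_real t * d - w0))\<^sup>2 = 2 * (cmod (v - w0))\<^sup>2 + 2 * t\<^sup>2"
      proof -
        have "(cmod ((v - w0) - of_real t * d))\<^sup>2 + (cmod ((v - w0) + of_real t * d))\<^sup>2
            = 2 * (cmod (v - w0))\<^sup>2 + 2 * (cmod (of_real t * d))\<^sup>2"
          unfolding cmod_power2 by (simp add: power2_eq_square algebra_simps)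
        then show ?thesis using d t(1) by (simp add: norm_mult algebra_simps)
      qed
      have "g (v - of_real t * d) + g (v + of_real t * d) \<le> 2 * g v"
        using v(2)[OF in_ball(1)] v(2)[OF in_ball(2)] by linarith
      then have "h (v - of_real t * d) + h (v + of_real t * d) - 2 * h v
          \<le> \<epsilon> * (2 * (cmod (v - w0))\<^sup>2 - ((cmod (v - of_real t * d - w0))\<^sup>2 + (cmod (v + of_real t * d - w0))\<^sup>2))"
        by (simp add: g_def algebra_simps)
      then have "h (v - of_real t * d) + h (v + of_real t * d) - 2 * h v \<le> (- 2 * \<epsilon>) * t\<^sup>2"
        unfolding sq by (simp add: algebra_simps)
      then show ?thesis using t(1) by (simp add: pos_divide_le_eq)
    qed
    show ?thesis unfolding int using le[of 1] le[of \<i>] by (simp add: complex_eq_iff)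
  qed
  have "\<forall>\<^sub>F k in sequentially. inverse (real (Suc k)) < R - dist w0 v"
    using LIMSEQ_inverse_real_of_nat vR by (intro order_tendstoD(2)) auto
  then have "\<forall>\<^sub>F k in sequentially. (LINT z|?M. \<Delta> k z) \<le> - 4 * \<epsilon>" by eventually_elim (rule neg)
  then have "(LINT z|?M. L z) \<le> - 4 * \<epsilon>" using tendsto_upperbound[OF lim] by simp
  moreover have "(LINT z|?M. L z) = 2 * (LINT z|?M. 2 * rho1 b n ((cmod (?\<zeta> z - v))\<^sup>2) +
    2 * (cmod (?\<zeta> z - v))\<^sup>2 * rho2 b n ((cmod (?\<zeta> z - v))\<^sup>2))"
    unfolding L_def by (rule integral_mult_right_zero)
  ultimately have "(LINT z|?M. 2 * rho1 b n ((cmod (?\<zeta> z - v))\<^sup>2) +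
    2 * (cmod (?\<zeta> z - v))\<^sup>2 * rho2 b n ((cmod (?\<zeta> z - v))\<^sup>2)) < 0" using \<epsilon> by linarith
  then show ?thesis by blast
qed

text \<open>Symmetry of a component of D - a: conjugating its value on \<open>\<phi>\<close> gives
  the transpose on the conjugate of \<open>\<phi>\<close>, so the weak identity moves it to
  \<open>f\<close>.\<close>

lemma (in mag_domain) L2_inner_mag_test:
  assumes f: "mag_weak a \<Omega> f r" and \<phi>: "\<phi> \<in> test_fun \<Omega>"
  shows "L2_inner \<Omega> f (\<lambda>z. - \<i> * frechet_derivative \<phi> (at z) (axis i 1) - of_real (a z $ i) * \<phi> z)
    = L2_inner \<Omega> (\<lambda>z. r z $ i) \<phi>"
proof -
  have "cnj (- \<i> * frechet_derivative \<phi> (at z) (axis i 1) - of_real (a z $ i) * \<phi> z) = mag_test a (\<lambda>z. cnj (\<phi> z)) i z" for z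
    by (simp add: mag_test_def frechet_derivative_cnj_test_fun[OF \<phi>])
  then show ?thesis unfolding L2_inner_def using mag_weakD[OF f test_fun_cnj[OF \<phi>], of i] by simp
qed

text \<open>Contains the factor B. With indices 1 and 2 it is B A for both potentials of the
  theorem; in dimension 3 the remaining component is zero.\<close>

definition Avec :: "real \<Rightarrow> 'n \<Rightarrow> 'n \<Rightarrow> real^'n \<Rightarrow> real^'n" where
  "Avec B i1 i2 z = (\<chi> i. if i = i1 then - (B / 2) * z $ i2 else if i = i2 then B / 2 * z $ i1 else 0)"

lemma continuous_on_Avec: "continuous_on UNIV (Avec B i1 i2)"
  unfolding Avec_def
proof (rule continuous_on_vec_lambda)
  fix i
  show "continuous_on UNIV (\<lambda>z. if i = i1 then - (B / 2) * z $ i2 else if i = i2 then B / 2 * z $ i1 else 0)"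
    by (cases "i = i1"; cases "i = i2") (auto intro!: continuous_intros)
qed

text \<open>In this gauge the lowest Landau level consists of the Gaussian times holomorphic
  functions of \<open>zeta\<close>; the factor exp(\<alpha> \<open>zeta\<close>) moves the
  centre.\<close>

definition landau_exp :: "real \<Rightarrow> 'n \<Rightarrow> 'n \<Rightarrow> complex \<Rightarrow> real^'n \<Rightarrow> real^'n \<Rightarrow> complex" where
  "landau_exp B i1 i2 \<alpha> \<xi> z = - of_real (B / 4) * (zeta i1 i2 z * cnj (zeta i1 i2 z))
     + \<alpha> * zeta i1 i2 z + \<i> * of_real (\<xi> \<bullet> z)"

text \<open>Up to normalisation, the magnetic translate by \<open>2 cnj \<alpha> / B\<close> of a state of angular momentum
  \<open>- n\<close> in the \<open>n\<close>-th Landau level (counted from zero), times a plane wave in the remaining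
  variables.\<close>

definition landau :: "real \<Rightarrow> 'n \<Rightarrow> 'n \<Rightarrow> complex \<Rightarrow> real^'n \<Rightarrow> nat \<Rightarrow> real^'n \<Rightarrow> complex" where
  "landau B i1 i2 \<alpha> \<xi> n z = exp (landau_exp B i1 i2 \<alpha> \<xi> z) * (cnj (zeta i1 i2 z) - 2 * \<alpha> / of_real B) ^ n"

text \<open>Ladder form of D - A: the two components in the plane combine the functions of indices n
  + 1 and n - 1, and the others multiply by the frequency. At n = 0 the lowering term has factor
  0.\<close>

definition landau_grad :: "real \<Rightarrow> 'n \<Rightarrow> 'n \<Rightarrow> complex \<Rightarrow> real^'n \<Rightarrow> nat \<Rightarrow> real^'n \<Rightarrow> complex^'n" where
  "landau_grad B i1 i2 \<alpha> \<xi> n z = (\<chi> i.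
     (if i = i1 then \<i> * of_real (B / 2) * landau B i1 i2 \<alpha> \<xi> (Suc n) z - \<i> * of_nat n * landau B i1 i2 \<alpha> \<xi> (n - 1) z else 0)
   + (if i = i2 then - of_real (B / 2) * landau B i1 i2 \<alpha> \<xi> (Suc n) z - of_nat n * landau B i1 i2 \<alpha> \<xi> (n - 1) z else 0)
   + of_real (\<xi> $ i) * landau B i1 i2 \<alpha> \<xi> n z)"

lemma landau_has_derivative:
  "(landau B i1 i2 \<alpha> \<xi> n has_derivative (\<lambda>h.
      landau B i1 i2 \<alpha> \<xi> n z * (- of_real (B / 4) * (zeta i1 i2 z * cnj (zeta i1 i2 h) + zeta i1 i2 h * cnj (zeta i1 i2 z))
        + \<alpha> * zeta i1 i2 h + \<i> * of_real (\<xi> \<bullet> h))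
      + of_nat n * cnj (zeta i1 i2 h) * landau B i1 i2 \<alpha> \<xi> (n - 1) z)) (at z)"
proof -
  let ?\<zeta> = "zeta i1 i2"
  have z: "(?\<zeta> has_derivative ?\<zeta>) (at z)" by (rule bounded_linear_imp_has_derivative[OF bounded_linear_zeta])
  have zc: "((\<lambda>z. cnj (?\<zeta> z)) has_derivative (\<lambda>h. cnj (?\<zeta> h))) (at z)" by (rule has_derivative_cnj[OF z])
  have xi: "((\<lambda>z. complex_of_real (\<xi> \<bullet> z)) has_derivative (\<lambda>h. of_real (\<xi> \<bullet> h))) (at z)"
    by (intro has_derivative_of_real bounded_linear_imp_has_derivative bounded_linear_inner_right)
  have E: "(landau_exp B i1 i2 \<alpha> \<xi> has_derivative (\<lambda>h. - of_real (B / 4) * (?\<zeta> z * cnj (?\<zeta> h) + ?\<zeta> h * cnj (?\<zeta> z))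
        + \<alpha> * ?\<zeta> h + \<i> * of_real (\<xi> \<bullet> h))) (at z)"
    unfolding landau_exp_def[abs_def]
    by (intro has_derivative_add has_derivative_mult_right has_derivative_mult z zc xi)
  have ex: "((\<lambda>z. exp (landau_exp B i1 i2 \<alpha> \<xi> z)) has_derivative (\<lambda>h. exp (landau_exp B i1 i2 \<alpha> \<xi> z) *
      (- of_real (B / 4) * (?\<zeta> z * cnj (?\<zeta> h) + ?\<zeta> h * cnj (?\<zeta> z)) + \<alpha> * ?\<zeta> h + \<i> * of_real (\<xi> \<bullet> h)))) (at z)"
    by (rule has_derivative_compose[OF E DERIV_exp[unfolded has_field_derivative_def]])
  have g: "((\<lambda>z. cnj (?\<zeta> z) - 2 * \<alpha> / of_real B) has_derivative (\<lambda>h. cnj (?\<zeta> h))) (at z)"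
    using has_derivative_diff[OF zc has_derivative_const[of "2 * \<alpha> / of_real B"]] by simp
  have "((\<lambda>z. exp (landau_exp B i1 i2 \<alpha> \<xi> z) * (cnj (?\<zeta> z) - 2 * \<alpha> / of_real B) ^ n) has_derivative
      (\<lambda>h. exp (landau_exp B i1 i2 \<alpha> \<xi> z) * (of_nat n * cnj (?\<zeta> h) * (cnj (?\<zeta> z) - 2 * \<alpha> / of_real B) ^ (n - 1))
       + (exp (landau_exp B i1 i2 \<alpha> \<xi> z) * (- of_real (B / 4) * (?\<zeta> z * cnj (?\<zeta> h) + ?\<zeta> h * cnj (?\<zeta> z)) + \<alpha> * ?\<zeta> h + \<i> * of_real (\<xi> \<bullet> h)))
         * (cnj (?\<zeta> z) - 2 * \<alpha> / of_real B) ^ n)) (at z)"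
    by (rule has_derivative_mult[OF ex has_derivative_power[OF g]])
  then show ?thesis
    unfolding landau_def[abs_def] by (rule back_subst[of "\<lambda>D. (_ has_derivative D) _"]) (auto simp: fun_eq_iff algebra_simps)
qed

lemma continuous_on_landau: "continuous_on S (landau B i1 i2 \<alpha> \<xi> n)"
  using has_derivative_continuous[OF landau_has_derivative] by (intro continuous_at_imp_continuous_on ballI)

lemma landau_partial:
  assumes i: "i1 \<noteq> i2" and \<xi>: "\<xi> $ i1 = 0" "\<xi> $ i2 = 0" and B: "B > 0"
  shows "- \<i> * (landau B i1 i2 \<alpha> \<xi> n z * (- of_real (B / 4) * (zeta i1 i2 z * cnj (zeta i1 i2 (axis i 1)) + zeta i1 i2 (axis i 1) * cnj (zeta i1 i2 z))
        + \<alpha> * zeta i1 i2 (axis i 1) + \<i> * of_real (\<xi> \<bullet> axis i 1))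
      + of_nat n * cnj (zeta i1 i2 (axis i 1)) * landau B i1 i2 \<alpha> \<xi> (n - 1) z)
      - of_real (Avec B i1 i2 z $ i) * landau B i1 i2 \<alpha> \<xi> n z = landau_grad B i1 i2 \<alpha> \<xi> n z $ i"
proof -
  let ?\<zeta> = "zeta i1 i2 z"
  let ?u = "landau B i1 i2 \<alpha> \<xi>"
  have rec: "?u (Suc n) z = (cnj ?\<zeta> - 2 * \<alpha> / of_real B) * ?u n z" by (simp add: landau_def)
  have B0: "complex_of_real B \<noteq> 0" using B by simp
  have x: "complex_of_real (z $ i1) = (?\<zeta> + cnj ?\<zeta>) / 2" and y: "complex_of_real (z $ i2) = - \<i> * (?\<zeta> - cnj ?\<zeta>) / 2"
    by (simp_all add: zeta_def complex_eq_iff)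
  have ax: "\<xi> \<bullet> axis i 1 = \<xi> $ i" by (simp add: inner_axis)
  consider "i = i1" | "i = i2" | "i \<noteq> i1" "i \<noteq> i2" by blast
  then show ?thesis
  proof cases
    case 1
    have z1: "zeta i1 i2 (axis i 1) = 1" using 1 i by (simp add: zeta_def axis_def complex_eq_iff)
    have A: "complex_of_real (Avec B i1 i2 z $ i) = of_real B / 2 * (\<i> * (?\<zeta> - cnj ?\<zeta>) / 2)"
      using 1 by (simp add: Avec_def y)
    show ?thesis
      unfolding z1 ax A using 1 i \<xi> B0 by (simp add: landau_grad_def rec field_simps)
  next
    case 2
    have z1: "zeta i1 i2 (axis i 1) = \<i>" using 2 i by (simp add: zeta_def axis_def complex_eq_iff)
    have A: "complex_of_real (Avec B i1 i2 z $ i) = of_real B / 2 * ((?\<zeta> + cnj ?\<zeta>) / 2)"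
      using 2 i by (simp add: Avec_def x)
    show ?thesis
      unfolding z1 ax A using 2 i \<xi> B0 by (simp add: landau_grad_def rec field_simps)
  next
    case 3
    have z1: "zeta i1 i2 (axis i 1) = 0" using 3 by (simp add: zeta_def axis_def complex_eq_iff)
    have A: "Avec B i1 i2 z $ i = 0" using 3 by (simp add: Avec_def)
    have ii: "- \<i> * (a * (\<i> * b)) = b * a" for a b :: complex by (simp add: complex_eq_iff)
    show ?thesis
      unfolding z1 ax A using 3 by (simp add: landau_grad_def ii[simplified])
  qed
qed

text \<open>Completing the square in the real part of the exponent: the modulus is centred at 2 cnj
  \<alpha> / B, also the zero of the polynomial factor. The plane wave has modulus 1.\<close>

lemma cmod_landau_sq:
  assumes B: "B > 0"
  shows "(cmod (landau B i1 i2 \<alpha> \<xi> n z))\<^sup>2 = exp (B / 2 * (cmod (2 * cnj \<alpha> / of_real B))\<^sup>2) *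
    rho (B / 2) n ((cmod (zeta i1 i2 z - 2 * cnj \<alpha> / of_real B))\<^sup>2)"
proof -
  let ?\<zeta> = "zeta i1 i2 z"
  define w where "w = 2 * cnj \<alpha> / of_real B"
  have \<alpha>: "\<alpha> = of_real (B / 2) * cnj w" using B by (simp add: w_def)
  have w': "2 * \<alpha> / of_real B = cnj w" by (simp add: w_def)
  have re: "2 * Re (landau_exp B i1 i2 \<alpha> \<xi> z) = B / 2 * (cmod w)\<^sup>2 + - (B / 2) * (cmod (?\<zeta> - w))\<^sup>2"
    unfolding landau_exp_def \<alpha> cmod_power2 by (simp add: power2_eq_square field_simps)
  have "(cmod (landau B i1 i2 \<alpha> \<xi> n z))\<^sup>2 = (exp (Re (landau_exp B i1 i2 \<alpha> \<xi> z)))\<^sup>2 * ((cmod (cnj (?\<zeta> - w))) ^ n)\<^sup>2"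
    unfolding landau_def w' by (simp add: norm_mult norm_power power_mult_distrib)
  also have "(exp (Re (landau_exp B i1 i2 \<alpha> \<xi> z)))\<^sup>2 = exp (B / 2 * (cmod w)\<^sup>2 + - (B / 2) * (cmod (?\<zeta> - w))\<^sup>2)"
    unfolding re[symmetric] by (simp add: exp_double)
  also have "((cmod (cnj (?\<zeta> - w))) ^ n)\<^sup>2 = ((cmod (?\<zeta> - w))\<^sup>2) ^ n"
    by (simp only: complex_mod_cnj power_mult[symmetric] mult.commute)
  finally show ?thesis unfolding w_def[symmetric] exp_add rho_def by (simp only: mult.commute mult.left_commute)
qed

lemma landau_bounded:
  assumes B: "B > 0"
  obtains C where "\<And>z. cmod (landau B i1 i2 \<alpha> \<xi> n z) \<le> C"
proof -
  obtain C where C: "\<And>s. s \<ge> 0 \<Longrightarrow> \<bar>rho (B / 2) n s\<bar> \<le> C"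
    by (rule rho_bounded[of "B / 2" n]) (use B in \<open>auto intro: that\<close>)
  let ?w = "2 * cnj \<alpha> / of_real B"
  let ?D = "exp (B / 2 * (cmod ?w)\<^sup>2) * C"
  show ?thesis
  proof (rule that)
    fix z
    have "rho (B / 2) n ((cmod (zeta i1 i2 z - ?w))\<^sup>2) \<le> C" using C[of "(cmod (zeta i1 i2 z - ?w))\<^sup>2"] by auto
    then have "(cmod (landau B i1 i2 \<alpha> \<xi> n z))\<^sup>2 \<le> ?D"
      unfolding cmod_landau_sq[OF B] by (intro mult_left_mono) auto
    then show "cmod (landau B i1 i2 \<alpha> \<xi> n z) \<le> sqrt ?D" by (rule real_le_rsqrt)
  qed
qed

section \<open>Landau functions as trial functions on a domain\<close>

locale landau_domain =
  fixes B :: real and i1 i2 :: "'n::finite" and \<Omega> :: "(real^'n) set"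
  assumes B: "B > 0" and i12: "i1 \<noteq> i2"
    and \<Omega>: "open \<Omega>" "\<Omega> \<in> lmeasurable" "\<Omega> \<noteq> {}"
begin

sublocale mag_domain \<Omega> "Avec B i1 i2"
  using \<Omega> continuous_on_Avec by unfold_locales auto

abbreviation A where "A \<equiv> Avec B i1 i2"
abbreviation u where "u \<equiv> landau B i1 i2"
abbreviation P where "P \<equiv> landau_grad B i1 i2"

lemma u_L2: "u \<alpha> \<xi> n \<in> L2 \<Omega>"
proof -
  obtain C where C: "\<And>z. cmod (u \<alpha> \<xi> n z) \<le> C" by (rule landau_bounded[OF B]) (rule that)
  show ?thesis
    by (rule L2_bounded[OF \<Omega>(2) borel_measurable_continuous_onI[OF continuous_on_landau] C])
qed

lemma P_L2: "P \<alpha> \<xi> n \<in> L2 \<Omega>"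
  unfolding L2_vec_iff
proof
  fix i
  show "(\<lambda>z. P \<alpha> \<xi> n z $ i) \<in> L2 \<Omega>"
  proof -
    have t: "(\<lambda>z. if b then c * u \<alpha> \<xi> k z - d * u \<alpha> \<xi> m z else 0) \<in> L2 \<Omega>" for b c d k m
      by (cases b) (auto intro!: L2_diff L2_cmult u_L2 L2_const[OF \<Omega>(2)])
    show ?thesis
      unfolding landau_grad_def vec_lambda_beta by (intro L2_add t L2_cmult u_L2)
  qed
qed

lemma mag_weak_landau:
  assumes \<xi>: "\<xi> $ i1 = 0" "\<xi> $ i2 = 0"
  shows "mag_weak A \<Omega> (u \<alpha> \<xi> n) (P \<alpha> \<xi> n)"
proof -
  define F where "F z h = u \<alpha> \<xi> n z * (- of_real (B / 4) * (zeta i1 i2 z * cnj (zeta i1 i2 h) + zeta i1 i2 h * cnj (zeta i1 i2 z))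
        + \<alpha> * zeta i1 i2 h + \<i> * of_real (\<xi> \<bullet> h))
      + of_nat n * cnj (zeta i1 i2 h) * u \<alpha> \<xi> (n - 1) z" for z h
  have eq: "(\<lambda>z. \<chi> i. - \<i> * F z (axis i 1) - of_real (A z $ i) * u \<alpha> \<xi> n z) = P \<alpha> \<xi> n"
    using landau_partial[OF i12 \<xi> B, of \<alpha> n] by (simp add: fun_eq_iff vec_eq_iff F_def)
  have "mag_weak A \<Omega> (u \<alpha> \<xi> n) (\<lambda>z. \<chi> i. - \<i> * F z (axis i 1) - of_real (A z $ i) * u \<alpha> \<xi> n z)"
  proof (rule mag_weak_C1)
    show "(u \<alpha> \<xi> n has_derivative F z) (at z)" for z
      using landau_has_derivative[of B i1 i2 \<alpha> \<xi> n z] by (simp add: F_def[abs_def])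
    show "continuous_on UNIV (\<lambda>z. F z (axis i 1))" for i
      unfolding F_def
      by (intro continuous_on_add continuous_on_mult continuous_on_const continuous_on_landau continuous_on_zeta continuous_on_cnj)
    show "u \<alpha> \<xi> n \<in> L2 \<Omega>" by (rule u_L2)
    show "(\<lambda>z. \<chi> i. - \<i> * F z (axis i 1) - of_real (A z $ i) * u \<alpha> \<xi> n z) \<in> L2 \<Omega>" unfolding eq by (rule P_L2)
  qed
  then show ?thesis unfolding eq .
qed

lemma landau_H1_mag: "\<xi> $ i1 = 0 \<Longrightarrow> \<xi> $ i2 = 0 \<Longrightarrow> u \<alpha> \<xi> n \<in> H1_mag A \<Omega>"
  using mag_weak_H1_mag(1)[OF mag_weak_landau] .

definition level :: "nat \<Rightarrow> real^'n \<Rightarrow> real" where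
  "level n \<xi> = B * (2 * real n + 1) + (norm \<xi>)\<^sup>2"

text \<open>Each component of the gradient is itself a combination of Landau functions with known
  weak gradients, so the second factor D - A can be moved over weakly. The terms of index n + 2 and
  n - 2 cancel between the two directions of the plane.\<close>

lemma landau_form_test:
  assumes \<xi>: "\<xi> $ i1 = 0" "\<xi> $ i2 = 0" and \<phi>: "\<phi> \<in> test_fun \<Omega>"
  shows "mag_form A \<Omega> (u \<alpha> \<xi> n) \<phi> = of_real (level n \<xi>) * L2_inner \<Omega> (u \<alpha> \<xi> n) \<phi>"
proof -
  let ?u = "u \<alpha> \<xi>" and ?P = "P \<alpha> \<xi>"
  note W = mag_weak_landau[OF \<xi>, of \<alpha>]
  \<comment> \<open>The common diagonal part; each of the two directions contributes half of B (2 n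
    + 1).\<close>
  define X where "X z = (of_real (B / 2) * of_nat (2 * n + 1)) * ?u n z" for z
  define Q where "Q i z = (if i = i1 then X z - of_real (B\<^sup>2 / 4) * ?u (n + 2) z - of_nat (n * (n - 1)) * ?u (n - 2) z else 0)
     + (if i = i2 then X z + of_real (B\<^sup>2 / 4) * ?u (n + 2) z + of_nat (n * (n - 1)) * ?u (n - 2) z else 0)
     + of_real ((\<xi> $ i)\<^sup>2) * ?u n z" for i z
  have comp: "L2_inner \<Omega> (\<lambda>z. ?P n z $ i) (\<lambda>z. - \<i> * frechet_derivative \<phi> (at z) (axis i 1) - of_real (A z $ i) * \<phi> z)
      = L2_inner \<Omega> (Q i) \<phi>" for i
  proof -
    consider "i = i1" | "i = i2" | "i \<noteq> i1" "i \<noteq> i2" by blast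
    then show ?thesis
    proof cases
      case 1
      define c d where "c = \<i> * complex_of_real (B / 2)" and "d = - \<i> * of_nat n"
      have w: "mag_weak A \<Omega> (fscale c (?u (Suc n)) + fscale d (?u (n - 1))) (\<lambda>z. c *s ?P (Suc n) z + d *s ?P (n - 1) z)"
        by (intro mag_weak_add mag_weak_scale W)
      have 2: "fscale c (?u (Suc n)) + fscale d (?u (n - 1)) = (\<lambda>z. ?P n z $ i)"
        using 1 i12 \<xi> by (auto simp: fscale_def landau_grad_def c_def d_def fun_eq_iff)
      have 3: "(\<lambda>z. (c *s ?P (Suc n) z + d *s ?P (n - 1) z) $ i) = Q i"
        using 1 i12 \<xi> by (cases n) (auto simp: Q_def X_def landau_grad_def c_def d_def fun_eq_iff power2_eq_square field_simps)
      show ?thesis using L2_inner_mag_test[OF w \<phi>, of i] unfolding 2 3 .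
    next
      case 2
      define c d where "c = - complex_of_real (B / 2)" and "d = - complex_of_nat n"
      have w: "mag_weak A \<Omega> (fscale c (?u (Suc n)) + fscale d (?u (n - 1))) (\<lambda>z. c *s ?P (Suc n) z + d *s ?P (n - 1) z)"
        by (intro mag_weak_add mag_weak_scale W)
      have 1: "fscale c (?u (Suc n)) + fscale d (?u (n - 1)) = (\<lambda>z. ?P n z $ i)"
        using 2 i12 \<xi> by (auto simp: fscale_def landau_grad_def c_def d_def fun_eq_iff)
      have 3: "(\<lambda>z. (c *s ?P (Suc n) z + d *s ?P (n - 1) z) $ i) = Q i"
        using 2 i12 \<xi> by (cases n) (auto simp: Q_def X_def landau_grad_def c_def d_def fun_eq_iff power2_eq_square field_simps)
      show ?thesis using L2_inner_mag_test[OF w \<phi>, of i] unfolding 1 3 .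
    next
      case 3
      define c where "c = complex_of_real (\<xi> $ i)"
      have w: "mag_weak A \<Omega> (fscale c (?u n)) (\<lambda>z. c *s ?P n z)"
        by (intro mag_weak_scale W)
      have 1: "fscale c (?u n) = (\<lambda>z. ?P n z $ i)"
        using 3 by (auto simp: fscale_def landau_grad_def c_def fun_eq_iff)
      have 2: "(\<lambda>z. (c *s ?P n z) $ i) = Q i"
        using 3 by (auto simp: Q_def landau_grad_def c_def fun_eq_iff power2_eq_square)
      show ?thesis using L2_inner_mag_test[OF w \<phi>, of i] unfolding 1 2 .
    qed
  qed
  have QL2: "Q i \<in> L2 \<Omega>" for i
  proof -
    have z: "(\<lambda>_. 0 :: complex) \<in> L2 \<Omega>" by (rule L2_const[OF \<Omega>(2)])
    have X: "X \<in> L2 \<Omega>" unfolding X_def by (intro L2_cmult u_L2)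
    have t1: "(\<lambda>z. if b then X z - c * ?u k z - d * ?u m z else 0) \<in> L2 \<Omega>" for b c d k m
      by (cases b) (auto intro!: L2_diff L2_cmult u_L2 X z)
    have t2: "(\<lambda>z. if b then X z + c * ?u k z + d * ?u m z else 0) \<in> L2 \<Omega>" for b c d k m
      by (cases b) (auto intro!: L2_add L2_cmult u_L2 X z)
    show ?thesis unfolding Q_def by (intro L2_add t1 t2 L2_cmult u_L2)
  qed
  have \<phi>L: "\<phi> \<in> L2 \<Omega>" by (rule mag_test_L2(3)[OF \<phi>])
  have "mag_form A \<Omega> (?u n) \<phi> = (\<Sum>i\<in>UNIV. L2_inner \<Omega> (Q i) \<phi>)"
    using mag_form_eq[OF W mag_weak_test_fun[OF \<phi>], of n] by (simp only: vec_lambda_beta comp)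
  also have "\<dots> = (LINT z|lebesgue_on \<Omega>. (\<Sum>i\<in>UNIV. Q i z * cnj (\<phi> z)))"
    unfolding L2_inner_def by (intro Bochner_Integration.integral_sum[symmetric] L2_integrable_cnj QL2 \<phi>L)
  also have "\<dots> = (LINT z|lebesgue_on \<Omega>. of_real (level n \<xi>) * (?u n z * cnj (\<phi> z)))"
  proof (intro Bochner_Integration.integral_cong refl)
    fix z
    have "(\<Sum>i\<in>UNIV. complex_of_real ((\<xi> $ i)\<^sup>2)) = of_real ((norm \<xi>)\<^sup>2)"
      by (simp add: norm_sq_vec)
    then have "(\<Sum>i\<in>UNIV. Q i z) = 2 * X z + of_real ((norm \<xi>)\<^sup>2) * ?u n z"
      unfolding Q_def sum.distrib sum_distrib_right[symmetric] by simp
    also have "\<dots> = of_real (level n \<xi>) * ?u n z"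
      by (simp add: X_def level_def algebra_simps)
    finally show "(\<Sum>i\<in>UNIV. Q i z * cnj (\<phi> z)) = of_real (level n \<xi>) * (?u n z * cnj (\<phi> z))"
      by (simp add: sum_distrib_right[symmetric])
  qed
  finally show ?thesis by (simp add: L2_inner_def)
qed

text \<open>Density of test functions in the Dirichlet form domain. It fails on the Neumann domain,
  where boundary terms would appear; this asymmetry is what makes the comparison possible.\<close>

lemma landau_form:
  assumes \<xi>: "\<xi> $ i1 = 0" "\<xi> $ i2 = 0" and v: "v \<in> H1_mag_0 A \<Omega>"
  shows "mag_form A \<Omega> (u \<alpha> \<xi> n) v = of_real (level n \<xi>) * L2_inner \<Omega> (u \<alpha> \<xi> n) v"
proof -
  interpret ip: psd_form fscale "H1_mag A \<Omega>" "L2_inner \<Omega>" by (rule psd_form_ip)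
  interpret h: psd_form fscale "H1_mag A \<Omega>" "mag_form A \<Omega>" by (rule psd_form_h)
  have uH: "u \<alpha> \<xi> n \<in> H1_mag A \<Omega>" by (rule landau_H1_mag[OF \<xi>])
  have vH: "v \<in> H1_mag A \<Omega>" using v H1_mag_0_subset by blast
  obtain \<phi> where \<phi>: "\<forall>k. \<phi> k \<in> test_fun \<Omega>"
    "(\<lambda>k. mag_form A \<Omega> (\<phi> k) (u \<alpha> \<xi> n)) \<longlonglongrightarrow> mag_form A \<Omega> v (u \<alpha> \<xi> n)"
    "(\<lambda>k. L2_inner \<Omega> (\<phi> k) (u \<alpha> \<xi> n)) \<longlonglongrightarrow> L2_inner \<Omega> v (u \<alpha> \<xi> n)"
    using H1_mag_0_limits[OF v] uH by blast
  have \<phi>H: "\<phi> k \<in> H1_mag A \<Omega>" for k using \<phi>(1) test_fun_H1_mag by blast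
  have "mag_form A \<Omega> (\<phi> k) (u \<alpha> \<xi> n) = of_real (level n \<xi>) * L2_inner \<Omega> (\<phi> k) (u \<alpha> \<xi> n)" for k
    using landau_form_test[OF \<xi> \<phi>(1)[rule_format], of \<alpha> n k] h.herm[OF uH \<phi>H, of k] ip.herm[OF uH \<phi>H, of k] by simp
  then have "mag_form A \<Omega> v (u \<alpha> \<xi> n) = of_real (level n \<xi>) * L2_inner \<Omega> v (u \<alpha> \<xi> n)"
    using LIMSEQ_unique[OF \<phi>(2)] tendsto_mult_left[OF \<phi>(3), of "of_real (level n \<xi>)"] by simp
  then show ?thesis using h.herm[OF vH uH] ip.herm[OF vH uH] by simp
qed

text \<open>Both squared moduli are radial profiles about the same centre. The squared gradient has
  indices n + 1 and n - 1 only, besides the frequency term, and subtracting the level produces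
  exactly the right-hand side of \<open>rho_laplacian\<close> with b = B / 2, halved.\<close>

lemma landau_energy:
  fixes \<alpha> :: complex
  assumes \<xi>: "\<xi> $ i1 = 0" "\<xi> $ i2 = 0"
  defines "s \<equiv> \<lambda>z. (cmod (zeta i1 i2 z - 2 * cnj \<alpha> / of_real B))\<^sup>2"
  shows "Re (mag_form A \<Omega> (u \<alpha> \<xi> n) (u \<alpha> \<xi> n)) - level n \<xi> * Re (L2_inner \<Omega> (u \<alpha> \<xi> n) (u \<alpha> \<xi> n))
    = exp (B / 2 * (cmod (2 * cnj \<alpha> / of_real B))\<^sup>2) *
      (LINT z|lebesgue_on \<Omega>. 2 * rho1 (B / 2) n (s z) + 2 * s z * rho2 (B / 2) n (s z))"
proof -
  let ?u = "u \<alpha> \<xi>"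
  have pn: "(norm (P \<alpha> \<xi> n z))\<^sup>2 = B\<^sup>2 / 2 * (cmod (?u (Suc n) z))\<^sup>2 + 2 * (real n)\<^sup>2 * (cmod (?u (n - 1) z))\<^sup>2
     + (norm \<xi>)\<^sup>2 * (cmod (?u n z))\<^sup>2" for z
  proof -
    define X where "X = of_real (B / 2) * ?u (Suc n) z"
    define Y where "Y = of_nat n * ?u (n - 1) z"
    \<comment> \<open>Parallelogram identity: raising and lowering parts do not interfere in the sum
      over the two directions of the plane.\<close>
    have XY: "(cmod (\<i> * X - \<i> * Y))\<^sup>2 + (cmod (- X - Y))\<^sup>2 = 2 * (cmod X)\<^sup>2 + 2 * (cmod Y)\<^sup>2"
      unfolding cmod_power2 by (simp add: power2_eq_square algebra_simps)
    have "(cmod (P \<alpha> \<xi> n z $ i))\<^sup>2 = (if i = i1 then (cmod (\<i> * X - \<i> * Y))\<^sup>2 else 0)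
        + (if i = i2 then (cmod (- X - Y))\<^sup>2 else 0) + (\<xi> $ i)\<^sup>2 * (cmod (?u n z))\<^sup>2" for i
      using i12 \<xi> by (auto simp: landau_grad_def X_def Y_def mult.assoc norm_mult power_mult_distrib)
    then have "(norm (P \<alpha> \<xi> n z))\<^sup>2 = (cmod (\<i> * X - \<i> * Y))\<^sup>2 + (cmod (- X - Y))\<^sup>2 + (\<Sum>i\<in>UNIV. (\<xi> $ i)\<^sup>2 * (cmod (?u n z))\<^sup>2)"
      unfolding norm_sq_vec[of "P \<alpha> \<xi> n z"] by (simp add: sum.distrib)
    also have "(\<Sum>i\<in>UNIV. (\<xi> $ i)\<^sup>2 * (cmod (?u n z))\<^sup>2) = (norm \<xi>)\<^sup>2 * (cmod (?u n z))\<^sup>2"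
      unfolding norm_sq_vec[of \<xi>] by (simp add: sum_distrib_right)
    finally show ?thesis unfolding XY
      by (simp add: X_def Y_def norm_mult power_mult_distrib power_divide)
  qed
  have i1: "integrable (lebesgue_on \<Omega>) (\<lambda>z. (norm (P \<alpha> \<xi> n z))\<^sup>2)" by (rule L2_integrable_sq[OF P_L2])
  have i2: "integrable (lebesgue_on \<Omega>) (\<lambda>z. (cmod (?u n z))\<^sup>2)" by (rule L2_integrable_sq[OF u_L2])
  have "Re (mag_form A \<Omega> (?u n) (?u n)) - level n \<xi> * Re (L2_inner \<Omega> (?u n) (?u n))
      = (LINT z|lebesgue_on \<Omega>. (norm (P \<alpha> \<xi> n z))\<^sup>2) - level n \<xi> * (LINT z|lebesgue_on \<Omega>. (cmod (?u n z))\<^sup>2)"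
    by (simp only: Re_mag_form[OF mag_weak_landau[OF \<xi>]] Re_L2_inner_self[OF u_L2])
  also have "\<dots> = (LINT z|lebesgue_on \<Omega>. (norm (P \<alpha> \<xi> n z))\<^sup>2 - level n \<xi> * (cmod (?u n z))\<^sup>2)"
    using i1 i2 by simp
  also have "\<dots> = (LINT z|lebesgue_on \<Omega>. exp (B / 2 * (cmod (2 * cnj \<alpha> / of_real B))\<^sup>2) *
      (2 * rho1 (B / 2) n (s z) + 2 * s z * rho2 (B / 2) n (s z)))"
  proof (intro Bochner_Integration.integral_cong refl)
    fix z
    have sz: "(cmod (zeta i1 i2 z - 2 * cnj \<alpha> / of_real B))\<^sup>2 = s z" by (simp add: s_def)
    have lap: "2 * rho1 (B / 2) n (s z) + 2 * s z * rho2 (B / 2) n (s z) =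
      2 * (real n)\<^sup>2 * rho (B / 2) (n - 1) (s z) - B * (2 * real n + 1) * rho (B / 2) n (s z) + B\<^sup>2 / 2 * rho (B / 2) (Suc n) (s z)"
      using rho_laplacian[of "B / 2" n "s z"] by (simp add: power2_eq_square)
    show "(norm (P \<alpha> \<xi> n z))\<^sup>2 - level n \<xi> * (cmod (?u n z))\<^sup>2 = exp (B / 2 * (cmod (2 * cnj \<alpha> / of_real B))\<^sup>2) *
      (2 * rho1 (B / 2) n (s z) + 2 * s z * rho2 (B / 2) n (s z))"
      unfolding lap pn cmod_landau_sq[OF B] sz level_def by (simp add: algebra_simps)
  qed
  also have "\<dots> = exp (B / 2 * (cmod (2 * cnj \<alpha> / of_real B))\<^sup>2) *
      (LINT z|lebesgue_on \<Omega>. 2 * rho1 (B / 2) n (s z) + 2 * s z * rho2 (B / 2) n (s z))"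
    by (rule integral_mult_right_zero)
  finally show ?thesis .
qed

lemma landau_negative:
  assumes \<xi>: "\<xi> $ i1 = 0" "\<xi> $ i2 = 0"
  shows "\<exists>\<alpha>. Re (mag_form A \<Omega> (u \<alpha> \<xi> n) (u \<alpha> \<xi> n)) < level n \<xi> * Re (L2_inner \<Omega> (u \<alpha> \<xi> n) (u \<alpha> \<xi> n))"
proof -
  obtain w where w: "(LINT z|lebesgue_on \<Omega>. 2 * rho1 (B / 2) n ((cmod (zeta i1 i2 z - w))\<^sup>2) +
    2 * (cmod (zeta i1 i2 z - w))\<^sup>2 * rho2 (B / 2) n ((cmod (zeta i1 i2 z - w))\<^sup>2)) < 0"
    using exists_negative_mean[OF \<Omega>(2,1,3), of "B / 2" n i1 i2] B by auto
  \<comment> \<open>Inverts the relation between parameter and centre, so that the translate is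
    centred at \<open>w\<close>.\<close>
  define \<alpha> where "\<alpha> = of_real (B / 2) * cnj w"
  have \<alpha>: "2 * cnj \<alpha> / of_real B = w" using B by (simp add: \<alpha>_def)
  have "Re (mag_form A \<Omega> (u \<alpha> \<xi> n) (u \<alpha> \<xi> n)) - level n \<xi> * Re (L2_inner \<Omega> (u \<alpha> \<xi> n) (u \<alpha> \<xi> n)) < 0"
    unfolding landau_energy[OF \<xi>] \<alpha> using w by (intro mult_pos_neg) auto
  then show ?thesis by (intro exI[of _ \<alpha>]) simp
qed

text \<open>The form between the two functions is evaluated twice: \<open>v\<close> in the Dirichlet
  domain gives the factor \<open>level n \<xi>\<close>, and the Neumann equation of \<open>v\<close>
  gives \<open>\<mu>\<close>.\<close>

lemma orthogonal_to_landau: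
  assumes \<xi>: "\<xi> $ i1 = 0" "\<xi> $ i2 = 0" and v: "v \<in> H1_mag_0 A \<Omega>"
    and N: "\<And>w. w \<in> H1_mag A \<Omega> \<Longrightarrow> mag_form A \<Omega> v w = of_real \<mu> * L2_inner \<Omega> v w"
    and ne: "level n \<xi> \<noteq> \<mu>"
  shows "L2_inner \<Omega> (u \<alpha> \<xi> n) v = 0"
proof -
  interpret ip: psd_form fscale "H1_mag A \<Omega>" "L2_inner \<Omega>" by (rule psd_form_ip)
  interpret h: psd_form fscale "H1_mag A \<Omega>" "mag_form A \<Omega>" by (rule psd_form_h)
  have uH: "u \<alpha> \<xi> n \<in> H1_mag A \<Omega>" by (rule landau_H1_mag[OF \<xi>])
  have vH: "v \<in> H1_mag A \<Omega>" using v H1_mag_0_subset by blast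
  have "of_real (level n \<xi>) * L2_inner \<Omega> (u \<alpha> \<xi> n) v = of_real \<mu> * L2_inner \<Omega> (u \<alpha> \<xi> n) v"
    using landau_form[OF \<xi> v, of \<alpha> n] N[OF uH] h.herm[OF vH uH] ip.herm[OF vH uH] by auto
  then show ?thesis using ne by simp
qed

end

section \<open>The Fourier transform\<close>

text \<open>Lebesgue measure is the image of the product measure over the coordinates, where the
  integral of a product splits.\<close>

lemma lborel_integral_prod_Basis:
  fixes g :: "'a::euclidean_space \<Rightarrow> real \<Rightarrow> complex"
  assumes g: "\<And>b. b \<in> Basis \<Longrightarrow> integrable lborel (g b)"
  shows "integrable lborel (\<lambda>x::'a. \<Prod>b\<in>Basis. g b (x \<bullet> b))"
    and "(LINT x|lborel. (\<Prod>b\<in>Basis. g b (x \<bullet> b))) = (\<Prod>b\<in>Basis. (LINT t|lborel. g b t))"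
proof -
  interpret product_sigma_finite "\<lambda>_::'a. lborel :: real measure" ..
  have l: "lborel = distr (\<Pi>\<^sub>M b\<in>Basis. lborel :: real measure) borel (\<lambda>f. \<Sum>b\<in>Basis. f b *\<^sub>R b :: 'a)"
    by (subst lborel_def) (simp add: lborel_eq_real)
  have m[measurable]: "(\<lambda>f. \<Sum>b\<in>Basis. f b *\<^sub>R b :: 'a) \<in> (\<Pi>\<^sub>M b\<in>Basis. lborel :: real measure) \<rightarrow>\<^sub>M borel"
    by measurable
  have gm: "g b \<in> borel_measurable borel" if "b \<in> Basis" for b using g[OF that] by auto
  have gm2[measurable]: "(\<lambda>x::'a. \<Prod>b\<in>Basis. g b (x \<bullet> b)) \<in> borel_measurable borel"
  proof (rule borel_measurable_prod)
    fix b :: 'a assume b: "b \<in> Basis"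
    show "(\<lambda>x. g b (x \<bullet> b)) \<in> borel_measurable borel"
      by (rule measurable_compose[OF _ gm[OF b]]) measurable
  qed
  have eq: "(\<Prod>b\<in>Basis. g b ((\<Sum>b\<in>Basis. f b *\<^sub>R b) \<bullet> b)) = (\<Prod>b\<in>Basis. g b (f b))" for f :: "'a \<Rightarrow> real"
    by (intro prod.cong refl) simp
  show "integrable lborel (\<lambda>x::'a. \<Prod>b\<in>Basis. g b (x \<bullet> b))"
    by (subst l, subst integrable_distr_eq[OF m]) (auto simp: eq intro!: product_integrable_prod g)
  show "(LINT x|lborel. (\<Prod>b\<in>Basis. g b (x \<bullet> b))) = (\<Prod>b\<in>Basis. (LINT t|lborel. g b t))"
    by (subst l, subst integral_distr[OF m]) (auto simp: eq intro!: product_integral_prod g)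
qed

text \<open>Read off from the characteristic function of the standard normal distribution.\<close>

lemma gaussian_fourier_1d:
  "integrable lborel (\<lambda>t. complex_of_real (exp (- t\<^sup>2 / 2)) * iexp (s * t))"
  "(LINT t|lborel. complex_of_real (exp (- t\<^sup>2 / 2)) * iexp (s * t)) = of_real (sqrt (2 * pi) * exp (- s\<^sup>2 / 2))"
proof -
  have d: "std_normal_density t = exp (- t\<^sup>2 / 2) / sqrt (2 * pi)" for t by (simp add: std_normal_density_def)
  have i0: "integrable lborel std_normal_density" by (rule integrable_normal_density) simp
  have e: "exp (- t\<^sup>2 / 2) = sqrt (2 * pi) * std_normal_density t" for t by (simp add: d)
  have "integrable lborel (\<lambda>t. exp (- t\<^sup>2 / 2) :: real)" unfolding e using i0 by simp
  then show "integrable lborel (\<lambda>t. complex_of_real (exp (- t\<^sup>2 / 2)) * iexp (s * t))"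
    by (rule Bochner_Integration.integrable_bound) (auto simp: norm_mult)
  have "complex_of_real (exp (- s\<^sup>2 / 2)) = char std_normal_distribution s"
    by (simp add: char_std_normal_distribution)
  also have "\<dots> = (LINT t|lborel. std_normal_density t *\<^sub>R iexp (s * t))"
    unfolding char_def by (subst integral_density) auto
  also have "\<dots> = (LINT t|lborel. (1 / sqrt (2 * pi)) *\<^sub>R (complex_of_real (exp (- t\<^sup>2 / 2)) * iexp (s * t)))"
    by (intro Bochner_Integration.integral_cong) (auto simp: d scaleR_conv_of_real)
  also have "\<dots> = (1 / sqrt (2 * pi)) *\<^sub>R (LINT t|lborel. complex_of_real (exp (- t\<^sup>2 / 2)) * iexp (s * t))"
    by simp
  finally show "(LINT t|lborel. complex_of_real (exp (- t\<^sup>2 / 2)) * iexp (s * t)) = of_real (sqrt (2 * pi) * exp (- s\<^sup>2 / 2))"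
    by (simp add: scaleR_conv_of_real field_simps)
qed

definition wave :: "'a::euclidean_space \<Rightarrow> 'a \<Rightarrow> complex" where
  "wave k x = exp (\<i> * of_real (k \<bullet> x))"

lemma norm_wave [simp]: "cmod (wave k x) = 1"
  by (simp add: wave_def)

lemma wave_measurable [measurable (raw)]:
  assumes [measurable]: "f \<in> borel_measurable M" "g \<in> borel_measurable M"
  shows "(\<lambda>x. wave (f x) (g x)) \<in> borel_measurable M"
proof -
  have [measurable]: "(exp :: complex \<Rightarrow> complex) \<in> borel_measurable borel"
    by (intro borel_measurable_continuous_onI continuous_intros)
  show ?thesis unfolding wave_def by measurable
qed

definition gauss :: "'a::euclidean_space \<Rightarrow> real" where "gauss x = exp (- (norm x)\<^sup>2 / 2)"

lemma gauss_pos: "0 < gauss x" and gauss_le_1: "gauss x \<le> 1"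
  by (auto simp: gauss_def)

lemma norm_gauss_wave_le: "cmod (of_real (gauss x) * (w * wave k z)) \<le> cmod w"
proof -
  have "gauss x * cmod w \<le> 1 * cmod w" by (intro mult_right_mono gauss_le_1) simp
  then show ?thesis by (simp add: norm_mult abs_of_pos[OF gauss_pos])
qed

lemma continuous_on_gauss: "continuous_on S gauss"
  unfolding gauss_def by (intro continuous_intros) auto

lemma gauss_measurable [measurable]: "gauss \<in> borel_measurable borel"
  using continuous_on_gauss by (rule borel_measurable_continuous_onI)

lemma gauss_fourier:
  fixes s :: "'a::euclidean_space"
  shows "integrable lborel (\<lambda>x::'a. of_real (gauss x) * wave s x)"
    and "(LINT x|lborel. of_real (gauss x) * wave s x) = of_real (sqrt (2 * pi) ^ DIM('a) * gauss s)"
proof -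
  have prod: "of_real (gauss x) * wave s x = (\<Prod>b\<in>Basis. complex_of_real (exp (- (x \<bullet> b)\<^sup>2 / 2)) * iexp ((s \<bullet> b) * (x \<bullet> b)))" for x
  proof -
    have "gauss x = (\<Prod>b\<in>Basis. exp (- (x \<bullet> b)\<^sup>2 / 2))"
      unfolding gauss_def by (subst exp_sum[symmetric]) (auto simp: norm_eq_sqrt_inner euclidean_inner[of x x] power2_eq_square sum_nonneg sum_divide_distrib sum_negf)
    moreover have "wave s x = (\<Prod>b\<in>Basis. iexp ((s \<bullet> b) * (x \<bullet> b)))"
      unfolding wave_def by (subst exp_sum[symmetric]) (auto simp: euclidean_inner[of s x] sum_distrib_left)
    ultimately show ?thesis by (simp add: prod.distrib)
  qed
  note P = lborel_integral_prod_Basis[OF gaussian_fourier_1d(1), of "\<lambda>b. s \<bullet> b"]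
  show "integrable lborel (\<lambda>x::'a. of_real (gauss x) * wave s x)"
    unfolding prod by (rule P)
  have g: "gauss s = (\<Prod>b\<in>Basis. exp (- (s \<bullet> b)\<^sup>2 / 2))"
    unfolding gauss_def by (subst exp_sum[symmetric]) (auto simp: norm_eq_sqrt_inner euclidean_inner[of s s] power2_eq_square sum_nonneg sum_divide_distrib sum_negf)
  show "(LINT x|lborel. of_real (gauss x) * wave s x) = of_real (sqrt (2 * pi) ^ DIM('a) * gauss s)"
    unfolding prod P(2) gaussian_fourier_1d(2) g by (simp add: prod.distrib)
qed

lemma gauss_integrable: "integrable lborel (gauss :: 'a::euclidean_space \<Rightarrow> real)"
proof -
  have "integrable lborel (\<lambda>x::'a. complex_of_real (gauss x))"
    using gauss_fourier(1)[of "0::'a"] by (simp add: wave_def)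
  then have "integrable lborel (\<lambda>x::'a. cmod (complex_of_real (gauss x)))" by (rule integrable_norm)
  then show ?thesis by (simp add: abs_of_pos[OF gauss_pos])
qed

lemma lborel_integral_affine:
  fixes f :: "'a::euclidean_space \<Rightarrow> 'b::{banach, second_countable_topology}"
  assumes [measurable]: "f \<in> borel_measurable borel" and t: "t \<noteq> 0"
  shows "(LINT x|lborel. f x) = \<bar>t\<bar> ^ DIM('a) *\<^sub>R (LINT x|lborel. f (a + t *\<^sub>R x))"
    and "integrable lborel f \<longleftrightarrow> integrable lborel (\<lambda>x. f (a + t *\<^sub>R x))"
proof -
  have e: "(\<lambda>_::'a. ennreal (\<bar>t\<bar> ^ DIM('a))) = (\<lambda>_. ennreal \<bar>t\<bar> ^ DIM('a))" by (simp add: ennreal_power)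
  show "(LINT x|lborel. f x) = \<bar>t\<bar> ^ DIM('a) *\<^sub>R (LINT x|lborel. f (a + t *\<^sub>R x))"
    by (subst lborel_affine[OF t, of a], subst integral_density) (auto simp: integral_distr)
  have sc: "integrable lborel (\<lambda>x. k *\<^sub>R g x) \<longleftrightarrow> integrable lborel g" if "k \<noteq> 0" for k and g :: "'a \<Rightarrow> 'b"
    using integrable_scaleR_right[of "inverse k" lborel "\<lambda>x. k *\<^sub>R g x"] that by auto
  show "integrable lborel f \<longleftrightarrow> integrable lborel (\<lambda>x. f (a + t *\<^sub>R x))"
    using t by (subst lborel_affine[OF t, of a], subst integrable_density) (auto simp: integrable_distr_eq sc)
qed

text \<open>The product of the moduli of \<open>f\<close> and \<open>g\<close>, times
  \<open>C\<close>, is an integrable majorant on the product space.\<close>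

lemma fubini_bounded_kernel:
  fixes f :: "'a::euclidean_space \<Rightarrow> complex" and g :: "'b::euclidean_space \<Rightarrow> complex"
  assumes f: "integrable lborel f" and g: "integrable lborel g"
    and K[measurable]: "(\<lambda>(x, y). K x y) \<in> borel_measurable (borel \<Otimes>\<^sub>M borel)" and C: "\<And>x y. cmod (K x y) \<le> C"
  shows "(LINT x|lborel. f x * (LINT y|lborel. g y * K x y)) = (LINT y|lborel. g y * (LINT x|lborel. f x * K x y))"
proof -
  interpret lborel_pair: pair_sigma_finite "lborel :: 'a measure" "lborel :: 'b measure" ..
  have [measurable]: "f \<in> borel_measurable borel" "g \<in> borel_measurable borel" using f g by auto
  have Km: "(\<lambda>p. K (fst p) (snd p)) \<in> borel_measurable (lborel \<Otimes>\<^sub>M lborel)"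
    using K by (simp add: case_prod_beta' cong: measurable_cong_sets)
  then have [measurable]: "(\<lambda>y. K x y) \<in> borel_measurable borel" "(\<lambda>x. K x y) \<in> borel_measurable borel" for x y
    using measurable_compose_Pair1[of x borel "\<lambda>p. K (fst p) (snd p)" borel borel]
    measurable_compose[OF measurable_Pair2'[of y borel borel], of "\<lambda>p. K (fst p) (snd p)" borel] K
    by (auto simp: case_prod_beta')
  have C0: "C \<ge> 0" using C norm_ge_zero order_trans by blast
  have int: "integrable (lborel \<Otimes>\<^sub>M lborel) (\<lambda>p. f (fst p) * (g (snd p) * K (fst p) (snd p)))"
  proof (rule Bochner_Integration.integrable_bound)
    show "integrable (lborel \<Otimes>\<^sub>M lborel) (\<lambda>p. C *\<^sub>R (f (fst p) * g (snd p)))"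
    proof (intro integrable_scaleR_right lborel_pair.Fubini_integrable)
      show "(\<lambda>p. f (fst p) * g (snd p)) \<in> borel_measurable (lborel \<Otimes>\<^sub>M lborel)" by measurable
      show "integrable lborel (\<lambda>x. LINT y|lborel. cmod (f (fst (x, y)) * g (snd (x, y))))"
        using f by (simp add: norm_mult)
      show "AE x in lborel. integrable lborel (\<lambda>y. f (fst (x, y)) * g (snd (x, y)))"
        using g by simp
    qed
    show "(\<lambda>p. f (fst p) * (g (snd p) * K (fst p) (snd p))) \<in> borel_measurable (lborel \<Otimes>\<^sub>M lborel)"
      using Km by measurable
    show "AE p in lborel \<Otimes>\<^sub>M lborel. cmod (f (fst p) * (g (snd p) * K (fst p) (snd p))) \<le> cmod (C *\<^sub>R (f (fst p) * g (snd p)))"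
    proof (intro AE_I2)
      fix p
      have "cmod (f (fst p) * g (snd p)) * cmod (K (fst p) (snd p)) \<le> cmod (f (fst p) * g (snd p)) * C"
        by (intro mult_left_mono C) simp
      then show "cmod (f (fst p) * (g (snd p) * K (fst p) (snd p))) \<le> cmod (C *\<^sub>R (f (fst p) * g (snd p)))"
        using C0 by (simp add: norm_mult mult_ac)
    qed
  qed
  have "(LINT x|lborel. f x * (LINT y|lborel. g y * K x y)) = (LINT x|lborel. (LINT y|lborel. f x * (g y * K x y)))"
    by simp
  also have "\<dots> = (LINT y|lborel. (LINT x|lborel. f x * (g y * K x y)))"
    using lborel_pair.Fubini_integral[of "\<lambda>x y. f x * (g y * K x y)"] int by (simp add: case_prod_beta')
  also have "\<dots> = (LINT y|lborel. g y * (LINT x|lborel. f x * K x y))"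
    by (simp add: mult.left_commute[of "f _"])
  finally show ?thesis .
qed

section \<open>Fourier inversion\<close>

definition fourier :: "('a::euclidean_space \<Rightarrow> complex) \<Rightarrow> 'a \<Rightarrow> complex" where
  "fourier f k = (LINT y|lborel. f y * wave k y)"

lemma fourier_measurable [measurable]:
  assumes [measurable]: "f \<in> borel_measurable borel"
  shows "fourier f \<in> borel_measurable borel"
proof -
  have "(\<lambda>k. LINT y|lborel. f y * wave k y) \<in> borel_measurable borel"
    by (rule lborel.borel_measurable_lebesgue_integral) (simp add: case_prod_beta')
  then show ?thesis unfolding fourier_def[abs_def] .
qed

text \<open>The inverse transform is damped by a Gaussian, which turns it into a convolution of
  \<open>f\<close> with an approximate identity. Pairing with a box puts the convolution on the
  indicator, whose continuity off a null set suffices, so no regularity of \<open>f\<close> is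
  needed.\<close>

lemma fourier_inversion_box:
  fixes f :: "'a::euclidean_space \<Rightarrow> complex"
  assumes f: "integrable lborel f" and F: "integrable lborel (fourier f)"
  defines "c \<equiv> sqrt (2 * pi) ^ DIM('a)"
  shows "(LINT z|lborel. indicator (box a b) z * (LINT k|lborel. fourier f k * wave (- k) z))
    = of_real (c\<^sup>2) * (LINT z|lborel. indicator (box a b) z * f z)"
proof -
  have [measurable]: "f \<in> borel_measurable borel" "fourier f \<in> borel_measurable borel" using f F by auto
  define ch :: "'a \<Rightarrow> complex" where "ch = indicator (box a b)"
  have chm[measurable]: "ch \<in> borel_measurable borel" unfolding ch_def by measurable
  have ch_int: "integrable lborel ch"
  proof -
    have "integrable lborel (indicator (box a b) :: 'a \<Rightarrow> real)"
      by (rule integrable_real_indicator) (auto simp: emeasure_lborel_box_eq)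
    then have "integrable lborel (\<lambda>z. complex_of_real (indicator (box a b) z))" by simp
    also have "(\<lambda>z. complex_of_real (indicator (box a b) z)) = ch" by (auto simp: ch_def fun_eq_iff indicator_def)
    finally show ?thesis .
  qed
  have ch1: "cmod (ch z) \<le> 1" for z by (simp add: ch_def indicator_def)
  \<comment> \<open>Transform of the damping factor: again a Gaussian, concentrating at 0 as
    \<open>t\<close> tends to 0.\<close>
  define H where "H t x = (LINT k|lborel. of_real (gauss (t *\<^sub>R k)) * wave k x)" for t :: real and x :: 'a
  have gt_int: "integrable lborel (\<lambda>k::'a. complex_of_real (gauss (t *\<^sub>R k)))" if "t > 0" for t
  proof -
    have "integrable lborel (\<lambda>k::'a. gauss (0 + t *\<^sub>R k))"
      by (rule iffD1[OF lborel_integral_affine(2)]) (use that gauss_integrable in auto)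
    then have "integrable lborel (\<lambda>k::'a. gauss (t *\<^sub>R k))" by simp
    then show ?thesis by simp
  qed
  have H_eq: "H t x = of_real ((1 / t) ^ DIM('a) * (c * gauss ((1 / t) *\<^sub>R x)))" if t: "t > 0" for t x
  proof -
    have "H t x = \<bar>1 / t\<bar> ^ DIM('a) *\<^sub>R (LINT k|lborel. of_real (gauss (t *\<^sub>R (0 + (1 / t) *\<^sub>R k))) * wave (0 + (1 / t) *\<^sub>R k) x)"
      unfolding H_def using t by (intro lborel_integral_affine(1)) auto
    also have "(\<lambda>k. of_real (gauss (t *\<^sub>R (0 + (1 / t) *\<^sub>R k))) * wave (0 + (1 / t) *\<^sub>R k) x) = (\<lambda>k. of_real (gauss k) * wave ((1 / t) *\<^sub>R x) k)"
      using t by (auto simp: wave_def fun_eq_iff inner_commute)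
    also have "(LINT k|lborel. of_real (gauss k) * wave ((1 / t) *\<^sub>R x) k) = of_real (c * gauss ((1 / t) *\<^sub>R x))"
      unfolding c_def by (rule gauss_fourier(2))
    finally show ?thesis using t by (simp add: scaleR_conv_of_real)
  qed
  define \<Phi> where "\<Phi> t z = (LINT k|lborel. of_real (gauss (t *\<^sub>R k)) * (fourier f k * wave (- k) z))" for t z
  have \<Phi>_eq: "\<Phi> t z = (LINT y|lborel. f y * H t (y - z))" if t: "t > 0" for t z
  proof -
    have w: "wave k y * wave (- k) z = wave k (y - z)" for k y
      by (simp add: wave_def exp_add[symmetric] inner_diff_right algebra_simps)
    have "\<Phi> t z = (LINT k|lborel. of_real (gauss (t *\<^sub>R k)) * (LINT y|lborel. f y * wave k (y - z)))"
      unfolding \<Phi>_def fourier_def by (simp add: w[symmetric] mult.assoc[symmetric])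
    also have "\<dots> = (LINT y|lborel. f y * (LINT k|lborel. of_real (gauss (t *\<^sub>R k)) * wave k (y - z)))"
      by (rule fubini_bounded_kernel[OF gt_int[OF t] f, of _ 1]) (auto simp: case_prod_beta')
    finally show ?thesis by (simp add: H_def)
  qed
  \<comment> \<open>Substituting z = y - t x cancels the normalising power of t and leaves a fixed
    Gaussian weight, with t only inside the indicator.\<close>
  have main: "(LINT z|lborel. ch z * \<Phi> t z) = (LINT y|lborel. f y * (LINT x|lborel. ch (y - t *\<^sub>R x) * of_real (c * gauss x)))"
    if t: "t > 0" for t
  proof -
    have Hb: "cmod (H t x) \<le> (1 / t) ^ DIM('a) * (c * 1)" for x
    proof -
      have "c \<ge> 0" by (simp add: c_def)
      moreover have "cmod (H t x) = (1 / t) ^ DIM('a) * (c * gauss ((1 / t) *\<^sub>R x))"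
        unfolding H_eq[OF t] norm_of_real using t gauss_pos[of "(1 / t) *\<^sub>R x"] \<open>c \<ge> 0\<close> by (simp add: abs_mult)
      moreover have "c * gauss ((1 / t) *\<^sub>R x) \<le> c * 1" using \<open>c \<ge> 0\<close> gauss_le_1 by (rule mult_left_mono[rotated])
      ultimately show ?thesis using t by (simp only:) (intro mult_left_mono, auto simp: gauss_le_1)
    qed
    have Hm[measurable]: "H t \<in> borel_measurable borel"
      unfolding H_eq[OF t, abs_def] by measurable
    have "(LINT z|lborel. ch z * \<Phi> t z) = (LINT z|lborel. ch z * (LINT y|lborel. f y * H t (y - z)))"
      by (simp add: \<Phi>_eq[OF t])
    also have "\<dots> = (LINT y|lborel. f y * (LINT z|lborel. ch z * H t (y - z)))"
      by (rule fubini_bounded_kernel[OF ch_int f _ Hb]) (simp add: case_prod_beta')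
    also have "(\<lambda>y. LINT z|lborel. ch z * H t (y - z)) = (\<lambda>y. LINT x|lborel. ch (y - t *\<^sub>R x) * of_real (c * gauss x))"
    proof
      fix y
      have "(LINT z|lborel. ch z * H t (y - z)) = \<bar>- t\<bar> ^ DIM('a) *\<^sub>R (LINT x|lborel. ch (y + (- t) *\<^sub>R x) * H t (y - (y + (- t) *\<^sub>R x)))"
        using t by (intro lborel_integral_affine(1)) auto
      also have "\<dots> = t ^ DIM('a) *\<^sub>R (LINT x|lborel. of_real ((1 / t) ^ DIM('a)) * (ch (y - t *\<^sub>R x) * of_real (c * gauss x)))"
        using t by (simp add: H_eq[OF t] mult_ac)
      also have "\<dots> = (LINT x|lborel. ch (y - t *\<^sub>R x) * of_real (c * gauss x))"
        using t by (simp add: scaleR_conv_of_real power_divide)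
      finally show "(LINT z|lborel. ch z * H t (y - z)) = (LINT x|lborel. ch (y - t *\<^sub>R x) * of_real (c * gauss x))" .
    qed
    finally show ?thesis .
  qed
  let ?t = "\<lambda>n. inverse (real (Suc n))"
  have c0: "c \<ge> 0" by (simp add: c_def)
  have cb: "cmod (ch w * of_real (c * gauss x)) \<le> c * gauss x" for w x :: 'a
  proof -
    have "0 \<le> c * gauss x" using c0 gauss_pos[of x] by simp
    then show ?thesis using mult_right_mono[OF ch1[of w], of "c * gauss x"]
      by (simp only: norm_mult norm_of_real abs_of_nonneg mult_1)
  qed
  have cg: "integrable lborel (\<lambda>x::'a. c * gauss x)" by (simp add: gauss_integrable)
  have cg_int: "(LINT x|lborel. complex_of_real (c * gauss (x::'a))) = of_real (c\<^sup>2)"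
    using gauss_fourier(2)[of "0::'a"] by (simp add: wave_def gauss_def c_def power2_eq_square)
  have limL: "(\<lambda>n. LINT y|lborel. f y * (LINT x|lborel. ch (y - ?t n *\<^sub>R x) * of_real (c * gauss x)))
      \<longlonglongrightarrow> (LINT y|lborel. f y * (ch y * of_real (c\<^sup>2)))"
  proof (rule integral_dominated_convergence[where w = "\<lambda>y. cmod (f y) * (LINT x|lborel. c * gauss (x::'a))"])
    show "integrable lborel (\<lambda>y. cmod (f y) * (LINT x|lborel. c * gauss (x::'a)))" using f by simp
    have b: "cmod (LINT x|lborel. ch (y - s *\<^sub>R x) * of_real (c * gauss x)) \<le> (LINT x|lborel. c * gauss (x::'a))" for y s
    proof (rule order_trans[OF integral_norm_bound], rule integral_mono_AE')
      show "AE x in lborel. cmod (ch (y - s *\<^sub>R x) * of_real (c * gauss x)) \<le> c * gauss x"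
        by (intro AE_I2 cb)
      show "AE x in lborel. 0 \<le> c * gauss (x::'a)" by (intro AE_I2 mult_nonneg_nonneg c0 less_imp_le[OF gauss_pos])
    qed (rule cg)
    show "AE y in lborel. cmod (f y * (LINT x|lborel. ch (y - ?t n *\<^sub>R x) * of_real (c * gauss x))) \<le> cmod (f y) * (LINT x|lborel. c * gauss (x::'a))" for n
      unfolding norm_mult by (intro AE_I2 mult_left_mono b) simp
    have "(\<lambda>y. LINT x|lborel. ch (y - s *\<^sub>R x) * of_real (c * gauss x)) \<in> borel_measurable borel" for s
      by (rule lborel.borel_measurable_lebesgue_integral) (simp add: case_prod_beta')
    then show "(\<lambda>y. f y * (LINT x|lborel. ch (y - ?t n *\<^sub>R x) * of_real (c * gauss x))) \<in> borel_measurable lborel" for n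
      by simp
    \<comment> \<open>Off the boundary of the box the indicator is locally constant, which gives the
      pointwise limit.\<close>
    have "negligible (cbox a b - box a b)" by (rule negligible_frontier_interval)
    then have "AE y in lebesgue. y \<notin> cbox a b - box a b"
      by (intro AE_not_in) (simp add: negligible_iff_null_sets)
    then have "AE y in lborel. y \<notin> cbox a b - box a b" by (simp add: AE_completion_iff)
    then show "AE y in lborel. (\<lambda>n. f y * (LINT x|lborel. ch (y - ?t n *\<^sub>R x) * of_real (c * gauss x))) \<longlonglongrightarrow> f y * (ch y * of_real (c\<^sup>2))"
    proof eventually_elim
      case (elim y)
      have "(\<lambda>n. LINT x|lborel. ch (y - ?t n *\<^sub>R x) * of_real (c * gauss x)) \<longlonglongrightarrow> (LINT x|lborel. ch y * of_real (c * gauss (x::'a)))"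
      proof (rule integral_dominated_convergence[where w = "\<lambda>x. c * gauss x"])
        show "AE x in lborel. cmod (ch (y - ?t n *\<^sub>R x) * of_real (c * gauss x)) \<le> c * gauss x" for n
          by (intro AE_I2 cb)
        show "AE x in lborel. (\<lambda>n. ch (y - ?t n *\<^sub>R x) * of_real (c * gauss x)) \<longlonglongrightarrow> ch y * of_real (c * gauss x)"
        proof (intro AE_I2 tendsto_mult tendsto_const)
          fix x
          have l: "(\<lambda>n. y - ?t n *\<^sub>R x) \<longlonglongrightarrow> y - 0 *\<^sub>R x"
            by (intro tendsto_intros LIMSEQ_inverse_real_of_nat)
          show "(\<lambda>n. ch (y - ?t n *\<^sub>R x)) \<longlonglongrightarrow> ch y"
          proof (cases "y \<in> box a b")
            case True
            then have "\<forall>\<^sub>F n in sequentially. y - ?t n *\<^sub>R x \<in> box a b"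
              using l by (intro topological_tendstoD[OF _ open_box]) auto
            then have "\<forall>\<^sub>F n in sequentially. ch (y - ?t n *\<^sub>R x) = ch y"
              by eventually_elim (use True in \<open>simp add: ch_def\<close>)
            then show ?thesis by (rule tendsto_eventually)
          next
            case False
            then have "y \<in> - cbox a b" using elim by auto
            then have "\<forall>\<^sub>F n in sequentially. y - ?t n *\<^sub>R x \<in> - cbox a b"
              using l by (intro topological_tendstoD[of _ y]) auto
            then have "\<forall>\<^sub>F n in sequentially. ch (y - ?t n *\<^sub>R x) = ch y"
            proof eventually_elim
              case (elim n)
              then have "y - ?t n *\<^sub>R x \<notin> box a b" using box_subset_cbox by blast
              then show ?case using False by (simp add: ch_def)
            qed
            then show ?thesis by (rule tendsto_eventually)
          qed
        qed
      qed (use cg in auto)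
      then have "(\<lambda>n. LINT x|lborel. ch (y - ?t n *\<^sub>R x) * of_real (c * gauss x)) \<longlonglongrightarrow> ch y * of_real (c\<^sup>2)"
        using cg_int by simp
      then show ?case by (intro tendsto_mult tendsto_const)
    qed
  qed (use f in auto)
  have \<Phi>b: "cmod (\<Phi> t z) \<le> (LINT k|lborel. cmod (fourier f k))" for t z
    unfolding \<Phi>_def
  proof (rule order_trans[OF integral_norm_bound], rule integral_mono_AE')
    show "integrable lborel (\<lambda>k. cmod (fourier f k))" using F by simp
    show "AE k in lborel. cmod (of_real (gauss (t *\<^sub>R k)) * (fourier f k * wave (- k) z)) \<le> cmod (fourier f k)"
      by (intro AE_I2 norm_gauss_wave_le)
  qed simp
  have limR: "(\<lambda>n. LINT z|lborel. ch z * \<Phi> (?t n) z) \<longlonglongrightarrow> (LINT z|lborel. ch z * (LINT k|lborel. fourier f k * wave (- k) z))"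
  proof (rule integral_dominated_convergence[where w = "\<lambda>z. cmod (ch z) * (LINT k|lborel. cmod (fourier f k))"])
    show "integrable lborel (\<lambda>z. cmod (ch z) * (LINT k|lborel. cmod (fourier f k)))" using ch_int by simp
    show "AE z in lborel. cmod (ch z * \<Phi> (?t n) z) \<le> cmod (ch z) * (LINT k|lborel. cmod (fourier f k))" for n
      unfolding norm_mult by (intro AE_I2 mult_left_mono \<Phi>b) simp
    show "AE z in lborel. (\<lambda>n. ch z * \<Phi> (?t n) z) \<longlonglongrightarrow> ch z * (LINT k|lborel. fourier f k * wave (- k) z)"
    proof (intro AE_I2 tendsto_mult tendsto_const)
      fix z
      show "(\<lambda>n. \<Phi> (?t n) z) \<longlonglongrightarrow> (LINT k|lborel. fourier f k * wave (- k) z)"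
        unfolding \<Phi>_def
      proof (rule integral_dominated_convergence[where w = "\<lambda>k. cmod (fourier f k)"])
        show "AE k in lborel. cmod (of_real (gauss (?t n *\<^sub>R k)) * (fourier f k * wave (- k) z)) \<le> cmod (fourier f k)" for n
          by (intro AE_I2 norm_gauss_wave_le)
        show "AE k in lborel. (\<lambda>n. of_real (gauss (?t n *\<^sub>R k)) * (fourier f k * wave (- k) z)) \<longlonglongrightarrow> fourier f k * wave (- k) z"
        proof (rule AE_I2)
          fix k :: 'a
          have "(\<lambda>n. gauss (?t n *\<^sub>R k)) \<longlonglongrightarrow> gauss (0 *\<^sub>R k)"
            unfolding gauss_def by (intro tendsto_intros LIMSEQ_inverse_real_of_nat) auto
          then have "(\<lambda>n. complex_of_real (gauss (?t n *\<^sub>R k)) * (fourier f k * wave (- k) z)) \<longlonglongrightarrow> of_real (gauss (0 *\<^sub>R k)) * (fourier f k * wave (- k) z)"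
            by (intro tendsto_intros)
          then show "(\<lambda>n. complex_of_real (gauss (?t n *\<^sub>R k)) * (fourier f k * wave (- k) z)) \<longlonglongrightarrow> fourier f k * wave (- k) z"
            by (simp add: gauss_def)
        qed
      qed (use F in auto)
    qed
    have "(\<lambda>z. \<Phi> t z) \<in> borel_measurable borel" for t unfolding \<Phi>_def
      by (rule lborel.borel_measurable_lebesgue_integral) (simp add: case_prod_beta')
    then show "(\<lambda>z. ch z * \<Phi> (?t n) z) \<in> borel_measurable lborel" for n by simp
    have "(\<lambda>z. LINT k|lborel. fourier f k * wave (- k) z) \<in> borel_measurable borel"
      by (rule lborel.borel_measurable_lebesgue_integral) (simp add: case_prod_beta')
    then show "(\<lambda>z. ch z * (LINT k|lborel. fourier f k * wave (- k) z)) \<in> borel_measurable lborel" by simp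
  qed
  have "(LINT z|lborel. ch z * (LINT k|lborel. fourier f k * wave (- k) z)) = (LINT y|lborel. f y * (ch y * of_real (c\<^sup>2)))"
    using LIMSEQ_unique[OF limR] limL by (simp add: main)
  also have "\<dots> = of_real (c\<^sup>2) * (LINT z|lborel. ch z * f z)"
    by (simp add: mult_ac flip: integral_mult_right_zero)
  finally show ?thesis by (simp add: ch_def)
qed

text \<open>Both sides have equal integrals over all boxes. The right-hand side is only known to be
  bounded, so the difference is compared on bounded boxes exhausting the space.\<close>

lemma fourier_inversion:
  fixes f :: "'a::euclidean_space \<Rightarrow> complex"
  assumes f: "integrable lborel f" and F: "integrable lborel (fourier f)"
  shows "AE z in lborel. of_real ((2 * pi) ^ DIM('a)) * f z = (LINT k|lborel. fourier f k * wave (- k) z)"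
proof -
  define c where "c = (sqrt (2 * pi) ^ DIM('a))\<^sup>2"
  have c: "c = (2 * pi) ^ DIM('a)"
    unfolding c_def by (simp add: power_mult[symmetric] mult.commute[of _ 2]) (simp add: power_mult)
  define G where "G z = (LINT k|lborel. fourier f k * wave (- k) z)" for z
  have [measurable]: "f \<in> borel_measurable borel" "fourier f \<in> borel_measurable borel" using f F by auto
  have Gm[measurable]: "G \<in> borel_measurable borel" unfolding G_def
    by (rule lborel.borel_measurable_lebesgue_integral) (simp add: case_prod_beta')
  have Gb: "cmod (G z) \<le> (LINT k|lborel. cmod (fourier f k))" for z
    unfolding G_def by (rule order_trans[OF integral_norm_bound]) (simp add: norm_mult)
  have box_int: "integrable lborel (\<lambda>z. indicator (box a b) z *\<^sub>R (of_real c * f z - G z))" for a b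
  proof -
    have "integrable lborel (\<lambda>z. indicator (box a b) z *\<^sub>R G z)"
    proof (rule Bochner_Integration.integrable_bound[where f = "\<lambda>z. indicator (box a b) z * (LINT k|lborel. cmod (fourier f k))"])
      have "integrable lborel (indicator (box a b) :: 'a \<Rightarrow> real)"
        by (rule integrable_real_indicator) (auto simp: emeasure_lborel_box_eq)
      then show "integrable lborel (\<lambda>z. indicator (box a b) z * (LINT k|lborel. cmod (fourier f k)))" by simp
      show "AE z in lborel. norm (indicator (box a b) z *\<^sub>R G z) \<le> norm (indicator (box a b) z * (LINT k|lborel. cmod (fourier f k)))"
        using Gb order_trans[OF Gb abs_ge_self] by (intro AE_I2) (auto simp: indicator_def)
    qed measurable
    moreover have "integrable lborel (\<lambda>z. indicator (box a b) z *\<^sub>R (of_real c * f z))"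
      using f by (intro integrable_mult_indicator) auto
    ultimately show ?thesis by (simp add: scaleR_diff_right)
  qed
  have zero: "(LINT z|lborel. indicator (box a b) z *\<^sub>R (of_real c * f z - G z)) = 0" for a b
  proof -
    have i1: "integrable lborel (\<lambda>z. indicator (box a b) z *\<^sub>R (of_real c * f z))"
      using f by (intro integrable_mult_indicator) auto
    have "integrable lborel (\<lambda>z. indicator (box a b) z *\<^sub>R (of_real c * f z) - indicator (box a b) z *\<^sub>R (of_real c * f z - G z))"
      by (intro Bochner_Integration.integrable_diff i1 box_int)
    then have i2: "integrable lborel (\<lambda>z. indicator (box a b) z *\<^sub>R G z)" by (simp add: scaleR_diff_right)
    have ind: "indicator (box a b) z *\<^sub>R w = indicator (box a b) z * w" for z and w :: complex
      by (simp add: indicator_def)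
    have "(LINT z|lborel. indicator (box a b) z *\<^sub>R (of_real c * f z - G z))
        = (LINT z|lborel. indicator (box a b) z *\<^sub>R (of_real c * f z)) - (LINT z|lborel. indicator (box a b) z *\<^sub>R G z)"
      unfolding scaleR_diff_right using i1 i2 by simp
    also have "\<dots> = 0"
      using fourier_inversion_box[OF f F, of a b] unfolding ind G_def c_def
      by (simp add: mult.left_commute[of _ "complex_of_real _"] flip: integral_mult_right_zero of_real_power)
    finally show ?thesis .
  qed
  have "AE z in lborel. \<forall>n::nat. z \<in> box (-(real n *\<^sub>R One)) (real n *\<^sub>R One) \<longrightarrow> of_real c * f z - G z = 0"
  proof (subst AE_all_countable, rule allI)
    fix n :: nat
    let ?b = "box (-(real n *\<^sub>R One)) (real n *\<^sub>R One) :: 'a set"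
    let ?h = "\<lambda>z. indicator ?b z *\<^sub>R (of_real c * f z - G z)"
    have "AE z in lebesgue. ?h z = 0"
    proof (rule AE_zero_lebesgue_if_box_integrals_zero)
      show "integrable lebesgue ?h" using box_int by (subst integrable_completion) auto
      fix a b
      obtain a' b' where ab: "box a b \<inter> ?b = box a' b'" by (rule that[OF box_Int_box])
      have "(LINT x|lebesgue. indicator (box a b) x *\<^sub>R ?h x) = (LINT x|lebesgue. indicator (box a' b') x *\<^sub>R (of_real c * f x - G x))"
        unfolding ab[symmetric] by (intro Bochner_Integration.integral_cong refl) (auto simp: indicator_def)
      also have "\<dots> = (LINT x|lborel. indicator (box a' b') x *\<^sub>R (of_real c * f x - G x))"
        by (rule integral_completion) measurable
      also have "\<dots> = 0" by (rule zero)
      finally show "(LINT x|lebesgue. indicator (box a b) x *\<^sub>R ?h x) = 0" .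
    qed
    then have "AE z in lborel. ?h z = 0" by (simp add: AE_completion_iff)
    then show "AE z in lborel. z \<in> ?b \<longrightarrow> of_real c * f z - G z = 0"
      by eventually_elim auto
  qed
  then show ?thesis
  proof eventually_elim
    case (elim z)
    have "z \<in> (\<Union>n::nat. box (-(real n *\<^sub>R One)) (real n *\<^sub>R One))" by (simp add: UN_box_eq_UNIV)
    then obtain n :: nat where "z \<in> box (-(real n *\<^sub>R One)) (real n *\<^sub>R One)" by blast
    from elim[rule_format, OF this] show ?case by (simp add: G_def c)
  qed
qed

text \<open>If a point of \<open>E\<close> is not accumulated by \<open>E\<close> from the side \<open>v\<close>, then small translates of such
  points in direction \<open>v\<close> are disjoint.\<close>

lemma negligible_one_sided_isolated:
  fixes E :: "'a::euclidean_space set"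
  assumes E: "closed E"
  shows "negligible {z \<in> E. \<exists>\<delta>>0. \<forall>t. 0 < t \<and> t < \<delta> \<longrightarrow> z + t *\<^sub>R v \<notin> E}"
proof -
  \<comment> \<open>The index m bounds the length of the free segment from below and R bounds the
    position; countably many such pieces cover the set.\<close>
  define N where "N m R = {z \<in> E \<inter> cball 0 (real R). \<forall>t. 0 < t \<and> t \<le> 1 / Suc m \<longrightarrow> z + t *\<^sub>R v \<notin> E}" for m R :: nat
  have negl: "negligible (N m R)" for m R
  proof -
    \<comment> \<open>Points from which \<open>E\<close> is reached by a step of length between the
      two parameters. These sets are closed, which makes \<open>N m R\<close> measurable.\<close>
    define D where "D j = (\<Union>z\<in>E. \<Union>y\<in>(\<lambda>t. t *\<^sub>R v) ` {1 / Suc j .. 1 / Suc m}. {z - y})" for j :: nat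
    have Dcl: "closed (D j)" for j
    proof -
      have "compact ((\<lambda>t. t *\<^sub>R v) ` {1 / real (Suc j) .. 1 / real (Suc m)})"
        by (intro compact_continuous_image continuous_intros) auto
      then show ?thesis unfolding D_def by (rule closed_compact_differences[OF E])
    qed
    have Neq: "N m R = E \<inter> cball 0 (real R) - (\<Union>j. D j)"
    proof (intro set_eqI iffI)
      fix z assume z: "z \<in> N m R"
      have "z \<notin> D j" for j
      proof
        assume "z \<in> D j"
        then obtain y t where y: "y \<in> E" "1 / Suc j \<le> t" "t \<le> 1 / Suc m" "z = y - t *\<^sub>R v" by (auto simp: D_def)
        have "0 < 1 / real (Suc j)" by simp
        then have "0 < t" using y(2) by linarith
        then have "z + t *\<^sub>R v \<notin> E" using z y(3) by (simp add: N_def)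
        then show False using y(1,4) by simp
      qed
      then show "z \<in> E \<inter> cball 0 (real R) - (\<Union>j. D j)" using z by (auto simp: N_def)
    next
      fix z assume z: "z \<in> E \<inter> cball 0 (real R) - (\<Union>j. D j)"
      have "z + t *\<^sub>R v \<notin> E" if t: "0 < t" "t \<le> 1 / Suc m" for t
      proof
        assume a: "z + t *\<^sub>R v \<in> E"
        obtain j where j: "inverse (real (Suc j)) < t" using reals_Archimedean[OF t(1)] by blast
        have "z \<in> D j"
          unfolding D_def using j t a
          by (intro UN_I[of "z + t *\<^sub>R v"] UN_I[of "t *\<^sub>R v"]) (auto simp: inverse_eq_divide)
        then show False using z by blast
      qed
      then show "z \<in> N m R" using z by (auto simp: N_def)
    qed
    have Nl: "N m R \<in> lmeasurable"
    proof -
      have "E \<inter> cball 0 (real R) \<in> lmeasurable"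
        using E by (intro lmeasurable_compact closed_Int_compact compact_cball)
      moreover have "(\<Union>j. D j) \<in> sets lebesgue" using Dcl by (intro sets.countable_UN) auto
      ultimately show ?thesis unfolding Neq by (rule fmeasurable_Diff)
    qed
    \<comment> \<open>Infinitely many distinct shift parameters not exceeding 1 / (m + 1), so that
      differences of two of them stay in the forbidden range.\<close>
    define t where "t j = 1 / (real (Suc m) * real (Suc j))" for j :: nat
    have tpos: "0 < t j" "t j \<le> 1 / Suc m" "t j \<le> 1" for j
    proof -
      show "0 < t j" by (simp add: t_def)
      have "real (Suc m) * 1 \<le> real (Suc m) * real (Suc j)" by (intro mult_left_mono) auto
      then show "t j \<le> 1 / Suc m" unfolding t_def by (intro divide_left_mono) auto
      also have "\<dots> \<le> 1" by simp
      finally show "t j \<le> 1" .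
    qed
    have tinj: "t i \<noteq> t j" if "i \<noteq> j" for i j using that by (simp add: t_def)
    let ?T = "\<lambda>j. (+) (t j *\<^sub>R v) ` N m R"
    have disj: "disjoint_family_on ?T {..<n}" for n :: nat
      unfolding disjoint_family_on_def
    proof (intro ballI impI)
      fix i j :: nat assume "i \<noteq> j"
      have *: "False" if ij: "t i < t j" and x: "x \<in> ?T i" "x \<in> ?T j" for i j x
      proof -
        obtain y y' where y: "y \<in> N m R" "y' \<in> N m R" "x = t i *\<^sub>R v + y" "x = t j *\<^sub>R v + y'" using x by blast
        have "y = y' + (t j - t i) *\<^sub>R v" using y(3,4) by (simp add: algebra_simps)
        moreover have "y' + (t j - t i) *\<^sub>R v \<notin> E"
          using y(2) ij tpos(1)[of i] tpos(2)[of j] by (simp add: N_def)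
        ultimately show False using y(1) by (simp add: N_def)
      qed
      show "?T i \<inter> ?T j = {}"
        using *[of i j] *[of j i] tinj[OF \<open>i \<noteq> j\<close>] by (cases "t i < t j") (auto simp: not_less le_less)
    qed
    \<comment> \<open>Any number of disjoint translates of equal measure fit into one ball, so that
      measure must be zero.\<close>
    have bound: "real n * measure lebesgue (N m R) \<le> measure lebesgue (cball 0 (real R + norm v) :: 'a set)" for n
    proof -
      have Tl: "?T j \<in> lmeasurable" for j using Nl by (rule measurable_translation)
      have "measure lebesgue (\<Union>j\<in>{..<n}. ?T j) = (\<Sum>j<n. measure lebesgue (?T j))"
      proof (rule measure_finite_Union)
        show "emeasure lebesgue (?T j) \<noteq> \<infinity>" for j
          unfolding infinity_ennreal_def by (rule fmeasurableD2[OF Tl])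
      qed (use fmeasurableD[OF Tl] disj in \<open>auto simp: image_subset_iff\<close>)
      also have "\<dots> = real n * measure lebesgue (N m R)" by (simp add: measure_translation)
      finally have eq: "real n * measure lebesgue (N m R) = measure lebesgue (\<Union>j\<in>{..<n}. ?T j)" by simp
      show ?thesis unfolding eq
      proof (rule measure_mono_fmeasurable)
        show "(\<Union>j\<in>{..<n}. ?T j) \<subseteq> cball 0 (real R + norm v)"
        proof
          fix x assume "x \<in> (\<Union>j\<in>{..<n}. ?T j)"
          then obtain j y where y: "y \<in> N m R" "x = t j *\<^sub>R v + y" by blast
          have "norm x \<le> norm (t j *\<^sub>R v) + norm y" unfolding y(2) by (rule norm_triangle_ineq)
          also have "norm (t j *\<^sub>R v) \<le> norm v" using tpos[of j] by (simp add: mult_left_le_one_le)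
          also have "norm y \<le> real R" using y(1) by (simp add: N_def)
          finally show "x \<in> cball 0 (real R + norm v)" by simp
        qed
      qed (use Tl in \<open>auto intro!: sets.finite_UN fmeasurableD\<close>)
    qed
    have "measure lebesgue (N m R) = 0"
    proof (rule ccontr)
      assume "measure lebesgue (N m R) \<noteq> 0"
      then have pos: "measure lebesgue (N m R) > 0" by (simp add: zero_less_measure_iff)
      obtain n :: nat where "measure lebesgue (cball 0 (real R + norm v) :: 'a set) < real n * measure lebesgue (N m R)"
        using reals_Archimedean3[OF pos] by blast
      then show False using bound[of n] by linarith
    qed
    then show ?thesis using Nl by (simp add: negligible_iff_measure)
  qed
  have "{z \<in> E. \<exists>\<delta>>0. \<forall>t. 0 < t \<and> t < \<delta> \<longrightarrow> z + t *\<^sub>R v \<notin> E} \<subseteq> (\<Union>m. \<Union>R. N m R)"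
  proof
    fix z assume "z \<in> {z \<in> E. \<exists>\<delta>>0. \<forall>t. 0 < t \<and> t < \<delta> \<longrightarrow> z + t *\<^sub>R v \<notin> E}"
    then obtain \<delta> where z: "z \<in> E" "\<delta> > 0" "\<And>t. 0 < t \<Longrightarrow> t < \<delta> \<Longrightarrow> z + t *\<^sub>R v \<notin> E" by blast
    obtain m where m: "inverse (real (Suc m)) < \<delta>" using reals_Archimedean[OF z(2)] by blast
    obtain R :: nat where R: "norm z \<le> real R" using real_arch_simple by blast
    have "z \<in> N m R" unfolding N_def using z m R by (auto simp: inverse_eq_divide)
    then show "z \<in> (\<Union>m. \<Union>R. N m R)" by blast
  qed
  then show ?thesis by (rule negligible_subset[rotated]) (intro negligible_countable_Union[of "range _"] | auto intro!: negligible_countable_Union negl)+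
qed

text \<open>If \<open>g\<close> decays exponentially, its Fourier integral is analytic along every line.\<close>

lemma fourier_integral_line:
  fixes g :: "'a::euclidean_space \<Rightarrow> complex"
  assumes g[measurable]: "g \<in> borel_measurable borel"
    and decay: "\<And>M. integrable lborel (\<lambda>k. cmod (g k) * exp (M * norm k))"
  defines "F \<equiv> \<lambda>z. LINT k|lborel. g k * wave (- k) z"
  shows "\<exists>a. \<forall>t::real. (\<lambda>m. a m * (of_real t) ^ m) sums F (z + t *\<^sub>R v)"
proof -
  \<comment> \<open>Taylor coefficients in t of the integrand at
    \<open>z + t *\<^sub>R v\<close>.\<close>
  define c where "c m k = g k * wave (- k) z * (- \<i> * of_real (k \<bullet> v)) ^ m / fact m" for m k
  have cm[measurable]: "c m \<in> borel_measurable borel" for m unfolding c_def[abs_def] by measurable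
  have nc: "cmod (c m k * of_real t ^ m) = cmod (g k) * ((\<bar>t\<bar> * \<bar>k \<bullet> v\<bar>) ^ m / fact m)" for m k t
    by (simp add: c_def norm_mult norm_divide norm_power power_mult_distrib)
  \<comment> \<open>The majorant exp(|t| |v| |k|) is integrable against \<open>g\<close> by the
    decay hypothesis; it justifies integrating the series term by term for every real t.\<close>
  have sum_le: "(\<Sum>m<n. (\<bar>t\<bar> * \<bar>k \<bullet> v\<bar>) ^ m / fact m) \<le> exp (\<bar>t\<bar> * norm v * norm k)" for n t k
  proof -
    have "(\<Sum>m<n. (\<bar>t\<bar> * \<bar>k \<bullet> v\<bar>) ^ m / fact m) = (\<Sum>m<n. (\<bar>t\<bar> * \<bar>k \<bullet> v\<bar>) ^ m /\<^sub>R fact m)"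
      by (simp add: divide_inverse mult.commute)
    also have "\<dots> \<le> (\<Sum>m. (\<bar>t\<bar> * \<bar>k \<bullet> v\<bar>) ^ m /\<^sub>R fact m)"
      by (intro sum_le_suminf sums_summable[OF exp_converges]) auto
    also have "\<dots> = exp (\<bar>t\<bar> * \<bar>k \<bullet> v\<bar>)" by (simp add: exp_def)
    also have "\<dots> \<le> exp (\<bar>t\<bar> * norm v * norm k)"
      using Cauchy_Schwarz_ineq2[of k v] by (simp add: mult.assoc mult_left_mono mult.commute[of "norm v"])
    finally show ?thesis .
  qed
  have term_le: "(\<bar>t\<bar> * \<bar>k \<bullet> v\<bar>) ^ m / fact m \<le> exp (\<bar>t\<bar> * norm v * norm k)" for m t k
  proof -
    have "(\<bar>t\<bar> * \<bar>k \<bullet> v\<bar>) ^ m / fact m \<le> (\<Sum>m<Suc m. (\<bar>t\<bar> * \<bar>k \<bullet> v\<bar>) ^ m / fact m)"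
      by (rule member_le_sum) auto
    then show ?thesis using sum_le[of t k "Suc m"] by linarith
  qed
  have int: "integrable lborel (\<lambda>k. c m k * of_real t ^ m)" for m t
  proof (rule Bochner_Integration.integrable_bound[OF decay[of "\<bar>t\<bar> * norm v"]])
    show "AE k in lborel. cmod (c m k * of_real t ^ m) \<le> norm (cmod (g k) * exp (\<bar>t\<bar> * norm v * norm k))"
    proof (rule AE_I2)
      fix k
      have "cmod (c m k * of_real t ^ m) \<le> cmod (g k) * exp (\<bar>t\<bar> * norm v * norm k)"
        unfolding nc by (intro mult_left_mono term_le norm_ge_zero)
      then show "cmod (c m k * of_real t ^ m) \<le> norm (cmod (g k) * exp (\<bar>t\<bar> * norm v * norm k))" by simp
    qed
  qed measurable
  have line: "(\<lambda>m. c m k * of_real t ^ m) sums (g k * wave (- k) (z + t *\<^sub>R v))" for k t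
  proof -
    have "(\<lambda>m. (- \<i> * of_real (k \<bullet> v) * of_real t) ^ m /\<^sub>R fact m) sums exp (- \<i> * of_real (k \<bullet> v) * of_real t)"
      by (rule exp_converges)
    then have "(\<lambda>m. g k * wave (- k) z * ((- \<i> * of_real (k \<bullet> v) * of_real t) ^ m /\<^sub>R fact m)) sums
        (g k * wave (- k) z * exp (- \<i> * of_real (k \<bullet> v) * of_real t))" by (rule sums_mult)
    moreover have "g k * wave (- k) z * ((- \<i> * of_real (k \<bullet> v) * of_real t) ^ m /\<^sub>R fact m) = c m k * of_real t ^ m" for m
    proof -
      have pm: "(- \<i> * complex_of_real (k \<bullet> v) * of_real t) ^ m = (- \<i> * complex_of_real (k \<bullet> v)) ^ m * of_real t ^ m"
        by (rule power_mult_distrib)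
      show ?thesis unfolding pm c_def by (simp only: scaleR_conv_of_real of_real_inverse of_real_fact divide_inverse mult_ac)
    qed
    moreover have "wave (- k) z * exp (- \<i> * of_real (k \<bullet> v) * of_real t) = wave (- k) (z + t *\<^sub>R v)"
      by (simp add: wave_def exp_add[symmetric] inner_add_right algebra_simps)
    ultimately show ?thesis by (simp add: mult.assoc)
  qed
  have "(\<lambda>m. (LINT k|lborel. c m k) * of_real t ^ m) sums F (z + t *\<^sub>R v)" for t
  proof -
    have "(\<lambda>m. LINT k|lborel. c m k * of_real t ^ m) sums (LINT k|lborel. (\<Sum>m. c m k * of_real t ^ m))"
    proof (rule sums_integral[OF int])
      show "AE k in lborel. summable (\<lambda>m. cmod (c m k * of_real t ^ m))"
        unfolding nc
      proof (intro AE_I2 summable_mult)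
        fix k
        show "summable (\<lambda>m. (\<bar>t\<bar> * \<bar>k \<bullet> v\<bar>) ^ m / fact m)"
          using sums_summable[OF exp_converges[of "\<bar>t\<bar> * \<bar>k \<bullet> v\<bar>"]] by (simp add: divide_inverse mult.commute)
      qed
      show "summable (\<lambda>m. LINT k|lborel. cmod (c m k * of_real t ^ m))"
      proof (rule summableI_nonneg_bounded)
        fix n
        have "(\<Sum>m<n. LINT k|lborel. cmod (c m k * of_real t ^ m)) = (LINT k|lborel. (\<Sum>m<n. cmod (c m k * of_real t ^ m)))"
          using int by (intro Bochner_Integration.integral_sum[symmetric] integrable_norm)
        also have "\<dots> \<le> (LINT k|lborel. cmod (g k) * exp (\<bar>t\<bar> * norm v * norm k))"
        proof (rule integral_mono[OF _ decay])
          show "integrable lborel (\<lambda>k. \<Sum>m<n. cmod (c m k * of_real t ^ m))"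
            using int by (intro Bochner_Integration.integrable_sum integrable_norm)
          show "(\<Sum>m<n. cmod (c m k * of_real t ^ m)) \<le> cmod (g k) * exp (\<bar>t\<bar> * norm v * norm k)" for k
            unfolding nc sum_distrib_left[symmetric] by (intro mult_left_mono sum_le) simp
        qed
        finally show "(\<Sum>m<n. LINT k|lborel. cmod (c m k * of_real t ^ m)) \<le> (LINT k|lborel. cmod (g k) * exp (\<bar>t\<bar> * norm v * norm k))" .
      qed simp
    qed
    then show ?thesis using line[of _ t] by (simp add: sums_iff F_def)
  qed
  then show ?thesis by (intro exI[of _ "\<lambda>m. LINT k|lborel. c m k"]) blast
qed

text \<open>Convergence for all real arguments gives infinite radius of convergence, hence an entire
  function. A nonzero coefficient would make its zero at the origin isolated.\<close>

lemma power_series_zero_accumulation: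
  fixes a :: "nat \<Rightarrow> complex" and G :: "real \<Rightarrow> complex"
  assumes s: "\<And>t. (\<lambda>m. a m * (of_real t) ^ m) sums G t"
    and acc: "\<And>\<delta>. \<delta> > 0 \<Longrightarrow> \<exists>t. 0 < t \<and> t < \<delta> \<and> G t = 0" and G0: "G 0 = 0"
  shows "G t = 0"
proof -
  have summ: "summable (\<lambda>m. a m * w ^ m)" for w :: complex
  proof (rule powser_inside)
    show "summable (\<lambda>m. a m * of_real (cmod w + 1) ^ m)" using s[of "cmod w + 1"] by (rule sums_summable)
    have "0 \<le> cmod w" by simp
    then show "norm w < norm (complex_of_real (cmod w + 1))" unfolding norm_of_real by linarith
  qed
  define f where "f w = (\<Sum>m. a m * w ^ m)" for w
  have f: "(\<lambda>m. a m * (w - 0) ^ m) sums f w" for w using summ[of w] by (simp add: f_def summable_sums)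
  have fG: "f (of_real t) = G t" for t using s[of t] by (simp add: f_def sums_iff)
  have "(\<lambda>m. a m * 0 ^ m) sums G 0" using s[of 0] by (simp only: of_real_0)
  from sums_unique2[OF this powser_sums_zero] have a0: "a 0 = 0" using G0 by simp
  have "a m = 0" for m
  proof (rule ccontr)
    assume am: "a m \<noteq> 0"
    then have "m > 0" using a0 by (cases m) auto
    obtain r where r: "0 < r" "\<And>z. z \<in> cball 0 r - {0} \<Longrightarrow> f z \<noteq> 0"
      by (rule powser_0_nonzero[of 1 0 a f m]) (use f fG[of 0] G0 am \<open>m > 0\<close> in auto)
    obtain t where t: "0 < t" "t < r" "G t = 0" using acc[OF r(1)] by blast
    have "f (of_real t) \<noteq> 0" using t by (intro r(2)) auto
    then show False using t(3) fG by simp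
  qed
  then have "(\<lambda>m. a m * (of_real t) ^ m) sums 0" by simp
  then show ?thesis using s[of t] sums_unique2 by blast
qed

text \<open>Directions are added one at a time. Almost every point of the positive-measure zero set
  is accumulated by it along a given direction, and analyticity on that line makes the whole line
  vanish. This gains one direction and loses only a null set.\<close>

lemma fourier_integral_zero:
  fixes g :: "'a::euclidean_space \<Rightarrow> complex"
  assumes g[measurable]: "g \<in> borel_measurable borel"
    and decay: "\<And>M. integrable lborel (\<lambda>k. cmod (g k) * exp (M * norm k))"
  defines "F \<equiv> \<lambda>z. LINT k|lborel. g k * wave (- k) z"
  assumes Z: "\<not> negligible {z. F z = 0}"
  shows "F z = 0"
proof -
  have gi: "integrable lborel (\<lambda>k. cmod (g k))" using decay[of 0] by simp
  have Fcont: "continuous_on UNIV F"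
    unfolding continuous_on_sequentially
  proof (intro allI ballI impI, elim conjE)
    fix x :: "nat \<Rightarrow> 'a" and y assume x: "x \<longlonglongrightarrow> y"
    show "(F \<circ> x) \<longlonglongrightarrow> F y"
      unfolding F_def o_def
    proof (rule integral_dominated_convergence[where w = "\<lambda>k. cmod (g k)"])
      show "AE k in lborel. (\<lambda>n. g k * wave (- k) (x n)) \<longlonglongrightarrow> g k * wave (- k) y"
        unfolding wave_def by (intro AE_I2 tendsto_intros x)
    qed (use gi in \<open>auto simp: norm_mult\<close>)
  qed
  \<comment> \<open>Base points whose whole affine subspace in the directions \<open>S\<close>
    consists of zeros. The shift by the entire span makes all lines parallel to the new direction
    share the same accumulating parameters.\<close>
  define E where "E S = {z. \<forall>x\<in>span S. F (z + x) = 0}" for S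
  have Ecl: "closed (E S)" for S
  proof -
    have "E S = (\<Inter>x\<in>span S. (\<lambda>z. F (z + x)) -` {0})" by (auto simp: E_def)
    moreover have "closed ((\<lambda>z. F (z + x)) -` {0})" for x
      by (intro closed_vimage continuous_on_compose2[OF Fcont] continuous_intros) auto
    ultimately show ?thesis by auto
  qed
  have "\<not> negligible (E S)" if "finite S" for S
    using that
  proof (induction S rule: finite_induct)
    case empty
    then show ?case using Z by (simp add: E_def)
  next
    case (insert v S)
    have "E S - {z \<in> E S. \<exists>\<delta>>0. \<forall>t. 0 < t \<and> t < \<delta> \<longrightarrow> z + t *\<^sub>R v \<notin> E S} \<subseteq> E (insert v S)"
    proof
      fix z assume z: "z \<in> E S - {z \<in> E S. \<exists>\<delta>>0. \<forall>t. 0 < t \<and> t < \<delta> \<longrightarrow> z + t *\<^sub>R v \<notin> E S}"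
      have "F (z + x + t *\<^sub>R v) = 0" if x: "x \<in> span S" for x t
      proof -
        obtain a where a: "\<forall>t::real. (\<lambda>m. a m * (of_real t) ^ m) sums F (z + x + t *\<^sub>R v)"
          using fourier_integral_line[OF g decay, of "z + x" v] unfolding F_def by blast
        show ?thesis
        proof (rule power_series_zero_accumulation[where G = "\<lambda>t. F (z + x + t *\<^sub>R v)"])
          show "(\<lambda>m. a m * (of_real t) ^ m) sums F (z + x + t *\<^sub>R v)" for t using a by blast
          show "F (z + x + 0 *\<^sub>R v) = 0" using z x by (simp add: E_def)
          fix \<delta> :: real assume "\<delta> > 0"
          then obtain t where t: "0 < t" "t < \<delta>" "z + t *\<^sub>R v \<in> E S" using z by blast
          then have "F (z + t *\<^sub>R v + x) = 0" using x by (simp add: E_def)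
          moreover have "z + t *\<^sub>R v + x = z + x + t *\<^sub>R v" by simp
          ultimately show "\<exists>t. 0 < t \<and> t < \<delta> \<and> F (z + x + t *\<^sub>R v) = 0" using t by metis
        qed
      qed
      then have "F (z + y) = 0" if y: "y \<in> span (insert v S)" for y
      proof -
        obtain k where k: "y - k *\<^sub>R v \<in> span S" using y unfolding span_breakdown_eq by blast
        have "F (z + (y - k *\<^sub>R v) + k *\<^sub>R v) = 0"
          using k \<open>\<And>x t. x \<in> span S \<Longrightarrow> F (z + x + t *\<^sub>R v) = 0\<close> by blast
        moreover have "z + (y - k *\<^sub>R v) + k *\<^sub>R v = z + y" by simp
        ultimately show ?thesis by metis
      qed
      then show "z \<in> E (insert v S)" by (simp add: E_def)
    qed
    then have "E S \<subseteq> E (insert v S) \<union> {z \<in> E S. \<exists>\<delta>>0. \<forall>t. 0 < t \<and> t < \<delta> \<longrightarrow> z + t *\<^sub>R v \<notin> E S}" by blast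
    then show ?case
      using insert.IH negligible_one_sided_isolated[OF Ecl, of S v] negligible_Un negligible_subset by blast
  qed
  from this[OF finite_Basis] have "E (Basis :: 'a set) \<noteq> {}" by force
  then obtain w where w: "w \<in> E (Basis :: 'a set)" by blast
  have "F (w + (z - w)) = 0" using w unfolding E_def span_Basis by blast
  then show ?thesis by simp
qed

text \<open>By inversion \<open>f\<close> agrees almost everywhere with the analytic Fourier
  integral, up to a nonzero constant; that integral therefore vanishes on almost all of
  \<open>X\<close>.\<close>

lemma fourier_decay_zero:
  fixes f :: "'a::euclidean_space \<Rightarrow> complex"
  assumes f: "integrable lborel f"
    and decay: "\<And>M. integrable lborel (\<lambda>k. cmod (fourier f k) * exp (M * norm k))"
    and X: "X \<in> sets borel" "\<not> negligible X" "AE z in lborel. z \<in> X \<longrightarrow> f z = 0"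
  shows "AE z in lborel. f z = 0"
proof -
  have [measurable]: "f \<in> borel_measurable borel" using f by auto
  have "integrable lborel (\<lambda>k. cmod (fourier f k))" using decay[of 0] by simp
  then have F: "integrable lborel (fourier f)" by (subst (asm) integrable_norm_iff) auto
  have inv: "AE z in lborel. of_real ((2 * pi) ^ DIM('a)) * f z = (LINT k|lborel. fourier f k * wave (- k) z)"
    by (rule fourier_inversion[OF f F])
  let ?Z = "{z. (LINT k|lborel. fourier f k * wave (- k) z) = 0}"
  have "\<not> negligible ?Z"
  proof
    assume "negligible ?Z"
    then have 1: "AE z in lebesgue. z \<notin> ?Z" by (intro AE_not_in) (simp add: negligible_iff_null_sets)
    have 2: "AE z in lebesgue. of_real ((2 * pi) ^ DIM('a)) * f z = (LINT k|lborel. fourier f k * wave (- k) z)"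
      using inv by (rule AE_completion)
    have "AE z in lebesgue. z \<notin> X"
      using 1 2 AE_completion[OF X(3)] by eventually_elim auto
    then have "negligible X" using X(1) by (simp add: negligible_iff_null_sets AE_iff_null_sets)
    then show False using X(2) by blast
  qed
  then have zero: "(LINT k|lborel. fourier f k * wave (- k) z) = 0" for z
    by (intro fourier_integral_zero decay) auto
  from inv show ?thesis by eventually_elim (simp add: zero)
qed

section \<open>The lower bound for the Dirichlet form\<close>

lemma difference_quotient:
  fixes f :: "'a::euclidean_space \<Rightarrow> 'b::real_normed_vector"
  assumes D: "\<And>z. (f has_derivative D z) (at z)" and M: "\<And>z. norm (D z e) \<le> M"
  shows "norm ((f (z + t *\<^sub>R e) - f z) /\<^sub>R t) \<le> M"
    and "((\<lambda>t. (f (z + t *\<^sub>R e) - f z) /\<^sub>R t) \<longlongrightarrow> D z e) (at 0)"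
proof -
  have lin: "D z (h *\<^sub>R e) = h *\<^sub>R D z e" for z h
    using has_derivative_bounded_linear[OF D] by (simp add: linear_simps)
  have line: "((\<lambda>s. f (z + s *\<^sub>R e)) has_derivative (\<lambda>h. D (z + s *\<^sub>R e) (h *\<^sub>R e))) (at s within S)" for s S
    by (rule has_derivative_compose[OF _ D]) (auto intro!: derivative_eq_intros)
  have M0: "0 \<le> M" using M norm_ge_zero order_trans by blast
  have "norm (f (z + t *\<^sub>R e) - f (z + 0 *\<^sub>R e)) \<le> M * norm (t - 0)"
  proof (rule differentiable_bound[of UNIV "\<lambda>s. f (z + s *\<^sub>R e)"])
    show "onorm (\<lambda>h. D (z + s *\<^sub>R e) (h *\<^sub>R e)) \<le> M" for s
      unfolding lin by (rule onorm_bound[OF M0]) (simp add: mult.commute[of M] mult_left_mono M)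
  qed (use line in auto)
  then have *: "norm (f (z + t *\<^sub>R e) - f z) \<le> M * \<bar>t\<bar>" by simp
  show "norm ((f (z + t *\<^sub>R e) - f z) /\<^sub>R t) \<le> M"
  proof (cases "t = 0")
    case False
    then have "inverse \<bar>t\<bar> * norm (f (z + t *\<^sub>R e) - f z) \<le> inverse \<bar>t\<bar> * (M * \<bar>t\<bar>)"
      by (intro mult_left_mono *) simp
    also have "\<dots> = M" using False by simp
    finally show ?thesis by simp
  qed (simp add: M0)
  have "((\<lambda>s. f (z + s *\<^sub>R e)) has_vector_derivative D z e) (at 0)"
    using line[of 0 UNIV] unfolding lin by (simp add: has_vector_derivative_def)
  then show "((\<lambda>t. (f (z + t *\<^sub>R e) - f z) /\<^sub>R t) \<longlongrightarrow> D z e) (at 0)"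
    using has_vector_derivative_at_0_lim[of "\<lambda>s. f (z + s *\<^sub>R e)"] by simp
qed

lemma integrable_continuous_compact_support:
  fixes f :: "'a::euclidean_space \<Rightarrow> 'b::{banach, second_countable_topology}"
  assumes "continuous_on UNIV f" "compact K" "\<And>z. z \<notin> K \<Longrightarrow> f z = 0"
  shows "integrable lborel f"
proof -
  have "integrable lborel (\<lambda>x. indicator K x *\<^sub>R f x)"
    using assms by (intro borel_integrable_compact) (auto intro: continuous_on_subset)
  also have "(\<lambda>x. indicator K x *\<^sub>R f x) = f" using assms(3) by (auto simp: fun_eq_iff indicator_def)
  finally show ?thesis .
qed

text \<open>Integrating by parts twice without second derivatives: one derivative is replaced by a
  difference quotient, which moves to the other factor by translation, and the step then tends to
  0.\<close>

lemma integral_cross_derivatives: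
  fixes \<phi> \<psi> :: "real^'n \<Rightarrow> complex"
  assumes \<phi>: "\<phi> \<in> test_fun \<Omega>" and \<psi>: "\<psi> \<in> test_fun \<Omega>"
  shows "(LINT z|lborel. frechet_derivative \<phi> (at z) (axis i 1) * frechet_derivative \<psi> (at z) (axis j 1))
    = (LINT z|lborel. frechet_derivative \<phi> (at z) (axis j 1) * frechet_derivative \<psi> (at z) (axis i 1))"
proof -
  let ?d = "\<lambda>\<phi> z i. frechet_derivative \<phi> (at z) (axis i 1)"
  let ?e = "axis i 1 :: real^'n"
  note c = test_fun_continuous[OF \<phi>] test_fun_continuous[OF \<psi>] test_fun_continuous_partial[OF \<phi>] test_fun_continuous_partial[OF \<psi>]
  note D\<phi> = test_fun_has_derivative[OF \<phi>] and D\<psi> = test_fun_has_derivative[OF \<psi>]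
  obtain K where K: "compact K" "\<And>z. z \<notin> K \<Longrightarrow> \<phi> z = 0" "\<And>z b. z \<notin> K \<Longrightarrow> frechet_derivative \<phi> (at z) b = 0"
    by (rule test_fun_support[OF \<phi>]) (rule that)
  obtain L where L: "compact L" "\<And>z. z \<notin> L \<Longrightarrow> \<psi> z = 0" "\<And>z b. z \<notin> L \<Longrightarrow> frechet_derivative \<psi> (at z) b = 0"
    by (rule test_fun_support[OF \<psi>]) (rule that)
  obtain M where M: "\<And>z i. cmod (?d \<phi> z i) \<le> M" by (rule test_fun_bounded[OF \<phi>]) (rule that)
  obtain M' where M': "\<And>z i. cmod (?d \<psi> z i) \<le> M'" by (rule test_fun_bounded[OF \<psi>]) (rule that)
  have i\<phi>: "integrable lborel (\<lambda>z. ?d \<phi> z j)" by (rule integrable_continuous_compact_support[OF c(3) K(1,3)])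
  have i\<psi>: "integrable lborel (\<lambda>z. ?d \<psi> z j)" by (rule integrable_continuous_compact_support[OF c(4) L(1,3)])
  have sh: "continuous_on UNIV (\<lambda>z. g (z + t *\<^sub>R ?e))" if "continuous_on UNIV g" for g :: "real^'n \<Rightarrow> complex" and t
    by (rule continuous_on_compose2[OF that]) (auto intro!: continuous_intros)
  \<comment> \<open>The derivative in direction j moves by integration by parts, the difference in
    direction i by a shift, which reverses the sign of the step.\<close>
  have eq: "(LINT z|lborel. ((\<phi> (z + t *\<^sub>R ?e) - \<phi> z) /\<^sub>R t) * ?d \<psi> z j)
      = (LINT z|lborel. ?d \<phi> z j * ((\<psi> (z + (- t) *\<^sub>R ?e) - \<psi> z) /\<^sub>R (- t)))" if t: "t \<noteq> 0" for t :: real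
  proof -
    define f where "f z = \<phi> (z + t *\<^sub>R ?e) - \<phi> z" for z
    define F where "F z h = frechet_derivative \<phi> (at (z + t *\<^sub>R ?e)) h - frechet_derivative \<phi> (at z) h" for z h
    have fD: "(f has_derivative F z) (at z)" for z
      unfolding f_def F_def
      by (intro has_derivative_diff D\<phi> has_derivative_compose[OF _ D\<phi>, where f = "\<lambda>z. z + t *\<^sub>R ?e", simplified]) (auto intro!: derivative_eq_intros)
    have fc: "continuous_on UNIV f" unfolding f_def by (intro continuous_on_diff sh c)
    have Fc: "continuous_on UNIV (\<lambda>z. F z (axis j 1))" unfolding F_def
      by (rule continuous_on_diff[OF sh[OF c(3)] c(3)])
    have zero: "(LINT z|lborel. f z * ?d \<psi> z j + F z (axis j 1) * \<psi> z) = 0"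
    proof (rule integral_directional_derivative_zero[where f = "\<lambda>z. f z * \<psi> z"
          and D = "\<lambda>z h. f z * frechet_derivative \<psi> (at z) h + F z h * \<psi> z"])
      show "((\<lambda>z. f z * \<psi> z) has_derivative (\<lambda>h. f z * frechet_derivative \<psi> (at z) h + F z h * \<psi> z)) (at z)" for z
        by (rule has_derivative_mult[OF fD D\<psi>])
      show "continuous_on UNIV (\<lambda>z. f z * ?d \<psi> z j + F z (axis j 1) * \<psi> z)"
        by (intro continuous_on_add continuous_on_mult fc Fc c)
    qed (use L in auto)
    have I1: "integrable lborel (\<lambda>z. f z * ?d \<psi> z j)"
      by (rule integrable_continuous_compact_support[OF continuous_on_mult[OF fc c(4)] L(1)]) (simp add: L)
    have I2: "integrable lborel (\<lambda>z. F z (axis j 1) * \<psi> z)"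
      by (rule integrable_continuous_compact_support[OF continuous_on_mult[OF Fc c(2)] L(1)]) (simp add: L)
    have I3: "integrable lborel (\<lambda>z. ?d \<phi> z j * \<psi> z)"
      by (rule integrable_continuous_compact_support[OF continuous_on_mult[OF c(3,2)] L(1)]) (simp add: L)
    have I4: "integrable lborel (\<lambda>z. ?d \<phi> (z + t *\<^sub>R ?e) j * \<psi> z)"
      by (rule integrable_continuous_compact_support[OF continuous_on_mult[OF sh[OF c(3)] c(2)] L(1)]) (simp add: L)
    have I5: "integrable lborel (\<lambda>z. ?d \<phi> z j * \<psi> (z + (- t) *\<^sub>R ?e))"
      by (rule integrable_continuous_compact_support[OF continuous_on_mult[OF c(3) sh[OF c(2)]] K(1)]) (simp add: K)
    have shift: "(LINT z|lborel. ?d \<phi> z j * \<psi> (z + (- t) *\<^sub>R ?e)) = (LINT z|lborel. ?d \<phi> (z + t *\<^sub>R ?e) j * \<psi> z)"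
      using lborel_integral_affine(1)[of "\<lambda>z. ?d \<phi> z j * \<psi> (z + (- t) *\<^sub>R ?e)" 1 "t *\<^sub>R ?e"] I5
      by (simp add: add.commute borel_measurable_integrable)
    have "(LINT z|lborel. f z * ?d \<psi> z j) = - (LINT z|lborel. F z (axis j 1) * \<psi> z)"
      using zero I1 I2 by (simp add: eq_neg_iff_add_eq_0)
    also have "\<dots> = (LINT z|lborel. ?d \<phi> z j * \<psi> z) - (LINT z|lborel. ?d \<phi> (z + t *\<^sub>R ?e) j * \<psi> z)"
      unfolding F_def left_diff_distrib using I3 I4 by simp
    also have "\<dots> = (LINT z|lborel. ?d \<phi> z j * (\<psi> z - \<psi> (z + (- t) *\<^sub>R ?e)))"
      unfolding right_diff_distrib shift[symmetric] using I3 I5 by simp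
    finally have 1: "(LINT z|lborel. f z * ?d \<psi> z j) = (LINT z|lborel. ?d \<phi> z j * (\<psi> z - \<psi> (z + (- t) *\<^sub>R ?e)))" .
    have "(LINT z|lborel. ((\<phi> (z + t *\<^sub>R ?e) - \<phi> z) /\<^sub>R t) * ?d \<psi> z j) = (LINT z|lborel. f z * ?d \<psi> z j) /\<^sub>R t"
      by (simp add: f_def flip: integral_scaleR_right)
    also have "\<dots> = (LINT z|lborel. (?d \<phi> z j * (\<psi> z - \<psi> (z + (- t) *\<^sub>R ?e))) /\<^sub>R t)"
      unfolding 1 by simp
    also have "\<dots> = (LINT z|lborel. ?d \<phi> z j * ((\<psi> (z + (- t) *\<^sub>R ?e) - \<psi> z) /\<^sub>R (- t)))"
      by (intro Bochner_Integration.integral_cong refl) (simp add: scaleR_conv_of_real algebra_simps)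
    finally show ?thesis .
  qed
  let ?t = "\<lambda>n. inverse (real (Suc n))"
  have t0: "filterlim ?t (at 0) sequentially" "filterlim (\<lambda>n. - ?t n) (at 0) sequentially"
  proof -
    show "filterlim ?t (at 0) sequentially" using LIMSEQ_inverse_real_of_nat by (simp add: filterlim_at)
    have "(\<lambda>n. - ?t n) \<longlonglongrightarrow> - 0" by (intro tendsto_minus LIMSEQ_inverse_real_of_nat)
    then show "filterlim (\<lambda>n. - ?t n) (at 0) sequentially" by (simp add: filterlim_at)
  qed
  have quot_m: "(\<lambda>z. (g (z + t *\<^sub>R ?e) - g z) /\<^sub>R t) \<in> borel_measurable borel" if "continuous_on UNIV g" for g :: "real^'n \<Rightarrow> complex" and t
    by (intro borel_measurable_continuous_onI continuous_on_scaleR continuous_on_const continuous_on_diff sh that)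
  have dm: "(\<lambda>z. ?d \<phi> z i) \<in> borel_measurable borel" "(\<lambda>z. ?d \<psi> z i) \<in> borel_measurable borel"
    "(\<lambda>z. ?d \<phi> z j) \<in> borel_measurable borel" "(\<lambda>z. ?d \<psi> z j) \<in> borel_measurable borel"
    using c by (auto intro: borel_measurable_continuous_onI)
  have lim1: "(\<lambda>n. LINT z|lborel. ((\<phi> (z + ?t n *\<^sub>R ?e) - \<phi> z) /\<^sub>R ?t n) * ?d \<psi> z j) \<longlonglongrightarrow> (LINT z|lborel. ?d \<phi> z i * ?d \<psi> z j)"
  proof (rule integral_dominated_convergence[where w = "\<lambda>z. M * cmod (?d \<psi> z j)"])
    show "AE z in lborel. (\<lambda>n. ((\<phi> (z + ?t n *\<^sub>R ?e) - \<phi> z) /\<^sub>R ?t n) * ?d \<psi> z j) \<longlonglongrightarrow> ?d \<phi> z i * ?d \<psi> z j"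
      by (intro AE_I2 tendsto_mult tendsto_const filterlim_compose[OF difference_quotient(2)[OF D\<phi> M] t0(1)])
    show "AE z in lborel. norm (((\<phi> (z + ?t n *\<^sub>R ?e) - \<phi> z) /\<^sub>R ?t n) * ?d \<psi> z j) \<le> M * cmod (?d \<psi> z j)" for n
      unfolding norm_mult by (intro AE_I2 mult_right_mono difference_quotient(1)[OF D\<phi> M]) simp
    show "(\<lambda>z. ((\<phi> (z + ?t n *\<^sub>R ?e) - \<phi> z) /\<^sub>R ?t n) * ?d \<psi> z j) \<in> borel_measurable lborel" for n
      using borel_measurable_times[OF quot_m[OF c(1), of "?t n"] dm(4)] by (simp only: measurable_lborel2)
    show "(\<lambda>z. ?d \<phi> z i * ?d \<psi> z j) \<in> borel_measurable lborel" using dm by simp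
    show "integrable lborel (\<lambda>z. M * cmod (?d \<psi> z j))" using i\<psi> by simp
  qed
  have lim2: "(\<lambda>n. LINT z|lborel. ?d \<phi> z j * ((\<psi> (z + (- ?t n) *\<^sub>R ?e) - \<psi> z) /\<^sub>R (- ?t n))) \<longlonglongrightarrow> (LINT z|lborel. ?d \<phi> z j * ?d \<psi> z i)"
  proof (rule integral_dominated_convergence[where w = "\<lambda>z. cmod (?d \<phi> z j) * M'"])
    show "AE z in lborel. (\<lambda>n. ?d \<phi> z j * ((\<psi> (z + (- ?t n) *\<^sub>R ?e) - \<psi> z) /\<^sub>R (- ?t n))) \<longlonglongrightarrow> ?d \<phi> z j * ?d \<psi> z i"
      by (intro AE_I2 tendsto_mult tendsto_const filterlim_compose[OF difference_quotient(2)[OF D\<psi> M'] t0(2)])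
    show "AE z in lborel. norm (?d \<phi> z j * ((\<psi> (z + (- ?t n) *\<^sub>R ?e) - \<psi> z) /\<^sub>R (- ?t n))) \<le> cmod (?d \<phi> z j) * M'" for n
      unfolding norm_mult by (intro AE_I2 mult_left_mono difference_quotient(1)[OF D\<psi> M']) simp
    show "(\<lambda>z. ?d \<phi> z j * ((\<psi> (z + (- ?t n) *\<^sub>R ?e) - \<psi> z) /\<^sub>R (- ?t n))) \<in> borel_measurable lborel" for n
      using borel_measurable_times[OF dm(3) quot_m[OF c(2), of "- ?t n"]] by (simp only: measurable_lborel2)
    show "(\<lambda>z. ?d \<phi> z j * ?d \<psi> z i) \<in> borel_measurable lborel" using dm by simp
    show "integrable lborel (\<lambda>z. cmod (?d \<phi> z j) * M')" using i\<phi> by simp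
  qed
  have "(\<lambda>n. LINT z|lborel. ((\<phi> (z + ?t n *\<^sub>R ?e) - \<phi> z) /\<^sub>R ?t n) * ?d \<psi> z j)
      = (\<lambda>n. LINT z|lborel. ?d \<phi> z j * ((\<psi> (z + (- ?t n) *\<^sub>R ?e) - \<psi> z) /\<^sub>R (- ?t n)))"
    by (intro ext eq) simp
  then show ?thesis using LIMSEQ_unique[OF lim1] lim2 by simp
qed

context landau_domain
begin

text \<open>\<open>\<parallel>(D - A) \<phi>\<parallel>\<^sup>2 - B \<parallel>\<phi>\<parallel>\<^sup>2 \<ge> \<parallel>((D - A)\<^sub>1 + \<i> (D - A)\<^sub>2) \<phi>\<parallel>\<^sup>2\<close>, because the commutator of \<open>(D - A)\<^sub>1\<close> and
  \<open>(D - A)\<^sub>2\<close> is \<open>\<i> B\<close>.\<close>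

lemma mag_form_ge_test:
  assumes \<phi>: "\<phi> \<in> test_fun \<Omega>"
  shows "B * Re (L2_inner \<Omega> \<phi> \<phi>) \<le> Re (mag_form A \<Omega> \<phi> \<phi>)"
proof -
  define p where "p i z = frechet_derivative \<phi> (at z) (axis i 1)" for i z
  define Q where "Q z = (\<chi> i. - \<i> * p i z - of_real (A z $ i) * \<phi> z)" for z
  obtain K where K': "compact K" "K \<subseteq> \<Omega>" "\<And>z. z \<notin> K \<Longrightarrow> \<phi> z = 0"
    "\<And>z b. z \<notin> K \<Longrightarrow> frechet_derivative \<phi> (at z) b = 0"
    by (rule test_fun_support[OF \<phi>]) (rule that)
  have "p i z = 0" if "z \<notin> K" for i z using K'(4)[OF that] by (simp add: p_def)
  note K = K'(1-3) this
  have pc: "continuous_on UNIV (p i)" for i unfolding p_def by (rule test_fun_continuous_partial[OF \<phi>])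
  note \<phi>c = test_fun_continuous[OF \<phi>] and D\<phi> = test_fun_has_derivative[OF \<phi>]
  have xc: "continuous_on UNIV (\<lambda>z::real^'n. complex_of_real (z $ i))" for i by (intro continuous_intros)
  have Qc: "continuous_on UNIV (\<lambda>z. Q z $ i)" for i
    unfolding Q_def vec_lambda_beta
    by (intro continuous_on_diff continuous_on_mult continuous_on_const continuous_on_of_real pc \<phi>c cont_a_nth)
  have Q0: "Q z $ i = 0" if "z \<notin> K" for z i using K that by (simp add: Q_def)
  \<comment> \<open>The derivative in direction i of z_i |\<phi>|^2, so its integral is
    zero.\<close>
  define S where "S i z = cnj (\<phi> z) * \<phi> z + of_real (z $ i) * (p i z * cnj (\<phi> z) + \<phi> z * cnj (p i z))" for i z
  have S_zero: "(LINT z|lborel. S i z) = 0" for i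
  proof -
    have "(LINT z|lborel. (of_real (z $ i) * (\<phi> z * cnj (frechet_derivative \<phi> (at z) (axis i 1)) + frechet_derivative \<phi> (at z) (axis i 1) * cnj (\<phi> z))
         + of_real (axis i (1::real) $ i) * (\<phi> z * cnj (\<phi> z)))) = 0"
    proof (rule integral_directional_derivative_zero[where f = "\<lambda>z. of_real (z $ i) * (\<phi> z * cnj (\<phi> z))"
          and D = "\<lambda>z h. of_real (z $ i) * (\<phi> z * cnj (frechet_derivative \<phi> (at z) h) + frechet_derivative \<phi> (at z) h * cnj (\<phi> z))
         + of_real (h $ i) * (\<phi> z * cnj (\<phi> z))" and e = "axis i 1"])
      show "((\<lambda>z. complex_of_real (z $ i) * (\<phi> z * cnj (\<phi> z))) has_derivative
          (\<lambda>h. of_real (z $ i) * (\<phi> z * cnj (frechet_derivative \<phi> (at z) h) + frechet_derivative \<phi> (at z) h * cnj (\<phi> z))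
         + of_real (h $ i) * (\<phi> z * cnj (\<phi> z)))) (at z)" for z
        by (intro has_derivative_mult has_derivative_cnj D\<phi> has_derivative_of_real bounded_linear_imp_has_derivative bounded_linear_vec_nth)
      show "continuous_on UNIV (\<lambda>z. of_real (z $ i) * (\<phi> z * cnj (frechet_derivative \<phi> (at z) (axis i 1)) + frechet_derivative \<phi> (at z) (axis i 1) * cnj (\<phi> z))
         + of_real (axis i (1::real) $ i) * (\<phi> z * cnj (\<phi> z)))"
        by (intro continuous_on_add continuous_on_mult continuous_on_cnj xc \<phi>c continuous_on_const test_fun_continuous_partial[OF \<phi>])
    qed (use K' in auto)
    then show ?thesis by (simp add: S_def p_def axis_def algebra_simps)
  qed
  \<comment> \<open>The interaction of the two derivatives in the plane. Its integral is real by the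
    symmetry of cross derivatives, so it contributes nothing.\<close>
  define X where "X z = p i1 z * cnj (p i2 z)" for z
  have X_real: "Im (LINT z|lborel. X z) = 0"
  proof -
    have "(LINT z|lborel. X z) = (LINT z|lborel. p i2 z * cnj (p i1 z))"
      using integral_cross_derivatives[OF \<phi> test_fun_cnj[OF \<phi>], of i1 i2]
      by (simp add: X_def p_def frechet_derivative_cnj_test_fun[OF \<phi>])
    also have "\<dots> = cnj (LINT z|lborel. X z)"
      unfolding Bochner_Integration.integral_cnj[symmetric] by (simp add: X_def mult.commute del: Bochner_Integration.integral_cnj)
    finally show ?thesis by (simp add: complex_eq_iff)
  qed
  have int: "integrable lborel g" if "continuous_on UNIV g" "\<And>z. z \<notin> K \<Longrightarrow> g z = 0" for g :: "real^'n \<Rightarrow> complex"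
    by (rule integrable_continuous_compact_support[OF that(1) K(1) that(2)])
  have intr: "integrable lborel g" if "continuous_on UNIV g" "\<And>z. z \<notin> K \<Longrightarrow> g z = 0" for g :: "real^'n \<Rightarrow> real"
    by (rule integrable_continuous_compact_support[OF that(1) K(1) that(2)])
  have IX: "integrable lborel X"
    by (rule int) (auto simp: X_def[abs_def] K intro!: continuous_on_mult continuous_on_cnj pc)
  have IS: "integrable lborel (S i)" for i
    by (rule int) (auto simp: S_def[abs_def] K intro!: continuous_on_add continuous_on_mult continuous_on_cnj pc \<phi>c xc)
  define R where "R z = (cmod (Q z $ i1 + \<i> * Q z $ i2))\<^sup>2" for z
  have IR: "integrable lborel R" "integrable lborel (\<lambda>z. (cmod (Q z $ i1))\<^sup>2)" "integrable lborel (\<lambda>z. (cmod (Q z $ i2))\<^sup>2)"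
    "integrable lborel (\<lambda>z. (cmod (\<phi> z))\<^sup>2)"
    by (rule intr; auto simp: R_def[abs_def] Q0 K intro!: continuous_on_add continuous_on_mult continuous_on_power continuous_on_norm continuous_on_const Qc \<phi>c)+
  \<comment> \<open>Pointwise form of the commutator identity. The terms linear in the potential are
    completed to the divergences \<open>S\<close>, which leaves the zero order term with factor
    B.\<close>
  have pt: "(cmod (Q z $ i1))\<^sup>2 + (cmod (Q z $ i2))\<^sup>2 = R z - 2 * Im (X z) - B / 2 * (Re (S i1 z) + Re (S i2 z)) + B * (cmod (\<phi> z))\<^sup>2" for z
  proof -
    have A1: "A z $ i1 = - (B / 2) * z $ i2" and A2: "A z $ i2 = B / 2 * z $ i1"
      using i12 by (simp_all add: Avec_def)
    show ?thesis
      unfolding R_def X_def S_def Q_def vec_lambda_beta A1 A2 cmod_power2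
      by (simp add: power2_eq_square) (simp add: field_simps)
  qed
  have "B * (LINT z|lborel. (cmod (\<phi> z))\<^sup>2) \<le> (LINT z|lborel. R z) + B * (LINT z|lborel. (cmod (\<phi> z))\<^sup>2)"
    by (simp add: R_def)
  also have "\<dots> = (LINT z|lborel. R z) - 2 * Im (LINT z|lborel. X z)
      - B / 2 * (Re (LINT z|lborel. S i1 z) + Re (LINT z|lborel. S i2 z)) + B * (LINT z|lborel. (cmod (\<phi> z))\<^sup>2)"
    by (simp add: X_real S_zero)
  also have "\<dots> = (LINT z|lborel. R z - 2 * Im (X z) - B / 2 * (Re (S i1 z) + Re (S i2 z)) + B * (cmod (\<phi> z))\<^sup>2)"
    using IR IX IS by (simp add: integral_Im integral_Re)
  also have "\<dots> = (LINT z|lborel. (cmod (Q z $ i1))\<^sup>2 + (cmod (Q z $ i2))\<^sup>2)" by (simp only: pt)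
  also have "\<dots> = (LINT z|lebesgue_on \<Omega>. (cmod (Q z $ i1))\<^sup>2 + (cmod (Q z $ i2))\<^sup>2)"
    using \<Omega> Q0 K(2) IR by (intro LINT_lebesgue_on_eq_lborel[symmetric]) (auto simp: subset_iff)
  also have "\<dots> \<le> (LINT z|lebesgue_on \<Omega>. (norm (Q z))\<^sup>2)"
  proof (rule integral_mono)
    have w: "mag_weak A \<Omega> \<phi> Q" unfolding Q_def p_def by (rule mag_weak_test_fun[OF \<phi>])
    then have QL: "Q \<in> L2 \<Omega>" by (simp add: mag_weak_def)
    then show "integrable (lebesgue_on \<Omega>) (\<lambda>z. (norm (Q z))\<^sup>2)" by (rule L2_integrable_sq)
    show "integrable (lebesgue_on \<Omega>) (\<lambda>z. (cmod (Q z $ i1))\<^sup>2 + (cmod (Q z $ i2))\<^sup>2)"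
      using QL unfolding L2_vec_iff by (intro Bochner_Integration.integrable_add L2_integrable_sq) auto
    show "(cmod (Q z $ i1))\<^sup>2 + (cmod (Q z $ i2))\<^sup>2 \<le> (norm (Q z))\<^sup>2" for z
    proof -
      have "(\<Sum>i\<in>{i1, i2}. (cmod (Q z $ i))\<^sup>2) \<le> (\<Sum>i\<in>UNIV. (cmod (Q z $ i))\<^sup>2)" by (intro sum_mono2) auto
      then show ?thesis using i12 by (simp add: norm_sq_vec)
    qed
  qed
  also have "\<dots> = Re (mag_form A \<Omega> \<phi> \<phi>)"
    using Re_mag_form[OF mag_weak_test_fun[OF \<phi>]] by (simp add: Q_def p_def)
  finally have "B * (LINT z|lborel. (cmod (\<phi> z))\<^sup>2) \<le> Re (mag_form A \<Omega> \<phi> \<phi>)" .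
  moreover have "(LINT z|lborel. (cmod (\<phi> z))\<^sup>2) = Re (L2_inner \<Omega> \<phi> \<phi>)"
    unfolding Re_L2_inner_self[OF mag_test_L2(3)[OF \<phi>]]
    using \<Omega> K IR by (intro LINT_lebesgue_on_eq_lborel[symmetric]) (auto simp: subset_iff)
  ultimately show ?thesis by simp
qed

lemma mag_form_ge:
  assumes v: "v \<in> H1_mag_0 A \<Omega>"
  shows "B * Re (L2_inner \<Omega> v v) \<le> Re (mag_form A \<Omega> v v)"
proof -
  obtain \<phi> where \<phi>: "\<forall>k. \<phi> k \<in> test_fun \<Omega>"
    "(\<lambda>k. Re (mag_form A \<Omega> (\<phi> k) (\<phi> k))) \<longlonglongrightarrow> Re (mag_form A \<Omega> v v)"
    "(\<lambda>k. Re (L2_inner \<Omega> (\<phi> k) (\<phi> k))) \<longlonglongrightarrow> Re (L2_inner \<Omega> v v)"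
    using H1_mag_0_limits[OF v] by blast
  show ?thesis
    by (rule LIMSEQ_le[OF tendsto_mult_left[OF \<phi>(3)] \<phi>(2)]) (use mag_form_ge_test \<phi>(1) in auto)
qed

end

section \<open>Comparison of Dirichlet and Neumann eigenvalues\<close>

text \<open>With c the distance to the centre, the modulus is a Gaussian in c, and |s| c \<le> B c^2
  / 4 + |s|^2 / B absorbs the exponential. The bound does not depend on z.\<close>

lemma landau_exp_bound:
  assumes B: "B > 0"
  shows "cmod (exp (landau_exp B i1 i2 \<alpha> \<xi> z)) * exp (cmod s * cmod (cnj (zeta i1 i2 z) - 2 * \<alpha> / of_real B))
    \<le> exp (B / 4 * (cmod (2 * \<alpha> / of_real B))\<^sup>2 + (cmod s)\<^sup>2 / B)"
proof -
  define c where "c = cmod (cnj (zeta i1 i2 z) - 2 * \<alpha> / of_real B)"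
  define W where "W = cmod (2 * \<alpha> / of_real B)"
  have c: "cmod (zeta i1 i2 z - 2 * cnj \<alpha> / of_real B) = c"
    unfolding c_def by (subst complex_mod_cnj[symmetric]) simp
  have W: "cmod (2 * cnj \<alpha> / of_real B) = W" by (simp add: W_def norm_mult norm_divide)
  have "(cmod (exp (landau_exp B i1 i2 \<alpha> \<xi> z)))\<^sup>2 = (exp (B / 4 * W\<^sup>2 - B / 4 * c\<^sup>2))\<^sup>2"
    using cmod_landau_sq[OF B, of i1 i2 \<alpha> \<xi> 0 z] unfolding c W
    by (simp add: landau_def rho_def flip: exp_add exp_double)
  then have E: "cmod (exp (landau_exp B i1 i2 \<alpha> \<xi> z)) = exp (B / 4 * W\<^sup>2 - B / 4 * c\<^sup>2)"
    by (rule power2_eq_imp_eq) auto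
  have "0 \<le> B / 4 * (c - 2 * cmod s / B)\<^sup>2" using B by simp
  also have "\<dots> = B / 4 * c\<^sup>2 - cmod s * c + (cmod s)\<^sup>2 / B"
    using B by (simp add: power2_eq_square field_simps)
  finally show ?thesis unfolding E by (simp add: c_def W_def flip: exp_add)
qed

context landau_domain
begin

text \<open>Summing the powers in the Landau functions against s^n / n! gives an exponential.
  Partial sums are bounded by a constant in z, so a multiple of |v| dominates them.\<close>

lemma landau_series_pairing:
  assumes v: "v \<in> L2 \<Omega>"
  shows "(\<lambda>n. s ^ n / fact n * L2_inner \<Omega> (u \<alpha> \<xi> n) v) sums
    (LINT z|lebesgue_on \<Omega>. exp (landau_exp B i1 i2 \<alpha> \<xi> z + s * (cnj (zeta i1 i2 z) - 2 * \<alpha> / of_real B)) * cnj (v z))"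
proof -
  define E where "E z = exp (landau_exp B i1 i2 \<alpha> \<xi> z)" for z
  define c where "c z = cnj (zeta i1 i2 z) - 2 * \<alpha> / of_real B" for z
  define K where "K = exp (B / 4 * (cmod (2 * \<alpha> / of_real B))\<^sup>2 + (cmod s)\<^sup>2 / B)"
  define S where "S m z = (\<Sum>n<m. s ^ n / fact n * u \<alpha> \<xi> n z)" for m z
  have S_eq: "S m z = E z * (\<Sum>n<m. (s * c z) ^ n /\<^sub>R fact n)" for m z
    unfolding S_def sum_distrib_left
    by (intro sum.cong refl) (simp add: landau_def E_def c_def power_mult_distrib scaleR_conv_of_real divide_inverse)
  have i: "integrable (lebesgue_on \<Omega>) (\<lambda>z. u \<alpha> \<xi> n z * cnj (v z))" for n
    by (rule L2_integrable_cnj[OF u_L2 v])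
  have Sm: "(\<Sum>n<m. s ^ n / fact n * L2_inner \<Omega> (u \<alpha> \<xi> n) v) = (LINT z|lebesgue_on \<Omega>. S m z * cnj (v z))" for m
    unfolding S_def L2_inner_def sum_distrib_right using i by (simp add: mult.assoc)
  have mS: "(\<lambda>z. S m z * cnj (v z)) \<in> borel_measurable (lebesgue_on \<Omega>)" for m
    unfolding S_def sum_distrib_right using i by (intro borel_measurable_sum) (simp add: mult.assoc borel_measurable_integrable)
  have lim: "(\<lambda>m. S m z * cnj (v z)) \<longlonglongrightarrow> exp (landau_exp B i1 i2 \<alpha> \<xi> z + s * c z) * cnj (v z)" for z
    using exp_converges[of "s * c z"] unfolding sums_def S_eq exp_add E_def
    by (intro tendsto_mult tendsto_const)
  have bound: "cmod (S m z) \<le> K" for m z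
  proof -
    have "cmod (\<Sum>n<m. (s * c z) ^ n /\<^sub>R fact n) \<le> (\<Sum>n<m. (cmod s * cmod (c z)) ^ n /\<^sub>R fact n)"
      by (rule order_trans[OF norm_sum]) (simp add: norm_mult norm_power)
    also have "\<dots> \<le> exp (cmod s * cmod (c z))"
      using exp_converges[of "cmod s * cmod (c z)"] unfolding sums_iff
      by (auto intro!: sum_le_suminf elim!: subst)
    finally have "cmod (S m z) \<le> cmod (E z) * exp (cmod s * cmod (c z))"
      unfolding S_eq norm_mult by (intro mult_left_mono) auto
    also have "\<dots> \<le> K" unfolding E_def c_def K_def by (rule landau_exp_bound[OF B])
    finally show ?thesis .
  qed
  show ?thesis
    unfolding sums_def Sm c_def[symmetric]
  proof (rule integral_dominated_convergence[where w = "\<lambda>z. K * cmod (v z)"])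
    show "integrable (lebesgue_on \<Omega>) (\<lambda>z. K * cmod (v z))"
      using L2_integrable[OF \<Omega>(2) v] by simp
    show "AE z in lebesgue_on \<Omega>. norm (S m z * cnj (v z)) \<le> K * cmod (v z)" for m
      by (intro AE_I2) (simp add: norm_mult mult_right_mono bound)
    show "(\<lambda>z. exp (landau_exp B i1 i2 \<alpha> \<xi> z + s * c z) * cnj (v z)) \<in> borel_measurable (lebesgue_on \<Omega>)"
      by (rule borel_measurable_LIMSEQ_metric[OF mS lim])
    show "AE z in lebesgue_on \<Omega>. (\<lambda>m. S m z * cnj (v z)) \<longlonglongrightarrow> exp (landau_exp B i1 i2 \<alpha> \<xi> z + s * c z) * cnj (v z)"
      using lim by simp
  qed (rule mS)
qed

definition gauss_weighted :: "(real^'n \<Rightarrow> complex) \<Rightarrow> real^'n \<Rightarrow> complex" where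
  "gauss_weighted v z = cnj (v z) * of_real (exp (- (B / 4) * (cmod (zeta i1 i2 z))\<^sup>2))"

definition transversal :: "real^'n \<Rightarrow> real^'n" where
  "transversal k = (\<chi> i. if i = i1 \<or> i = i2 then 0 else k $ i)"

text \<open>The generating function of the trial functions turns their pairings with \<open>v\<close> into the
  Fourier transform of \<open>cnj v\<close> times a Gaussian.\<close>

lemma landau_series_fourier:
  assumes v: "v \<in> L2 \<Omega>"
  shows "(\<lambda>n. (\<i> * Complex (k $ i1) (k $ i2) / 2) ^ n / fact n
       * L2_inner \<Omega> (u (\<i> * cnj (Complex (k $ i1) (k $ i2)) / 2) (transversal k) n) v) sums
    (of_real (exp (((k $ i1)\<^sup>2 + (k $ i2)\<^sup>2) / (2 * B))) * (LINT z|lebesgue_on \<Omega>. gauss_weighted v z * wave k z))"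
proof -
  define p q where "p = k $ i1" and "q = k $ i2"
  \<comment> \<open>With these values the terms linear in \<open>zeta\<close> and its conjugate add
    up to \<i> (p x + q y), and - 2 s \<alpha> / B = (p^2 + q^2) / (2 B) is the prefactor's
    exponent.\<close>
  let ?\<alpha> = "\<i> * cnj (Complex p q) / 2" and ?s = "\<i> * Complex p q / 2"
  have split: "k \<bullet> z = p * z $ i1 + q * z $ i2 + transversal k \<bullet> z" for z
  proof -
    have "k = p *\<^sub>R axis i1 1 + q *\<^sub>R axis i2 1 + transversal k"
      using i12 by (simp add: vec_eq_iff transversal_def axis_def p_def q_def)
    then have "k \<bullet> z = (p *\<^sub>R axis i1 1 + q *\<^sub>R axis i2 1 + transversal k) \<bullet> z" by simp
    then show ?thesis by (simp add: inner_add_left inner_axis' )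
  qed
  have e: "landau_exp B i1 i2 ?\<alpha> (transversal k) z + ?s * (cnj (zeta i1 i2 z) - 2 * ?\<alpha> / of_real B)
     = of_real ((p\<^sup>2 + q\<^sup>2) / (2 * B)) + (of_real (- (B / 4) * (cmod (zeta i1 i2 z))\<^sup>2) + \<i> * of_real (k \<bullet> z))" for z
  proof -
    have 1: "?\<alpha> * zeta i1 i2 z + ?s * cnj (zeta i1 i2 z) = \<i> * of_real (p * z $ i1 + q * z $ i2)"
      by (simp add: complex_eq_iff zeta_def) (simp add: field_simps)
    have 2: "?s * (2 * ?\<alpha> / of_real B) = - of_real ((p\<^sup>2 + q\<^sup>2) / (2 * B))"
      using B by (simp add: complex_eq_iff power2_eq_square field_simps)
    have 3: "of_real (B / 4) * (zeta i1 i2 z * cnj (zeta i1 i2 z)) = complex_of_real (B / 4 * (cmod (zeta i1 i2 z))\<^sup>2)"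
      using complex_norm_square[of "zeta i1 i2 z"] by simp
    have "landau_exp B i1 i2 a (transversal k) z + s * (cnj (zeta i1 i2 z) - 2 * a / of_real B)
      = - (of_real (B / 4) * (zeta i1 i2 z * cnj (zeta i1 i2 z))) + (a * zeta i1 i2 z + s * cnj (zeta i1 i2 z))
        + \<i> * of_real (transversal k \<bullet> z) - s * (2 * a / of_real B)" for a s
      by (simp add: landau_exp_def right_diff_distrib)
    note this[of ?\<alpha> ?s, unfolded 1 2 3]
    then show ?thesis unfolding split by (simp add: distrib_left)
  qed
  have "exp (landau_exp B i1 i2 ?\<alpha> (transversal k) z + ?s * (cnj (zeta i1 i2 z) - 2 * ?\<alpha> / of_real B)) * cnj (v z)
     = of_real (exp ((p\<^sup>2 + q\<^sup>2) / (2 * B))) * (gauss_weighted v z * wave k z)" for z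
    unfolding e exp_add gauss_weighted_def wave_def exp_of_real by (simp add: mult_ac)
  then show ?thesis
    using landau_series_pairing[OF v, of ?s ?\<alpha> "transversal k"] by (simp add: p_def q_def)
qed

lemma inj_level: "level m \<xi> = level n \<xi> \<longleftrightarrow> m = n"
  using B by (auto simp: level_def)

lemma transversal_0: "transversal k $ i1 = 0" "transversal k $ i2 = 0"
  by (simp_all add: transversal_def)

text \<open>The constant is uniform in \<alpha> and \<xi>: only the normalising factor of
  \<open>cmod_landau_sq\<close> grows, and its exponent is what the Gaussian weight of the
  generating function has to beat.\<close>

lemma L2_inner_landau_bound:
  assumes v: "v \<in> L2 \<Omega>"
  obtains C where "C \<ge> 0" "\<And>\<alpha> \<xi>. cmod (L2_inner \<Omega> (u \<alpha> \<xi> n) v) \<le> C * exp (B / 4 * (cmod (2 * \<alpha> / of_real B))\<^sup>2)"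
proof -
  obtain C where C: "\<And>s. s \<ge> 0 \<Longrightarrow> \<bar>rho (B / 2) n s\<bar> \<le> C"
    by (rule rho_bounded[of "B / 2" n]) (use B in \<open>auto intro: that\<close>)
  have C0: "C \<ge> 0" using C[of 0] by simp
  define I where "I = (LINT z|lebesgue_on \<Omega>. cmod (v z))"
  have iv: "integrable (lebesgue_on \<Omega>) (\<lambda>z. cmod (v z))" using L2_integrable[OF \<Omega>(2) v] by simp
  have "cmod (L2_inner \<Omega> (u \<alpha> \<xi> n) v) \<le> (sqrt C * I) * exp (B / 4 * (cmod (2 * \<alpha> / of_real B))\<^sup>2)" for \<alpha> \<xi>
  proof -
    let ?e = "exp (B / 4 * (cmod (2 * \<alpha> / of_real B))\<^sup>2)"
    define K where "K = sqrt C * ?e"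
    have ub: "cmod (u \<alpha> \<xi> n z) \<le> K" for z
      unfolding K_def
    proof (rule power2_le_imp_le)
      have W: "cmod (2 * cnj \<alpha> / of_real B) = cmod (2 * \<alpha> / of_real B)" by (simp add: norm_mult norm_divide)
      have "(cmod (u \<alpha> \<xi> n z))\<^sup>2 \<le> exp (B / 2 * (cmod (2 * \<alpha> / of_real B))\<^sup>2) * C"
        unfolding cmod_landau_sq[OF B] W using C[of "(cmod (zeta i1 i2 z - 2 * cnj \<alpha> / of_real B))\<^sup>2"]
        by (intro mult_left_mono) auto
      also have "\<dots> = (sqrt C * ?e)\<^sup>2"
        using C0 by (simp add: power_mult_distrib flip: exp_double)
      finally show "(cmod (u \<alpha> \<xi> n z))\<^sup>2 \<le> (sqrt C * ?e)\<^sup>2" .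
    qed (use C0 in simp)
    have "cmod (L2_inner \<Omega> (u \<alpha> \<xi> n) v) \<le> (LINT z|lebesgue_on \<Omega>. K * cmod (v z))"
      unfolding L2_inner_def
      by (rule Bochner_Integration.integral_norm_bound_integral)
        (use iv L2_integrable_cnj[OF u_L2 v] in \<open>auto simp: norm_mult intro!: mult_right_mono ub\<close>)
    also have "\<dots> = (sqrt C * I) * ?e" using iv by (simp add: I_def K_def)
    finally show ?thesis .
  qed
  moreover have "sqrt C * I \<ge> 0" using C0 by (simp add: I_def)
  ultimately show ?thesis using that by blast
qed

end

section \<open>Dirichlet eigenfunctions that also solve the Neumann equation vanish\<close>

lemma lebesgue_integrable_borel_version:
  fixes g :: "'a::euclidean_space \<Rightarrow> complex"
  assumes g: "integrable lebesgue g"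
  obtains f where "integrable lborel f" "AE z in lebesgue. g z = f z"
proof -
  have "(\<lambda>z. Re (g z)) \<in> borel_measurable lebesgue" "(\<lambda>z. Im (g z)) \<in> borel_measurable lebesgue"
    using g by auto
  then obtain r i where [measurable]: "r \<in> borel_measurable lborel" "i \<in> borel_measurable lborel"
    and ri: "AE z in lborel. Re (g z) = r z" "AE z in lborel. Im (g z) = i z"
    using completion_ex_borel_measurable_real[of "\<lambda>z. Re (g z)" lborel] completion_ex_borel_measurable_real[of "\<lambda>z. Im (g z)" lborel] by blast
  define f where "f z = of_real (r z) + \<i> * of_real (i z)" for z
  have fm [measurable]: "f \<in> borel_measurable lborel" unfolding f_def[abs_def] by measurable
  have "AE z in lborel. g z = f z" using ri by eventually_elim (simp add: f_def complex_eq_iff)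
  then have ae: "AE z in lebesgue. g z = f z" by (rule AE_completion)
  have "integrable lebesgue f"
    using integrable_cong_AE_imp[OF g measurable_completion[OF fm]] ae by (simp add: eq_commute)
  then have "integrable lborel f" using integrable_completion[OF fm] by simp
  then show ?thesis using ae by (rule that)
qed

lemma gauss_scaled_integrable:
  assumes "c > 0"
  shows "integrable lborel (\<lambda>k::'a::euclidean_space. exp (- c * (norm k)\<^sup>2))"
proof -
  have "integrable lborel (\<lambda>k::'a. gauss (0 + sqrt (2 * c) *\<^sub>R k))"
    using lborel_integral_affine(2)[of "gauss :: 'a \<Rightarrow> real" "sqrt (2 * c)" 0] gauss_integrable[where 'a = 'a] assms by simp
  then show ?thesis using assms by (simp add: gauss_def power_mult_distrib)
qed

text \<open>The situation to be excluded: \<open>v\<close> lies in the small form domain but solves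
  the eigenvalue equation against the large one. Extended by zero it would satisfy both boundary
  conditions at once.\<close>

locale dirichlet_eigenfunction = landau_domain B i1 i2 \<Omega>
  for B and i1 i2 :: "'n::finite" and \<Omega> +
  fixes v :: "real^'n \<Rightarrow> complex" and \<mu> :: real
  assumes v0: "v \<in> H1_mag_0 A \<Omega>"
    and N: "\<And>w. w \<in> H1_mag A \<Omega> \<Longrightarrow> mag_form A \<Omega> v w = of_real \<mu> * L2_inner \<Omega> v w"
begin

lemma vL2: "v \<in> L2 \<Omega>"
  using v0 H1_mag_0_subset H1_mag_L2 by blast

definition FT :: "real^'n \<Rightarrow> complex" where
  "FT k = (LINT z|lebesgue_on \<Omega>. gauss_weighted v z * wave k z)"

text \<open>Orthogonality kills every coefficient of the generating series, and the exponential
  prefactor is not zero.\<close>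

lemma FT_zero:
  assumes "\<And>n. level n (transversal k) \<noteq> \<mu>"
  shows "FT k = 0"
proof -
  have "L2_inner \<Omega> (u \<alpha> (transversal k) n) v = 0" for \<alpha> n
    by (rule orthogonal_to_landau[OF transversal_0 v0 N assms])
  then have "(\<lambda>n. 0 :: complex) sums (of_real (exp (((k $ i1)\<^sup>2 + (k $ i2)\<^sup>2) / (2 * B))) * FT k)"
    using landau_series_fourier[OF vL2, of k] by (simp add: FT_def)
  then have "of_real (exp (((k $ i1)\<^sup>2 + (k $ i2)\<^sup>2) / (2 * B))) * FT k = 0"
    by (rule sums_unique2[OF _ sums_zero])
  then show ?thesis by simp
qed

lemma FT_level:
  assumes n: "level n (transversal k) = \<mu>"
  shows "of_real (exp (((k $ i1)\<^sup>2 + (k $ i2)\<^sup>2) / (2 * B))) * FT k = (\<i> * Complex (k $ i1) (k $ i2) / 2) ^ n / fact n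
     * L2_inner \<Omega> (u (\<i> * cnj (Complex (k $ i1) (k $ i2)) / 2) (transversal k) n) v"
proof -
  have z: "L2_inner \<Omega> (u \<alpha> (transversal k) m) v = 0" if "m \<noteq> n" for \<alpha> m
    by (rule orthogonal_to_landau[OF transversal_0 v0 N]) (use that n inj_level in auto)
  define f where "f m = (\<i> * Complex (k $ i1) (k $ i2) / 2) ^ m / fact m
     * L2_inner \<Omega> (u (\<i> * cnj (Complex (k $ i1) (k $ i2)) / 2) (transversal k) m) v" for m
  have "f sums (\<Sum>m\<in>{n}. f m)" by (rule sums_finite) (simp_all add: f_def z)
  then have "f sums f n" by simp
  with landau_series_fourier[OF vL2, of k, folded FT_def f_def] show ?thesis
    unfolding f_def[symmetric] by (rule sums_unique2)
qed

text \<open>At most one term of the series survives. Its growth exp(r^2 / (4 B)), up to a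
  polynomial, is beaten by the prefactor exp(r^2 / (2 B)); half of the difference absorbs the
  polynomial and exp(M r), and the other half remains.\<close>

lemma FT_decay_plane:
  assumes dim: "\<forall>i. i = i1 \<or> i = i2"
  shows "\<exists>K. \<forall>k. cmod (FT k) * exp (M * norm k) \<le> K * exp (- (1 / (8 * B)) * (norm k)\<^sup>2)"
proof -
  have transversal: "transversal k = 0" for k using dim by (auto simp: transversal_def vec_eq_iff)
  have nk: "(norm k)\<^sup>2 = (k $ i1)\<^sup>2 + (k $ i2)\<^sup>2" for k :: "real^'n"
  proof -
    have U: "UNIV = {i1, i2}" using dim by auto
    have "(norm k)\<^sup>2 = (\<Sum>i\<in>UNIV. (k $ i)\<^sup>2)" unfolding power2_norm_eq_inner inner_vec_def by (simp add: power2_eq_square)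
    then show ?thesis unfolding U using i12 by simp
  qed
  have cm: "cmod (Complex (k $ i1) (k $ i2)) = norm k" for k :: "real^'n"
    by (simp only: cmod_def complex.sel nk[symmetric] real_sqrt_abs abs_norm_cancel)
  show ?thesis
  proof (cases "\<exists>n. level n 0 = \<mu>")
    case True
    then obtain n where n: "level n 0 = \<mu>" by blast
    obtain C where C: "C \<ge> 0" "\<And>\<alpha> \<xi>. cmod (L2_inner \<Omega> (u \<alpha> \<xi> n) v) \<le> C * exp (B / 4 * (cmod (2 * \<alpha> / of_real B))\<^sup>2)"
      by (rule L2_inner_landau_bound[OF vL2]) (rule that)
    obtain D where D: "D > 0" "\<And>s::real. s \<ge> 0 \<Longrightarrow> s ^ n * exp (- 1 * s) \<le> D"
      by (rule power_exp_bounded[of 1 n]) (simp, rule that)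
    \<comment> \<open>The summand 1 / 2 accounts for exp(r / 2), which bounds the n-th power of r /
      2 up to the constant \<open>D\<close>.\<close>
    define m where "m = \<bar>M\<bar> + 1 / 2"
    have "cmod (FT k) * exp (M * norm k) \<le> C * D * exp (2 * B * m\<^sup>2) * exp (- (1 / (8 * B)) * (norm k)\<^sup>2)" for k
    proof -
      let ?r = "norm k"
      let ?\<alpha> = "\<i> * cnj (Complex (k $ i1) (k $ i2)) / 2"
      have w: "cmod (2 * ?\<alpha> / of_real B) = ?r / B"
        using B by (simp add: norm_mult norm_divide cm del: complex_cnj)
      have "exp (?r\<^sup>2 / (2 * B)) * cmod (FT k) = cmod (of_real (exp (((k $ i1)\<^sup>2 + (k $ i2)\<^sup>2) / (2 * B))) * FT k)"
        by (simp add: norm_mult nk)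
      also have "\<dots> = (?r / 2) ^ n / fact n * cmod (L2_inner \<Omega> (u ?\<alpha> (transversal k) n) v)"
        unfolding FT_level[OF n[folded transversal[of k]]] by (simp add: norm_mult norm_divide norm_power cm)
      also have "\<dots> \<le> (D * exp (?r / 2)) * (C * exp (B / 4 * (?r / B)\<^sup>2))"
      proof (rule mult_mono)
        have "(?r / 2) ^ n / fact n \<le> (?r / 2) ^ n / 1" by (intro divide_left_mono) auto
        also have "\<dots> = ((?r / 2) ^ n * exp (- 1 * (?r / 2))) * exp (?r / 2)" by (simp add: exp_minus)
        also have "\<dots> \<le> D * exp (?r / 2)" by (intro mult_right_mono D) auto
        finally show "(?r / 2) ^ n / fact n \<le> D * exp (?r / 2)" .
        show "cmod (L2_inner \<Omega> (u ?\<alpha> (transversal k) n) v) \<le> C * exp (B / 4 * (?r / B)\<^sup>2)"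
          using C(2)[of ?\<alpha> "transversal k"] unfolding w .
      qed (use D C in auto)
      finally have 1: "exp (?r\<^sup>2 / (2 * B)) * cmod (FT k) \<le> C * D * exp (?r / 2 + ?r\<^sup>2 / (4 * B))"
        using B by (simp add: exp_add power_divide power2_eq_square mult_ac)
      have "cmod (FT k) * exp (M * ?r) = (exp (?r\<^sup>2 / (2 * B)) * cmod (FT k)) * exp (M * ?r - ?r\<^sup>2 / (2 * B))"
        by (simp add: exp_diff)
      also have "\<dots> \<le> (C * D * exp (?r / 2 + ?r\<^sup>2 / (4 * B))) * exp (M * ?r - ?r\<^sup>2 / (2 * B))"
        by (intro mult_right_mono 1) simp
      also have "\<dots> = C * D * exp (?r / 2 + ?r\<^sup>2 / (4 * B) + (M * ?r - ?r\<^sup>2 / (2 * B)))" by (simp only: exp_add mult.assoc)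
      also have "\<dots> \<le> C * D * exp (2 * B * m\<^sup>2 + (- (1 / (8 * B)) * ?r\<^sup>2))"
      proof -
        \<comment> \<open>Completing the square for m r \<le> r^2 / (8 B) + 2 B m^2.\<close>
        have "0 \<le> (?r - 4 * B * m)\<^sup>2 / (8 * B)" using B by simp
        also have "\<dots> = ?r\<^sup>2 / (8 * B) - m * ?r + 2 * B * m\<^sup>2"
          using B by (simp add: power2_eq_square field_simps)
        finally have "m * ?r \<le> ?r\<^sup>2 / (8 * B) + 2 * B * m\<^sup>2" by simp
        moreover have "?r / 2 + M * ?r \<le> m * ?r"
          by (simp add: m_def distrib_right mult_right_mono)
        moreover have "?r\<^sup>2 / (4 * B) = 2 * (?r\<^sup>2 / (8 * B))" "?r\<^sup>2 / (2 * B) = 4 * (?r\<^sup>2 / (8 * B))" using B by simp_all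
        ultimately have "?r / 2 + ?r\<^sup>2 / (4 * B) + (M * ?r - ?r\<^sup>2 / (2 * B)) \<le> 2 * B * m\<^sup>2 + (- (1 / (8 * B)) * ?r\<^sup>2)"
          by simp
        then show ?thesis using C D by (intro mult_left_mono) auto
      qed
      finally show ?thesis by (simp only: exp_add mult.assoc)
    qed
    then show ?thesis by blast
  next
    case False
    then have "FT k = 0" for k by (intro FT_zero) (auto simp: transversal)
    then show ?thesis by (intro exI[of _ 0]) simp
  qed
qed

text \<open>For fixed n the level of a frequency equals \<open>\<mu>\<close> only if its third
  component is plus or minus one number. Countably many hyperplanes form a null set, and off them
  \<open>FT_zero\<close> applies.\<close>

lemma FT_zero_space:
  assumes i3: "i3 \<noteq> i1" "i3 \<noteq> i2" and dim: "\<forall>i. i = i1 \<or> i = i2 \<or> i = i3"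
  shows "AE k in lborel. FT k = 0"
proof -
  let ?c = "\<lambda>n. sqrt (\<mu> - B * (2 * real n + 1))"
  have "AE k in lborel. \<forall>n. k \<bullet> axis i3 (1::real) \<noteq> ?c n \<and> k \<bullet> axis i3 1 \<noteq> - ?c n"
    unfolding AE_all_countable by (intro allI AE_conjI AE_lborel_inner_neq) auto
  then show ?thesis
  proof eventually_elim
    case (elim k)
    have "transversal k = (k $ i3) *\<^sub>R axis i3 1"
      using i3 dim by (auto simp: vec_eq_iff transversal_def axis_def)
    then have "(norm (transversal k))\<^sup>2 = (k $ i3)\<^sup>2" by simp
    moreover have "k $ i3 \<noteq> ?c n \<and> k $ i3 \<noteq> - ?c n" for n using elim by (simp add: inner_axis)
    moreover have "\<bar>k $ i3\<bar> = ?c n" if "(k $ i3)\<^sup>2 = \<mu> - B * (2 * real n + 1)" for n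
      unfolding that[symmetric] by simp
    ultimately have "level n (transversal k) \<noteq> \<mu>" for n
      unfolding level_def by (smt (verit))
    then show ?case by (rule FT_zero)
  qed
qed

text \<open>The function \<open>gauss_weighted v\<close>, extended by zero, has rapidly decaying
  Fourier transform in both dimensions and vanishes off \<Omega>. The Gaussian factor is positive,
  so \<open>v\<close> vanishes along with it.\<close>

lemma eigenfunction_trivial:
  assumes dim: "(\<forall>i. i = i1 \<or> i = i2) \<or> (\<exists>i3. i3 \<noteq> i1 \<and> i3 \<noteq> i2 \<and> (\<forall>i. i = i1 \<or> i = i2 \<or> i = i3))"
  shows "Re (L2_inner \<Omega> v v) = 0"
proof -
  define g where "g z = indicator \<Omega> z *\<^sub>R gauss_weighted v z" for z
  have \<Omega>s: "\<Omega> \<in> sets lebesgue" using \<Omega>(2) by (rule fmeasurableD)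
  have "gauss_weighted v \<in> L2 \<Omega>"
    unfolding gauss_weighted_def[abs_def]
  proof (rule L2_mult_bounded[OF L2_cnj[OF vL2]])
    show "(\<lambda>z. complex_of_real (exp (- (B / 4) * (cmod (zeta i1 i2 z))\<^sup>2))) \<in> borel_measurable (lebesgue_on \<Omega>)"
      by (intro measurable_restrict_space1 measurable_completion)
        (simp, intro borel_measurable_continuous_onI continuous_intros continuous_on_zeta, simp)
    show "cmod (complex_of_real (exp (- (B / 4) * (cmod (zeta i1 i2 z))\<^sup>2))) \<le> 1" for z using B by simp
  qed
  then have "integrable (lebesgue_on \<Omega>) (gauss_weighted v)" by (rule L2_integrable[OF \<Omega>(2)])
  then have gi: "integrable lebesgue g"
    unfolding g_def[abs_def] using \<Omega>s by (simp add: integrable_restrict_space)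
  obtain f where f: "integrable lborel f" and gf: "AE z in lebesgue. g z = f z"
    by (rule lebesgue_integrable_borel_version[OF gi]) (rule that)
  have fb [measurable]: "f \<in> borel_measurable borel" using f by auto
  have F: "fourier f k = FT k" for k
  proof -
    have wm [measurable]: "wave k \<in> borel_measurable borel"
      by (rule wave_measurable[where f = "\<lambda>_. k" and g = "\<lambda>x. x" and M = borel]) simp_all
    have "FT k = (LINT z|lebesgue. indicator \<Omega> z *\<^sub>R (gauss_weighted v z * wave k z))"
      unfolding FT_def using \<Omega>s by (intro integral_restrict_space) auto
    also have "\<dots> = (LINT z|lebesgue. f z * wave k z)"
    proof (rule integral_cong_AE)
      have wl: "wave k \<in> borel_measurable lebesgue" by (rule measurable_completion) simp
      have fl: "f \<in> borel_measurable lebesgue" by (rule measurable_completion) simp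
      show "(\<lambda>z. f z * wave k z) \<in> borel_measurable lebesgue" by (rule borel_measurable_times[OF fl wl])
      have "(\<lambda>z. g z * wave k z) \<in> borel_measurable lebesgue"
        by (rule borel_measurable_times[OF borel_measurable_integrable[OF gi] wl])
      then show "(\<lambda>z. indicator \<Omega> z *\<^sub>R (gauss_weighted v z * wave k z)) \<in> borel_measurable lebesgue"
        by (simp add: g_def)
      show "AE z in lebesgue. indicator \<Omega> z *\<^sub>R (gauss_weighted v z * wave k z) = f z * wave k z"
        using gf by eventually_elim (metis g_def mult_scaleR_left)
    qed
    also have "\<dots> = (LINT z|lborel. f z * wave k z)" by (rule integral_completion) simp
    finally show ?thesis by (simp add: fourier_def)
  qed
  have decay: "integrable lborel (\<lambda>k. cmod (fourier f k) * exp (M * norm k))" for M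
    using dim
  proof
    assume "\<forall>i. i = i1 \<or> i = i2"
    then obtain K where K: "\<And>k. cmod (FT k) * exp (M * norm k) \<le> K * exp (- (1 / (8 * B)) * (norm k)\<^sup>2)"
      using FT_decay_plane by blast
    show ?thesis
    proof (rule Bochner_Integration.integrable_bound)
      show "integrable lborel (\<lambda>k::real^'n. K * exp (- (1 / (8 * B)) * (norm k)\<^sup>2))"
        using B by (intro integrable_mult_right gauss_scaled_integrable) simp
      show "AE k in lborel. norm (cmod (fourier f k) * exp (M * norm k)) \<le> norm (K * exp (- (1 / (8 * B)) * (norm k)\<^sup>2))"
        unfolding F by (intro AE_I2) (use K in \<open>simp add: order_trans[OF _ abs_ge_self]\<close>)
    qed measurable
  next
    assume "\<exists>i3. i3 \<noteq> i1 \<and> i3 \<noteq> i2 \<and> (\<forall>i. i = i1 \<or> i = i2 \<or> i = i3)"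
    then have z: "AE k in lborel. fourier f k = 0" unfolding F using FT_zero_space by blast
    show ?thesis
      by (rule integrable_cong_AE_imp[where g = "\<lambda>_. 0"]) (use z in \<open>auto elim: eventually_mono\<close>)
  qed
  \<comment> \<open>Otherwise the whole space would have finite measure.\<close>
  have "\<not> negligible (- \<Omega>)"
  proof
    assume "negligible (- \<Omega>)"
    then have "- \<Omega> \<in> lmeasurable" by (rule negligible_imp_measurable)
    then have "\<Omega> \<union> - \<Omega> \<in> lmeasurable" using \<Omega>(2) by (rule fmeasurable.Un[rotated])
    then show False by simp
  qed
  moreover have "- \<Omega> \<in> sets borel" using \<Omega>(1) by auto
  moreover have "AE z in lborel. z \<in> - \<Omega> \<longrightarrow> f z = 0"
  proof -
    have "AE z in lebesgue. z \<in> - \<Omega> \<longrightarrow> f z = 0" using gf by eventually_elim (auto simp: g_def)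
    then show ?thesis by (simp only: AE_completion_iff)
  qed
  ultimately have "AE z in lborel. f z = 0" by (intro fourier_decay_zero[OF f decay])
  then have "AE z in lebesgue. f z = 0" by (rule AE_completion)
  with gf have "AE z in lebesgue. z \<in> \<Omega> \<longrightarrow> v z = 0"
    by eventually_elim (auto simp: g_def gauss_weighted_def)
  then have "AE z in lebesgue_on \<Omega>. v z = 0" using \<Omega>s by (simp add: AE_restrict_space_iff)
  then have "L2_inner \<Omega> v v = 0"
    unfolding L2_inner_def by (intro integral_eq_zero_AE) (auto elim: eventually_mono)
  then show ?thesis by simp
qed

end

section \<open>The comparison on a domain with compact embedding\<close>

locale landau_domain_compact = landau_domain B i1 i2 \<Omega>
  for B and i1 i2 :: "'n::finite" and \<Omega> +
  assumes emb: "compact_embedding A \<Omega>"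
    and dim: "(\<forall>i. i = i1 \<or> i = i2) \<or> (\<exists>i3. i3 \<noteq> i1 \<and> i3 \<noteq> i2 \<and> (\<forall>i. i = i1 \<or> i = i2 \<or> i = i3))"
begin

sublocale D: compact_form_fun "H1_mag_0 A \<Omega>" \<Omega> "mag_form A \<Omega>"
  using compact_form_D[OF emb] H1_mag_0_subset H1_mag_L2
  by (auto simp: compact_form_fun_def compact_form_fun_axioms_def)

sublocale N: compact_form_fun "H1_mag A \<Omega>" \<Omega> "mag_form A \<Omega>"
  using compact_form_N[OF emb] H1_mag_L2
  by (auto simp: compact_form_fun_def compact_form_fun_axioms_def)

text \<open>Filonov's argument with the Dirichlet eigenvectors, a Landau function of negative excess
  and the triviality of common eigenfunctions. Energies need only be at most the level, so a
  Dirichlet eigenvalue equal to it is allowed while the conclusion stays strict.\<close>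

lemma neumann_eval_less:
  assumes \<xi>: "\<xi> $ i1 = 0" "\<xi> $ i2 = 0" and le: "\<And>i. i < j \<Longrightarrow> D.eval i \<le> level n \<xi>"
  shows "N.eval j < level n \<xi>"
proof -
  obtain \<alpha> where \<alpha>: "Re (mag_form A \<Omega> (u \<alpha> \<xi> n) (u \<alpha> \<xi> n)) < level n \<xi> * Re (L2_inner \<Omega> (u \<alpha> \<xi> n) (u \<alpha> \<xi> n))"
    using landau_negative[OF \<xi>] by blast
  show ?thesis
  proof (rule N.eval_less[where VD = "H1_mag_0 A \<Omega>" and f = D.evec and l = D.eval])
    show "fscale.subspace (H1_mag_0 A \<Omega>)" by (rule subspace_H1_mag_0)
    show "u \<alpha> \<xi> n \<in> H1_mag A \<Omega>" by (rule landau_H1_mag[OF \<xi>])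
    show "mag_form A \<Omega> (u \<alpha> \<xi> n) v = of_real (level n \<xi>) * L2_inner \<Omega> (u \<alpha> \<xi> n) v" if "v \<in> H1_mag_0 A \<Omega>" for v
      by (rule landau_form[OF \<xi> that])
    show "N.h.q (u \<alpha> \<xi> n) < level n \<xi> * N.ip.q (u \<alpha> \<xi> n)" by (rule \<alpha>)
    show "N.ip.q v = 0" if "v \<in> H1_mag_0 A \<Omega>"
      "\<And>w. w \<in> H1_mag A \<Omega> \<Longrightarrow> mag_form A \<Omega> v w = of_real (level n \<xi>) * L2_inner \<Omega> v w" for v
    proof -
      interpret dirichlet_eigenfunction B i1 i2 \<Omega> v "level n \<xi>" by unfold_locales (use that in auto)
      show ?thesis by (rule eigenfunction_trivial[OF dim])
    qed
    show "mag_form A \<Omega> (D.evec i) v = of_real (D.eval i) * L2_inner \<Omega> (D.evec i) v" if "v \<in> H1_mag_0 A \<Omega>" for i v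
      using D.evec_eigen[of i] that by (simp add: D.eigen_def)
  qed (use H1_mag_0_subset D.evec_V D.evec_orthonormal le in auto)
qed

lemma eigenvalue_count_less:
  assumes j: "eigenvalue_count \<Omega> (H_D A \<Omega>) {..level n 0} = enat j"
  shows "enat (j + 1) \<le> eigenvalue_count \<Omega> (H_N A \<Omega>) {..<level n 0}"
proof -
  let ?\<mu> = "level n 0"
  have "card {i. D.eval i \<le> ?\<mu>} = j"
    using j D.eigenvalue_count_form_op[of "{..?\<mu>}"] D.finite_eval_le by (simp add: H_D_def)
  \<comment> \<open>By monotonicity the \<open>j\<close> indices with value at most the level are
    the initial ones.\<close>
  have le: "D.eval i \<le> ?\<mu>" if "i < j" for i
  proof (rule ccontr)
    assume "\<not> D.eval i \<le> ?\<mu>"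
    then have "{i. D.eval i \<le> ?\<mu>} \<subseteq> {..<i}"
      using D.mono_eval by (force simp: not_less dest: monoD)
    then have "card {i. D.eval i \<le> ?\<mu>} \<le> i" using card_mono[of "{..<i}" "{i. D.eval i \<le> ?\<mu>}"] by simp
    then show False using \<open>card _ = j\<close> that by simp
  qed
  have "N.eval j < ?\<mu>" by (rule neumann_eval_less) (use le in auto)
  then have "{..j} \<subseteq> {i. N.eval i < ?\<mu>}"
    using N.mono_eval by (auto dest: monoD intro: le_less_trans)
  moreover have fin: "finite {i. N.eval i < ?\<mu>}"
    by (rule finite_subset[OF _ N.finite_eval_le[of ?\<mu>]]) auto
  ultimately have "j + 1 \<le> card {i. N.eval i < ?\<mu>}" using card_mono[OF fin, of "{..j}"] by simp
  then show ?thesis using N.eigenvalue_count_form_op[of "{..<?\<mu>}"] fin by (simp add: H_N_def)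
qed

lemma nth_eigenvalue_less:
  assumes i3: "i3 \<noteq> i1" "i3 \<noteq> i2" and j: "j \<ge> 1"
  shows "nth_eigenvalue \<Omega> (H_N A \<Omega>) (j + 1) < nth_eigenvalue \<Omega> (H_D A \<Omega>) j"
proof -
  define \<mu> where "\<mu> = D.eval (j - 1)"
  have "B * Re (L2_inner \<Omega> (D.evec (j - 1)) (D.evec (j - 1))) \<le> Re (mag_form A \<Omega> (D.evec (j - 1)) (D.evec (j - 1)))"
    by (rule mag_form_ge[OF D.evec_V])
  then have "B \<le> \<mu>" by (simp add: D.evec_orthonormal \<mu>_def D.eval_def)
  \<comment> \<open>The frequency along the third axis fills the gap between the lowest Landau level
    B and \<open>\<mu>\<close>; the lower bound of the Dirichlet form makes the square root
    real.\<close>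
  define \<xi> :: "real^'n" where "\<xi> = sqrt (\<mu> - B) *\<^sub>R axis i3 1"
  have l: "level 0 \<xi> = \<mu>" using \<open>B \<le> \<mu>\<close> by (simp add: level_def \<xi>_def)
  \<comment> \<open>The sequences start at 0: \<open>N.eval j\<close> is Neumann eigenvalue j + 1,
    and the indices below \<open>j\<close> end with Dirichlet eigenvalue j, which equals
    \<open>\<mu>\<close>.\<close>
  have "N.eval j < level 0 \<xi>"
  proof (rule neumann_eval_less)
    show "D.eval i \<le> level 0 \<xi>" if "i < j" for i
      unfolding l \<mu>_def using that by (intro monoD[OF D.mono_eval]) simp
  qed (use i3 in \<open>auto simp: \<xi>_def axis_def\<close>)
  then show ?thesis by (simp add: H_N_def H_D_def N.nth_eigenvalue_form_op D.nth_eigenvalue_form_op l \<mu>_def)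
qed

end

lemma landau_domain_compactI:
  assumes "B > 0" "i1 \<noteq> i2" "domain \<Omega>" "emeasure lebesgue \<Omega> < \<infinity>" "compact_embedding (Avec B i1 i2) \<Omega>"
    and "(\<forall>i. i = i1 \<or> i = i2) \<or> (\<exists>i3. i3 \<noteq> i1 \<and> i3 \<noteq> i2 \<and> (\<forall>i. i = i1 \<or> i = i2 \<or> i = i3))"
  shows "landau_domain_compact B i1 i2 \<Omega>"
proof -
  have "\<Omega> \<in> lmeasurable"
    using assms(3,4) by (intro fmeasurableI) (auto simp: domain_def lborelD)
  then show ?thesis
    using assms by unfold_locales (auto simp: domain_def)
qed

theorem theorem3p1:
  fixes B :: real
  assumes "B > 0"
  shows "(\<forall>\<Omega> :: (real^2) set.
            domain \<Omega> \<and> emeasure lebesgue \<Omega> < \<infinity> \<and> compact_embedding (\<lambda>z. B *\<^sub>R A2 z) \<Omega> \<longrightarrow>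
            (\<forall>k j :: nat. k \<ge> 1 \<and>
               eigenvalue_count \<Omega> (H_D (\<lambda>z. B *\<^sub>R A2 z) \<Omega>) {..B * (2 * real k - 1)} = enat j \<longrightarrow>
               eigenvalue_count \<Omega> (H_N (\<lambda>z. B *\<^sub>R A2 z) \<Omega>) {..<B * (2 * real k - 1)} \<ge> enat (j + 1)))
       \<and> (\<forall>\<Omega> :: (real^3) set.
            domain \<Omega> \<and> emeasure lebesgue \<Omega> < \<infinity> \<and> compact_embedding (\<lambda>z. B *\<^sub>R A3 z) \<Omega> \<longrightarrow>
            (\<forall>j :: nat. j \<ge> 1 \<longrightarrow>
               nth_eigenvalue \<Omega> (H_N (\<lambda>z. B *\<^sub>R A3 z) \<Omega>) (j + 1)
                 < nth_eigenvalue \<Omega> (H_D (\<lambda>z. B *\<^sub>R A3 z) \<Omega>) j))"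
proof (intro conjI allI impI)
  fix \<Omega> :: "(real^2) set" and k j :: nat
  assume \<Omega>: "domain \<Omega> \<and> emeasure lebesgue \<Omega> < \<infinity> \<and> compact_embedding (\<lambda>z. B *\<^sub>R A2 z) \<Omega>"
    and kj: "k \<ge> 1 \<and> eigenvalue_count \<Omega> (H_D (\<lambda>z. B *\<^sub>R A2 z) \<Omega>) {..B * (2 * real k - 1)} = enat j"
  have A: "(\<lambda>z. B *\<^sub>R A2 z) = Avec B 1 2"
    by (auto simp: fun_eq_iff vec_eq_iff forall_2 A2_def Avec_def)
  interpret landau_domain_compact B "1::2" 2 \<Omega>
    by (rule landau_domain_compactI) (use assms \<Omega> exhaust_2 in \<open>auto simp: A[symmetric]\<close>)
  \<comment> \<open>Levels are counted from zero, the theorem counts from one;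
    \<open>k \<ge> 1\<close> makes the subtraction exact.\<close>
  have l: "B * (2 * real k - 1) = level (k - 1) 0"
    using kj by (simp add: level_def of_nat_diff algebra_simps)
  show "eigenvalue_count \<Omega> (H_N (\<lambda>z. B *\<^sub>R A2 z) \<Omega>) {..<B * (2 * real k - 1)} \<ge> enat (j + 1)"
    using kj unfolding A l by (intro eigenvalue_count_less) simp
next
  fix \<Omega> :: "(real^3) set" and j :: nat
  assume \<Omega>: "domain \<Omega> \<and> emeasure lebesgue \<Omega> < \<infinity> \<and> compact_embedding (\<lambda>z. B *\<^sub>R A3 z) \<Omega>" and j: "j \<ge> 1"
  have A: "(\<lambda>z. B *\<^sub>R A3 z) = Avec B 1 2"
    by (auto simp: fun_eq_iff vec_eq_iff forall_3 A3_def Avec_def)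
  interpret landau_domain_compact B "1::3" 2 \<Omega>
    by (rule landau_domain_compactI) (use assms \<Omega> exhaust_3 in \<open>auto simp: A[symmetric] intro!: exI[of _ 3]\<close>)
  show "nth_eigenvalue \<Omega> (H_N (\<lambda>z. B *\<^sub>R A3 z) \<Omega>) (j + 1) < nth_eigenvalue \<Omega> (H_D (\<lambda>z. B *\<^sub>R A3 z) \<Omega>) j"
    unfolding A by (rule nth_eigenvalue_less[of 3]) (use j in auto)
qed

end
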